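(* Let $R$ be regular and essentially of finite type over an $F$-finite field of characteristic $p>0$. Let $(M,\kappa)$ be an $F$-regular Cartier module over $R$ and $f\in R$ an $M$-regular element. Then for all $e\ge1$ and all $i=(i_1,\dots,i_e)\in\{0,\dots,p-1\}^e$ the generalized $(i_1,\dots,i_e)$-eigenspace of $N_e$ is isomorphic as a $\mathcal D^e_R$-module to \[ {F^e}^!\Big(\tau\big(M,f^{(i_1+i_2p+\dots+i_ep^{e-1})/p^e}\big)\big/\tau\big(M,f^{(1+i_1+i_2p+\dots+i_ep^{e-1})/p^e}\big)\Big).\]
   Context: All rings are commutative Noetherian of prime characteristic $p$; $F$ is the Frobenius, and $F^e_*M$ is $M$ with $R$ acting through $p^e$-th powers. $R$ is $F$-finite if $F_*R$ is a finitely generated $R$-module. A Cartier module $(M,\kappa)$ is a finitely generated $R$-module $M$ with an $R$-linear map $\kappa\colon F_*M\to M$; $\kappa^e\colon F^e_*M\to M$ is its iterate, and for $g\in R$, $\kappa^e g$ denotes $m\mapsto\kappa^e(gm)$. $f\in R$ is $M$-regular if it is a non-zero-divisor on $M$. A Cartier algebra is an $\mathbb N$-graded ring $\mathcal C=\bigoplus_{e\ge0}\mathcal C_e$ with $\mathcal C_0=R$ and $r\varphi=\varphi r^{p^e}$ for $\varphi\in\mathcal C_e$, $r\in R$; $\mathcal C_+=\bigoplus_{e\ge1}\mathcal C_e$. A $\mathcal C$-module is a left $\mathcal C$-module finitely generated over $R$; it is nilpotent if $\mathcal C_+^aM=0$ for some $a$; a morphism is a nil-isomorphism if its kernel and cokernel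 are nilpotent. Test modules: for $f\in R$ and rational $\lambda\ge0$ let $\mathcal C$ be the Cartier algebra with $\mathcal C_0=R$, $\mathcal C_e=\kappa^ef^{\lceil\lambda p^e\rceil}R$ ($e\ge1$), acting on $M$. $\tau(M,f^\lambda)$ is the smallest $\mathcal C$-submodule $N\subseteq M$ such that $H^0_\eta(N)_\eta\subseteq H^0_\eta(M)_\eta$ is a nil-isomorphism for every associated prime $\eta$ of the $R$-module $M$ ($H^0_\eta$ = elements killed by a power of $\eta$; the outer subscript is localization). If $R$ is essentially of finite type over an $F$-finite field, $\tau(M,f^\lambda)$ exists for all $\lambda$ and is a non-increasing, right-continuous, discrete filtration. $(M,\kappa)$ is $F$-regular if $\tau(M,f^0)=M$. $\mathcal D$-modules: for an $\mathbb F_p$-algebra $A$, $\mathcal D^e_A=\operatorname{End}_A(F^e_*A)$, and modules over it are right modules. For an $A$-module $P$, ${F^e}^!P=\operatorname{Hom}_A(F^e_*A,P)$, a right $\mathcal D^e_A$-module by precomposition. In $\mathcal D^e_{R[t]}$ there are, for $a<p^e$, the Euler operators $\theta_a=t^a\partial_t^{[a]}$ acting by $\theta_a(rt^m)=\binom ma rt^m$ ($r\in R$), and $\mathcal D^e_R\subseteq\mathcal D^e_{R[t]}$ acts on coefficients. Every $\mathcal D^e_R[\theta_1,\theta_p,\dots,\theta_{p^{e-1}}]$-module $A$ decomposes uniquely as $A=\bigoplus_{i\in\mathbb F_p^e}E_i$ with $\theta_{p^{j-1}}$ acting on $E_i$ as multiplication by $i_j$ ($j=1,\dots,e$); $E_i$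 is the generalized $i$-eigenspace (with $\mathbb F_p$ identified with $\{0,\dots,p-1\}$). Let $\gamma\colon\operatorname{Spec}R\to\operatorname{Spec}R[t]$ be the graph embedding given by $\gamma^\#\colon R[t]\to R$, $t\mapsto f$. Let $C^e\colon M\to{F^e}^!M$, $m\mapsto[r\mapsto\kappa^e(rm)]$. For a submodule $A\subseteq M$, $\gamma_*C^e(A)\subseteq{F^e}^!\gamma_*M=\operatorname{Hom}_{R[t]}(F^e_*R[t],\gamma_*M)$ denotes the image of $C^e(A)$ under $\varphi\mapsto\varphi\circ\gamma^\#$, i.e. the set of maps $s\mapsto\kappa^e(\gamma^\#(s)m)$, $m\in A$. Put \[N_e=\big(\gamma_*C^e(M)\big)\mathcal D^e_R[\theta_1,\theta_p,\dots,\theta_{p^{e-1}}]\big/\big(\gamma_*C^e(fM)\big)\mathcal D^e_R[\theta_1,\theta_p,\dots,\theta_{p^{e-1}}].\] *)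

theory Defs
  imports "HOL-Algebra.Algebra" "HOL-Algebra.UnivPoly"
begin

hide_const (open) Multiset.mult

text \<open>
  Modules are values of the library record \<open>module\<close>, whose fields \<open>mult\<close> and \<open>one\<close> carry no
  meaning unless the module is an algebra; they are left \<open>undefined\<close> where nothing is intended.
  The record is also used for right modules over a noncommutative ring: there \<open>smult d x\<close> is the
  product \<open>x \<cdot> d\<close>.
\<close>


section \<open>Modules\<close>

definition self_module :: "('r, 'z) ring_scheme \<Rightarrow> ('r, 'r) module" where
  "self_module R = \<lparr>carrier = carrier R, mult = mult R, one = one R, ring.zero = ring.zero R, add = add R,
     smult = mult R\<rparr>"

definition restrict_scalars :: "('s \<Rightarrow> 'r) \<Rightarrow> ('r, 'm) module \<Rightarrow> ('s, 'm) module" where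
  "restrict_scalars g M = \<lparr>carrier = carrier M, mult = mult M, one = one M, ring.zero = ring.zero M,
     add = add M, smult = (\<lambda>s m. g s \<odot>\<^bsub>M\<^esub> m)\<rparr>"

definition fin_gen_module :: "('r, 'z) ring_scheme \<Rightarrow> ('r, 'm) module \<Rightarrow> bool" where
  "fin_gen_module R M \<longleftrightarrow> (\<exists>A. finite A \<and> A \<subseteq> carrier M \<and>
     (\<forall>N. submodule N R M \<and> A \<subseteq> N \<longrightarrow> N = carrier M))"

definition linear_map ::
  "('r, 'z) ring_scheme \<Rightarrow> ('r, 'm) module \<Rightarrow> ('r, 'n) module \<Rightarrow> ('m \<Rightarrow> 'n) \<Rightarrow> bool" where
  "linear_map R M N h \<longleftrightarrow> h \<in> carrier M \<rightarrow> carrier N \<and>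
     (\<forall>x\<in>carrier M. \<forall>y\<in>carrier M. h (x \<oplus>\<^bsub>M\<^esub> y) = h x \<oplus>\<^bsub>N\<^esub> h y) \<and>
     (\<forall>r\<in>carrier R. \<forall>x\<in>carrier M. h (r \<odot>\<^bsub>M\<^esub> x) = r \<odot>\<^bsub>N\<^esub> h x)"

definition Hom_module ::
  "('r, 'z) ring_scheme \<Rightarrow> ('r, 'm) module \<Rightarrow> ('r, 'n) module \<Rightarrow> ('m \<Rightarrow> 'n) set" where
  "Hom_module R M N = {h \<in> extensional (carrier M). linear_map R M N h}"

definition module_isomorphic ::
  "('r, 'z) ring_scheme \<Rightarrow> ('r, 'm) module \<Rightarrow> ('r, 'n) module \<Rightarrow> bool" where
  "module_isomorphic R M N \<longleftrightarrow> (\<exists>h. linear_map R M N h \<and> bij_betw h (carrier M) (carrier N))"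

text \<open>The map on cosets modulo \<open>N\<close> induced by a map \<open>\<phi>\<close>, written as a union in order to avoid a
  choice of representatives.\<close>

definition quot_map :: "('r, 'm) module \<Rightarrow> 'm set \<Rightarrow> ('m \<Rightarrow> 'm) \<Rightarrow> 'm set \<Rightarrow> 'm set" where
  "quot_map M N \<phi> U = (\<Union>x\<in>U. N +>\<^bsub>M\<^esub> \<phi> x)"

definition quot_module :: "('r, 'm) module \<Rightarrow> 'm set \<Rightarrow> ('r, 'm set) module" where
  "quot_module M N = \<lparr>carrier = a_rcosets\<^bsub>M\<^esub> N, mult = undefined, one = undefined, ring.zero = N,
     add = set_add M, smult = (\<lambda>r. quot_map M N (\<lambda>x. r \<odot>\<^bsub>M\<^esub> x))\<rparr>"

definition assoc_primes :: "('r, 'z) ring_scheme \<Rightarrow> ('r, 'm) module \<Rightarrow> 'r set set" where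
  "assoc_primes R M = {\<eta>. primeideal \<eta> R \<and>
     (\<exists>m\<in>carrier M. \<eta> = {r \<in> carrier R. r \<odot>\<^bsub>M\<^esub> m = \<zero>\<^bsub>M\<^esub>})}"

definition module_regular :: "('r, 'z) ring_scheme \<Rightarrow> ('r, 'm) module \<Rightarrow> 'r \<Rightarrow> bool" where
  "module_regular R M f \<longleftrightarrow> f \<in> carrier R \<and>
     (\<forall>m\<in>carrier M. f \<odot>\<^bsub>M\<^esub> m = \<zero>\<^bsub>M\<^esub> \<longrightarrow> m = \<zero>\<^bsub>M\<^esub>)"

text \<open>\<open>H\<^sup>0\<^sub>\<eta>(M)\<close>; the powers of \<open>\<eta>\<close> are taken in the library's monoid of ideals.\<close>

definition H0 :: "('r, 'z) ring_scheme \<Rightarrow> 'r set \<Rightarrow> ('r, 'm) module \<Rightarrow> ('r, 'm) module" where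
  "H0 R \<eta> M = M\<lparr>carrier := {m \<in> carrier M.
     \<exists>n::nat. \<forall>r \<in> \<eta> [^]\<^bsub>ideals_set R\<^esub> n. r \<odot>\<^bsub>M\<^esub> m = \<zero>\<^bsub>M\<^esub>}\<rparr>"


section \<open>Localization\<close>

text \<open>\<open>S\<close> is a multiplicative subset of \<open>R\<close>; \<open>fraction R S M m s\<close> is the fraction \<open>m/s\<close>.  For
  \<open>M = self_module R\<close> the record \<open>localization R S M\<close> is the ring \<open>S\<^sup>-\<^sup>1R\<close>; for a mere module the
  fields \<open>mult\<close> and \<open>one\<close> are irrelevant.\<close>

definition fraction ::
  "('r, 'z) ring_scheme \<Rightarrow> 'r set \<Rightarrow> ('r, 'm) module \<Rightarrow> 'm \<Rightarrow> 'r \<Rightarrow> ('m \<times> 'r) set" where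
  "fraction R S M m s = {(m', s'). m' \<in> carrier M \<and> s' \<in> S \<and>
     (\<exists>u\<in>S. u \<odot>\<^bsub>M\<^esub> (s' \<odot>\<^bsub>M\<^esub> m) = u \<odot>\<^bsub>M\<^esub> (s \<odot>\<^bsub>M\<^esub> m'))}"

definition localization ::
  "('r, 'z) ring_scheme \<Rightarrow> 'r set \<Rightarrow> ('r, 'm) module \<Rightarrow> ('r, ('m \<times> 'r) set) module" where
  "localization R S M = \<lparr>carrier = {fraction R S M m s | m s. m \<in> carrier M \<and> s \<in> S},
     mult = (\<lambda>U V. \<Union>(x, s)\<in>U. \<Union>(y, t)\<in>V. fraction R S M (x \<otimes>\<^bsub>M\<^esub> y) (s \<otimes>\<^bsub>R\<^esub> t)),
     one = fraction R S M \<one>\<^bsub>M\<^esub> \<one>\<^bsub>R\<^esub>,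
     ring.zero = fraction R S M \<zero>\<^bsub>M\<^esub> \<one>\<^bsub>R\<^esub>,
     add = (\<lambda>U V. \<Union>(x, s)\<in>U. \<Union>(y, t)\<in>V.
       fraction R S M ((t \<odot>\<^bsub>M\<^esub> x) \<oplus>\<^bsub>M\<^esub> (s \<odot>\<^bsub>M\<^esub> y)) (s \<otimes>\<^bsub>R\<^esub> t)),
     smult = (\<lambda>r U. \<Union>(x, s)\<in>U. fraction R S M (r \<odot>\<^bsub>M\<^esub> x) s)\<rparr>"

text \<open>The localization \<open>S\<^sup>-\<^sup>1N \<rightarrow> S\<^sup>-\<^sup>1M\<close> of an inclusion \<open>N \<subseteq> M\<close>.\<close>

definition loc_inclusion ::
  "('r, 'z) ring_scheme \<Rightarrow> 'r set \<Rightarrow> ('r, 'm) module \<Rightarrow> ('m \<times> 'r) set \<Rightarrow> ('m \<times> 'r) set" where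
  "loc_inclusion R S M U = (\<Union>(x, s)\<in>U. fraction R S M x s)"


section \<open>Regular rings, F-finiteness, essentially finite type\<close>

definition krull_dim_eq :: "('r, 'z) ring_scheme \<Rightarrow> nat \<Rightarrow> bool" where
  "krull_dim_eq R d \<longleftrightarrow>
     (let chain = (\<lambda>n P. (\<forall>i\<le>n. primeideal (P i) R) \<and> (\<forall>i<n. P i \<subset> P (Suc i)))
      in (\<exists>P. chain d P) \<and> (\<forall>n P. chain n P \<longrightarrow> n \<le> d))"

definition regular_local_ring :: "('r, 'z) ring_scheme \<Rightarrow> bool" where
  "regular_local_ring R \<longleftrightarrow> cring R \<and> noetherian_ring R \<and>
     (\<exists>\<mm>. {I. maximalideal I R} = {\<mm>} \<and>
       (\<exists>A. finite A \<and> A \<subseteq> carrier R \<and> krull_dim_eq R (card A) \<and> \<mm> = Idl\<^bsub>R\<^esub> A))"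

definition regular_ring :: "('r, 'z) ring_scheme \<Rightarrow> bool" where
  "regular_ring R \<longleftrightarrow> cring R \<and> noetherian_ring R \<and>
     (\<forall>P. primeideal P R \<longrightarrow>
       regular_local_ring (localization R (carrier R - P) (self_module R)))"

text \<open>\<open>F\<^sup>e\<^sub>*M\<close>\<close>

definition frob_push ::
  "('r, 'z) ring_scheme \<Rightarrow> nat \<Rightarrow> nat \<Rightarrow> ('r, 'm) module \<Rightarrow> ('r, 'm) module" where
  "frob_push R p e M = restrict_scalars (\<lambda>r. r [^]\<^bsub>R\<^esub> (p ^ e)) M"

definition F_finite :: "('r, 'z) ring_scheme \<Rightarrow> nat \<Rightarrow> bool" where
  "F_finite R p \<longleftrightarrow> fin_gen_module R (frob_push R p 1 (self_module R))"

text \<open>\<open>R\<close> is a localization of a finitely generated \<open>k\<close>-algebra, where \<open>\<sigma> : k \<rightarrow> R\<close> is the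
  structure map.  Replacing the algebra by its image \<open>B\<close> in \<open>R\<close>, one may take it to be a subring
  of \<open>R\<close>; then the elements of \<open>W\<close> are units of \<open>R\<close> and every element of \<open>R\<close> is a fraction \<open>b/w\<close>.\<close>

definition ess_finite_type ::
  "('k, 'y) ring_scheme \<Rightarrow> ('k \<Rightarrow> 'r) \<Rightarrow> ('r, 'z) ring_scheme \<Rightarrow> bool" where
  "ess_finite_type k \<sigma> R \<longleftrightarrow> \<sigma> \<in> ring_hom k R \<and>
     (\<exists>A W. finite A \<and> A \<subseteq> carrier R \<and>
       (let B = generate_ring R (\<sigma> ` carrier k \<union> A) in
         W \<subseteq> B \<and> W \<subseteq> Units R \<and> \<one>\<^bsub>R\<^esub> \<in> W \<and> (\<forall>v\<in>W. \<forall>w\<in>W. v \<otimes>\<^bsub>R\<^esub> w \<in> W) \<and>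
         (\<forall>r\<in>carrier R. \<exists>b\<in>B. \<exists>w\<in>W. r = b \<otimes>\<^bsub>R\<^esub> inv\<^bsub>R\<^esub> w)))"


section \<open>Cartier modules and test modules\<close>

definition cartier_module ::
  "('r, 'z) ring_scheme \<Rightarrow> nat \<Rightarrow> ('r, 'm) module \<Rightarrow> ('m \<Rightarrow> 'm) \<Rightarrow> bool" where
  "cartier_module R p M \<kappa> \<longleftrightarrow> module R M \<and> fin_gen_module R M \<and>
     linear_map R (frob_push R p 1 M) M \<kappa>"

text \<open>
  The structure of a module over a Cartier algebra \<open>\<C>\<close> on an abelian group is recorded by the
  family \<open>e \<mapsto> C e\<close> of the sets of operators by which the elements of \<open>\<C>\<^sub>e\<close> act.  The following is
  the action on \<open>M\<close> of the algebra with \<open>\<C>\<^sub>0 = R\<close> and \<open>\<C>\<^sub>e = \<kappa>\<^sup>e f\<^bsup>\<lceil>\<lambda>p^e\<rceil>\<^esup> R\<close>.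
\<close>

type_synonym 'm operators = "nat \<Rightarrow> ('m \<Rightarrow> 'm) set"

definition cartier_algebra ::
  "('r, 'z) ring_scheme \<Rightarrow> nat \<Rightarrow> ('r, 'm) module \<Rightarrow> ('m \<Rightarrow> 'm) \<Rightarrow> 'r \<Rightarrow> rat \<Rightarrow> 'm operators" where
  "cartier_algebra R p M \<kappa> f l e =
     (if e = 0 then {(\<lambda>m. r \<odot>\<^bsub>M\<^esub> m) | r. r \<in> carrier R}
      else {(\<lambda>m. (\<kappa> ^^ e) ((f [^]\<^bsub>R\<^esub> nat \<lceil>l * of_nat (p ^ e)\<rceil> \<otimes>\<^bsub>R\<^esub> r) \<odot>\<^bsub>M\<^esub> m)) | r.
              r \<in> carrier R})"

text \<open>The induced action on \<open>S\<^sup>-\<^sup>1M\<close>: an element \<open>\<phi>\<close> of degree \<open>e\<close> maps \<open>m/s = s\<^bsup>p^e-1\<^esup>m / s\<^bsup>p^e\<^esup>\<close>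
  to \<open>\<phi>(s\<^bsup>p^e-1\<^esup>m) / s\<close>.\<close>

definition loc_operators ::
  "('r, 'z) ring_scheme \<Rightarrow> nat \<Rightarrow> 'r set \<Rightarrow> ('r, 'm) module \<Rightarrow> 'm operators
     \<Rightarrow> ('m \<times> 'r) set operators" where
  "loc_operators R p S M C e =
     (\<lambda>\<phi> U. \<Union>(m, s)\<in>U. fraction R S M (\<phi> ((s [^]\<^bsub>R\<^esub> (p ^ e - 1)) \<odot>\<^bsub>M\<^esub> m)) s) ` C e"

definition quot_operators ::
  "('r, 'm) module \<Rightarrow> 'm set \<Rightarrow> 'm operators \<Rightarrow> 'm set operators" where
  "quot_operators M N C e = quot_map M N ` C e"

text \<open>\<open>\<C>\<^sub>+N\<close>\<close>

definition positive_part_mult :: "('r, 'm) module \<Rightarrow> 'm operators \<Rightarrow> 'm set \<Rightarrow> 'm set" where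
  "positive_part_mult M C N = generate (add_monoid M) {\<phi> x | e \<phi> x. 1 \<le> e \<and> \<phi> \<in> C e \<and> x \<in> N}"

definition nilpotent_module :: "('r, 'm) module \<Rightarrow> 'm operators \<Rightarrow> bool" where
  "nilpotent_module M C \<longleftrightarrow> (\<exists>a. (positive_part_mult M C ^^ a) (carrier M) = {\<zero>\<^bsub>M\<^esub>})"

definition nil_isomorphism ::
  "('r, 'm) module \<Rightarrow> 'm operators \<Rightarrow> ('r, 'n) module \<Rightarrow> 'n operators \<Rightarrow> ('m \<Rightarrow> 'n) \<Rightarrow> bool" where
  "nil_isomorphism M C N D h \<longleftrightarrow>
     nilpotent_module (M\<lparr>carrier := a_kernel M N h\<rparr>) C \<and>
     nilpotent_module (quot_module N (h ` carrier M)) (quot_operators N (h ` carrier M) D)"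

definition generically_nil_isomorphic ::
  "('r, 'z) ring_scheme \<Rightarrow> nat \<Rightarrow> ('r, 'm) module \<Rightarrow> 'm operators \<Rightarrow> 'm set \<Rightarrow> bool" where
  "generically_nil_isomorphic R p M C N \<longleftrightarrow>
     (\<forall>\<eta>\<in>assoc_primes R M.
       let S = carrier R - \<eta>; HN = H0 R \<eta> (M\<lparr>carrier := N\<rparr>); HM = H0 R \<eta> M in
         nil_isomorphism (localization R S HN) (loc_operators R p S HN C)
           (localization R S HM) (loc_operators R p S HM C) (loc_inclusion R S HM))"

definition is_test_module ::
  "('r, 'z) ring_scheme \<Rightarrow> nat \<Rightarrow> ('r, 'm) module \<Rightarrow> 'm operators \<Rightarrow> 'm set \<Rightarrow> bool" where
  "is_test_module R p M C N \<longleftrightarrow>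
     (let T = {N. submodule N R M \<and> (\<forall>e. \<forall>\<phi>\<in>C e. \<phi> ` N \<subseteq> N) \<and> generically_nil_isomorphic R p M C N}
      in N \<in> T \<and> (\<forall>N'\<in>T. N \<subseteq> N'))"

text \<open>\<open>\<tau>(M, f\<^sup>\<lambda>)\<close>\<close>

definition test_module ::
  "('r, 'z) ring_scheme \<Rightarrow> nat \<Rightarrow> ('r, 'm) module \<Rightarrow> ('m \<Rightarrow> 'm) \<Rightarrow> 'r \<Rightarrow> rat \<Rightarrow> 'm set" where
  "test_module R p M \<kappa> f l = (THE N. is_test_module R p M (cartier_algebra R p M \<kappa> f l) N)"

text \<open>\<open>f\<^sup>0\<close> does not depend on \<open>f\<close>, so \<open>f = \<one>\<close> may be taken here.  The condition
  \<open>\<tau>(M, f\<^sup>0) = M\<close> includes the existence of \<open>\<tau>(M, f\<^sup>0)\<close>.\<close>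

definition F_regular ::
  "('r, 'z) ring_scheme \<Rightarrow> nat \<Rightarrow> ('r, 'm) module \<Rightarrow> ('m \<Rightarrow> 'm) \<Rightarrow> bool" where
  "F_regular R p M \<kappa> \<longleftrightarrow>
     is_test_module R p M (cartier_algebra R p M \<kappa> \<one>\<^bsub>R\<^esub> 0) (carrier M)"


section \<open>Differential operators of level \<open>e\<close>\<close>

text \<open>\<open>\<D>\<^sup>e\<^sub>A = End\<^sub>A(F\<^sup>e\<^sub>*A)\<close>; as everywhere below, maps are extensional on their domain.\<close>

definition diff_ops :: "('a, 'z) ring_scheme \<Rightarrow> nat \<Rightarrow> nat \<Rightarrow> ('a \<Rightarrow> 'a) ring" where
  "diff_ops A p e =
     (let F = frob_push A p e (self_module A) in
       \<lparr>carrier = Hom_module A F F,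
        mult = compose (carrier A),
        one = (\<lambda>x\<in>carrier A. x),
        ring.zero = (\<lambda>x\<in>carrier A. \<zero>\<^bsub>A\<^esub>),
        add = (\<lambda>\<phi> \<psi>. \<lambda>x\<in>carrier A. \<phi> x \<oplus>\<^bsub>A\<^esub> \<psi> x)\<rparr>)"

text \<open>\<open>F\<^sup>e\<^sup>!P = Hom\<^sub>A(F\<^sup>e\<^sub>*A, P)\<close> as a right \<open>\<D>\<^sup>e\<^sub>A\<close>-module.\<close>

definition frob_shriek ::
  "('a, 'z) ring_scheme \<Rightarrow> nat \<Rightarrow> nat \<Rightarrow> ('a, 'm) module \<Rightarrow> ('a \<Rightarrow> 'a, 'a \<Rightarrow> 'm) module" where
  "frob_shriek A p e P =
     \<lparr>carrier = Hom_module A (frob_push A p e (self_module A)) P,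
      mult = undefined, one = undefined,
      ring.zero = (\<lambda>x\<in>carrier A. \<zero>\<^bsub>P\<^esub>),
      add = (\<lambda>\<phi> \<psi>. \<lambda>x\<in>carrier A. \<phi> x \<oplus>\<^bsub>P\<^esub> \<psi> x),
      smult = (\<lambda>d \<phi>. compose (carrier A) \<phi> d)\<rparr>"

text \<open>The inclusion \<open>\<D>\<^sup>e\<^sub>R \<subseteq> \<D>\<^sup>e\<^bsub>R[t]\<^esub>\<close>, with \<open>R[t] = UP R\<close>.\<close>

definition on_coeffs :: "('r, 'z) ring_scheme \<Rightarrow> ('r \<Rightarrow> 'r) \<Rightarrow> (nat \<Rightarrow> 'r) \<Rightarrow> (nat \<Rightarrow> 'r)" where
  "on_coeffs R d = (\<lambda>s\<in>carrier (UP R). \<lambda>n. d (coeff (UP R) s n))"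

definition euler_op :: "('r, 'z) ring_scheme \<Rightarrow> nat \<Rightarrow> (nat \<Rightarrow> 'r) \<Rightarrow> (nat \<Rightarrow> 'r)" where
  "euler_op R a = (\<lambda>s\<in>carrier (UP R). \<lambda>n. add_pow R (n choose a) (coeff (UP R) s n))"

text \<open>\<open>\<D>\<^sup>e\<^sub>R[\<theta>\<^sub>1, \<theta>\<^sub>p, \<dots>, \<theta>\<^bsub>p^(e-1)\<^esub>]\<close> as a subring of \<open>\<D>\<^sup>e\<^bsub>R[t]\<^esub>\<close>.\<close>

definition euler_algebra ::
  "('r, 'z) ring_scheme \<Rightarrow> nat \<Rightarrow> nat \<Rightarrow> ((nat \<Rightarrow> 'r) \<Rightarrow> (nat \<Rightarrow> 'r)) set" where
  "euler_algebra R p e = generate_ring (diff_ops (UP R) p e)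
     (on_coeffs R ` carrier (diff_ops R p e) \<union> {euler_op R (p ^ j) | j. j < e})"

text \<open>For a right module \<open>P\<close>: the additive subgroup \<open>U \<cdot> D\<close> generated by the products \<open>x \<cdot> d\<close>.\<close>

definition right_span :: "('d, 'x) module \<Rightarrow> 'x set \<Rightarrow> 'd set \<Rightarrow> 'x set" where
  "right_span P U D = generate (add_monoid P) {d \<odot>\<^bsub>P\<^esub> x | d x. d \<in> D \<and> x \<in> U}"


section \<open>The modules \<open>N\<^sub>e\<close> and their eigenspaces\<close>

text \<open>\<open>\<gamma>\<^sup># : R[t] \<rightarrow> R\<close>, \<open>t \<mapsto> f\<close>\<close>

definition graph_hom :: "('r, 'z) ring_scheme \<Rightarrow> 'r \<Rightarrow> (nat \<Rightarrow> 'r) \<Rightarrow> 'r" where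
  "graph_hom R f = UnivPoly.eval R R id f"

definition cartier_adjoint ::
  "('r, 'z) ring_scheme \<Rightarrow> ('r, 'm) module \<Rightarrow> ('m \<Rightarrow> 'm) \<Rightarrow> nat \<Rightarrow> 'm \<Rightarrow> 'r \<Rightarrow> 'm" where
  "cartier_adjoint R M \<kappa> e m = (\<lambda>r\<in>carrier R. (\<kappa> ^^ e) (r \<odot>\<^bsub>M\<^esub> m))"

text \<open>\<open>\<gamma>\<^sub>*C\<^sup>e(A)\<close>\<close>

definition graph_push_adjoint ::
  "('r, 'z) ring_scheme \<Rightarrow> ('r, 'm) module \<Rightarrow> ('m \<Rightarrow> 'm) \<Rightarrow> 'r \<Rightarrow> nat \<Rightarrow> 'm set
     \<Rightarrow> ((nat \<Rightarrow> 'r) \<Rightarrow> 'm) set" where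
  "graph_push_adjoint R M \<kappa> f e A =
     (\<lambda>\<phi>. compose (carrier (UP R)) \<phi> (graph_hom R f)) ` cartier_adjoint R M \<kappa> e ` A"

definition N_module ::
  "('r, 'z) ring_scheme \<Rightarrow> nat \<Rightarrow> ('r, 'm) module \<Rightarrow> ('m \<Rightarrow> 'm) \<Rightarrow> 'r \<Rightarrow> nat
     \<Rightarrow> ((nat \<Rightarrow> 'r) \<Rightarrow> (nat \<Rightarrow> 'r), ((nat \<Rightarrow> 'r) \<Rightarrow> 'm) set) module" where
  "N_module R p M \<kappa> f e =
     (let P = frob_shriek (UP R) p e (restrict_scalars (graph_hom R f) M);
          D = euler_algebra R p e;
          fM = (\<lambda>m. f \<odot>\<^bsub>M\<^esub> m) ` carrier M
      in quot_module
           (P\<lparr>carrier := right_span P (graph_push_adjoint R M \<kappa> f e (carrier M)) D\<rparr>)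
           (right_span P (graph_push_adjoint R M \<kappa> f e fM) D))"

text \<open>The summand \<open>E\<^sub>i\<close> of a \<open>\<D>\<^sup>e\<^sub>R[\<theta>\<^sub>1, \<dots>, \<theta>\<^bsub>p^(e-1)\<^esub>]\<close>-module, \<open>i = (i 1, \<dots>, i e)\<close>, regarded as a
  right \<open>\<D>\<^sup>e\<^sub>R\<close>-module.  As the module is the direct sum of the \<open>E\<^sub>i\<close>, on which the operators act as
  distinct tuples of scalars, \<open>E\<^sub>i\<close> consists of all elements on which they act as \<open>i\<close>.\<close>

definition eigenspace ::
  "('r, 'z) ring_scheme \<Rightarrow> nat \<Rightarrow> nat \<Rightarrow> (nat \<Rightarrow> nat)
     \<Rightarrow> ((nat \<Rightarrow> 'r) \<Rightarrow> (nat \<Rightarrow> 'r), 'x) module \<Rightarrow> ('r \<Rightarrow> 'r, 'x) module" where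
  "eigenspace R p e i A = restrict_scalars (on_coeffs R)
     (A\<lparr>carrier := {x \<in> carrier A.
        \<forall>j\<in>{1..e}. euler_op R (p ^ (j - 1)) \<odot>\<^bsub>A\<^esub> x = add_pow A (i j) x}\<rparr>)"

end

theory Submission
  imports Defs "HOL-Number_Theory.Residues"
begin

text \<open>Let \<open>q = p\<^sup>e\<close>. Two inputs drive the argument. First, \<open>F\<^sup>e\<^sub>*R\<close> is a finitely generated
  projective \<open>R\<close>-module (Kunz): locally, a regular system of parameters is a regular sequence, so the
  powers of its members have the expected relations and a minimal generating set of \<open>F\<^sup>e\<^sub>*R\<close> has no
  relations; the local bases are patched to a dual basis. Second, \<open>\<tau>(M, f\<^bsup>n/q\<^esup>) = \<kappa>\<^sup>e(f\<^sup>n M)\<close> for all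
  \<open>n\<close>: the right-hand side is stable under the Cartier algebra and generically nil-isomorphic to \<open>M\<close>,
  and if \<open>N\<close> is another such submodule, then the elements that are carried into \<open>N\<close> by all
  \<open>\<kappa>\<^bsup>e+a\<^esup> f\<^bsup>n p^a\<^esup> r\<close> form a test submodule for \<open>f\<^sup>0\<close>, which is all of \<open>M\<close> by \<open>F\<close>-regularity.

  A map in \<open>F\<^sup>e\<^sup>!\<gamma>\<^sub>*M\<close> is determined by its values on \<open>r t\<^sup>m\<close> with \<open>m < q\<close>. By Lucas' theorem the Euler
  operators separate these exponents, and by the dual basis \<open>\<D>\<^sup>e\<^sub>R\<close> fills out the coefficients, so the
  span of \<open>\<gamma>\<^sub>*C\<^sup>e(f\<^sup>k M)\<close> consists of the maps that send \<open>r t\<^sup>m\<close> into \<open>\<kappa>\<^sup>e(f\<^bsup>m+k\<^esup> M)\<close>. The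
  eigenspace with digits \<open>i\<close> of the quotient is the part with \<open>m = n\<close>, and evaluation at
  \<open>r t\<^sup>n\<close> identifies it with \<open>F\<^sup>e\<^sup>!\<close> of the quotient of consecutive test modules; surjectivity is
  again projectivity of \<open>F\<^sup>e\<^sub>*R\<close>.\<close>

text \<open>The values of one element \<open>G m\<close> at the various exponents all come from the
  same m. Their independence in the span rests on projections inside the Euler algebra onto the
  exponents of one residue modulo p^e, built from digit indicators by Fermat's theorem. Only
  exponents below p^e are tested because t^(p^e) acts through f. Dividing by the span for f M raises
  k by one, so the part at m is the quotient of the trace images for m and m + 1.

  F-regularity acts twice on the test modules: it makes \<kappa> surjective, which handles operators
  of degree below e, and it forces the auxiliary submodule to be M. M-regularity puts the powers of
  f outside the associated primes, so that they can be cancelled generically. Essential finiteness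
  over an F-finite field supplies the finitely many generators of F^e_* R with which the dual basis
  starts. That regular parameters form a regular sequence is a dimension count; it is done with
  chains of primes, through a form of Krull's principal ideal theorem that pushes a given element
  down a chain.\<close>

section \<open>Rings of prime characteristic\<close>

lemma (in semiring) add_pow_eq_mult_one:
  "a \<in> carrier R \<Longrightarrow> [(n::nat)] \<cdot> a = ([n] \<cdot> \<one>) \<otimes> a"
  by (simp add: add_pow_ldistr)

theorem (in cring) binomial:
  assumes [simp]: "x \<in> carrier R" "y \<in> carrier R"
  shows "(x \<oplus> y) [^] n = (\<Oplus>k\<in>{..n}. [(n choose k)] \<cdot> (x [^] k \<otimes> y [^] (n - k)))"
proof (induction n)
  case (Suc n)
  define T where "T n k = [(n choose k)] \<cdot> (x [^] k \<otimes> y [^] (n - k))" for n k :: nat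
  have [simp]: "T n k \<in> carrier R" for n k by (simp add: T_def)
  have T0: "T (Suc n) 0 = y \<otimes> T n 0" by (simp add: T_def m_ac)
  have TS: "T (Suc n) (Suc k) = x \<otimes> T n k \<oplus> y \<otimes> T n (Suc k)" if "k \<le> n" for k
  proof -
    have "x \<otimes> T n k = [(n choose k)] \<cdot> (x [^] Suc k \<otimes> y [^] (n - k))"
      by (simp add: T_def add_pow_rdistr m_ac)
    moreover have "y \<otimes> T n (Suc k) = [(n choose Suc k)] \<cdot> (x [^] Suc k \<otimes> y [^] (n - k))"
    proof (cases "k = n")
      case False
      then have e: "n - k = Suc (n - Suc k)" using that by simp
      show ?thesis unfolding e by (simp add: T_def add_pow_rdistr m_ac)
    qed (simp add: T_def binomial_eq_0)
    ultimately show ?thesis by (simp add: T_def add.nat_pow_mult)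
  qed
  define S where "S = (\<Oplus>k\<in>{..n}. T n k)"
  have [simp]: "S \<in> carrier R" by (simp add: S_def)
  have S': "S = (\<Oplus>k\<in>{..n}. T n (Suc k)) \<oplus> T n 0"
  proof -
    have "T n (Suc n) = \<zero>" by (simp add: T_def binomial_eq_0)
    then have "S = (\<Oplus>k\<in>{..Suc n}. T n k)" unfolding S_def by (subst finsum_Suc) auto
    then show ?thesis by (subst (asm) finsum_Suc2) auto
  qed
  have "(\<Oplus>k\<in>{..Suc n}. T (Suc n) k) = (\<Oplus>k\<in>{..n}. T (Suc n) (Suc k)) \<oplus> T (Suc n) 0"
    by (subst finsum_Suc2) auto
  also have "(\<Oplus>k\<in>{..n}. T (Suc n) (Suc k)) = (\<Oplus>k\<in>{..n}. x \<otimes> T n k \<oplus> y \<otimes> T n (Suc k))"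
    by (rule finsum_cong') (auto simp: TS)
  also have "\<dots> = x \<otimes> S \<oplus> y \<otimes> (\<Oplus>k\<in>{..n}. T n (Suc k))"
    unfolding S_def by (simp add: finsum_addf finsum_rdistr)
  also have "\<dots> \<oplus> T (Suc n) 0 = x \<otimes> S \<oplus> y \<otimes> S"
    unfolding T0 by (subst (2) S') (simp add: r_distr a_assoc)
  also have "\<dots> = (x \<oplus> y) [^] Suc n"
    using Suc unfolding S_def T_def by (simp add: l_distr m_comm flip: S_def)
  finally show ?case unfolding T_def by simp
qed simp

locale char_p_ring = cring +
  fixes p :: nat
  assumes prime_p: "Factorial_Ring.prime p" and char_p: "[p] \<cdot> \<one> = \<zero>"
begin

lemma char_p_dvd:
  assumes "p dvd n" "a \<in> carrier R" shows "[(n::nat)] \<cdot> a = \<zero>"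
proof -
  obtain m where "n = p * m" using assms(1) by (auto elim: dvdE)
  then have "[n] \<cdot> a = [m] \<cdot> ([p] \<cdot> a)"
    using assms(2) by (simp add: add.nat_pow_pow)
  also have "[p] \<cdot> a = \<zero>" using assms(2) char_p by (simp add: add_pow_eq_mult_one[of a])
  finally show ?thesis by simp
qed

lemma frob1_add:
  assumes [simp]: "x \<in> carrier R" "y \<in> carrier R"
  shows "(x \<oplus> y) [^] p = x [^] p \<oplus> y [^] p"
proof -
  define T where "T k = [(p choose k)] \<cdot> (x [^] k \<otimes> y [^] (p - k))" for k :: nat
  have [simp]: "T k \<in> carrier R" for k by (simp add: T_def)
  have "p \<ge> 2" using prime_p prime_ge_2_nat by blast
  then obtain r where r: "p = Suc (Suc r)" by (metis add_2_eq_Suc le_Suc_ex)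
  have "(x \<oplus> y) [^] p = (\<Oplus>k\<in>{..p}. T k)"
    unfolding T_def by (rule binomial) auto
  also have "\<dots> = T (Suc (Suc r)) \<oplus> (\<Oplus>k\<in>{..Suc r}. T k)" unfolding r by (subst finsum_Suc) auto
  also have "(\<Oplus>k\<in>{..Suc r}. T k) = (\<Oplus>k\<in>{..r}. T (Suc k)) \<oplus> T 0" by (subst finsum_Suc2) auto
  also have "(\<Oplus>k\<in>{..r}. T (Suc k)) = (\<Oplus>k\<in>{..r}. \<zero>)"
  proof (rule finsum_cong')
    fix k assume "k \<in> {..r}"
    then have "p dvd (p choose Suc k)" using prime_p by (intro dvd_choose_prime) (auto simp: r)
    then show "T (Suc k) = \<zero>" unfolding T_def by (intro char_p_dvd) auto
  qed auto
  also have "T (Suc (Suc r)) \<oplus> ((\<Oplus>k\<in>{..r}. \<zero>) \<oplus> T 0) = x [^] p \<oplus> y [^] p"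
    by (simp add: T_def flip: r)
  finally show ?thesis .
qed

lemma frob_add:
  "x \<in> carrier R \<Longrightarrow> y \<in> carrier R \<Longrightarrow> (x \<oplus> y) [^] (p ^ e) = x [^] (p ^ e) \<oplus> y [^] (p ^ e)"
proof (induction e)
  case (Suc e)
  then show ?case by (simp add: frob1_add mult.commute[of p] flip: nat_pow_pow)
qed simp

lemma q_pos: "p ^ e > 0"
  using prime_p prime_gt_0_nat by simp

lemma frob_zero: "\<zero> [^] (p ^ e) = \<zero>"
  using q_pos by (simp add: nat_pow_zero)

lemma frob_minus:
  assumes "x \<in> carrier R" shows "(\<ominus> x) [^] (p ^ e) = \<ominus> (x [^] (p ^ e))"
proof -
  have "(\<ominus> x) [^] (p ^ e) \<oplus> x [^] (p ^ e) = (\<ominus> x \<oplus> x) [^] (p ^ e)"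
    using assms by (simp add: frob_add)
  also have "\<dots> = \<zero>" using assms by (simp add: l_neg frob_zero)
  finally show ?thesis using assms by (simp add: minus_equality)
qed

end

section \<open>Saturated ideals and Krull's principal ideal theorem\<close>

definition adjoin :: "('r, 'z) ring_scheme \<Rightarrow> 'r set \<Rightarrow> 'r \<Rightarrow> 'r set" where
  "adjoin R I x = I <+>\<^bsub>R\<^esub> PIdl\<^bsub>R\<^esub> x"

lemma (in cring) mem_adjoin:
  "a \<in> adjoin R I x \<longleftrightarrow> (\<exists>i\<in>I. \<exists>r\<in>carrier R. a = i \<oplus> r \<otimes> x)"
  by (auto simp: adjoin_def set_add_def' cgenideal_def)

lemma (in cring) ideal_adjoin:
  assumes "ideal I R" "x \<in> carrier R" shows "ideal (adjoin R I x) R"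
  using assms add_ideals cgenideal_ideal unfolding adjoin_def by blast

lemma (in cring) adjoin_incl:
  assumes "ideal I R" "x \<in> carrier R" shows "I \<subseteq> adjoin R I x" "x \<in> adjoin R I x"
proof -
  interpret I: ideal I R by fact
  show "I \<subseteq> adjoin R I x"
  proof
    fix i assume "i \<in> I"
    then have "i = i \<oplus> \<zero> \<otimes> x" using assms(2) I.Icarr by simp
    then show "i \<in> adjoin R I x" using \<open>i \<in> I\<close> by (auto simp: mem_adjoin)
  qed
  have "x = \<zero> \<oplus> \<one> \<otimes> x" using assms(2) by simp
  then show "x \<in> adjoin R I x" using I.zero_closed one_closed unfolding mem_adjoin by metis
qed

lemma (in cring) adjoin_mono:
  "I \<subseteq> J \<Longrightarrow> adjoin R I x \<subseteq> adjoin R J x"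
  unfolding mem_adjoin subset_iff by blast

lemma (in cring) adjoin_minimal:
  assumes "ideal J R" "I \<subseteq> J" "x \<in> J" shows "adjoin R I x \<subseteq> J"
proof
  interpret J: ideal J R by fact
  fix a assume "a \<in> adjoin R I x"
  then show "a \<in> J" using assms J.I_l_closed by (auto simp: mem_adjoin)
qed

text \<open>The Noetherian hypothesis enters Nakayama's lemma, the choice of associated primes, the
  chain condition and the existence of maximal ideals in this form.\<close>

lemma (in noetherian_ring) exists_maximal_ideal_in:
  assumes "C \<noteq> {}" "\<And>I. I \<in> C \<Longrightarrow> ideal I R"
  shows "\<exists>I\<in>C. \<forall>J\<in>C. I \<subseteq> J \<longrightarrow> J = I"
proof (rule subset_Zorn_nonempty[OF assms(1)])
  fix D assume D: "D \<noteq> {}" "subset.chain C D"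
  then have "subset.chain {I. ideal I R} D" using assms(2)
    by (auto simp: subset_chain_def)
  then have "\<Union>D \<in> D" using ideal_chain_is_trivial D by blast
  then show "\<Union>D \<in> C" using D by (auto simp: subset_chain_def)
qed

text \<open>For a prime N this is the contraction to R of the extension of I to the localization at
  N. Saturated ideals of R stand for ideals of the localization, so that the arguments up to Krull's
  theorem stay inside R.\<close>

definition saturate :: "('r, 'z) ring_scheme \<Rightarrow> 'r set \<Rightarrow> 'r set \<Rightarrow> 'r set" where
  "saturate R N I = {a \<in> carrier R. \<exists>s\<in>carrier R - N. s \<otimes>\<^bsub>R\<^esub> a \<in> I}"

context primeideal begin

lemma one_notin: "\<one> \<notin> I"
  using I_notcarr one_imp_carrier by blast

lemma notin_mult: "s \<in> carrier R - I \<Longrightarrow> t \<in> carrier R - I \<Longrightarrow> s \<otimes> t \<in> carrier R - I"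
  using I_prime by auto

lemma saturate_incl: "ideal J R \<Longrightarrow> J \<subseteq> saturate R I J"
  using one_notin ideal.Icarr[of J R] by (force simp: saturate_def)

lemma saturate_mono: "J \<subseteq> K \<Longrightarrow> saturate R I J \<subseteq> saturate R I K"
  by (auto simp: saturate_def)

lemma saturate_ideal:
  assumes "ideal J R" shows "ideal (saturate R I J) R"
proof -
  interpret J: ideal J R by fact
  show ?thesis
  proof (rule idealI)
    show "subgroup (saturate R I J) (add_monoid R)"
    proof (rule add.subgroupI)
      show "saturate R I J \<noteq> {}" using saturate_incl[OF assms] J.zero_closed by blast
      fix a assume "a \<in> saturate R I J"
      then obtain s where s: "s \<in> carrier R - I" "s \<otimes> a \<in> J" "a \<in> carrier R"
        by (auto simp: saturate_def)
      then have "s \<otimes> (\<ominus> a) = \<ominus> (s \<otimes> a)" by (simp add: r_minus)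
      then show "\<ominus> a \<in> saturate R I J" using s J.a_inv_closed[OF s(2)]
        by (auto simp: saturate_def intro!: bexI[of _ s])
    next
      fix a b assume "a \<in> saturate R I J" "b \<in> saturate R I J"
      then obtain s t where s: "s \<in> carrier R - I" "s \<otimes> a \<in> J" "a \<in> carrier R"
        "t \<in> carrier R - I" "t \<otimes> b \<in> J" "b \<in> carrier R"
        by (auto simp: saturate_def)
      then have "(s \<otimes> t) \<otimes> (a \<oplus> b) = t \<otimes> (s \<otimes> a) \<oplus> s \<otimes> (t \<otimes> b)" by (simp, algebra)
      then have "(s \<otimes> t) \<otimes> (a \<oplus> b) \<in> J" using s J.I_l_closed by (simp add: J.a_closed)
      then show "a \<oplus> b \<in> saturate R I J" using s notin_mult[OF s(1,4)]
        by (auto simp: saturate_def intro!: bexI[of _ "s \<otimes> t"])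
    qed (auto simp: saturate_def)
    fix a x assume "a \<in> saturate R I J" "x \<in> carrier R"
    then obtain s where s: "s \<in> carrier R - I" "s \<otimes> a \<in> J" "a \<in> carrier R" "x \<in> carrier R"
      by (auto simp: saturate_def)
    then have "s \<otimes> (x \<otimes> a) = x \<otimes> (s \<otimes> a)" by (simp, algebra)
    then show "x \<otimes> a \<in> saturate R I J" using s J.I_l_closed[OF s(2,4)]
      by (auto simp: saturate_def intro!: bexI[of _ s])
    then show "a \<otimes> x \<in> saturate R I J" using s by (simp add: m_comm)
  qed (rule ring_axioms)
qed

lemma saturate_saturate:
  assumes "ideal J R" shows "saturate R I (saturate R I J) = saturate R I J"
proof
  show "saturate R I (saturate R I J) \<subseteq> saturate R I J"
  proof
    fix a assume "a \<in> saturate R I (saturate R I J)"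
    then obtain s t where s: "s \<in> carrier R - I" "t \<in> carrier R - I" "t \<otimes> (s \<otimes> a) \<in> J" "a \<in> carrier R"
      by (auto simp: saturate_def)
    then have "(t \<otimes> s) \<otimes> a \<in> J" by (simp add: m_assoc)
    then show "a \<in> saturate R I J" using s notin_mult[OF s(2,1)]
      by (auto simp: saturate_def intro!: bexI[of _ "t \<otimes> s"])
  qed
qed (rule saturate_incl[OF saturate_ideal[OF assms]])

lemma saturated_iff:
  assumes "saturate R I J = J" "s \<in> carrier R - I" "a \<in> carrier R" "s \<otimes> a \<in> J" shows "a \<in> J"
  using assms by (auto simp: saturate_def)

end

text \<open>An ideal that is maximal among the saturated ideals containing \<open>J\<close> but not \<open>K\<close> yields
  a proof of Nakayama's lemma without generators.\<close>

lemma nakayama_at_prime: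
  fixes R (structure)
  assumes "noetherian_ring R" "primeideal N R" and J: "ideal J R" and K: "ideal K R" and x: "x \<in> N"
    and h: "\<And>a. a \<in> K \<Longrightarrow> \<exists>s\<in>carrier R - N. \<exists>j\<in>J. \<exists>c\<in>K. s \<otimes> a = j \<oplus> x \<otimes> c"
  shows "K \<subseteq> saturate R N J"
proof (rule ccontr)
  interpret noetherian_ring R by fact
  interpret N: primeideal N R by fact
  interpret J: ideal J R by fact
  interpret K: ideal K R by fact
  assume ncon: "\<not> K \<subseteq> saturate R N J"
  define C where "C = {L. ideal L R \<and> J \<subseteq> L \<and> saturate R N L = L \<and> \<not> K \<subseteq> L}"
  have "saturate R N J \<in> C" using ncon N.saturate_ideal[OF J] N.saturate_incl[OF J]
      N.saturate_saturate[OF J] unfolding C_def by blast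
  then have "C \<noteq> {}" by blast
  moreover have "ideal L R" if "L \<in> C" for L using that unfolding C_def by blast
  ultimately obtain L where L: "L \<in> C" "\<forall>L'\<in>C. L \<subseteq> L' \<longrightarrow> L' = L"
    using exists_maximal_ideal_in[of C] by auto
  have Li: "ideal L R" "J \<subseteq> L" "saturate R N L = L" "\<not> K \<subseteq> L" using L(1) unfolding C_def by auto
  interpret L: ideal L R by (rule Li)
  obtain a where a: "a \<in> K" "a \<notin> L" using Li(4) by blast
  have ac: "a \<in> carrier R" using a K.Icarr by blast
  define L' where "L' = saturate R N (adjoin R L a)"
  have idl: "ideal (adjoin R L a) R" using N.ideal_adjoin Li(1) ac by blast
  have "L \<subseteq> L'" "a \<in> L'" unfolding L'_def
    using N.saturate_incl[OF idl] N.adjoin_incl[OF Li(1) ac] by auto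
  then have "L' \<notin> C" using bspec[OF L(2), of L'] a by blast
  then have "K \<subseteq> L'" using \<open>L \<subseteq> L'\<close> Li(2) N.saturate_ideal[OF idl] N.saturate_saturate[OF idl]
    unfolding C_def L'_def by blast
  obtain s j c where s: "s \<in> carrier R - N" "j \<in> J" "c \<in> K" "s \<otimes> a = j \<oplus> x \<otimes> c"
    using h[OF a(1)] by blast
  have "c \<in> L'" using \<open>K \<subseteq> L'\<close> s by blast
  then obtain t l r where t: "t \<in> carrier R - N" "l \<in> L" "r \<in> carrier R" "t \<otimes> c = l \<oplus> r \<otimes> a"
    by (auto simp: L'_def saturate_def N.mem_adjoin)
  have carr: "s \<in> carrier R" "t \<in> carrier R" "j \<in> carrier R" "c \<in> carrier R" "l \<in> carrier R" "x \<in> carrier R"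
    using s t x J.Icarr K.Icarr L.Icarr N.Icarr by auto
  \<comment> \<open>Eliminating c between s a = j + x c and t c = l + r a leaves a multiple of a in
    L. Its multiplier s t - r x lies outside N because x lies in N and s t does not.\<close>
  have "(s \<otimes> t \<ominus> r \<otimes> x) \<otimes> a = t \<otimes> (s \<otimes> a) \<ominus> r \<otimes> x \<otimes> a"
    using carr ac t(3) by algebra
  also have "\<dots> = t \<otimes> j \<oplus> x \<otimes> (t \<otimes> c) \<ominus> r \<otimes> x \<otimes> a"
    unfolding s(4) using carr ac t(3) by algebra
  also have "\<dots> = t \<otimes> j \<oplus> x \<otimes> l"
    unfolding t(4) using carr ac t(3) by algebra
  finally have eq: "(s \<otimes> t \<ominus> r \<otimes> x) \<otimes> a = t \<otimes> j \<oplus> x \<otimes> l" .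
  have "t \<otimes> j \<oplus> x \<otimes> l \<in> L" using s(2) Li(2) t(2) carr by (blast intro: L.I_l_closed L.a_closed)
  moreover have "s \<otimes> t \<ominus> r \<otimes> x \<notin> N"
  proof
    assume "s \<otimes> t \<ominus> r \<otimes> x \<in> N"
    moreover have "r \<otimes> x \<in> N" using x t(3) by (rule N.I_l_closed)
    ultimately have "s \<otimes> t \<ominus> r \<otimes> x \<oplus> r \<otimes> x \<in> N" by (rule N.a_closed)
    moreover have "s \<otimes> t \<ominus> r \<otimes> x \<oplus> r \<otimes> x = s \<otimes> t" using carr t(3) by algebra
    ultimately show False using N.notin_mult s(1) t(1) by auto
  qed
  ultimately have "a \<in> L" using N.saturated_iff[OF Li(3) _ ac, of "s \<otimes> t \<ominus> r \<otimes> x"] eq carr t(3) by auto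
  then show False using a by blast
qed

section \<open>Colon ideals and descending chains of saturated ideals\<close>

definition colon :: "('r, 'z) ring_scheme \<Rightarrow> 'r set \<Rightarrow> 'r \<Rightarrow> 'r set" where
  "colon R J a = {r \<in> carrier R. r \<otimes>\<^bsub>R\<^esub> a \<in> J}"

lemma (in cring) colon_ideal:
  assumes "ideal J R" "a \<in> carrier R" shows "ideal (colon R J a) R"
proof -
  interpret J: ideal J R by fact
  show ?thesis
  proof (rule idealI)
    show "subgroup (colon R J a) (add_monoid R)"
    proof (rule add.subgroupI)
      have "\<zero> \<in> colon R J a" using assms(2) J.zero_closed by (simp add: colon_def)
      then show "colon R J a \<noteq> {}" by blast
    qed (use assms J.a_inv_closed J.a_closed in \<open>auto simp: colon_def l_distr l_minus\<close>)
    fix b x assume b: "b \<in> colon R J a" "x \<in> carrier R"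
    then have "(x \<otimes> b) \<otimes> a = x \<otimes> (b \<otimes> a)" using assms(2) by (simp add: colon_def m_assoc)
    then show "x \<otimes> b \<in> colon R J a" using b assms(2) J.I_l_closed by (simp add: colon_def)
    then show "b \<otimes> x \<in> colon R J a" using b by (simp add: colon_def m_comm)
  qed (rule ring_axioms)
qed

text \<open>The colon ideals with g outside J are the annihilators of the nonzero elements of R/J,
  and a maximal one is an associated prime. If b g is outside J, the colon ideal of b g contains
  that of g, so by maximality they agree; hence a b g in J already gives a g in J.\<close>

lemma (in cring) exists_prime_colon:
  assumes "noetherian_ring R" "ideal J R" "J \<noteq> carrier R"
  shows "\<exists>g\<in>carrier R - J. primeideal (colon R J g) R"
proof -
  interpret N: noetherian_ring R by fact
  interpret J: ideal J R by fact
  define C where "C = colon R J ` (carrier R - J)"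
  have "C \<noteq> {}" using assms(3) J.Icarr by (auto simp: C_def)
  moreover have "ideal L R" if "L \<in> C" for L using that colon_ideal[OF assms(2)] unfolding C_def by blast
  ultimately obtain L where L: "L \<in> C" "\<forall>L'\<in>C. L \<subseteq> L' \<longrightarrow> L' = L"
    using N.exists_maximal_ideal_in[of C] by auto
  then obtain g where g: "g \<in> carrier R" "g \<notin> J" "L = colon R J g" by (auto simp: C_def)
  have "primeideal (colon R J g) R"
  proof (rule primeidealI)
    show "ideal (colon R J g) R" using colon_ideal assms g by blast
    show "cring R" by (rule is_cring)
    have "\<one> \<notin> colon R J g" using g by (simp add: colon_def)
    then show "carrier R \<noteq> colon R J g" by blast
    fix a b assume ab: "a \<in> carrier R" "b \<in> carrier R" "a \<otimes> b \<in> colon R J g"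
    show "a \<in> colon R J g \<or> b \<in> colon R J g"
    proof (rule disjCI)
      assume nb: "b \<notin> colon R J g"
      then have "b \<otimes> g \<in> carrier R - J" using ab g by (simp add: colon_def)
      then have "colon R J (b \<otimes> g) \<in> C" by (simp add: C_def)
      moreover have "colon R J g \<subseteq> colon R J (b \<otimes> g)"
      proof
        fix r assume r: "r \<in> colon R J g"
        then have "r \<otimes> (b \<otimes> g) = b \<otimes> (r \<otimes> g)" using ab g unfolding colon_def by (simp, algebra)
        then show "r \<in> colon R J (b \<otimes> g)" using r ab J.I_l_closed by (simp add: colon_def)
      qed
      ultimately have "colon R J (b \<otimes> g) = colon R J g" using L(2) g(3) by blast
      moreover have "a \<in> colon R J (b \<otimes> g)" using ab g by (simp add: colon_def m_assoc)
      ultimately show "a \<in> colon R J g" by simp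
    qed
  qed
  then show ?thesis using g by blast
qed

text \<open>Behind this is the fact that a Noetherian local ring with a single prime, here R/J
  localized at N, is Artinian. \<open>L\<close> is maximal among the saturated ideals over which
  some descending chain fails to stabilize, and \<open>g\<close> is chosen with colon ideal N, so
  that adjoining it to \<open>L\<close> adds a piece of length one at N. Chains over the enlarged
  ideal stabilize, and a chain over \<open>L\<close> can differ from such a chain only by that
  piece.\<close>

lemma saturated_chain_stabilizes:
  fixes R (structure)
  assumes noeth: "noetherian_ring R" and N: "primeideal N R"
    and uniq: "\<And>P. primeideal P R \<Longrightarrow> J \<subseteq> P \<Longrightarrow> P \<subseteq> N \<Longrightarrow> P = N"
    and J: "ideal J R" "saturate R N J = J"
    and I: "\<forall>n. ideal (I n) R \<and> J \<subseteq> I n \<and> saturate R N (I n) = I n \<and> I (Suc n) \<subseteq> I n"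
  shows "\<exists>n. \<forall>m\<ge>n. I m = I (n::nat)"
proof (rule ccontr)
  interpret noetherian_ring R by fact
  interpret N: primeideal N R by fact
  define ch where "ch L I \<longleftrightarrow> (\<forall>n. ideal (I n) R \<and> L \<subseteq> I n \<and> saturate R N (I n) = I n \<and> I (Suc n) \<subseteq> I n)"
    for L and I :: "nat \<Rightarrow> _ set"
  define C where "C = {L. ideal L R \<and> J \<subseteq> L \<and> saturate R N L = L \<and>
     \<not> (\<forall>I. ch L I \<longrightarrow> (\<exists>n. \<forall>m\<ge>n. I m = I (n::nat)))}"
  assume "\<not> (\<exists>n. \<forall>m\<ge>n. I m = I n)"
  moreover have "ch J I" using I unfolding ch_def by simp
  ultimately have "J \<in> C" using J unfolding C_def by blast
  then have "C \<noteq> {}" by blast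
  moreover have "ideal L R" if "L \<in> C" for L using that unfolding C_def by blast
  ultimately obtain L where L: "L \<in> C" "\<forall>L'\<in>C. L \<subseteq> L' \<longrightarrow> L' = L"
    using exists_maximal_ideal_in[of C] by auto
  have Li: "ideal L R" "J \<subseteq> L" "saturate R N L = L" using L(1) unfolding C_def by auto
  interpret L: ideal L R by (rule Li)
  from L(1) obtain I where I: "ch L I" "\<not> (\<exists>n. \<forall>m\<ge>n. I m = I (n::nat))" unfolding C_def by blast
  have Ii: "ideal (I n) R" "L \<subseteq> I n" "saturate R N (I n) = I n" "I (Suc n) \<subseteq> I n" for n
    using I(1) unfolding ch_def by auto
  have dec: "I m \<subseteq> I n" if "n \<le> m" for n m using lift_Suc_antimono_le[of I, OF Ii(4) that] .
  have "L \<noteq> carrier R"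
  proof
    assume "L = carrier R"
    then have "I n = carrier R" for n using Ii(2)[of n] ideal.Icarr[OF Ii(1)[of n]] by auto
    then show False using I(2) by simp
  qed
  then obtain g where g: "g \<in> carrier R" "g \<notin> L" "primeideal (colon R L g) R"
    using N.exists_prime_colon[OF noeth Li(1)] by blast
  have "colon R L g = N"
  proof (rule uniq[OF g(3)])
    show "J \<subseteq> colon R L g"
    proof
      fix j assume "j \<in> J"
      then have "j \<in> L" using Li by blast
      then show "j \<in> colon R L g" using g(1) L.I_r_closed L.Icarr by (simp add: colon_def)
    qed
    show "colon R L g \<subseteq> N"
      using N.saturated_iff[OF Li(3) _ g(1)] g(2) by (auto simp: colon_def)
  qed
  then have Ng: "r \<otimes> g \<in> L" if "r \<in> N" for r using that by (auto simp: colon_def)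
  define L' where "L' = saturate R N (adjoin R L g)"
  have idl: "ideal (adjoin R L g) R" using N.ideal_adjoin Li(1) g(1) by blast
  have "L \<subseteq> L'" "g \<in> L'" unfolding L'_def
    using N.saturate_incl[OF idl] N.adjoin_incl[OF Li(1) g(1)] by auto
  then have "L' \<notin> C" using bspec[OF L(2), of L'] g by blast
  moreover have "ideal L' R" "saturate R N L' = L'" "J \<subseteq> L'"
    using \<open>L \<subseteq> L'\<close> Li(2) N.saturate_ideal[OF idl] N.saturate_saturate[OF idl] by (auto simp: L'_def)
  ultimately have st: "\<exists>n. \<forall>m\<ge>n. I m = I (n::nat)" if "ch L' I" for I
    using that unfolding C_def by blast
  define K where "K n = saturate R N (adjoin R (I n) g)" for n
  have idI: "ideal (adjoin R (I n) g) R" for n using N.ideal_adjoin Ii(1) g(1) by blast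
  have "ch L' K"
    unfolding ch_def K_def L'_def
    using N.saturate_ideal[OF idI] N.saturate_mono[OF N.adjoin_mono[OF Ii(2)]]
      N.saturate_saturate[OF idI] N.saturate_mono[OF N.adjoin_mono[OF Ii(4)]] by blast
  then obtain n0 where n0: "\<And>m. m \<ge> n0 \<Longrightarrow> K m = K n0" using st by blast
  have "\<exists>n1\<ge>n0. \<forall>m\<ge>n1. I m = I n1"
  \<comment> \<open>If every \<open>I n\<close> contains \<open>g\<close>, then
    \<open>K n = I n\<close>. Otherwise \<open>g\<close> is missing from some index on, and there an
    equation s a = b + r g forces r into N, hence r g into \<open>L\<close>, which lies in every
    member of the chain.\<close>
  proof (cases "\<forall>n. g \<in> I n")
    case True
    have "K n = I n" for n
    proof
      show "K n \<subseteq> I n" using True N.saturate_mono[OF N.adjoin_minimal[OF Ii(1) subset_refl, of g n]] Ii(3)[of n]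
        unfolding K_def by blast
      show "I n \<subseteq> K n" using N.adjoin_incl(1)[OF Ii(1) g(1)] N.saturate_incl[OF idI] unfolding K_def by blast
    qed
    then show ?thesis using n0 by auto
  next
    case False
    then obtain n2 where n2: "g \<notin> I n2" by blast
    define n1 where "n1 = max n0 n2"
    have "I m = I n1" if m: "m \<ge> n1" for m
    proof
      show "I m \<subseteq> I n1" using dec m by blast
      show "I n1 \<subseteq> I m"
      proof
        fix a assume a: "a \<in> I n1"
        interpret In: ideal "I n1" R by (rule Ii)
        interpret Im: ideal "I m" R by (rule Ii)
        have ac: "a \<in> carrier R" using a In.Icarr by blast
        have "a \<in> K n1" using a N.adjoin_incl(1)[OF Ii(1) g(1)] N.saturate_incl[OF idI] unfolding K_def by blast
        then have "a \<in> K m" using n0[of m] n0[of n1] m by (simp add: n1_def)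
        then obtain s b r where s: "s \<in> carrier R - N" "b \<in> I m" "r \<in> carrier R" "s \<otimes> a = b \<oplus> r \<otimes> g"
          by (auto simp: K_def saturate_def N.mem_adjoin)
        have bc: "b \<in> carrier R" using s Im.Icarr by blast
        have "r \<otimes> g = s \<otimes> a \<ominus> b" unfolding s(4) using bc s(3) g(1) by algebra
        moreover have "s \<otimes> a \<ominus> b \<in> I n1"
          unfolding minus_eq using a s(1,2) dec[OF m]
          by (intro In.a_closed In.I_l_closed In.a_inv_closed) auto
        ultimately have rg: "r \<otimes> g \<in> I n1" by simp
        have "g \<notin> I n1" using n2 dec[of n2 n1] by (auto simp: n1_def)
        then have "r \<in> N" using N.saturated_iff[OF Ii(3) _ g(1), of r n1] rg s(3) by blast
        then have "r \<otimes> g \<in> I m" using Ng Ii(2) by blast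
        then have "s \<otimes> a \<in> I m" unfolding s(4) using s(2) by (simp add: Im.a_closed)
        then show "a \<in> I m" using N.saturated_iff[OF Ii(3) s(1) ac] by blast
      qed
    qed
    moreover have "n0 \<le> n1" by (simp add: n1_def)
    ultimately show ?thesis by blast
  qed
  then show False using I(2) by blast
qed

text \<open>Krull's principal ideal theorem, in the form in which it is used: a prime can be inserted
  strictly between \<open>Q\<close> and \<open>N\<close> that contains \<open>x\<close>.  Instead of symbolic powers of \<open>P\<close> it suffices
  to consider the contractions from the localization at \<open>P\<close> of \<open>Q + (y\<^sup>n)\<close> for one \<open>y \<in> P - Q\<close>.\<close>

lemma exists_intermediate_prime:
  fixes R (structure)
  assumes noeth: "noetherian_ring R" and pr: "primeideal Q R" "primeideal P R" "primeideal N R"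
    and sub: "Q \<subset> P" "P \<subset> N" and x: "x \<in> N"
  shows "\<exists>P'. primeideal P' R \<and> Q \<subset> P' \<and> P' \<subset> N \<and> x \<in> P'"
proof (rule ccontr)
  assume ncon: "\<not> ?thesis"
  interpret noetherian_ring R by fact
  interpret N: primeideal N R by fact
  interpret P: primeideal P R by fact
  interpret Q: primeideal Q R by fact
  \<comment> \<open>Otherwise P itself would be the prime sought. That x lies outside P is what
    later allows it to be cancelled modulo the P-saturated ideals \<open>I n\<close>.\<close>
  have xP: "x \<notin> P" using ncon pr sub by blast
  have xc: "x \<in> carrier R" using x N.Icarr by blast
  obtain y where y: "y \<in> P" "y \<notin> Q" using sub by blast
  have yc: "y \<in> carrier R" using y P.Icarr by blast
  define J where "J = saturate R N (adjoin R Q x)"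
  have idQx: "ideal (adjoin R Q x) R" using N.ideal_adjoin Q.ideal_axioms xc by blast
  have J: "ideal J R" "saturate R N J = J" "Q \<subseteq> J" "x \<in> J"
    using N.saturate_ideal[OF idQx] N.saturate_saturate[OF idQx] N.saturate_incl[OF idQx]
      N.adjoin_incl[OF Q.ideal_axioms xc] unfolding J_def by blast+
  have "x \<notin> Q" using xP sub by blast
  have uniq: "P' = N" if P': "primeideal P' R" "J \<subseteq> P'" "P' \<subseteq> N" for P'
  proof -
    have "Q \<subseteq> P'" "x \<in> P'" using P'(2) J(3,4) by blast+
    then have "Q \<subset> P'" using \<open>x \<notin> Q\<close> by blast
    then have "\<not> P' \<subset> N" using ncon P'(1) \<open>x \<in> P'\<close> by meson
    then show ?thesis using P'(3) by blast
  qed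
  define A where "A n = adjoin R Q (y [^] (n::nat))" for n
  have idA: "ideal (A n) R" for n unfolding A_def using N.ideal_adjoin Q.ideal_axioms yc by blast
  define I where "I n = saturate R P (A n)" for n
  have idI: "ideal (I n) R" for n unfolding I_def by (rule P.saturate_ideal[OF idA])
  have satI: "saturate R P (I n) = I n" for n unfolding I_def by (rule P.saturate_saturate[OF idA])
  have QI: "Q \<subseteq> I n" for n using N.adjoin_incl(1)[OF Q.ideal_axioms, of "y [^] n"] yc P.saturate_incl[OF idA]
    unfolding I_def A_def by blast
  have yA: "y [^] n \<in> A n" for n unfolding A_def using N.adjoin_incl[OF Q.ideal_axioms] yc by blast
  have "A (Suc n) \<subseteq> A n" for n
    unfolding A_def[of "Suc n"]
  proof (rule N.adjoin_minimal[OF idA])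
    show "Q \<subseteq> A n" unfolding A_def using N.adjoin_incl(1)[OF Q.ideal_axioms] yc by blast
    show "y [^] Suc n \<in> A n" using ideal.I_r_closed[OF idA yA yc] by simp
  qed
  then have decI: "I (Suc n) \<subseteq> I n" for n unfolding I_def by (rule P.saturate_mono)
  define K where "K n = saturate R N (adjoin R (I n) x)" for n
  have idIx: "ideal (adjoin R (I n) x) R" for n using N.ideal_adjoin[OF idI xc] .
  have "\<exists>n. \<forall>m\<ge>n. K m = K n"
  proof (rule saturated_chain_stabilizes[OF noeth pr(3) uniq J(1,2)])
    show "\<forall>n. ideal (K n) R \<and> J \<subseteq> K n \<and> saturate R N (K n) = K n \<and> K (Suc n) \<subseteq> K n"
      unfolding K_def J_def
      using N.saturate_ideal[OF idIx] N.saturate_saturate[OF idIx] N.saturate_mono[OF N.adjoin_mono[OF decI]]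
        N.saturate_mono[OF N.adjoin_mono[OF QI]] by blast
  qed
  then obtain n where n: "K (Suc n) = K n" by (metis le_Suc_eq order_refl)
  interpret In: ideal "I n" R by (rule idI)
  interpret IS: ideal "I (Suc n)" R by (rule idI)
  \<comment> \<open>Since \<open>K\<close> stabilizes, s a = b + c x with b in
    \<open>I (Suc n)\<close>. Then c x lies in \<open>I n\<close>, and cancelling x puts c into
    \<open>I n\<close>. So at N the ideal \<open>I n\<close> is \<open>I (Suc n)\<close> plus x
    times itself, which is the situation of Nakayama's lemma.\<close>
  have "I n \<subseteq> saturate R N (I (Suc n))"
  proof (rule nakayama_at_prime[OF noeth pr(3) idI idI x])
    fix a assume a: "a \<in> I n"
    then have ac: "a \<in> carrier R" using In.Icarr by blast
    have "a \<in> K n" using a N.adjoin_incl(1)[OF idI xc] N.saturate_incl[OF idIx] unfolding K_def by blast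
    then have "a \<in> K (Suc n)" using n by simp
    then obtain s b c where s: "s \<in> carrier R - N" "b \<in> I (Suc n)" "c \<in> carrier R" "s \<otimes> a = b \<oplus> c \<otimes> x"
      by (auto simp: K_def saturate_def N.mem_adjoin)
    have bc: "b \<in> carrier R" using s IS.Icarr by blast
    have "x \<otimes> c = s \<otimes> a \<ominus> b" unfolding s(4) using bc s(3) xc by algebra
    moreover have "s \<otimes> a \<ominus> b \<in> I n"
      unfolding minus_eq using a s(1,2) decI
      by (intro In.a_closed In.I_l_closed In.a_inv_closed) auto
    ultimately have "x \<otimes> c \<in> I n" by simp
    then have "c \<in> I n" using P.saturated_iff[OF satI _ s(3), of x n] xP xc by blast
    moreover have "s \<otimes> a = b \<oplus> x \<otimes> c" using s xc N.m_comm by simp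
    ultimately show "\<exists>s\<in>carrier R - N. \<exists>j\<in>I (Suc n). \<exists>c\<in>I n. s \<otimes> a = j \<oplus> x \<otimes> c" using s by blast
  qed
  moreover have "y [^] n \<in> I n" unfolding I_def using P.saturate_incl[OF idA] yA by blast
  ultimately obtain s where s: "s \<in> carrier R - N" "s \<otimes> y [^] n \<in> I (Suc n)" by (auto simp: saturate_def)
  then have "y [^] n \<in> I (Suc n)" using P.saturated_iff[OF satI _ _ s(2)] sub yc by blast
  then obtain t where t0: "t \<in> carrier R - P" "t \<otimes> y [^] n \<in> adjoin R Q (y [^] Suc n)"
    unfolding I_def saturate_def A_def by blast
  then obtain q c where t: "t \<in> carrier R - P" "q \<in> Q" "c \<in> carrier R" "t \<otimes> y [^] n = q \<oplus> c \<otimes> y [^] Suc n"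
    unfolding N.mem_adjoin by blast
  have qc: "q \<in> carrier R" using t Q.Icarr by blast
  have yn: "y [^] n \<in> carrier R" using yc by simp
  \<comment> \<open>Here t lies outside P and c y inside, so t - c y is outside P and a fortiori
    outside Q. The prime Q would therefore contain a power of y, although y was chosen outside
    Q.\<close>
  have "(t \<ominus> c \<otimes> y) \<otimes> y [^] n = t \<otimes> y [^] n \<ominus> c \<otimes> y [^] Suc n"
    using t(1,3) yc yn N.m_comm[OF yn yc] by (simp add: minus_eq l_distr l_minus m_assoc)
  also have "\<dots> = q" unfolding t(4) using qc t(3) yc by (simp add: minus_eq a_assoc r_neg)
  finally have "(t \<ominus> c \<otimes> y) \<otimes> y [^] n \<in> Q" using t(2) by simp
  moreover have "t \<ominus> c \<otimes> y \<notin> P"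
  proof
    assume "t \<ominus> c \<otimes> y \<in> P"
    then have "(t \<ominus> c \<otimes> y) \<oplus> c \<otimes> y \<in> P" using P.I_l_closed[OF y(1) t(3)] by (rule P.a_closed)
    moreover have "(t \<ominus> c \<otimes> y) \<oplus> c \<otimes> y = t" using t(1,3) yc by (simp add: minus_eq a_assoc l_neg)
    ultimately show False using t(1) by simp
  qed
  ultimately have "y [^] n \<in> Q" using Q.I_prime[of "t \<ominus> c \<otimes> y" "y [^] n"] t(1,3) yc yn sub by auto
  moreover have "y [^] k \<notin> Q" for k :: nat
  proof (induction k)
    case (Suc k)
    then show ?case using Q.I_prime[of "y [^] k" y] yc y by auto
  qed (use Q.one_notin in simp)
  ultimately show False by blast
qed

section \<open>Regular local rings\<close>

lemma (in noetherian_ring) exists_maximal_ideal: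
  assumes "ideal I R" "I \<noteq> carrier R" shows "\<exists>M. maximalideal M R \<and> I \<subseteq> M"
proof -
  define C where "C = {J. ideal J R \<and> I \<subseteq> J \<and> J \<noteq> carrier R}"
  have "C \<noteq> {}" using assms by (auto simp: C_def)
  moreover have "ideal J R" if "J \<in> C" for J using that unfolding C_def by blast
  ultimately obtain M where M: "M \<in> C" "\<forall>L\<in>C. M \<subseteq> L \<longrightarrow> L = M"
    using exists_maximal_ideal_in[of C] by auto
  have "maximalideal M R"
  proof (rule maximalidealI)
    fix J assume "ideal J R" "M \<subseteq> J" "J \<subseteq> carrier R"
    then show "J = M \<or> J = carrier R" using M unfolding C_def by blast
  qed (use M in \<open>auto simp: C_def\<close>)
  then show ?thesis using M by (auto simp: C_def)
qed

lemma (in cring) Idl_insert: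
  assumes "Y \<subseteq> carrier R" "y \<in> carrier R" shows "Idl (insert y Y) = adjoin R (Idl Y) y"
proof
  have idl: "ideal (Idl Y) R" using assms genideal_ideal by blast
  show "Idl (insert y Y) \<subseteq> adjoin R (Idl Y) y"
    using adjoin_incl[OF idl assms(2)] genideal_self[OF assms(1)]
    by (intro genideal_minimal ideal_adjoin idl assms(2)) auto
  have "insert y Y \<subseteq> Idl (insert y Y)" using assms by (intro genideal_self) auto
  then show "adjoin R (Idl Y) y \<subseteq> Idl (insert y Y)"
    using assms genideal_ideal[of "insert y Y"] by (intro adjoin_minimal genideal_minimal) auto
qed

lemma (in cring) Idl_empty: "Idl {} = {\<zero>}"
proof
  show "Idl {} \<subseteq> {\<zero>}" by (rule genideal_minimal[OF zeroideal]) simp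
  have "ideal (Idl {}) R" by (rule genideal_ideal) simp
  then show "{\<zero>} \<subseteq> Idl {}" by (simp add: ideal.axioms(1) additive_subgroup.zero_closed)
qed

section \<open>Chains of primes and regular systems of parameters\<close>

primrec prime_chain :: "('r, 'z) ring_scheme \<Rightarrow> 'r set \<Rightarrow> nat \<Rightarrow> 'r set \<Rightarrow> bool" where
  "prime_chain R N 0 Q \<longleftrightarrow> Q = N"
| "prime_chain R N (Suc n) Q \<longleftrightarrow> primeideal Q R \<and> (\<exists>Q'. Q \<subset> Q' \<and> prime_chain R N n Q')"

lemma prime_chain_prime: "primeideal N R \<Longrightarrow> prime_chain R N n Q \<Longrightarrow> primeideal Q R"
  by (cases n) auto

lemma prime_chain_subset: "prime_chain R N n Q \<Longrightarrow> Q \<subseteq> N"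
  by (induction n arbitrary: Q) auto

text \<open>Requiring the members above Q to contain x costs a chain at most one step. In the
  induction x already lies in the member \<open>Q2\<close> two places above Q; Krull's theorem
  applied to Q, \<open>Q1\<close>, \<open>Q2\<close> replaces \<open>Q1\<close> by a prime that
  contains x.\<close>

lemma prime_chain_adjoin:
  assumes "noetherian_ring R" "primeideal N R" "x \<in> N"
  shows "prime_chain R N (Suc n) Q \<Longrightarrow> \<exists>Q'. Q \<subset> Q' \<and> x \<in> Q' \<and> prime_chain R N n Q'"
proof (induction n arbitrary: Q)
  case 0
  then show ?case using assms(3) by auto
next
  case (Suc n)
  then obtain Q1 where Q1: "primeideal Q R" "Q \<subset> Q1" "prime_chain R N (Suc n) Q1"
    unfolding prime_chain.simps(2)[of R N "Suc n"] by blast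
  obtain Q2 where Q2: "Q1 \<subset> Q2" "x \<in> Q2" "prime_chain R N n Q2" using Suc.IH[OF Q1(3)] by blast
  have "\<exists>P'. primeideal P' R \<and> Q \<subset> P' \<and> P' \<subset> Q2 \<and> x \<in> P'"
    using prime_chain_prime[OF assms(2)] Q1 Q2 by (intro exists_intermediate_prime[OF assms(1) Q1(1)])
  then obtain P' where "primeideal P' R" "Q \<subset> P'" "P' \<subset> Q2" "x \<in> P'" by blast
  moreover from this have "prime_chain R N (Suc n) P'" using Q2(3) unfolding prime_chain.simps(2) by blast
  ultimately show ?case by blast
qed

text \<open>A local ring with maximal ideal \<open>\<mm>\<close> generated by a set \<open>B\<close> of as many elements as there are
  steps in some chain of primes, that is, a regular local ring with a regular system of parameters.\<close>

locale regular_params = cring R + noetherian_ring R for R (structure) +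
  fixes \<mm> :: "'a set" and B :: "'a set"
  assumes local: "{I. maximalideal I R} = {\<mm>}"
    and B: "finite B" "B \<subseteq> carrier R" "\<mm> = Idl B"
    and chain: "\<exists>Q. prime_chain R \<mm> (card B) Q"
begin

lemma max: "maximalideal \<mm> R" using local by auto

sublocale m: maximalideal \<mm> R by (rule max)

lemma prime_m: "primeideal \<mm> R" by (rule maximalideal_prime[OF max])

sublocale m: primeideal \<mm> R by (rule prime_m)

lemma proper_subset_m:
  assumes "ideal I R" "I \<noteq> carrier R" shows "I \<subseteq> \<mm>"
proof -
  obtain M where "maximalideal M R" "I \<subseteq> M" using exists_maximal_ideal[OF assms] by blast
  moreover have "M = \<mm>" using local \<open>maximalideal M R\<close> by blast
  ultimately show ?thesis by simp
qed

lemma notin_m_unit: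
  assumes "s \<in> carrier R" "s \<notin> \<mm>" shows "\<exists>t\<in>carrier R. t \<otimes> s = \<one>"
proof -
  have "PIdl s = carrier R"
    using proper_subset_m[OF cgenideal_ideal[OF assms(1)]] cgenideal_self[OF assms(1)] assms by blast
  then have "\<one> \<in> PIdl s" by simp
  then show ?thesis by (auto simp: cgenideal_def)
qed

lemma saturate_m:
  assumes "ideal J R" shows "saturate R \<mm> J = J"
proof
  interpret J: ideal J R by fact
  show "saturate R \<mm> J \<subseteq> J"
  proof
    fix a assume "a \<in> saturate R \<mm> J"
    then obtain s where s: "s \<in> carrier R - \<mm>" "s \<otimes> a \<in> J" "a \<in> carrier R" by (auto simp: saturate_def)
    then obtain t where t: "t \<in> carrier R" "t \<otimes> s = \<one>" using notin_m_unit by blast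
    have "t \<otimes> (s \<otimes> a) \<in> J" using J.I_l_closed s t by blast
    then show "a \<in> J" using s t by (simp flip: m_assoc)
  qed
qed (rule m.saturate_incl[OF assms])

lemma nakayama:
  assumes "ideal J R" "ideal K R" "x \<in> \<mm>" "\<And>a. a \<in> K \<Longrightarrow> \<exists>j\<in>J. \<exists>c\<in>K. a = j \<oplus> x \<otimes> c"
  shows "K \<subseteq> J"
proof -
  have "K \<subseteq> saturate R \<mm> J"
  proof (rule nakayama_at_prime[OF noetherian_ring_axioms prime_m assms(1,2,3)])
    fix a assume "a \<in> K"
    then have "a \<in> carrier R" using assms(2) ideal.Icarr by metis
    then have "\<exists>j\<in>J. \<exists>c\<in>K. \<one> \<otimes> a = j \<oplus> x \<otimes> c" using assms(4)[OF \<open>a \<in> K\<close>] by simp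
    then show "\<exists>s\<in>carrier R - \<mm>. \<exists>j\<in>J. \<exists>c\<in>K. s \<otimes> a = j \<oplus> x \<otimes> c"
      using m.one_notin by blast
  qed
  then show ?thesis using saturate_m[OF assms(1)] by simp
qed

lemma B_in_m: "B \<subseteq> \<mm>" using B(2,3) genideal_self by simp

text \<open>One half of the formula dim R/(Y) = card (B - Y): the elements of Y are imposed one by
  one on a chain of length card B, each at the cost of one step.\<close>

lemma chain_lower:
  assumes "Y \<subseteq> B" shows "\<exists>Q. Y \<subseteq> Q \<and> prime_chain R \<mm> (card (B - Y)) Q"
  using finite_subset[OF assms B(1)] assms
proof (induction Y rule: finite_induct)
  case (insert y Y)
  then obtain Q where Q: "Y \<subseteq> Q" "prime_chain R \<mm> (card (B - Y)) Q" by auto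
  have "card (B - Y) = Suc (card (B - insert y Y))"
    using insert B(1) by (metis Diff_insert card_Suc_Diff1 finite_Diff insert_Diff_if insert_subset Diff_iff)
  then obtain Q' where "Q \<subset> Q'" "y \<in> Q'" "prime_chain R \<mm> (card (B - insert y Y)) Q'"
    using prime_chain_adjoin[OF noetherian_ring_axioms prime_m, of y] Q(2) B_in_m insert.prems by (metis insert_subset subset_iff)
  then show ?case using Q(1) by blast
qed (use chain in simp)

text \<open>The other half of that formula. Imposing the remaining parameters one by one shortens
  the chain by one step each, and once all of B is contained in the prime, the prime is \<mm> and no
  step is left.\<close>

lemma chain_upper:
  assumes "Y \<subseteq> B" "Y \<subseteq> Q" "prime_chain R \<mm> n Q" shows "n \<le> card (B - Y)"
  using assms
proof (induction "card (B - Y)" arbitrary: Y Q n)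
  case 0
  then have "Y = B" using B(1) by auto
  have "\<mm> \<subseteq> Q"
    unfolding B(3) using prime_chain_prime[OF prime_m 0(4)] 0(3) \<open>Y = B\<close>
    by (intro genideal_minimal) (auto simp: primeideal.axioms)
  have "n = 0"
  proof (cases n)
    case (Suc n')
    then obtain Q' where "Q \<subset> Q'" "prime_chain R \<mm> n' Q'" using 0(4) by auto
    then show ?thesis using prime_chain_subset[of R \<mm> n' Q'] \<open>\<mm> \<subseteq> Q\<close> by blast
  qed
  then show ?case by simp
next
  case (Suc k)
  note prems = Suc.prems and hyps = Suc.hyps
  from Suc obtain y where y: "y \<in> B" "y \<notin> Y" by (metis Diff_iff card.empty nat.distinct(1) ex_in_conv)
  then have k: "k = card (B - insert y Y)" using Suc(2) B(1) by (metis Diff_iff Diff_insert card_Diff_singleton diff_Suc_1)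
  show ?case
  proof (cases n)
    case (Suc n')
    have "y \<in> \<mm>" using B_in_m y by blast
    then obtain Q' where "Q \<subset> Q'" "y \<in> Q'" "prime_chain R \<mm> n' Q'"
      using prime_chain_adjoin[OF noetherian_ring_axioms prime_m] prems(3) Suc by blast
    then have "n' \<le> card (B - insert y Y)" using y prems by (intro hyps(1)[OF k]) auto
    then show ?thesis using Suc hyps(2) k by simp
  qed simp
qed

text \<open>Descending induction on Y. Take a prime \<open>Q\<close> over Y with a chain of maximal
  length; the upper bound on chains keeps y out of \<open>Q\<close>. A prime \<open>Q'\<close> above
  \<open>Q\<close> that contains y has a chain one step shorter, and comparison of lengths
  identifies it with the prime (Y, y) of the induction hypothesis. Hence \<open>Q\<close> lies in
  (Y) + (y), in fact in (Y) + y \<open>Q\<close> because y is not in \<open>Q\<close>, and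
  Nakayama's lemma gives \<open>Q\<close> = (Y).\<close>

lemma Idl_prime:
  assumes "Y \<subseteq> B" shows "primeideal (Idl Y) R \<and> (\<forall>y\<in>B - Y. y \<notin> Idl Y)"
  using assms
proof (induction "card (B - Y)" arbitrary: Y)
  case 0
  then have "Y = B" using B(1) by auto
  then show ?case using prime_m B(3) by simp
next
  case (Suc k)
  have Yc: "Y \<subseteq> carrier R" using Suc B by blast
  have main: "primeideal (Idl Y) R \<and> y \<notin> Idl Y" if y: "y \<in> B - Y" for y
  proof -
    have yc: "y \<in> carrier R" using y B by blast
    have k: "k = card (B - insert y Y)" using Suc(2) y B(1) by (metis Diff_insert card_Diff_singleton diff_Suc_1)
    have pr: "primeideal (Idl (insert y Y)) R" using Suc(1)[OF k] Suc.prems y by auto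
    obtain Q where Q: "Y \<subseteq> Q" "prime_chain R \<mm> (Suc k) Q" using chain_lower[OF Suc.prems] Suc(2) by auto
    have yQ: "y \<notin> Q"
    proof
      assume "y \<in> Q"
      then have "Suc k \<le> card (B - insert y Y)" using Q y Suc.prems by (intro chain_upper) auto
      then show False using k by simp
    qed
    have "y \<in> \<mm>" using B_in_m y by blast
    then obtain Q' where Q': "Q \<subset> Q'" "y \<in> Q'" "prime_chain R \<mm> k Q'"
      using prime_chain_adjoin[OF noetherian_ring_axioms prime_m _ Q(2)] by blast
    interpret Q: primeideal Q R using prime_chain_prime[OF prime_m Q(2)] .
    interpret Q': primeideal Q' R using prime_chain_prime[OF prime_m Q'(3)] .
    have "Idl (insert y Y) \<subseteq> Q'" using Q Q' by (intro genideal_minimal Q'.ideal_axioms) auto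
    moreover have "\<not> Idl (insert y Y) \<subset> Q'"
    proof
      assume "Idl (insert y Y) \<subset> Q'"
      then have "prime_chain R \<mm> (Suc k) (Idl (insert y Y))" using pr Q'(3) by auto
      then have "Suc k \<le> card (B - insert y Y)"
        using y Suc.prems genideal_self[of "insert y Y"] yc Yc by (intro chain_upper) auto
      then show False using k by simp
    qed
    ultimately have eq: "Q' = adjoin R (Idl Y) y" using Idl_insert[OF Yc yc] by blast
    have idl: "ideal (Idl Y) R" using genideal_ideal[OF Yc] .
    have YQ: "Idl Y \<subseteq> Q" using Q by (intro genideal_minimal Q.ideal_axioms)
    have "Q \<subseteq> Idl Y"
    proof (rule nakayama[OF idl Q.ideal_axioms])
      show "y \<in> \<mm>" using y B_in_m by blast
      fix a assume a: "a \<in> Q"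
      then have "a \<in> adjoin R (Idl Y) y" using eq Q'(1) by blast
      then obtain i r where ir: "i \<in> Idl Y" "r \<in> carrier R" "a = i \<oplus> r \<otimes> y" by (auto simp: mem_adjoin)
      have ac: "a \<in> carrier R" "i \<in> carrier R" using a Q.Icarr ir(1) ideal.Icarr[OF idl] by auto
      have "r \<otimes> y = a \<ominus> i" unfolding ir(3) using ac ir yc by algebra
      moreover have "a \<ominus> i \<in> Q" unfolding minus_eq using a ir YQ by (intro Q.a_closed Q.a_inv_closed) auto
      ultimately have "r \<in> Q" using Q.I_prime[of r y] ir yc yQ by auto
      moreover have "a = i \<oplus> y \<otimes> r" using ir yc by (simp add: m_comm)
      ultimately show "\<exists>j\<in>Idl Y. \<exists>c\<in>Q. a = j \<oplus> y \<otimes> c" using ir(1) by blast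
    qed
    then have "Q = Idl Y" using YQ by blast
    then show ?thesis using Q.primeideal_axioms yQ by simp
  qed
  moreover have "B - Y \<noteq> {}" using Suc(2) by (metis card.empty nat.distinct(1))
  ultimately show ?case by blast
qed

section \<open>Powers of regular parameters as regular sequences\<close>

definition pow_ideal :: "('a \<Rightarrow> nat) \<Rightarrow> 'a set \<Rightarrow> 'a set" where
  "pow_ideal a S = Idl ((\<lambda>x. x [^] a x) ` S)"

lemma pow_ideal_ideal: "S \<subseteq> B \<Longrightarrow> ideal (pow_ideal a S) R"
  unfolding pow_ideal_def using B(2) by (intro genideal_ideal) auto

lemma pow_ideal_insert:
  assumes "S \<subseteq> B" "x \<in> B" shows "pow_ideal a (insert x S) = adjoin R (pow_ideal a S) (x [^] a x)"
  unfolding pow_ideal_def image_insert using assms B(2) by (intro Idl_insert) auto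

lemma pow_ideal_cong: "(\<And>x. x \<in> S \<Longrightarrow> a x = b x) \<Longrightarrow> pow_ideal a S = pow_ideal b S"
  unfolding pow_ideal_def by (simp cong: image_cong)

text \<open>Powers of regular parameters form a regular sequence in any order. If all exponents are
  1, the ideal is a prime that does not contain x. Otherwise one exponent is Suc k: with the smaller
  exponent k one gets z = i + w j^k, then j^k is cancelled modulo the other powers, and the exponent
  1 puts w into the ideal with j, so that z gains the missing factor j.\<close>

lemma pow_ideal_regular:
  assumes "S \<subseteq> B" "\<forall>y\<in>S. a y \<ge> 1" "x \<in> B" "x \<notin> S" "z \<in> carrier R" "x \<otimes> z \<in> pow_ideal a S"
  shows "z \<in> pow_ideal a S"
  using assms
proof (induction "sum a S" arbitrary: S a x z rule: less_induct)
  case less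
  have fin: "finite S" using less.prems B finite_subset by blast
  have xc: "x \<in> carrier R" using less B by blast
  show ?case
  proof (cases "\<forall>y\<in>S. a y = 1")
    case True
    then have "(\<lambda>x. x [^] a x) ` S = S" using less.prems(1) B(2) by (auto simp: image_def subset_iff)
    then have eq: "pow_ideal a S = Idl S" by (simp add: pow_ideal_def)
    have "primeideal (Idl S) R" "x \<notin> Idl S" using Idl_prime less.prems by auto
    then show ?thesis using primeideal.I_prime[of "Idl S" R x z] less.prems xc unfolding eq by auto
  next
    case False
    then obtain j where j: "j \<in> S" "a j \<noteq> 1" by blast
    define k where "k = a j - 1"
    have ajk: "a j = Suc k" "k \<ge> 1" using j less.prems(2) by (auto simp: k_def Suc_le_eq)
    have jX: "j \<in> B" "j \<in> carrier R" using j less.prems B by auto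
    define S' where "S' = S - {j}"
    have S': "S = insert j S'" "j \<notin> S'" "S' \<subseteq> B" "finite S'" "x \<noteq> j" "x \<notin> S'" using j less.prems fin by (auto simp: S'_def)
    define I where "I = pow_ideal a S'"
    interpret I: ideal I R unfolding I_def by (rule pow_ideal_ideal[OF S'(3)])
    have Ib: "pow_ideal (a(j := m)) S = adjoin R I (j [^] m)" for m
    proof -
      have "pow_ideal (a(j := m)) S' = I" unfolding I_def by (rule pow_ideal_cong) (use S' in auto)
      then show ?thesis using pow_ideal_insert[OF S'(3) jX(1), of "a(j:=m)"] S'(1) by simp
    qed
    \<comment> \<open>Applied with m = k and with m = 1. Both are smaller than a j = Suc k because k
      is at least 1.\<close>
    have IHm: "w \<in> adjoin R I (j [^] m)" if "x \<otimes> w \<in> adjoin R I (j [^] m)" "w \<in> carrier R" "1 \<le> m" "m < a j" for w m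
    proof -
      have "sum (a(j := m)) S' = sum a S'" using S' by (intro sum.cong) auto
      then have "sum (a(j := m)) S < sum a S" using S' that by simp
      then show ?thesis using less.hyps[of "a(j:=m)" S x w] less.prems that unfolding Ib by auto
    qed
    have IHI: "w \<in> I" if "j \<otimes> w \<in> I" "w \<in> carrier R" for w
    proof -
      have "sum a S' < sum a S" using S' ajk by simp
      then show ?thesis using less.hyps[of a S' j w] less.prems that S' jX unfolding I_def by auto
    qed
    have IHk: "w \<in> I" if "j [^] (n::nat) \<otimes> w \<in> I" "w \<in> carrier R" for w n
      using that
    proof (induction n)
      case (Suc n)
      have "j \<otimes> (j [^] n \<otimes> w) = j [^] Suc n \<otimes> w" using jX Suc.prems(2) by (simp add: m_ac)
      then have "j \<otimes> (j [^] n \<otimes> w) \<in> I" using Suc.prems(1) by (simp only:)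
      then have "j [^] n \<otimes> w \<in> I" using IHI jX Suc.prems(2) by simp
      then show ?case by (rule Suc.IH[OF _ Suc.prems(2)])
    qed simp
    have Sa: "pow_ideal a S = adjoin R I (j [^] Suc k)" using Ib[of "a j"] unfolding fun_upd_triv by (simp only: ajk(1))
    have jk: "j [^] Suc k = j \<otimes> j [^] k" "j [^] k \<in> carrier R" using jX by (auto simp: m_comm)
    obtain i' v where i': "i' \<in> I" "v \<in> carrier R" "x \<otimes> z = i' \<oplus> v \<otimes> (j \<otimes> j [^] k)"
      using less.prems(6) unfolding Sa mem_adjoin jk by blast
    have "x \<otimes> z = i' \<oplus> (v \<otimes> j) \<otimes> j [^] k" using i' jX jk by (simp add: m_assoc)
    then have "x \<otimes> z \<in> adjoin R I (j [^] k)" unfolding mem_adjoin using i' jX by blast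
    then have "z \<in> adjoin R I (j [^] k)" using IHm[of z k] less.prems(5) ajk by auto
    then obtain i w where iw: "i \<in> I" "w \<in> carrier R" "z = i \<oplus> w \<otimes> j [^] k" unfolding mem_adjoin by blast
    have carr: "i \<in> carrier R" "i' \<in> carrier R" using iw i' I.Icarr by auto
    have "j [^] k \<otimes> (x \<otimes> w \<ominus> v \<otimes> j) = (x \<otimes> z \<ominus> x \<otimes> i) \<ominus> v \<otimes> (j \<otimes> j [^] k)"
      unfolding iw(3) using carr iw(2) i'(2) jX jk(2) xc by algebra
    also have "\<dots> = i' \<ominus> x \<otimes> i"
      unfolding i'(3) using carr iw(2) i'(2) jX jk(2) xc by algebra
    finally have "j [^] k \<otimes> (x \<otimes> w \<ominus> v \<otimes> j) \<in> I"
      using i'(1) iw(1) xc unfolding minus_eq by (auto intro!: I.a_closed I.a_inv_closed I.I_l_closed)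
    then have xw: "x \<otimes> w \<ominus> v \<otimes> j \<in> I" using IHk xc iw(2) i'(2) jX by simp
    have "x \<otimes> w = (x \<otimes> w \<ominus> v \<otimes> j) \<oplus> v \<otimes> j" using xc iw(2) i'(2) jX by (simp add: minus_eq a_assoc l_neg)
    then have "x \<otimes> w \<in> adjoin R I (j [^] (1::nat))" unfolding mem_adjoin using xw i'(2) jX by auto
    then have "w \<in> adjoin R I (j [^] (1::nat))" using IHm[of w 1] iw(2) ajk by auto
    then obtain i2 u where u: "i2 \<in> I" "u \<in> carrier R" "w = i2 \<oplus> u \<otimes> j" unfolding mem_adjoin using jX by auto
    have u2: "i2 \<in> carrier R" using u I.Icarr by auto
    have "z = (i \<oplus> j [^] k \<otimes> i2) \<oplus> u \<otimes> (j \<otimes> j [^] k)"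
      unfolding iw(3) u(3) using carr u(2) u2 jX jk(2) by algebra
    moreover have "i \<oplus> j [^] k \<otimes> i2 \<in> I" using iw(1) u(1) jk(2) by (intro I.a_closed I.I_l_closed)
    ultimately show ?thesis unfolding Sa mem_adjoin jk using u(2) by blast
  qed
qed

end

section \<open>The Frobenius on a regular local ring\<close>

context char_p_ring begin

text \<open>The linear combination of U in F^e_* R, where a scalar acts through its p^e-th
  power.\<close>

definition frob_comb :: "nat \<Rightarrow> 'a set \<Rightarrow> ('a \<Rightarrow> 'a) \<Rightarrow> 'a" where
  "frob_comb e U a = (\<Oplus>u\<in>U. a u [^] (p ^ e) \<otimes> u)"

definition frob_generates :: "nat \<Rightarrow> 'a set \<Rightarrow> bool" where
  "frob_generates e U \<longleftrightarrow> (\<forall>x\<in>carrier R. \<exists>a\<in>U \<rightarrow> carrier R. x = frob_comb e U a)"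

context
  fixes U assumes U: "finite U" "U \<subseteq> carrier R"
begin

lemma frob_comb_closed [simp]: "a \<in> U \<rightarrow> carrier R \<Longrightarrow> frob_comb e U a \<in> carrier R"
  unfolding frob_comb_def using U by (intro finsum_closed) auto

lemma frob_comb_cong: "a \<in> U \<rightarrow> carrier R \<Longrightarrow> (\<And>u. u \<in> U \<Longrightarrow> b u = a u) \<Longrightarrow> frob_comb e U b = frob_comb e U a"
  unfolding frob_comb_def using U by (intro finsum_cong') auto

lemma frob_comb_add:
  assumes "a \<in> U \<rightarrow> carrier R" "b \<in> U \<rightarrow> carrier R"
  shows "frob_comb e U (\<lambda>u. a u \<oplus> b u) = frob_comb e U a \<oplus> frob_comb e U b"
proof -
  have "frob_comb e U (\<lambda>u. a u \<oplus> b u) = (\<Oplus>u\<in>U. a u [^] (p ^ e) \<otimes> u \<oplus> b u [^] (p ^ e) \<otimes> u)"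
    unfolding frob_comb_def using assms U
    by (intro finsum_cong') (auto simp: frob_add l_distr Pi_iff subset_iff)
  also have "\<dots> = frob_comb e U a \<oplus> frob_comb e U b"
    unfolding frob_comb_def using assms U by (intro finsum_addf) auto
  finally show ?thesis .
qed

lemma frob_comb_smult:
  assumes "a \<in> U \<rightarrow> carrier R" "r \<in> carrier R"
  shows "frob_comb e U (\<lambda>u. r \<otimes> a u) = r [^] (p ^ e) \<otimes> frob_comb e U a"
proof -
  have "frob_comb e U (\<lambda>u. r \<otimes> a u) = (\<Oplus>u\<in>U. r [^] (p ^ e) \<otimes> (a u [^] (p ^ e) \<otimes> u))"
    unfolding frob_comb_def using assms U
    by (intro finsum_cong') (auto simp: nat_pow_distrib m_assoc Pi_iff subset_iff)
  also have "\<dots> = r [^] (p ^ e) \<otimes> frob_comb e U a"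
    unfolding frob_comb_def using assms U by (intro finsum_rdistr[symmetric]) auto
  finally show ?thesis .
qed

lemma frob_comb_minus:
  assumes "a \<in> U \<rightarrow> carrier R"
  shows "frob_comb e U (\<lambda>u. \<ominus> a u) = \<ominus> frob_comb e U a"
proof -
  have "frob_comb e U (\<lambda>u. \<ominus> a u) = frob_comb e U (\<lambda>u. \<ominus> \<one> \<otimes> a u)"
    using assms by (intro frob_comb_cong) (auto simp: l_minus Pi_iff)
  also have "\<dots> = \<ominus> frob_comb e U a"
    using assms by (subst frob_comb_smult) (auto simp: frob_minus l_minus)
  finally show ?thesis .
qed

lemma frob_comb_zero: "frob_comb e U (\<lambda>u. \<zero>) = \<zero>"
proof -
  have "frob_comb e U (\<lambda>u. \<zero>) = (\<Oplus>u\<in>U. \<zero>)"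
    unfolding frob_comb_def using U by (intro finsum_cong') (auto simp: frob_zero subset_iff)
  then show ?thesis by simp
qed

end

lemma frob_comb_remove:
  assumes "finite U" "U \<subseteq> carrier R" "u \<in> U" "a \<in> U \<rightarrow> carrier R"
  shows "frob_comb e U a = a u [^] (p ^ e) \<otimes> u \<oplus> frob_comb e (U - {u}) a"
proof -
  have "U = insert u (U - {u})" using assms by auto
  then have "frob_comb e U a = frob_comb e (insert u (U - {u})) a" by simp
  also have "\<dots> = a u [^] (p ^ e) \<otimes> u \<oplus> frob_comb e (U - {u}) a"
    unfolding frob_comb_def using assms by (intro finsum_insert) auto
  finally show ?thesis .
qed

end

locale regular_params_char_p = regular_params + char_p_ring
begin

lemma frob_mem_pow_ideal:
  assumes "Y \<subseteq> B" "c \<in> Idl Y" shows "c [^] (p ^ e) \<in> pow_ideal (\<lambda>_. p ^ e) Y"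
proof -
  have Yc: "Y \<subseteq> carrier R" using assms B by blast
  interpret I: ideal "pow_ideal (\<lambda>_. p ^ e) Y" R by (rule pow_ideal_ideal[OF assms(1)])
  define J where "J = {c \<in> carrier R. c [^] (p ^ e) \<in> pow_ideal (\<lambda>_. p ^ e) Y}"
  have "ideal J R"
  proof (rule idealI)
    show "subgroup J (add_monoid R)"
    proof (rule add.subgroupI)
      have "\<zero> \<in> J" by (simp add: J_def frob_zero)
      then show "J \<noteq> {}" by blast
    qed (auto simp: J_def frob_minus frob_add)
    fix a x assume "a \<in> J" "x \<in> carrier R"
    then show "x \<otimes> a \<in> J" "a \<otimes> x \<in> J"
      by (auto simp: J_def nat_pow_distrib I.I_l_closed I.I_r_closed)
  qed (rule ring_axioms)
  moreover have "Y \<subseteq> J"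
    using Yc genideal_self[of "(\<lambda>x. x [^] (p ^ e)) ` Y"] by (auto simp: J_def pow_ideal_def)
  ultimately have "Idl Y \<subseteq> J" by (rule genideal_minimal)
  then show ?thesis using assms(2) by (auto simp: J_def)
qed

lemma pow_ideal_regular_pow:
  assumes "Y \<subseteq> B" "y \<in> B - Y"
  shows "z \<in> carrier R \<Longrightarrow> y [^] (n::nat) \<otimes> z \<in> pow_ideal (\<lambda>_. p ^ e) Y \<Longrightarrow> z \<in> pow_ideal (\<lambda>_. p ^ e) Y"
proof (induction n)
  case (Suc n)
  have yc: "y \<in> carrier R" using assms B by blast
  have "y \<otimes> (y [^] n \<otimes> z) = y [^] Suc n \<otimes> z" using yc Suc.prems(1) by (simp add: m_ac)
  then have "y \<otimes> (y [^] n \<otimes> z) \<in> pow_ideal (\<lambda>_. p ^ e) Y" using Suc.prems(2) by (simp only:)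
  then have "y [^] n \<otimes> z \<in> pow_ideal (\<lambda>_. p ^ e) Y"
    using assms yc Suc.prems(1) q_pos[of e]
    by (intro pow_ideal_regular[of Y "\<lambda>_. p ^ e" y "y [^] n \<otimes> z"] ballI) (simp_all add: Suc_le_eq)
  then show ?case by (rule Suc.IH[OF Suc.prems(1)])
qed simp

text \<open>The bracket power of \<mm> is \<mm> times F^e_* R. The set \<open>T\<close> of
  combinations with coefficients in \<mm> is an ideal of R, not just a submodule of F^e_* R:
  multiplication by x is R-linear on F^e_* R, so the products x u can be expanded over U again. It
  contains the generators x^(p^e), as an expansion of 1 multiplied by x^(p^e) shows.\<close>

lemma frob_comb_mem_bracket_power:
  assumes U: "finite U" "U \<subseteq> carrier R" "frob_generates e U"
    and z: "z \<in> pow_ideal (\<lambda>_. p ^ e) B"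
  shows "\<exists>c\<in>U \<rightarrow> \<mm>. z = frob_comb e U c"
proof -
  define T where "T = frob_comb e U ` (U \<rightarrow> \<mm>)"
  have mc: "c \<in> U \<rightarrow> carrier R" if "c \<in> U \<rightarrow> \<mm>" for c
    using that m.a_subset unfolding Pi_iff by blast
  have T0: "\<zero> \<in> T" unfolding T_def using frob_comb_zero[OF U(1,2)]
    by (intro image_eqI[of _ _ "\<lambda>u. \<zero>"]) auto
  have Tadd: "a \<oplus> b \<in> T" if "a \<in> T" "b \<in> T" for a b
  proof -
    obtain c d where cd: "c \<in> U \<rightarrow> \<mm>" "d \<in> U \<rightarrow> \<mm>" "a = frob_comb e U c" "b = frob_comb e U d"
      using \<open>a \<in> T\<close> \<open>b \<in> T\<close> unfolding T_def by blast
    have "(\<lambda>u. c u \<oplus> d u) \<in> U \<rightarrow> \<mm>" using cd(1,2) by (simp add: Pi_iff)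
    moreover have "a \<oplus> b = frob_comb e U (\<lambda>u. c u \<oplus> d u)"
      unfolding cd(3,4) by (rule frob_comb_add[OF U(1,2) mc mc, symmetric]) (fact cd)+
    ultimately show ?thesis unfolding T_def by blast
  qed
  have Tcarr: "T \<subseteq> carrier R" unfolding T_def using frob_comb_closed[OF U(1,2) mc] by (rule image_subsetI)
  have Tsum: "(\<Oplus>u\<in>F. g u) \<in> T" if "finite F" "g \<in> F \<rightarrow> T" for F and g :: "'a \<Rightarrow> 'a"
    using that
  proof (induction F rule: finite_induct)
    case (insert u F)
    then have "g u \<in> carrier R" "g \<in> F \<rightarrow> carrier R" using Tcarr by auto
    then show ?case using insert Tadd by simp
  qed (simp add: T0)
  have "\<forall>x\<in>carrier R. \<exists>a. a \<in> U \<rightarrow> carrier R \<and> x = frob_comb e U a"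
    using U(3) unfolding frob_generates_def by blast
  then obtain \<rho> where \<rho>: "\<And>x. x \<in> carrier R \<Longrightarrow> \<rho> x \<in> U \<rightarrow> carrier R \<and> x = frob_comb e U (\<rho> x)"
    by metis
  have "ideal T R"
  proof (rule idealI)
    show "subgroup T (add_monoid R)"
    proof (rule add.subgroupI)
      fix a assume "a \<in> T"
      then obtain c where c: "c \<in> U \<rightarrow> \<mm>" "a = frob_comb e U c" unfolding T_def by blast
      then show "\<ominus> a \<in> T" unfolding T_def
        by (intro image_eqI[of _ _ "\<lambda>u. \<ominus> c u"]) (auto simp: frob_comb_minus[OF U(1,2) mc])
    qed (use T0 Tadd Tcarr in auto)
    fix a x assume a: "a \<in> T" and x: "x \<in> carrier R"
    then obtain c where c: "c \<in> U \<rightarrow> \<mm>" "a = frob_comb e U c" unfolding T_def by blast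
    have cc: "c u \<in> carrier R" "u \<in> carrier R" if "u \<in> U" for u using that mc[OF c(1)] U(2) by auto
    have "x \<otimes> a = (\<Oplus>u\<in>U. x \<otimes> (c u [^] (p ^ e) \<otimes> u))"
      unfolding c(2) frob_comb_def using U cc x by (intro finsum_rdistr) auto
    also have "\<dots> = (\<Oplus>u\<in>U. frob_comb e U (\<lambda>v. c u \<otimes> \<rho> (x \<otimes> u) v))"
    proof (rule finsum_cong')
      fix u assume u: "u \<in> U"
      have xu: "x \<otimes> u \<in> carrier R" using cc x u by simp
      have "x \<otimes> (c u [^] (p ^ e) \<otimes> u) = c u [^] (p ^ e) \<otimes> (x \<otimes> u)" using cc[OF u] x by (simp add: m_ac)
      also have "\<dots> = c u [^] (p ^ e) \<otimes> frob_comb e U (\<rho> (x \<otimes> u))" using \<rho>[OF xu] by simp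
      also have "\<dots> = frob_comb e U (\<lambda>v. c u \<otimes> \<rho> (x \<otimes> u) v)"
        using \<rho>[OF xu] cc[OF u] by (intro frob_comb_smult[OF U(1,2), symmetric]) auto
      finally show "x \<otimes> (c u [^] (p ^ e) \<otimes> u) = frob_comb e U (\<lambda>v. c u \<otimes> \<rho> (x \<otimes> u) v)" .
    next
      show "(\<lambda>u. frob_comb e U (\<lambda>v. c u \<otimes> \<rho> (x \<otimes> u) v)) \<in> U \<rightarrow> carrier R"
      proof
        fix u assume u: "u \<in> U"
        then have "x \<otimes> u \<in> carrier R" using cc x by simp
        then show "frob_comb e U (\<lambda>v. c u \<otimes> \<rho> (x \<otimes> u) v) \<in> carrier R"
          using \<rho> cc[OF u] by (intro frob_comb_closed[OF U(1,2)]) (auto simp: Pi_iff)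
      qed
    qed simp
    also have "\<dots> \<in> T"
    proof (rule Tsum[OF U(1)], rule Pi_I)
      fix u assume u: "u \<in> U"
      then have xu: "x \<otimes> u \<in> carrier R" using cc x by simp
      have "c u \<in> \<mm>" using c(1) u by auto
      then show "frob_comb e U (\<lambda>v. c u \<otimes> \<rho> (x \<otimes> u) v) \<in> T" unfolding T_def
        using \<rho>[OF xu] m.I_r_closed by (intro imageI) (auto simp: Pi_iff)
    qed
    finally show "x \<otimes> a \<in> T" .
    then show "a \<otimes> x \<in> T" using x a Tcarr by (metis m_comm subsetD)
  qed (rule ring_axioms)
  moreover have "(\<lambda>x. x [^] (p ^ e)) ` B \<subseteq> T"
  proof (rule image_subsetI)
    fix x assume x: "x \<in> B"
    then have xc: "x \<in> carrier R" using B by blast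
    have "x [^] (p ^ e) = x [^] (p ^ e) \<otimes> frob_comb e U (\<rho> \<one>)" using \<rho>[of \<one>] xc by simp
    also have "\<dots> = frob_comb e U (\<lambda>u. x \<otimes> \<rho> \<one> u)"
      using \<rho>[of \<one>] xc by (intro frob_comb_smult[OF U(1,2), symmetric]) auto
    also have "\<dots> \<in> T" unfolding T_def using \<rho>[of \<one>] x B_in_m m.I_r_closed
      by (intro imageI) (auto simp: Pi_iff)
    finally show "x [^] (p ^ e) \<in> T" .
  qed
  ultimately have "pow_ideal (\<lambda>_. p ^ e) B \<subseteq> T" unfolding pow_ideal_def by (rule genideal_minimal)
  then show ?thesis using z unfolding T_def by blast
qed

text \<open>By the preceding lemma, a combination in the bracket power can be corrected by
  coefficients in \<mm> to a genuine relation. If the coefficient at w were outside \<mm>, it would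
  still be a unit after the correction, and w could be eliminated from the generators.\<close>

lemma minimal_frob_generators:
  assumes U: "finite U" "U \<subseteq> carrier R" "frob_generates e U"
    and min: "\<And>V. V \<subset> U \<Longrightarrow> \<not> frob_generates e V"
    and a: "a \<in> U \<rightarrow> carrier R" "frob_comb e U a \<in> pow_ideal (\<lambda>_. p ^ e) B" and w: "w \<in> U"
  shows "a w \<in> \<mm>"
proof (rule ccontr)
  assume aw: "a w \<notin> \<mm>"
  obtain c where c: "c \<in> U \<rightarrow> \<mm>" "frob_comb e U a = frob_comb e U c"
    using frob_comb_mem_bracket_power[OF U a(2)] by blast
  have cc: "c \<in> U \<rightarrow> carrier R" using c(1) m.a_subset unfolding Pi_iff by blast
  define d where "d u = a u \<oplus> \<ominus> c u" for u
  have dc: "d \<in> U \<rightarrow> carrier R" using a cc by (auto simp: d_def Pi_iff)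
  have "frob_comb e U d = frob_comb e U a \<oplus> frob_comb e U (\<lambda>u. \<ominus> c u)"
    unfolding d_def using a(1) cc by (intro frob_comb_add[OF U(1,2)]) auto
  also have "\<dots> = \<zero>" using a(1) cc unfolding frob_comb_minus[OF U(1,2) cc] c(2)
    by (simp add: frob_comb_closed[OF U(1,2)] r_neg)
  finally have d0: "frob_comb e U d = \<zero>" .
  have dw: "d w \<in> carrier R" "a w \<in> carrier R" "c w \<in> carrier R" "w \<in> carrier R" using w dc a cc U by auto
  have "d w \<notin> \<mm>"
  proof
    assume "d w \<in> \<mm>"
    then have "d w \<oplus> c w \<in> \<mm>" using c(1) w by auto
    moreover have "d w \<oplus> c w = a w" using dw by (simp add: d_def a_assoc l_neg)
    ultimately show False using aw by simp
  qed
  then obtain t where t: "t \<in> carrier R" "t \<otimes> d w = \<one>" using notin_m_unit dw by blast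
  define g where "g u = t \<otimes> d u" for u
  have gc: "g \<in> U \<rightarrow> carrier R" using dc t by (auto simp: g_def Pi_iff)
  have "frob_comb e U g = \<zero>" unfolding g_def using frob_comb_smult[OF U(1,2) dc t(1)] d0 t by simp
  then have rel: "w \<oplus> frob_comb e (U - {w}) g = \<zero>"
    using frob_comb_remove[OF U(1,2) w gc] t(2) dw by (simp add: g_def)
  define V where "V = U - {w}"
  have V: "finite V" "V \<subseteq> carrier R" using U by (auto simp: V_def)
  have gV: "g \<in> V \<rightarrow> carrier R" using gc by (auto simp: V_def)
  have w_eq: "w = frob_comb e V (\<lambda>u. \<ominus> g u)"
    using rel dw frob_comb_closed[OF V gV] unfolding frob_comb_minus[OF V gV] V_def[symmetric]
    by (metis minus_equality minus_minus a_comm)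
  have "frob_generates e V"
    unfolding frob_generates_def
  proof
    fix x assume "x \<in> carrier R"
    then obtain b where b: "b \<in> U \<rightarrow> carrier R" "x = frob_comb e U b" using U(3) unfolding frob_generates_def by blast
    have bV: "b \<in> V \<rightarrow> carrier R" "b w \<in> carrier R" using b w by (auto simp: V_def)
    have "x = b w [^] (p ^ e) \<otimes> w \<oplus> frob_comb e V b"
      unfolding b(2) V_def by (rule frob_comb_remove[OF U(1,2) w b(1)])
    also have "b w [^] (p ^ e) \<otimes> w = b w [^] (p ^ e) \<otimes> frob_comb e V (\<lambda>u. \<ominus> g u)"
      using w_eq by (rule arg_cong)
    also have "\<dots> \<oplus> frob_comb e V b = frob_comb e V (\<lambda>u. b w \<otimes> (\<ominus> g u) \<oplus> b u)"
      using gV bV by (subst frob_comb_add[OF V]) (auto simp: frob_comb_smult[OF V] Pi_iff)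
    finally show "\<exists>a\<in>V \<rightarrow> carrier R. x = frob_comb e V a"
      using gV bV by (intro bexI[of _ "\<lambda>u. b w \<otimes> (\<ominus> g u) \<oplus> b u"]) (auto simp: Pi_iff)
  qed
  then show False using min[of V] w by (auto simp: V_def)
qed

text \<open>Descending induction on Y from the full system of parameters to the empty set: freeness
  of F^e_* R modulo (Y) is lifted through one regular element at a time. Given coefficients a = i +
  y r, the part with the i lies in the bracket power of (Y), so y^(p^e) times the combination of the
  r does too. Since y^(p^e) is regular modulo this ideal, r satisfies the hypothesis that a
  satisfies.\<close>

lemma frob_comb_pow_ideal:
  assumes U: "finite U" "U \<subseteq> carrier R" "frob_generates e U"
    and min: "\<And>V. V \<subset> U \<Longrightarrow> \<not> frob_generates e V"
    and Y: "Y \<subseteq> B"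
    and a: "a \<in> U \<rightarrow> carrier R" "frob_comb e U a \<in> pow_ideal (\<lambda>_. p ^ e) Y" "w \<in> U"
  shows "a w \<in> Idl Y"
  using Y a
proof (induction "card (B - Y)" arbitrary: Y a w)
  case 0
  then have "Y = B" using B(1) by auto
  then show ?case using minimal_frob_generators[OF U min] 0 B(3) by blast
next
  case (Suc k)
  then have "B - Y \<noteq> {}" by (metis card.empty nat.distinct(1))
  then obtain y where y: "y \<in> B - Y" by blast
  have yc: "y \<in> carrier R" and Yc: "Y \<subseteq> carrier R" using y B Suc by auto
  have k: "k = card (B - insert y Y)" using Suc(2) y B(1) by (metis Diff_insert card_Diff_singleton diff_Suc_1)
  define P where "P = pow_ideal (\<lambda>_. p ^ e) Y"
  have idP: "ideal P R" unfolding P_def by (rule pow_ideal_ideal[OF Suc.prems(1)])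
  interpret P: ideal P R by (rule idP)
  interpret Y: ideal "Idl Y" R by (rule genideal_ideal[OF Yc])
  \<comment> \<open>All coefficients at w that occur in combinations lying in the bracket power of
    (Y). They form an ideal, which is what makes Nakayama's lemma applicable to K = (Y) + y
    K.\<close>
  define K where "K = {a w | a. a \<in> U \<rightarrow> carrier R \<and> frob_comb e U a \<in> P}"
  have Kmem: "a w \<in> K" if "a \<in> U \<rightarrow> carrier R" "frob_comb e U a \<in> P" for a using that unfolding K_def by blast
  have "ideal K R"
  proof (rule idealI)
    show "subgroup K (add_monoid R)"
    proof (rule add.subgroupI)
      show "K \<subseteq> carrier R" unfolding K_def using Suc.prems(4) by auto
      have "(\<lambda>_. \<zero>) w \<in> K" by (rule Kmem) (auto simp: frob_comb_zero[OF U(1,2)])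
      then show "K \<noteq> {}" by blast
      fix s assume "s \<in> K"
      then obtain a where a: "a \<in> U \<rightarrow> carrier R" "frob_comb e U a \<in> P" "s = a w" unfolding K_def by blast
      have "(\<lambda>u. \<ominus> a u) w \<in> K" using a by (intro Kmem) (auto simp: frob_comb_minus[OF U(1,2) a(1)])
      then show "\<ominus> s \<in> K" using a by simp
      fix t assume "t \<in> K"
      then obtain b where b: "b \<in> U \<rightarrow> carrier R" "frob_comb e U b \<in> P" "t = b w" unfolding K_def by blast
      have "(\<lambda>u. a u \<oplus> b u) w \<in> K" using a b by (intro Kmem) (auto simp: frob_comb_add[OF U(1,2)])
      then show "s \<oplus> t \<in> K" using a b by simp
    qed
    fix s r assume "s \<in> K" and r: "r \<in> carrier R"
    then obtain a where a: "a \<in> U \<rightarrow> carrier R" "frob_comb e U a \<in> P" "s = a w" unfolding K_def by blast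
    have "(\<lambda>u. r \<otimes> a u) w \<in> K" using a r
      by (intro Kmem) (auto simp: frob_comb_smult[OF U(1,2)] P.I_l_closed)
    then show "r \<otimes> s \<in> K" using a by simp
    then show "s \<otimes> r \<in> K" using a r Suc.prems(4) by (auto simp: m_comm Pi_iff)
  qed (rule ring_axioms)
  then have "K \<subseteq> Idl Y"
  proof (rule nakayama[OF Y.ideal_axioms])
    show "y \<in> \<mm>" using y B_in_m by blast
    fix s assume "s \<in> K"
    then obtain a where a: "a \<in> U \<rightarrow> carrier R" "frob_comb e U a \<in> P" "s = a w" unfolding K_def by blast
    have ins: "pow_ideal (\<lambda>_. p ^ e) (insert y Y) = adjoin R P (y [^] (p ^ e))"
      unfolding P_def using y Suc.prems by (intro pow_ideal_insert) auto
    have "P \<subseteq> adjoin R P (y [^] (p ^ e))" using adjoin_incl[OF idP] yc by simp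
    then have "a u \<in> Idl (insert y Y)" if "u \<in> U" for u
      using a y Suc.prems that ins by (intro Suc.hyps(1)[OF k]) auto
    then have "\<forall>u\<in>U. \<exists>i r. i \<in> Idl Y \<and> r \<in> carrier R \<and> a u = i \<oplus> r \<otimes> y"
      unfolding Idl_insert[OF Yc yc] mem_adjoin by blast
    then obtain i r where "\<forall>u\<in>U. i u \<in> Idl Y \<and> r u \<in> carrier R \<and> a u = i u \<oplus> r u \<otimes> y"
      by metis
    then have ir: "i u \<in> Idl Y" "r u \<in> carrier R" "a u = i u \<oplus> y \<otimes> r u" if "u \<in> U" for u
      using that yc by (auto simp: m_comm)
    have ic: "i \<in> U \<rightarrow> carrier R" "r \<in> U \<rightarrow> carrier R" "(\<lambda>u. y \<otimes> r u) \<in> U \<rightarrow> carrier R"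
      using ir Y.Icarr yc by auto
    have "frob_comb e U a = frob_comb e U (\<lambda>u. i u \<oplus> y \<otimes> r u)"
      using ir ic by (intro frob_comb_cong[OF U(1,2)]) auto
    also have "\<dots> = frob_comb e U i \<oplus> y [^] (p ^ e) \<otimes> frob_comb e U r"
      using ic yc by (simp add: frob_comb_add[OF U(1,2)] frob_comb_smult[OF U(1,2)])
    finally have eq: "frob_comb e U a = frob_comb e U i \<oplus> y [^] (p ^ e) \<otimes> frob_comb e U r" .
    have iP: "frob_comb e U i \<in> P"
    proof -
      have "(\<Oplus>u\<in>F. i u [^] (p ^ e) \<otimes> u) \<in> P" if "finite F" "F \<subseteq> U" for F
        using that
      proof (induction F rule: finite_induct)
        case (insert u F)
        then have uc: "u \<in> carrier R" "i u \<in> carrier R" using U ic by auto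
        have Fc: "(\<lambda>u. i u [^] (p ^ e) \<otimes> u) \<in> F \<rightarrow> carrier R" using U ic insert by (auto simp: Pi_iff subset_iff)
        have "i u [^] (p ^ e) \<in> P" unfolding P_def using ir insert by (intro frob_mem_pow_ideal Suc.prems) auto
        then have "i u [^] (p ^ e) \<otimes> u \<in> P" using uc P.I_r_closed by blast
        then show ?case using insert uc Fc by simp
      qed simp
      then show ?thesis using U(1) unfolding frob_comb_def by blast
    qed
    have cc: "frob_comb e U i \<in> carrier R" "frob_comb e U r \<in> carrier R" using ic frob_comb_closed[OF U(1,2)] by auto
    have yq: "y [^] (p ^ e) \<otimes> frob_comb e U r \<in> carrier R" using cc yc by simp
    have "y [^] (p ^ e) \<otimes> frob_comb e U r = \<ominus> frob_comb e U i \<oplus> frob_comb e U a"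
      unfolding eq using r_neg1[OF cc(1) yq] by (simp only:)
    also have "\<dots> \<in> P" using a(2) iP by (intro P.a_closed P.a_inv_closed)
    finally have "frob_comb e U r \<in> P" unfolding P_def by (rule pow_ideal_regular_pow[OF Suc.prems(1) y cc(2)])
    then have "r w \<in> K" using ic by (intro Kmem)
    then show "\<exists>j\<in>Idl Y. \<exists>c\<in>K. s = j \<oplus> y \<otimes> c" using ir[OF Suc.prems(4)] a(3) by blast
  qed
  then show ?case using Kmem Suc.prems by (auto simp: P_def)
qed

text \<open>Kunz: \<open>F\<^sup>e\<^sub>*R\<close> is free.\<close>

theorem exists_frob_basis:
  assumes W: "finite W" "W \<subseteq> carrier R" "frob_generates e W"
  shows "\<exists>U\<subseteq>W. frob_generates e U \<and>
    (\<forall>a\<in>U \<rightarrow> carrier R. frob_comb e U a = \<zero> \<longrightarrow> (\<forall>u\<in>U. a u = \<zero>))"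
proof -
  define C where "C = {U. U \<subseteq> W \<and> frob_generates e U}"
  have "finite C" "C \<noteq> {}" using W finite_subset[of C "Pow W"] by (auto simp: C_def)
  then obtain U where U: "U \<in> C" "\<And>V. V \<in> C \<Longrightarrow> V \<subseteq> U \<Longrightarrow> V = U"
    using finite_has_minimal[of C] by auto
  have U': "U \<subseteq> W" "finite U" "U \<subseteq> carrier R" "frob_generates e U"
    using U(1) W finite_subset unfolding C_def by auto
  have min: "\<not> frob_generates e V" if "V \<subset> U" for V using U(2)[of V] U'(1) that by (auto simp: C_def)
  have "a u = \<zero>" if "a \<in> U \<rightarrow> carrier R" "frob_comb e U a = \<zero>" "u \<in> U" for a u
  proof -
    have "ideal (pow_ideal (\<lambda>_. p ^ e) {}) R" by (rule pow_ideal_ideal) simp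
    then have "\<zero> \<in> pow_ideal (\<lambda>_. p ^ e) {}" by (simp add: ideal.axioms(1) additive_subgroup.zero_closed)
    \<comment> \<open>The induction ends at empty Y, where (Y) is the zero ideal: the conclusion
      becomes linear independence.\<close>
    then have "a u \<in> Idl {}" using frob_comb_pow_ideal[OF U'(2-4) min, of "{}" a u] that by simp
    then show ?thesis by (simp add: Idl_empty)
  qed
  then show ?thesis using U' by blast
qed

end

section \<open>Localization\<close>

locale localized_module = module R M for R :: "('a, 'z) ring_scheme" (structure) and M :: "('a, 'c) module" (structure) +
  fixes S
  assumes S_carrier: "S \<subseteq> carrier R" and S_one: "\<one>\<^bsub>R\<^esub> \<in> S"
    and S_mult: "s \<in> S \<Longrightarrow> t \<in> S \<Longrightarrow> s \<otimes>\<^bsub>R\<^esub> t \<in> S"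
begin

abbreviation frac :: "'c \<Rightarrow> 'a \<Rightarrow> ('c \<times> 'a) set" where "frac \<equiv> fraction R S M"
abbreviation loc :: "('a, ('c \<times> 'a) set) module" where "loc \<equiv> localization R S M"

lemma S_closed [simp]: "s \<in> S \<Longrightarrow> s \<in> carrier R" using S_carrier by blast

definition frac_rel :: "('c \<times> 'a) \<Rightarrow> ('c \<times> 'a) \<Rightarrow> bool" where
  "frac_rel a b \<longleftrightarrow> (\<exists>u\<in>S. u \<odot>\<^bsub>M\<^esub> (snd b \<odot>\<^bsub>M\<^esub> fst a) = u \<odot>\<^bsub>M\<^esub> (snd a \<odot>\<^bsub>M\<^esub> fst b))"

lemma frac_rel_trans:
  assumes "frac_rel (x, s) (y, t)" "frac_rel (y, t) (z, r)" "x \<in> carrier M" "y \<in> carrier M" "z \<in> carrier M"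
    "s \<in> S" "t \<in> S" "r \<in> S"
  shows "frac_rel (x, s) (z, r)"
proof -
  obtain u v where u: "u \<in> S" "u \<odot>\<^bsub>M\<^esub> (t \<odot>\<^bsub>M\<^esub> x) = u \<odot>\<^bsub>M\<^esub> (s \<odot>\<^bsub>M\<^esub> y)"
    and v: "v \<in> S" "v \<odot>\<^bsub>M\<^esub> (r \<odot>\<^bsub>M\<^esub> y) = v \<odot>\<^bsub>M\<^esub> (t \<odot>\<^bsub>M\<^esub> z)"
    using assms by (auto simp: frac_rel_def)
  have c [simp]: "u \<in> carrier R" "v \<in> carrier R" "s \<in> carrier R" "t \<in> carrier R" "r \<in> carrier R" using u v assms by auto
  note [simp] = assms(3-5)
  have "(u \<otimes>\<^bsub>R\<^esub> v \<otimes>\<^bsub>R\<^esub> t) \<odot>\<^bsub>M\<^esub> (r \<odot>\<^bsub>M\<^esub> x) = (v \<otimes>\<^bsub>R\<^esub> r) \<odot>\<^bsub>M\<^esub> (u \<odot>\<^bsub>M\<^esub> (t \<odot>\<^bsub>M\<^esub> x))"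
    by (simp flip: smult_assoc1 add: R.m_ac)
  also have "\<dots> = (u \<otimes>\<^bsub>R\<^esub> s) \<odot>\<^bsub>M\<^esub> (v \<odot>\<^bsub>M\<^esub> (r \<odot>\<^bsub>M\<^esub> y))"
    unfolding u(2) by (simp flip: smult_assoc1 add: R.m_ac)
  also have "\<dots> = (u \<otimes>\<^bsub>R\<^esub> v \<otimes>\<^bsub>R\<^esub> t) \<odot>\<^bsub>M\<^esub> (s \<odot>\<^bsub>M\<^esub> z)"
    unfolding v(2) by (simp flip: smult_assoc1 add: R.m_ac)
  finally show ?thesis using u v assms S_mult unfolding frac_rel_def by (intro bexI[of _ "u \<otimes>\<^bsub>R\<^esub> v \<otimes>\<^bsub>R\<^esub> t"]) auto
qed

lemma frac_rel_sym: "frac_rel a b \<Longrightarrow> frac_rel b a"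
  unfolding frac_rel_def by metis

lemma mem_frac: "a \<in> frac x s \<longleftrightarrow> fst a \<in> carrier M \<and> snd a \<in> S \<and> frac_rel (x, s) a"
  by (cases a) (simp add: fraction_def frac_rel_def)

lemma frac_self: "x \<in> carrier M \<Longrightarrow> s \<in> S \<Longrightarrow> (x, s) \<in> frac x s"
  using S_one by (auto simp: mem_frac frac_rel_def)

lemma frac_eq_iff:
  assumes "x \<in> carrier M" "s \<in> S" "y \<in> carrier M" "t \<in> S"
  shows "frac x s = frac y t \<longleftrightarrow> (\<exists>u\<in>S. u \<odot>\<^bsub>M\<^esub> (t \<odot>\<^bsub>M\<^esub> x) = u \<odot>\<^bsub>M\<^esub> (s \<odot>\<^bsub>M\<^esub> y))"
proof -
  have "frac x s = frac y t \<longleftrightarrow> frac_rel (x, s) (y, t)"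
  proof
    assume "frac x s = frac y t"
    then have "(y, t) \<in> frac x s" using frac_self assms by simp
    then show "frac_rel (x, s) (y, t)" by (simp add: mem_frac)
  next
    assume r: "frac_rel (x, s) (y, t)"
    show "frac x s = frac y t"
    proof (rule Set.set_eqI)
      fix a
      show "a \<in> frac x s \<longleftrightarrow> a \<in> frac y t"
        using frac_rel_trans[of y t x s "fst a" "snd a"] frac_rel_trans[of x s y t "fst a" "snd a"]
          frac_rel_sym[OF r] r assms by (auto simp: mem_frac)
    qed
  qed
  then show ?thesis by (simp add: frac_rel_def)
qed

lemma frac_eqI:
  assumes "x \<in> carrier M" "s \<in> S" "y \<in> carrier M" "t \<in> S" "t \<odot>\<^bsub>M\<^esub> x = s \<odot>\<^bsub>M\<^esub> y"
  shows "frac x s = frac y t"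
  using assms S_one by (subst frac_eq_iff) (auto intro!: bexI[of _ "\<one>\<^bsub>R\<^esub>"])

lemma frac_cancel:
  assumes "x \<in> carrier M" "s \<in> S" "u \<in> S"
  shows "frac (u \<odot>\<^bsub>M\<^esub> x) (u \<otimes>\<^bsub>R\<^esub> s) = frac x s"
  using assms S_mult by (intro frac_eqI) (auto simp: R.m_comm simp flip: smult_assoc1)

lemma frac_zero: "s \<in> S \<Longrightarrow> frac \<zero>\<^bsub>M\<^esub> s = frac \<zero>\<^bsub>M\<^esub> \<one>\<^bsub>R\<^esub>"
  using S_one by (intro frac_eqI) auto

lemma frac_eq_zero_iff:
  assumes "x \<in> carrier M" "s \<in> S"
  shows "frac x s = frac \<zero>\<^bsub>M\<^esub> \<one>\<^bsub>R\<^esub> \<longleftrightarrow> (\<exists>u\<in>S. u \<odot>\<^bsub>M\<^esub> x = \<zero>\<^bsub>M\<^esub>)"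
  using assms S_one by (subst frac_eq_iff) auto

text \<open>Operations on fractions are defined as unions over all representatives. Once the value
  is shown to be independent of the representative, the union collapses to that value; every
  operation on the localization is evaluated this way.\<close>

lemma UN_frac:
  assumes "x \<in> carrier M" "s \<in> S"
    and "\<And>y t u. y \<in> carrier M \<Longrightarrow> t \<in> S \<Longrightarrow> u \<in> S \<Longrightarrow> u \<odot>\<^bsub>M\<^esub> (t \<odot>\<^bsub>M\<^esub> x) = u \<odot>\<^bsub>M\<^esub> (s \<odot>\<^bsub>M\<^esub> y) \<Longrightarrow> G y t = G x s"
  shows "(\<Union>(y, t)\<in>frac x s. G y t) = G x s"
proof -
  have "(case a of (y, t) \<Rightarrow> G y t) = G x s" if "a \<in> frac x s" for a
  proof -
    obtain y t where a: "a = (y, t)" by (cases a)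
    obtain u where "u \<in> S" "u \<odot>\<^bsub>M\<^esub> (t \<odot>\<^bsub>M\<^esub> x) = u \<odot>\<^bsub>M\<^esub> (s \<odot>\<^bsub>M\<^esub> y)" "y \<in> carrier M" "t \<in> S"
      using \<open>a \<in> frac x s\<close> unfolding fraction_def a by blast
    then have "G y t = G x s" by (intro assms(3))
    then show ?thesis by (simp add: a)
  qed
  moreover have "frac x s \<noteq> {}" using frac_self[OF assms(1,2)] by blast
  ultimately show ?thesis by (metis SUP_cong cSUP_const)
qed

lemma loc_carrier: "carrier loc = {frac m s | m s. m \<in> carrier M \<and> s \<in> S}"
  and loc_zero: "\<zero>\<^bsub>loc\<^esub> = frac \<zero>\<^bsub>M\<^esub> \<one>\<^bsub>R\<^esub>"
  and loc_one: "\<one>\<^bsub>loc\<^esub> = frac \<one>\<^bsub>M\<^esub> \<one>\<^bsub>R\<^esub>"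
  by (simp_all add: localization_def)

lemma frac_closed [simp]: "x \<in> carrier M \<Longrightarrow> s \<in> S \<Longrightarrow> frac x s \<in> carrier loc"
  by (auto simp: loc_carrier)

lemma loc_add:
  assumes "x \<in> carrier M" "s \<in> S" "y \<in> carrier M" "t \<in> S"
  shows "frac x s \<oplus>\<^bsub>loc\<^esub> frac y t = frac (t \<odot>\<^bsub>M\<^esub> x \<oplus>\<^bsub>M\<^esub> s \<odot>\<^bsub>M\<^esub> y) (s \<otimes>\<^bsub>R\<^esub> t)"
proof -
  \<comment> \<open>Independence of the representative of the first summand. Claim \<open>2\<close>,
    for the second summand, is the same statement with the summands exchanged.\<close>
  have 1: "frac (t' \<odot>\<^bsub>M\<^esub> x' \<oplus>\<^bsub>M\<^esub> s' \<odot>\<^bsub>M\<^esub> y) (s' \<otimes>\<^bsub>R\<^esub> t') = frac (t' \<odot>\<^bsub>M\<^esub> x \<oplus>\<^bsub>M\<^esub> s \<odot>\<^bsub>M\<^esub> y) (s \<otimes>\<^bsub>R\<^esub> t')"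
    if h: "x' \<in> carrier M" "x \<in> carrier M" "y \<in> carrier M" "s' \<in> S" "s \<in> S" "t' \<in> S" "u \<in> S"
      "u \<odot>\<^bsub>M\<^esub> (s' \<odot>\<^bsub>M\<^esub> x) = u \<odot>\<^bsub>M\<^esub> (s \<odot>\<^bsub>M\<^esub> x')" for x' x s' s t' u y
  proof -
    have "u \<odot>\<^bsub>M\<^esub> ((s \<otimes>\<^bsub>R\<^esub> t') \<odot>\<^bsub>M\<^esub> (t' \<odot>\<^bsub>M\<^esub> x' \<oplus>\<^bsub>M\<^esub> s' \<odot>\<^bsub>M\<^esub> y))
      = (t' \<otimes>\<^bsub>R\<^esub> t') \<odot>\<^bsub>M\<^esub> (u \<odot>\<^bsub>M\<^esub> (s \<odot>\<^bsub>M\<^esub> x')) \<oplus>\<^bsub>M\<^esub> (u \<otimes>\<^bsub>R\<^esub> s \<otimes>\<^bsub>R\<^esub> t' \<otimes>\<^bsub>R\<^esub> s') \<odot>\<^bsub>M\<^esub> y"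
      using h(1-7) by (simp add: smult_r_distr R.m_ac flip: smult_assoc1)
    also have "\<dots> = u \<odot>\<^bsub>M\<^esub> ((s' \<otimes>\<^bsub>R\<^esub> t') \<odot>\<^bsub>M\<^esub> (t' \<odot>\<^bsub>M\<^esub> x \<oplus>\<^bsub>M\<^esub> s \<odot>\<^bsub>M\<^esub> y))"
      unfolding h(8)[symmetric] using h(1-7) by (simp add: smult_r_distr R.m_ac flip: smult_assoc1)
    finally show ?thesis using h by (subst frac_eq_iff) (auto intro: S_mult)
  qed
  have 2: "frac (t' \<odot>\<^bsub>M\<^esub> x \<oplus>\<^bsub>M\<^esub> s \<odot>\<^bsub>M\<^esub> y') (s \<otimes>\<^bsub>R\<^esub> t') = frac (t \<odot>\<^bsub>M\<^esub> x \<oplus>\<^bsub>M\<^esub> s \<odot>\<^bsub>M\<^esub> y) (s \<otimes>\<^bsub>R\<^esub> t)"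
    if h: "y' \<in> carrier M" "t' \<in> S" "u \<in> S" "u \<odot>\<^bsub>M\<^esub> (t' \<odot>\<^bsub>M\<^esub> y) = u \<odot>\<^bsub>M\<^esub> (t \<odot>\<^bsub>M\<^esub> y')" for y' t' u
    using 1[of y' y x t' t s u] h assms by (simp add: R.m_comm M.a_comm)
  have "frac x s \<oplus>\<^bsub>loc\<^esub> frac y t
      = (\<Union>(x', s')\<in>frac x s. \<Union>(y', t')\<in>frac y t. frac (t' \<odot>\<^bsub>M\<^esub> x' \<oplus>\<^bsub>M\<^esub> s' \<odot>\<^bsub>M\<^esub> y') (s' \<otimes>\<^bsub>R\<^esub> t'))"
    by (simp add: localization_def)
  also have "\<dots> = (\<Union>(y', t')\<in>frac y t. frac (t' \<odot>\<^bsub>M\<^esub> x \<oplus>\<^bsub>M\<^esub> s \<odot>\<^bsub>M\<^esub> y') (s \<otimes>\<^bsub>R\<^esub> t'))"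
  proof (rule UN_frac[OF assms(1,2)])
    fix x' s' u assume h: "x' \<in> carrier M" "s' \<in> S" "u \<in> S" "u \<odot>\<^bsub>M\<^esub> (s' \<odot>\<^bsub>M\<^esub> x) = u \<odot>\<^bsub>M\<^esub> (s \<odot>\<^bsub>M\<^esub> x')"
    show "(\<Union>(y', t')\<in>frac y t. frac (t' \<odot>\<^bsub>M\<^esub> x' \<oplus>\<^bsub>M\<^esub> s' \<odot>\<^bsub>M\<^esub> y') (s' \<otimes>\<^bsub>R\<^esub> t'))
      = (\<Union>(y', t')\<in>frac y t. frac (t' \<odot>\<^bsub>M\<^esub> x \<oplus>\<^bsub>M\<^esub> s \<odot>\<^bsub>M\<^esub> y') (s \<otimes>\<^bsub>R\<^esub> t'))"
      using 1[OF h(1) assms(1) _ h(2) assms(2) _ h(3,4)]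
      by (intro SUP_cong refl) (auto simp: mem_frac)
  qed
  also have "\<dots> = frac (t \<odot>\<^bsub>M\<^esub> x \<oplus>\<^bsub>M\<^esub> s \<odot>\<^bsub>M\<^esub> y) (s \<otimes>\<^bsub>R\<^esub> t)"
    by (rule UN_frac[OF assms(3,4)]) (rule 2)
  finally show ?thesis .
qed

lemma loc_cases:
  assumes "U \<in> carrier loc" obtains x s where "x \<in> carrier M" "s \<in> S" "U = frac x s"
  using assms by (auto simp: loc_carrier)

lemma loc_add_same:
  assumes "x \<in> carrier M" "s \<in> S" "y \<in> carrier M"
  shows "frac x s \<oplus>\<^bsub>loc\<^esub> frac y s = frac (x \<oplus>\<^bsub>M\<^esub> y) s"
proof -
  have "frac x s \<oplus>\<^bsub>loc\<^esub> frac y s = frac (s \<odot>\<^bsub>M\<^esub> (x \<oplus>\<^bsub>M\<^esub> y)) (s \<otimes>\<^bsub>R\<^esub> s)"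
    using assms by (simp add: loc_add smult_r_distr)
  then show ?thesis using assms by (simp add: frac_cancel)
qed

lemma loc_abelian_group: "abelian_group loc"
proof (rule abelian_groupI)
  fix x y assume "x \<in> carrier loc" "y \<in> carrier loc"
  then show "x \<oplus>\<^bsub>loc\<^esub> y \<in> carrier loc"
    by (elim loc_cases) (simp add: loc_add S_mult)
next
  show "\<zero>\<^bsub>loc\<^esub> \<in> carrier loc" by (simp add: loc_zero S_one)
next
  fix x y z assume "x \<in> carrier loc" "y \<in> carrier loc" "z \<in> carrier loc"
  then show "x \<oplus>\<^bsub>loc\<^esub> y \<oplus>\<^bsub>loc\<^esub> z = x \<oplus>\<^bsub>loc\<^esub> (y \<oplus>\<^bsub>loc\<^esub> z)"
    by (elim loc_cases) (simp add: loc_add S_mult smult_r_distr M.a_assoc R.m_ac flip: smult_assoc1)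
next
  fix x y assume "x \<in> carrier loc" "y \<in> carrier loc"
  then show "x \<oplus>\<^bsub>loc\<^esub> y = y \<oplus>\<^bsub>loc\<^esub> x"
    by (elim loc_cases) (simp add: loc_add S_mult M.a_comm R.m_comm)
next
  fix x assume "x \<in> carrier loc"
  then show "\<zero>\<^bsub>loc\<^esub> \<oplus>\<^bsub>loc\<^esub> x = x"
    by (elim loc_cases) (simp add: loc_add loc_zero S_one)
next
  fix x assume "x \<in> carrier loc"
  then obtain m s where m: "m \<in> carrier M" "s \<in> S" "x = frac m s" by (elim loc_cases)
  have "frac (\<ominus>\<^bsub>M\<^esub> m) s \<oplus>\<^bsub>loc\<^esub> x = \<zero>\<^bsub>loc\<^esub>"
    using m by (simp add: loc_add_same M.l_neg loc_zero frac_zero)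
  moreover have "frac (\<ominus>\<^bsub>M\<^esub> m) s \<in> carrier loc" using m by simp
  ultimately show "\<exists>y\<in>carrier loc. y \<oplus>\<^bsub>loc\<^esub> x = \<zero>\<^bsub>loc\<^esub>" by blast
qed

end

lemma self_module_simps [simp]:
  "carrier (self_module R) = carrier R" "monoid.mult (self_module R) = monoid.mult R" "one (self_module R) = one R"
  "ring.zero (self_module R) = ring.zero R" "add (self_module R) = add R" "smult (self_module R) = monoid.mult R"
  by (simp_all add: self_module_def)

lemma (in cring) self_module_module: "module R (self_module R)"
proof (rule moduleI)
  show "abelian_group (self_module R)"
    by (rule abelian_groupI) (auto simp: a_ac intro: l_neg)
qed (auto simp: is_cring l_distr r_distr m_assoc)

section \<open>The localized ring and the canonical map into it\<close>

locale localized_ring = cring R for R (structure) +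
  fixes S
  assumes S_carrier': "S \<subseteq> carrier R" and S_one': "\<one> \<in> S" and S_mult': "s \<in> S \<Longrightarrow> t \<in> S \<Longrightarrow> s \<otimes> t \<in> S"
begin

sublocale L: localized_module R "self_module R" S
  using S_carrier' S_one' S_mult' self_module_module
  by (intro localized_module.intro localized_module_axioms.intro) auto

lemma loc_mult:
  assumes "x \<in> carrier R" "s \<in> S" "y \<in> carrier R" "t \<in> S"
  shows "L.frac x s \<otimes>\<^bsub>L.loc\<^esub> L.frac y t = L.frac (x \<otimes> y) (s \<otimes> t)"
proof -
  have 1: "L.frac (x' \<otimes> y) (s' \<otimes> t) = L.frac (x \<otimes> y) (s \<otimes> t)"
    if h: "x' \<in> carrier R" "s' \<in> S" "u \<in> S" "u \<otimes> (s' \<otimes> x) = u \<otimes> (s \<otimes> x')"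
      and c: "x \<in> carrier R" "s \<in> S" "y \<in> carrier R" "t \<in> S" for x' s' u x s y t
  proof -
    have "u \<otimes> ((s \<otimes> t) \<otimes> (x' \<otimes> y)) = (t \<otimes> y) \<otimes> (u \<otimes> (s \<otimes> x'))"
      using h(1-3) c by (simp add: m_ac)
    also have "\<dots> = u \<otimes> ((s' \<otimes> t) \<otimes> (x \<otimes> y))"
      unfolding h(4)[symmetric] using h(1-3) c by (simp add: m_ac)
    finally show ?thesis using h c by (subst L.frac_eq_iff) (auto intro: L.S_mult)
  qed
  have "L.frac x s \<otimes>\<^bsub>L.loc\<^esub> L.frac y t
      = (\<Union>(x', s')\<in>L.frac x s. \<Union>(y', t')\<in>L.frac y t. L.frac (x' \<otimes> y') (s' \<otimes> t'))"
    by (simp add: localization_def)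
  also have "\<dots> = (\<Union>(y', t')\<in>L.frac y t. L.frac (x \<otimes> y') (s \<otimes> t'))"
  proof (rule L.UN_frac)
    fix x' s' u
    assume h: "x' \<in> carrier (self_module R)" "s' \<in> S" "u \<in> S"
      "u \<odot>\<^bsub>self_module R\<^esub> (s' \<odot>\<^bsub>self_module R\<^esub> x) = u \<odot>\<^bsub>self_module R\<^esub> (s \<odot>\<^bsub>self_module R\<^esub> x')"
    show "(\<Union>(y', t')\<in>L.frac y t. L.frac (x' \<otimes> y') (s' \<otimes> t')) = (\<Union>(y', t')\<in>L.frac y t. L.frac (x \<otimes> y') (s \<otimes> t'))"
      using 1[of x' s' u x s] h assms by (intro SUP_cong refl) (auto simp: L.mem_frac)
  qed (use assms in auto)
  also have "\<dots> = L.frac (x \<otimes> y) (s \<otimes> t)"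
  proof (rule L.UN_frac)
    fix y' t' u
    assume h: "y' \<in> carrier (self_module R)" "t' \<in> S" "u \<in> S"
      "u \<odot>\<^bsub>self_module R\<^esub> (t' \<odot>\<^bsub>self_module R\<^esub> y) = u \<odot>\<^bsub>self_module R\<^esub> (t \<odot>\<^bsub>self_module R\<^esub> y')"
    show "L.frac (x \<otimes> y') (s \<otimes> t') = L.frac (x \<otimes> y) (s \<otimes> t)"
      using 1[of y' t' u y t x s] h assms by (simp add: m_comm)
  qed (use assms in auto)
  finally show ?thesis .
qed

definition \<iota> :: "'a \<Rightarrow> ('a \<times> 'a) set" where "\<iota> x = L.frac x \<one>"

lemma \<iota>_hom: "\<iota> \<in> ring_hom R L.loc"
  unfolding \<iota>_def using S_one'
  by (intro ring_hom_memI) (auto simp: loc_mult L.loc_add_same L.loc_one)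

lemma \<iota>_eq_zero_iff: "x \<in> carrier R \<Longrightarrow> \<iota> x = \<zero>\<^bsub>L.loc\<^esub> \<longleftrightarrow> (\<exists>u\<in>S. u \<otimes> x = \<zero>)"
  unfolding \<iota>_def using S_one' L.frac_eq_zero_iff[of x \<one>] by (simp add: L.loc_zero)

lemma \<iota>_inverse: "s \<in> S \<Longrightarrow> \<iota> s \<otimes>\<^bsub>L.loc\<^esub> L.frac \<one> s = \<one>\<^bsub>L.loc\<^esub>"
  unfolding \<iota>_def using S_one' S_carrier' by (simp add: loc_mult L.loc_one subset_iff) (intro L.frac_eqI, auto)

lemma frac_eq_mult: "x \<in> carrier R \<Longrightarrow> s \<in> S \<Longrightarrow> L.frac x s = \<iota> x \<otimes>\<^bsub>L.loc\<^esub> L.frac \<one> s"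
  unfolding \<iota>_def using S_one' by (simp add: loc_mult L.S_closed)

end

lemma (in cring) localized_ringI_prime:
  assumes "primeideal P R" shows "localized_ring R (carrier R - P)"
proof -
  interpret P: primeideal P R by fact
  show ?thesis using P.one_imp_carrier P.I_notcarr P.I_prime by unfold_locales auto
qed

section \<open>Dual bases for the Frobenius\<close>

lemma regular_local_ringE:
  fixes R (structure)
  assumes "regular_local_ring R"
  obtains \<mm> B where "regular_params R \<mm> B"
proof -
  interpret cring R using assms by (simp add: regular_local_ring_def)
  interpret noetherian_ring R using assms by (simp add: regular_local_ring_def)
  obtain \<mm> B where m: "{I. maximalideal I R} = {\<mm>}" and B: "finite B" "B \<subseteq> carrier R"
    "krull_dim_eq R (card B)" "\<mm> = Idl B"
    using assms unfolding regular_local_ring_def by blast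
  interpret m: maximalideal \<mm> R using m by blast
  have pm: "primeideal \<mm> R" using maximalideal_prime m.maximalideal_axioms by blast
  have sub: "I \<subseteq> \<mm>" if I: "primeideal I R" for I
  proof -
    have "I \<noteq> carrier R" "ideal I R" using I primeideal.I_notcarr primeideal.axioms(1) by blast+
    then obtain M where M: "maximalideal M R" "I \<subseteq> M" using exists_maximal_ideal by blast
    moreover have "M = \<mm>" using m M(1) by blast
    ultimately show ?thesis by simp
  qed
  define d where "d = card B"
  obtain P where P: "\<forall>i\<le>d. primeideal (P i) R" "\<forall>i<d. P i \<subset> P (Suc i)"
    using B(3) unfolding krull_dim_eq_def d_def by (auto simp: Let_def)
  \<comment> \<open>The top prime P d of a longest chain lies in \<mm> but is not known to equal it,
    so \<mm> is put in its place; this keeps the number of steps.\<close>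
  have "prime_chain R \<mm> k (if k = 0 then \<mm> else P (d - k))" if "k \<le> d" for k
    using that
  proof (induction k)
    case (Suc k)
    then have IH: "prime_chain R \<mm> k (if k = 0 then \<mm> else P (d - k))" by simp
    have s: "Suc (d - Suc k) = d - k" using Suc by simp
    have pr: "primeideal (P (d - Suc k)) R" using P(1) by simp
    have lt: "P (d - Suc k) \<subset> P (d - k)"
      using P(2)[rule_format, of "d - Suc k"] Suc.prems unfolding s by simp
    have "P (d - Suc k) \<subset> (if k = 0 then \<mm> else P (d - k))"
    proof (cases "k = 0")
      case True
      then show ?thesis using lt sub[of "P d"] P(1) by (simp add: psubset_subset_trans)
    qed (use lt in simp)
    then show ?case using pr IH by auto
  qed simp
  then have "\<exists>Q. prime_chain R \<mm> (card B) Q" unfolding d_def by blast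
  then have "regular_params R \<mm> B"
    using m B(1,2,4) by unfold_locales auto
  then show ?thesis by (rule that)
qed

context char_p_ring begin

text \<open>Turns a sum over an index set into a combination over the set U. The indexing g may
  repeat elements of U, as happens when distinct generators of R become equal in a
  localization.\<close>

lemma frob_span_closed:
  assumes U: "finite U" "U \<subseteq> carrier R"
  shows "finite F \<Longrightarrow> (\<And>i. i \<in> F \<Longrightarrow> c i \<in> carrier R \<and> g i \<in> U) \<Longrightarrow>
    \<exists>a\<in>U \<rightarrow> carrier R. (\<Oplus>i\<in>F. c i [^] (p ^ e) \<otimes> g i) = frob_comb e U a"
proof (induction F rule: finite_induct)
  case empty
  show ?case by (rule bexI[of _ "\<lambda>_. \<zero>"]) (simp_all add: frob_comb_zero[OF U])
next
  case (insert i F)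
  then obtain a where a: "a \<in> U \<rightarrow> carrier R" "(\<Oplus>i\<in>F. c i [^] (p ^ e) \<otimes> g i) = frob_comb e U a" by auto
  have i: "c i \<in> carrier R" "g i \<in> U" "g i \<in> carrier R" using insert U by auto
  define d where "d = (\<lambda>u. if u = g i then c i else \<zero>)"
  have d: "d \<in> U \<rightarrow> carrier R" using i by (auto simp: d_def)
  have "frob_comb e (U - {g i}) d = frob_comb e (U - {g i}) (\<lambda>_. \<zero>)"
    using U by (intro frob_comb_cong) (auto simp: d_def)
  also have "\<dots> = \<zero>" using U by (intro frob_comb_zero) auto
  finally have "frob_comb e U d = c i [^] (p ^ e) \<otimes> g i"
    using frob_comb_remove[OF U i(2) d] i by (simp add: d_def)
  moreover have "(\<Oplus>i\<in>insert i F. c i [^] (p ^ e) \<otimes> g i) = c i [^] (p ^ e) \<otimes> g i \<oplus> (\<Oplus>i\<in>F. c i [^] (p ^ e) \<otimes> g i)"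
    using insert U i by (intro finsum_insert) (auto simp: subset_iff)
  ultimately have "(\<Oplus>i\<in>insert i F. c i [^] (p ^ e) \<otimes> g i) = frob_comb e U (\<lambda>u. d u \<oplus> a u)"
    unfolding frob_comb_add[OF U d a(1)] a(2) by simp
  moreover have "(\<lambda>u. d u \<oplus> a u) \<in> U \<rightarrow> carrier R" using d a by auto
  ultimately show ?case by blast
qed

lemma frob_generates_induct:
  assumes W: "finite W" "W \<subseteq> carrier R" "frob_generates e W" and x: "x \<in> carrier R"
    and "P \<zero>" "\<And>x y. x \<in> carrier R \<Longrightarrow> y \<in> carrier R \<Longrightarrow> P x \<Longrightarrow> P y \<Longrightarrow> P (x \<oplus> y)"
    "\<And>a w. a \<in> carrier R \<Longrightarrow> w \<in> W \<Longrightarrow> P (a [^] (p ^ e) \<otimes> w)"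
  shows "P x"
proof -
  obtain a where a: "a \<in> W \<rightarrow> carrier R" "x = frob_comb e W a" using W(3) x unfolding frob_generates_def by blast
  have "P (\<Oplus>w\<in>F. a w [^] (p ^ e) \<otimes> w)" if "finite F" "F \<subseteq> W" for F
    using that
  proof (induction F rule: finite_induct)
    case (insert w F)
    then have w: "w \<in> W" "w \<in> carrier R" "a w \<in> carrier R" using W(2) a by auto
    have Fc: "(\<lambda>w. a w [^] (p ^ e) \<otimes> w) \<in> F \<rightarrow> carrier R" using insert W(2) a by (auto simp: Pi_iff subset_iff)
    have "(\<Oplus>w\<in>insert w F. a w [^] (p ^ e) \<otimes> w) = a w [^] (p ^ e) \<otimes> w \<oplus> (\<Oplus>w\<in>F. a w [^] (p ^ e) \<otimes> w)"
      using insert w Fc by (intro finsum_insert) auto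
    then show ?case using insert w Fc assms(6,7) by (simp add: finsum_closed)
  qed (simp add: assms(5))
  then show ?thesis using a(2) W(1) unfolding frob_comb_def by blast
qed

text \<open>Maps \<open>F\<^sup>e\<^sub>*R \<rightarrow> R\<close>; a pair \<open>(l, w)\<close> in a dual basis contributes \<open>x \<mapsto> l(x) \<cdot> w\<close>.\<close>

definition frob_linear :: "nat \<Rightarrow> ('a \<Rightarrow> 'a) \<Rightarrow> bool" where
  "frob_linear e l \<longleftrightarrow> l \<in> carrier R \<rightarrow> carrier R \<and>
     (\<forall>x\<in>carrier R. \<forall>y\<in>carrier R. l (x \<oplus> y) = l x \<oplus> l y) \<and>
     (\<forall>a\<in>carrier R. \<forall>x\<in>carrier R. l (a [^] (p ^ e) \<otimes> x) = a \<otimes> l x)"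

definition dual_sum :: "nat \<Rightarrow> (('a \<Rightarrow> 'a) \<times> 'a) list \<Rightarrow> 'a \<Rightarrow> 'a" where
  "dual_sum e xs x = foldr (\<lambda>(l, w) s. l x [^] (p ^ e) \<otimes> w \<oplus> s) xs \<zero>"

definition dual_list :: "nat \<Rightarrow> (('a \<Rightarrow> 'a) \<times> 'a) list \<Rightarrow> bool" where
  "dual_list e xs \<longleftrightarrow> (\<forall>(l, w)\<in>set xs. frob_linear e l \<and> w \<in> carrier R)"

lemma dual_sum_Nil [simp]: "dual_sum e [] x = \<zero>"
  and dual_sum_Cons [simp]: "dual_sum e ((l, w) # xs) x = l x [^] (p ^ e) \<otimes> w \<oplus> dual_sum e xs x"
  by (simp_all add: dual_sum_def)

lemma dual_list_Nil [simp]: "dual_list e []"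
  and dual_list_Cons [simp]: "dual_list e ((l, w) # xs) \<longleftrightarrow> frob_linear e l \<and> w \<in> carrier R \<and> dual_list e xs"
  by (auto simp: dual_list_def)

lemma frob_linear_closed: "frob_linear e l \<Longrightarrow> x \<in> carrier R \<Longrightarrow> l x \<in> carrier R"
  by (auto simp: frob_linear_def)

lemma dual_sum_closed: "dual_list e xs \<Longrightarrow> x \<in> carrier R \<Longrightarrow> dual_sum e xs x \<in> carrier R"
  by (induction xs) (auto simp: frob_linear_closed)

lemma dual_list_append [simp]: "dual_list e (xs @ ys) \<longleftrightarrow> dual_list e xs \<and> dual_list e ys"
  by (auto simp: dual_list_def)

lemma dual_sum_append:
  "dual_list e xs \<Longrightarrow> dual_list e ys \<Longrightarrow> x \<in> carrier R \<Longrightarrow>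
    dual_sum e (xs @ ys) x = dual_sum e xs x \<oplus> dual_sum e ys x"
  by (induction xs) (auto simp: dual_sum_closed frob_linear_closed a_assoc)

lemma frob_linear_smult:
  assumes "frob_linear e l" "r \<in> carrier R" shows "frob_linear e (\<lambda>x. r \<otimes> l x)"
  using assms by (auto simp: frob_linear_def r_distr m_lcomm Pi_iff)

lemma dual_sum_smult:
  assumes "dual_list e xs" "x \<in> carrier R" "r \<in> carrier R"
  shows "dual_list e (map (\<lambda>(l, w). (\<lambda>x. r \<otimes> l x, w)) xs) \<and>
    dual_sum e (map (\<lambda>(l, w). (\<lambda>x. r \<otimes> l x, w)) xs) x = r [^] (p ^ e) \<otimes> dual_sum e xs x"
  using assms(1)
proof (induction xs)
  case (Cons a xs)
  obtain l w where a: "a = (l, w)" by (cases a)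
  have "l x \<in> carrier R" "w \<in> carrier R" "dual_sum e xs x \<in> carrier R"
    using Cons.prems assms a frob_linear_closed dual_sum_closed by auto
  then show ?case using Cons assms a by (auto simp: frob_linear_smult nat_pow_distrib m_assoc r_distr)
qed (use assms in simp)

text \<open>The s for which multiplication by s on F^e_* R factors through a finite free module.
  That 1 belongs to it says that F^e_* R has a finite dual basis. Being an ideal, by rescaling
  functionals and concatenating lists, it reduces this claim to finding an element outside each
  maximal ideal.\<close>

definition dual_ideal :: "nat \<Rightarrow> 'a set" where
  "dual_ideal e = {s \<in> carrier R. \<exists>xs. dual_list e xs \<and> (\<forall>x\<in>carrier R. s [^] (p ^ e) \<otimes> x = dual_sum e xs x)}"

lemma dual_ideal_ideal: "ideal (dual_ideal e) R"
proof -
  have smult: "r \<otimes> s \<in> dual_ideal e" if s: "s \<in> dual_ideal e" and r: "r \<in> carrier R" for r s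
  proof -
    obtain xs where xs: "s \<in> carrier R" "dual_list e xs" "\<And>x. x \<in> carrier R \<Longrightarrow> s [^] (p ^ e) \<otimes> x = dual_sum e xs x"
      using s unfolding dual_ideal_def by blast
    have "(r \<otimes> s) [^] (p ^ e) \<otimes> x = dual_sum e (map (\<lambda>(l, w). (\<lambda>x. r \<otimes> l x, w)) xs) x" if x: "x \<in> carrier R" for x
      using dual_sum_smult[OF xs(2) x r] xs(3)[OF x, symmetric] x r xs(1) by (simp add: nat_pow_distrib m_assoc)
    then show ?thesis using dual_sum_smult[OF xs(2) zero_closed r] r xs(1) unfolding dual_ideal_def by blast
  qed
  have add: "s \<oplus> t \<in> dual_ideal e" if s: "s \<in> dual_ideal e" and t: "t \<in> dual_ideal e" for s t
  proof -
    obtain xs where xs: "s \<in> carrier R" "dual_list e xs" "\<And>x. x \<in> carrier R \<Longrightarrow> s [^] (p ^ e) \<otimes> x = dual_sum e xs x"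
      using s unfolding dual_ideal_def by blast
    obtain ys where ys: "t \<in> carrier R" "dual_list e ys" "\<And>x. x \<in> carrier R \<Longrightarrow> t [^] (p ^ e) \<otimes> x = dual_sum e ys x"
      using t unfolding dual_ideal_def by blast
    have "(s \<oplus> t) [^] (p ^ e) \<otimes> x = dual_sum e (xs @ ys) x" if x: "x \<in> carrier R" for x
      using xs ys x by (simp add: dual_sum_append frob_add l_distr)
    then show ?thesis using xs(1,2) ys(1,2) unfolding dual_ideal_def by (auto intro!: exI[of _ "xs @ ys"])
  qed
  have zero: "\<zero> \<in> dual_ideal e" unfolding dual_ideal_def by (auto simp: frob_zero intro!: exI[of _ "[]"])
  have sub: "dual_ideal e \<subseteq> carrier R" by (auto simp: dual_ideal_def)
  show ?thesis
  proof (rule idealI)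
    show "subgroup (dual_ideal e) (add_monoid R)"
    proof (rule add.subgroupI)
      fix a assume a: "a \<in> dual_ideal e"
      then have "\<ominus> a = \<ominus> \<one> \<otimes> a" using sub by (auto simp: l_minus)
      then show "\<ominus> a \<in> dual_ideal e" using smult[OF a, of "\<ominus> \<one>"] by simp
    qed (use zero add sub in auto)
    fix a x assume "a \<in> dual_ideal e" "x \<in> carrier R"
    then show "x \<otimes> a \<in> dual_ideal e" using smult by simp
    then show "a \<otimes> x \<in> dual_ideal e" using sub \<open>a \<in> dual_ideal e\<close> \<open>x \<in> carrier R\<close> by (metis m_comm subsetD)
  qed (rule ring_axioms)
qed

end

lemma (in localized_ring) common_multiplier:
  assumes "finite I" "\<And>i. i \<in> I \<Longrightarrow> \<exists>s\<in>S. Q i s"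
    and "\<And>i s t. i \<in> I \<Longrightarrow> s \<in> S \<Longrightarrow> t \<in> S \<Longrightarrow> Q i s \<Longrightarrow> Q i (t \<otimes> s)"
  shows "\<exists>s\<in>S. \<forall>i\<in>I. Q i s"
  using assms
proof (induction I rule: finite_induct)
  case empty
  then show ?case using S_one' by auto
next
  case (insert i I)
  then obtain s where s: "s \<in> S" "\<forall>i\<in>I. Q i s" by blast
  obtain t where t: "t \<in> S" "Q i t" using insert.prems(1) by blast
  have "Q i (s \<otimes> t)" using insert.prems(2)[of i t s] s t by blast
  moreover have "Q j (s \<otimes> t)" if "j \<in> I" for j
  proof -
    have "Q j (t \<otimes> s)" using insert.prems(2)[of j s t] s t that by blast
    moreover have "t \<otimes> s = s \<otimes> t" using s t S_carrier' by (blast intro: m_comm)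
    ultimately show ?thesis by simp
  qed
  ultimately show ?case using S_mult'[OF s(1) t(1)] by blast
qed

lemma finsum_eq_foldr:
  fixes G (structure)
  assumes "abelian_monoid G" "distinct us" "g \<in> set us \<rightarrow> carrier G"
  shows "(\<Oplus>u\<in>set us. g u) = foldr (\<lambda>u s. g u \<oplus> s) us \<zero>"
  using assms(2,3)
proof (induction us)
  interpret abelian_monoid G by fact
  case (Cons u us)
  then have "g \<in> set us \<rightarrow> carrier G" "g u \<in> carrier G" by auto
  then show ?case using Cons by simp
qed (simp add: abelian_monoid.finsum_empty[OF assms(1)])

text \<open>The localization at P has a basis of F^e_* taken from the images of W. Its coordinate
  functions \<open>lm\<close> take values in the localization; \<open>s\<close> clears their
  denominators. Lifts of the values to R are linear only modulo the kernel of the localization map,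
  and \<open>t\<close> annihilates that kernel.\<close>

lemma (in char_p_ring) exists_dual_multiplier:
  assumes P: "primeideal P R" and reg: "regular_local_ring (localization R (carrier R - P) (self_module R))"
    and noeth: "noetherian_ring R" and W: "finite W" "W \<subseteq> carrier R" "frob_generates e W"
  shows "\<exists>s\<in>carrier R - P. s \<in> dual_ideal e"
proof -
  define S where "S = carrier R - P"
  interpret LR: localized_ring R S unfolding S_def by (rule localized_ringI_prime[OF P])
  obtain \<mm> B where rp: "regular_params LR.L.loc \<mm> B" using reg regular_local_ringE unfolding S_def by blast
  define L where "L = LR.L.loc"
  interpret L: regular_params L \<mm> B using rp unfolding L_def .
  interpret h: ring_hom_cring R L LR.\<iota>
    using LR.\<iota>_hom[folded L_def] by (intro ring_hom_cring.intro ring_hom_cring_axioms.intro cring_axioms L.is_cring)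
  have S: "s \<in> carrier R" if "s \<in> S" for s using that by (simp add: S_def)
  have hadd: "LR.\<iota> ([(n::nat)] \<cdot> x) = [n] \<cdot>\<^bsub>L\<^esub> LR.\<iota> x" if "x \<in> carrier R" for n x
    by (induction n) (use that in simp_all)
  have "[p] \<cdot>\<^bsub>L\<^esub> \<one>\<^bsub>L\<^esub> = \<zero>\<^bsub>L\<^esub>" using hadd[of \<one> p] char_p by simp
  then interpret L: regular_params_char_p L \<mm> B p using prime_p by unfold_locales
  have WL: "finite (LR.\<iota> ` W)" "LR.\<iota> ` W \<subseteq> carrier L" using W by auto
  have "L.frob_generates e (LR.\<iota> ` W)"
    unfolding L.frob_generates_def
  proof
    fix z assume "z \<in> carrier L"
    then obtain x s where xs: "x \<in> carrier R" "s \<in> S" "z = LR.L.frac x s" unfolding L_def by (auto elim: LR.L.loc_cases)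
    define i where "i = LR.L.frac \<one> s"
    have i: "i \<in> carrier L" "LR.\<iota> s \<otimes>\<^bsub>L\<^esub> i = \<one>\<^bsub>L\<^esub>" unfolding i_def L_def using xs LR.\<iota>_inverse by auto
    have sc: "s \<in> carrier R" "LR.\<iota> s \<in> carrier L" "LR.\<iota> x \<in> carrier L" using xs S by auto
    \<comment> \<open>Here q is p^e - 1, so that x/s = (x s^q) / s^(p^e) has a denominator which
      acts as a scalar on F^e_*.\<close>
    obtain q where q: "p ^ e = Suc q" using q_pos[of e] by (cases "p ^ e") auto
    have "x \<otimes> s [^] q \<in> carrier R" using xs sc by simp
    then obtain a where a: "a \<in> W \<rightarrow> carrier R" "x \<otimes> s [^] q = frob_comb e W a"
      using W(3) unfolding frob_generates_def by blast
    have ac: "a w \<in> carrier R" "w \<in> carrier R" "LR.\<iota> (a w) \<in> carrier L" "LR.\<iota> w \<in> carrier L" if "w \<in> W" for w using a(1) W(2) that by auto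
    have "z = LR.\<iota> x \<otimes>\<^bsub>L\<^esub> i" unfolding i_def L_def xs(3) by (rule LR.frac_eq_mult[OF xs(1,2)])
    also have "\<dots> = LR.\<iota> x \<otimes>\<^bsub>L\<^esub> (LR.\<iota> s \<otimes>\<^bsub>L\<^esub> i) [^]\<^bsub>L\<^esub> q \<otimes>\<^bsub>L\<^esub> i" unfolding i(2) using sc i by simp
    also have "\<dots> = LR.\<iota> (x \<otimes> s [^] q) \<otimes>\<^bsub>L\<^esub> i [^]\<^bsub>L\<^esub> (p ^ e)"
      unfolding q using sc i(1) xs(1) by (simp add: L.nat_pow_distrib L.m_assoc)
    also have "LR.\<iota> (x \<otimes> s [^] q) = (\<Oplus>\<^bsub>L\<^esub>w\<in>W. LR.\<iota> (a w) [^]\<^bsub>L\<^esub> (p ^ e) \<otimes>\<^bsub>L\<^esub> LR.\<iota> w)"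
    proof -
      have "LR.\<iota> (x \<otimes> s [^] q) = (\<Oplus>\<^bsub>L\<^esub>w\<in>W. LR.\<iota> (a w [^] (p ^ e) \<otimes> w))"
        unfolding a(2) frob_comb_def using ac W(1) by (subst h.hom_finsum) (auto simp: comp_def)
      also have "\<dots> = (\<Oplus>\<^bsub>L\<^esub>w\<in>W. LR.\<iota> (a w) [^]\<^bsub>L\<^esub> (p ^ e) \<otimes>\<^bsub>L\<^esub> LR.\<iota> w)"
        using ac by (intro L.finsum_cong') auto
      finally show ?thesis .
    qed
    also have "\<dots> \<otimes>\<^bsub>L\<^esub> i [^]\<^bsub>L\<^esub> (p ^ e) = (\<Oplus>\<^bsub>L\<^esub>w\<in>W. LR.\<iota> (a w) [^]\<^bsub>L\<^esub> (p ^ e) \<otimes>\<^bsub>L\<^esub> LR.\<iota> w \<otimes>\<^bsub>L\<^esub> i [^]\<^bsub>L\<^esub> (p ^ e))"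
      using ac i W(1) by (intro L.finsum_ldistr) auto
    also have "\<dots> = (\<Oplus>\<^bsub>L\<^esub>w\<in>W. (LR.\<iota> (a w) \<otimes>\<^bsub>L\<^esub> i) [^]\<^bsub>L\<^esub> (p ^ e) \<otimes>\<^bsub>L\<^esub> LR.\<iota> w)"
      using ac i by (intro L.finsum_cong') (auto simp: L.nat_pow_distrib L.m_ac)
    finally have z: "z = (\<Oplus>\<^bsub>L\<^esub>w\<in>W. (LR.\<iota> (a w) \<otimes>\<^bsub>L\<^esub> i) [^]\<^bsub>L\<^esub> (p ^ e) \<otimes>\<^bsub>L\<^esub> LR.\<iota> w)" .
    show "\<exists>a\<in>LR.\<iota> ` W \<rightarrow> carrier L. z = L.frob_comb e (LR.\<iota> ` W) a"
      unfolding z by (rule L.frob_span_closed[OF WL W(1)]) (use ac i in auto)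
  qed
  then obtain U where U: "U \<subseteq> LR.\<iota> ` W" "L.frob_generates e U"
    and ind: "\<And>a u. a \<in> U \<rightarrow> carrier L \<Longrightarrow> L.frob_comb e U a = \<zero>\<^bsub>L\<^esub> \<Longrightarrow> u \<in> U \<Longrightarrow> a u = \<zero>\<^bsub>L\<^esub>"
    using L.exists_frob_basis[OF WL] by meson
  have Uf: "finite U" "U \<subseteq> carrier L" using U(1) WL finite_subset by auto
  have uniq: "a u = b u" if "a \<in> U \<rightarrow> carrier L" "b \<in> U \<rightarrow> carrier L" "L.frob_comb e U a = L.frob_comb e U b" "u \<in> U" for a b u
  proof -
    have mb: "(\<lambda>u. \<ominus>\<^bsub>L\<^esub> b u) \<in> U \<rightarrow> carrier L" using that(2) by auto
    have "L.frob_comb e U (\<lambda>u. a u \<oplus>\<^bsub>L\<^esub> \<ominus>\<^bsub>L\<^esub> b u) = L.frob_comb e U a \<oplus>\<^bsub>L\<^esub> \<ominus>\<^bsub>L\<^esub> L.frob_comb e U b"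
      by (simp add: L.frob_comb_add[OF Uf that(1) mb] L.frob_comb_minus[OF Uf that(2)])
    also have "\<dots> = \<zero>\<^bsub>L\<^esub>" unfolding that(3) using L.frob_comb_closed[OF Uf that(2)] by (rule L.r_neg)
    finally have z: "L.frob_comb e U (\<lambda>u. a u \<oplus>\<^bsub>L\<^esub> \<ominus>\<^bsub>L\<^esub> b u) = \<zero>\<^bsub>L\<^esub>" .
    have "(\<lambda>u. a u \<oplus>\<^bsub>L\<^esub> \<ominus>\<^bsub>L\<^esub> b u) \<in> U \<rightarrow> carrier L" using that(1,2) by auto
    then have "a u \<oplus>\<^bsub>L\<^esub> \<ominus>\<^bsub>L\<^esub> b u = \<zero>\<^bsub>L\<^esub>" using ind[OF _ z that(4)] by blast
    then show ?thesis using that(1,2,4) by (metis L.minus_eq L.r_right_minus_eq PiE)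
  qed
  have "\<forall>u\<in>U. \<exists>w\<in>W. LR.\<iota> w = u" using U(1) by blast
  then obtain w where w: "\<And>u. u \<in> U \<Longrightarrow> w u \<in> W" "\<And>u. u \<in> U \<Longrightarrow> LR.\<iota> (w u) = u" by metis
  have "\<forall>x\<in>carrier R. \<exists>a. a \<in> U \<rightarrow> carrier L \<and> LR.\<iota> x = L.frob_comb e U a"
    using U(2) h.hom_closed unfolding L.frob_generates_def by blast
  then obtain lm where lam: "\<And>x. x \<in> carrier R \<Longrightarrow> lm x \<in> U \<rightarrow> carrier L"
    "\<And>x. x \<in> carrier R \<Longrightarrow> LR.\<iota> x = L.frob_comb e U (lm x)"
    by metis
  have lamc: "lm x u \<in> carrier L" if "x \<in> carrier R" "u \<in> U" for x u using lam(1) that by auto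
  have lam_add: "lm (x \<oplus> y) u = lm x u \<oplus>\<^bsub>L\<^esub> lm y u" if "x \<in> carrier R" "y \<in> carrier R" "u \<in> U" for x y u
  proof -
    have c: "(\<lambda>u. lm x u \<oplus>\<^bsub>L\<^esub> lm y u) \<in> U \<rightarrow> carrier L" using lamc that by auto
    have "L.frob_comb e U (lm (x \<oplus> y)) = L.frob_comb e U (\<lambda>u. lm x u \<oplus>\<^bsub>L\<^esub> lm y u)"
      using that by (simp add: L.frob_comb_add[OF Uf lam(1) lam(1)] lam(2)[symmetric])
    then show ?thesis using uniq[OF lam(1) c _ that(3), of "x \<oplus> y"] that by simp
  qed
  have lam_smult: "lm (a [^] (p ^ e) \<otimes> x) u = LR.\<iota> a \<otimes>\<^bsub>L\<^esub> lm x u" if "a \<in> carrier R" "x \<in> carrier R" "u \<in> U" for a x u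
  proof -
    have c: "(\<lambda>u. LR.\<iota> a \<otimes>\<^bsub>L\<^esub> lm x u) \<in> U \<rightarrow> carrier L" using lamc that by auto
    have "L.frob_comb e U (lm (a [^] (p ^ e) \<otimes> x)) = L.frob_comb e U (\<lambda>u. LR.\<iota> a \<otimes>\<^bsub>L\<^esub> lm x u)"
      using that by (simp add: L.frob_comb_smult[OF Uf lam(1)] lam(2)[symmetric])
    then show ?thesis using uniq[OF lam(1) c _ that(3), of "a [^] (p ^ e) \<otimes> x"] that by simp
  qed
  define I where "I = LR.\<iota> ` carrier R"
  have I0: "\<zero>\<^bsub>L\<^esub> \<in> I" unfolding I_def by (metis h.hom_zero image_eqI zero_closed)
  have I1: "x \<oplus>\<^bsub>L\<^esub> y \<in> I \<and> x \<otimes>\<^bsub>L\<^esub> y \<in> I" if xI: "x \<in> I" and yI: "y \<in> I" for x y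
  proof -
    obtain a where a: "x = LR.\<iota> a" "a \<in> carrier R" using xI unfolding I_def by (rule imageE)
    obtain b where b: "y = LR.\<iota> b" "b \<in> carrier R" using yI unfolding I_def by (rule imageE)
    note ab = a(2) b(2)
    have "x \<oplus>\<^bsub>L\<^esub> y = LR.\<iota> (a \<oplus> b)" "x \<otimes>\<^bsub>L\<^esub> y = LR.\<iota> (a \<otimes> b)"
      unfolding a(1) b(1) using ab by simp_all
    then show ?thesis using ab(1,2) unfolding I_def by blast
  qed
  note I = I0 conjunct1[OF I1] conjunct2[OF I1]
  \<comment> \<open>It is enough to clear the finitely many coordinates of the generators in W;
    linearity of the coordinates carries the same \<open>s\<close> to every x.\<close>
  have "\<exists>s\<in>S. \<forall>i\<in>W \<times> U. LR.\<iota> s \<otimes>\<^bsub>L\<^esub> lm (fst i) (snd i) \<in> I"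
  proof (rule LR.common_multiplier)
    show "finite (W \<times> U)" using W Uf by simp
    fix k assume k: "k \<in> W \<times> U"
    define v u where "v = fst k" and "u = snd k"
    have vu: "v \<in> W" "u \<in> U" using k by (auto simp: v_def u_def)
    then have "lm v u \<in> carrier L" using lamc W by blast
    then obtain x s where xs: "x \<in> carrier R" "s \<in> S" "lm v u = LR.L.frac x s" unfolding L_def by (auto elim: LR.L.loc_cases)
    define i where "i = LR.L.frac \<one> s"
    have i: "i \<in> carrier L" "LR.\<iota> s \<otimes>\<^bsub>L\<^esub> i = \<one>\<^bsub>L\<^esub>" unfolding i_def L_def using xs LR.\<iota>_inverse by auto
    have "lm v u = LR.\<iota> x \<otimes>\<^bsub>L\<^esub> i" unfolding i_def L_def xs(3) by (rule LR.frac_eq_mult[OF xs(1,2)])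
    then have "LR.\<iota> s \<otimes>\<^bsub>L\<^esub> lm v u = (LR.\<iota> s \<otimes>\<^bsub>L\<^esub> i) \<otimes>\<^bsub>L\<^esub> LR.\<iota> x"
      using i(1) h.hom_closed[OF xs(1)] h.hom_closed[OF S[OF xs(2)]] by (simp add: L.m_ac)
    also have "\<dots> = LR.\<iota> x" using i(2) h.hom_closed[OF xs(1)] by simp
    finally have "LR.\<iota> s \<otimes>\<^bsub>L\<^esub> lm v u \<in> I" using xs(1) unfolding I_def by blast
    then show "\<exists>s\<in>S. LR.\<iota> s \<otimes>\<^bsub>L\<^esub> lm (fst k) (snd k) \<in> I" using xs(2) unfolding v_def u_def by blast
  next
    fix k s t assume k: "k \<in> W \<times> U" "s \<in> S" "t \<in> S" "LR.\<iota> s \<otimes>\<^bsub>L\<^esub> lm (fst k) (snd k) \<in> I"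
    define v u where "v = fst k" and "u = snd k"
    have h: "v \<in> W \<and> u \<in> U" "s \<in> S" "t \<in> S" "LR.\<iota> s \<otimes>\<^bsub>L\<^esub> lm v u \<in> I"
      using k by (auto simp: v_def u_def)
    then have "LR.\<iota> (t \<otimes> s) \<otimes>\<^bsub>L\<^esub> lm v u = LR.\<iota> t \<otimes>\<^bsub>L\<^esub> (LR.\<iota> s \<otimes>\<^bsub>L\<^esub> lm v u)"
      using S lamc W(2) by (simp add: L.m_assoc subset_iff)
    also have "\<dots> \<in> I" using S[OF h(3)] by (intro I(3)[OF _ h(4)]) (simp add: I_def)
    finally show "LR.\<iota> (t \<otimes> s) \<otimes>\<^bsub>L\<^esub> lm (fst k) (snd k) \<in> I" unfolding v_def u_def .
  qed
  then obtain s where s: "s \<in> S" "\<And>v u. v \<in> W \<Longrightarrow> u \<in> U \<Longrightarrow> LR.\<iota> s \<otimes>\<^bsub>L\<^esub> lm v u \<in> I" by fastforce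
  have sc: "s \<in> carrier R" "LR.\<iota> s \<in> carrier L" using s S by auto
  have zero_lam: "lm \<zero> u = \<zero>\<^bsub>L\<^esub>" if "u \<in> U" for u
    using lam_smult[OF zero_closed zero_closed that] lamc[OF zero_closed that] by (simp add: frob_zero)
  have "\<forall>u\<in>U. LR.\<iota> s \<otimes>\<^bsub>L\<^esub> lm x u \<in> I" if x: "x \<in> carrier R" for x
    using W x
  proof (rule frob_generates_induct)
    show "\<forall>u\<in>U. LR.\<iota> s \<otimes>\<^bsub>L\<^esub> lm \<zero> u \<in> I" using zero_lam I(1) sc by simp
    fix x y assume "x \<in> carrier R" "y \<in> carrier R" "\<forall>u\<in>U. LR.\<iota> s \<otimes>\<^bsub>L\<^esub> lm x u \<in> I" "\<forall>u\<in>U. LR.\<iota> s \<otimes>\<^bsub>L\<^esub> lm y u \<in> I"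
    then show "\<forall>u\<in>U. LR.\<iota> s \<otimes>\<^bsub>L\<^esub> lm (x \<oplus> y) u \<in> I"
      using I(2) lamc sc by (simp add: lam_add L.r_distr)
  next
    fix a v assume av: "a \<in> carrier R" "v \<in> W"
    then have vc: "v \<in> carrier R" using W by blast
    have "LR.\<iota> s \<otimes>\<^bsub>L\<^esub> lm (a [^] (p ^ e) \<otimes> v) u = LR.\<iota> a \<otimes>\<^bsub>L\<^esub> (LR.\<iota> s \<otimes>\<^bsub>L\<^esub> lm v u)" if "u \<in> U" for u
      using lam_smult[OF av(1) vc that] lamc[OF vc that] sc h.hom_closed[OF av(1)] by (simp add: L.m_ac)
    then show "\<forall>u\<in>U. LR.\<iota> s \<otimes>\<^bsub>L\<^esub> lm (a [^] (p ^ e) \<otimes> v) u \<in> I"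
      using I(3) s(2)[OF av(2)] av(1) by (simp add: I_def)
  qed
  then have "\<forall>x\<in>carrier R. \<forall>u\<in>U. \<exists>r. r \<in> carrier R \<and> LR.\<iota> r = LR.\<iota> s \<otimes>\<^bsub>L\<^esub> lm x u"
    unfolding I_def by (metis imageE)
  then obtain r where r: "\<And>x u. x \<in> carrier R \<Longrightarrow> u \<in> U \<Longrightarrow> r x u \<in> carrier R"
    "\<And>x u. x \<in> carrier R \<Longrightarrow> u \<in> U \<Longrightarrow> LR.\<iota> (r x u) = LR.\<iota> s \<otimes>\<^bsub>L\<^esub> lm x u" by metis
  \<comment> \<open>Each element of the kernel is killed by something outside P; finite generation
    of the kernel gives one \<open>t\<close> for all of them.\<close>
  have "\<exists>t\<in>S. \<forall>x\<in>carrier R. LR.\<iota> x = \<zero>\<^bsub>L\<^esub> \<longrightarrow> t \<otimes> x = \<zero>"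
  proof -
    have "ideal (a_kernel R L LR.\<iota>) R"
      by (rule ring_hom_ring.kernel_is_ideal[OF ring_hom_ringI2[OF ring_axioms L.ring_axioms h.homh]])
    then obtain A where A: "A \<subseteq> carrier R" "finite A" "a_kernel R L LR.\<iota> = Idl A"
      using noetherian_ring.finetely_gen[OF noeth] by blast
    have "\<exists>t\<in>S. \<forall>a\<in>A. t \<otimes> a = \<zero>"
    proof (rule LR.common_multiplier[OF A(2)])
      fix a assume a: "a \<in> A"
      then have "a \<in> a_kernel R L LR.\<iota>" unfolding A(3) using genideal_self[OF A(1)] by (rule rev_subsetD)
      then have "LR.\<iota> a = \<zero>\<^bsub>L\<^esub>" by (simp only: a_kernel_def' mem_Collect_eq)
      moreover have "a \<in> carrier R" using A(1) a by (rule subsetD)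
      ultimately show "\<exists>t\<in>S. t \<otimes> a = \<zero>" using LR.\<iota>_eq_zero_iff[of a] by (simp only: L_def)
    next
      fix a s t assume "a \<in> A" "s \<in> S" "t \<in> S" "s \<otimes> a = \<zero>"
      then show "t \<otimes> s \<otimes> a = \<zero>" using S[of s] S[of t] subsetD[OF A(1)] by (simp add: m_assoc)
    qed
    then obtain t where t: "t \<in> S" "\<forall>a\<in>A. t \<otimes> a = \<zero>" by blast
    have "ideal (colon R {\<zero>} t) R" using colon_ideal[OF zeroideal] S t by blast
    moreover have "A \<subseteq> colon R {\<zero>} t"
    proof
      fix x assume x: "x \<in> A"
      then have xc: "x \<in> carrier R" using A(1) by blast
      have "x \<otimes> t = \<zero>" using m_comm[OF xc S[OF t(1)]] t(2) x by simp
      then show "x \<in> colon R {\<zero>} t" using xc by (simp add: colon_def)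
    qed
    ultimately have "Idl A \<subseteq> colon R {\<zero>} t" by (rule genideal_minimal)
    then have "t \<otimes> x = \<zero>" if "x \<in> carrier R" "LR.\<iota> x = \<zero>\<^bsub>L\<^esub>" for x
    proof -
      have "x \<in> a_kernel R L LR.\<iota>" unfolding a_kernel_def' using that by blast
      then have "x \<in> colon R {\<zero>} t" using \<open>Idl A \<subseteq> colon R {\<zero>} t\<close> A(3) by blast
      then have "x \<in> carrier R" "x \<otimes> t = \<zero>" by (simp_all add: colon_def)
      then show ?thesis using m_comm[OF _ S[OF t(1)], of x] by simp
    qed
    then show ?thesis using t(1) by blast
  qed
  then obtain t where t: "t \<in> S" "\<And>x. x \<in> carrier R \<Longrightarrow> LR.\<iota> x = \<zero>\<^bsub>L\<^esub> \<Longrightarrow> t \<otimes> x = \<zero>" by blast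
  have tc: "t \<in> carrier R" using t S by blast
  have t_eq: "t \<otimes> x = t \<otimes> y" if "x \<in> carrier R" "y \<in> carrier R" "LR.\<iota> x = LR.\<iota> y" for x y
  proof -
    have "LR.\<iota> (x \<ominus> y) = \<zero>\<^bsub>L\<^esub>" using that by (simp add: minus_eq h.hom_a_inv L.r_neg)
    then have "t \<otimes> (x \<ominus> y) = \<zero>" using t(2) that by simp
    then have "t \<otimes> x \<ominus> t \<otimes> y = \<zero>" using that tc by (simp add: minus_eq r_distr r_minus)
    then show ?thesis using that tc by (simp add: r_right_minus_eq)
  qed
  \<comment> \<open>Multiplication by \<open>t\<close> turns equalities in the localization into
    equalities in R, which makes the lifted coordinates additive and linear.\<close>
  define l where "l u x = t \<otimes> r x u" for u x
  have lin: "frob_linear e (l u)" if u: "u \<in> U" for u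
    unfolding frob_linear_def
  proof (intro conjI ballI)
    show "l u \<in> carrier R \<rightarrow> carrier R" using r u tc by (auto simp: l_def)
    fix x y assume x: "x \<in> carrier R" and y: "y \<in> carrier R"
    have "t \<otimes> r (x \<oplus> y) u = t \<otimes> (r x u \<oplus> r y u)"
      using x y u r lamc sc by (intro t_eq) (auto simp: lam_add L.r_distr)
    then show "l u (x \<oplus> y) = l u x \<oplus> l u y" using r x y u tc by (simp add: l_def r_distr)
  next
    fix a x assume a: "a \<in> carrier R" and x: "x \<in> carrier R"
    have "t \<otimes> r (a [^] (p ^ e) \<otimes> x) u = t \<otimes> (a \<otimes> r x u)"
      using x a u r lamc sc by (intro t_eq) (auto simp: lam_smult L.m_ac)
    then show "l u (a [^] (p ^ e) \<otimes> x) = a \<otimes> l u x" using r x a u tc by (simp add: l_def m_lcomm)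
  qed
  obtain us where us: "set us = U" "distinct us" using finite_distinct_list[OF Uf(1)] by blast
  \<comment> \<open>A second factor \<open>t\<close> is needed because the expansion of (t s)^(p^e)
    x is itself known only in the localization. The multiplier obtained is therefore t t s.\<close>
  define xs where "xs = map (\<lambda>u. (\<lambda>x. t \<otimes> l u x, w u)) us"
  have wc: "w u \<in> carrier R" if "u \<in> U" for u using w(1)[OF that] W(2) by blast
  have "dual_list e xs" using us lin wc frob_linear_smult tc by (auto simp: dual_list_def xs_def)
  moreover have "(t \<otimes> t \<otimes> s) [^] (p ^ e) \<otimes> x = dual_sum e xs x" if x: "x \<in> carrier R" for x
  proof -
    have lc: "l u x \<in> carrier R" if "u \<in> U" for u using lin[OF that] frob_linear_closed x by blast
    define y where "y = (\<Oplus>u\<in>U. l u x [^] (p ^ e) \<otimes> w u)"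
    have yc: "y \<in> carrier R" unfolding y_def using lc wc by (intro finsum_closed) auto
    have "LR.\<iota> y = (\<Oplus>\<^bsub>L\<^esub>u\<in>U. LR.\<iota> (l u x [^] (p ^ e) \<otimes> w u))"
      unfolding y_def using lc wc Uf(1) by (subst h.hom_finsum) (auto simp: comp_def)
    also have "\<dots> = (\<Oplus>\<^bsub>L\<^esub>u\<in>U. (LR.\<iota> (t \<otimes> s) \<otimes>\<^bsub>L\<^esub> lm x u) [^]\<^bsub>L\<^esub> (p ^ e) \<otimes>\<^bsub>L\<^esub> u)"
    proof (rule L.finsum_cong')
      fix u assume u: "u \<in> U"
      have "LR.\<iota> (l u x) = LR.\<iota> (t \<otimes> s) \<otimes>\<^bsub>L\<^esub> lm x u"
        unfolding l_def using u r x tc sc lamc by (simp add: L.m_assoc)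
      then show "LR.\<iota> (l u x [^] (p ^ e) \<otimes> w u) = (LR.\<iota> (t \<otimes> s) \<otimes>\<^bsub>L\<^esub> lm x u) [^]\<^bsub>L\<^esub> (p ^ e) \<otimes>\<^bsub>L\<^esub> u"
        using u lc wc w(2) by simp
    qed (use lamc x tc sc Uf in auto)
    also have "\<dots> = LR.\<iota> (t \<otimes> s) [^]\<^bsub>L\<^esub> (p ^ e) \<otimes>\<^bsub>L\<^esub> LR.\<iota> x"
      using L.frob_comb_smult[OF Uf lam(1)[OF x], of "LR.\<iota> (t \<otimes> s)" e] lam(2)[OF x] tc sc
      by (simp add: L.frob_comb_def)
    also have "\<dots> = LR.\<iota> ((t \<otimes> s) [^] (p ^ e) \<otimes> x)" using tc sc x by simp
    finally have "t \<otimes> y = t \<otimes> ((t \<otimes> s) [^] (p ^ e) \<otimes> x)" using yc tc sc x by (intro t_eq) auto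
    moreover obtain q where q: "p ^ e = Suc q" using q_pos[of e] by (cases "p ^ e") auto
    ultimately have "t [^] (p ^ e) \<otimes> y = t [^] (p ^ e) \<otimes> ((t \<otimes> s) [^] (p ^ e) \<otimes> x)"
      using tc sc x yc by (simp add: m_assoc)
    also have "\<dots> = (t \<otimes> t \<otimes> s) [^] (p ^ e) \<otimes> x" using tc sc x by (simp add: nat_pow_distrib m_assoc)
    finally have "(t \<otimes> t \<otimes> s) [^] (p ^ e) \<otimes> x = t [^] (p ^ e) \<otimes> y" by simp
    also have "\<dots> = (\<Oplus>u\<in>U. t [^] (p ^ e) \<otimes> (l u x [^] (p ^ e) \<otimes> w u))"
      unfolding y_def using Uf lc wc tc by (intro finsum_rdistr) auto
    also have "\<dots> = (\<Oplus>u\<in>U. (t \<otimes> l u x) [^] (p ^ e) \<otimes> w u)"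
      using lc wc tc by (intro finsum_cong') (auto simp: nat_pow_distrib m_assoc)
    also have "\<dots> = foldr (\<lambda>u s. (t \<otimes> l u x) [^] (p ^ e) \<otimes> w u \<oplus> s) us \<zero>"
      unfolding us(1)[symmetric] using us lc wc tc by (intro finsum_eq_foldr abelian_monoid_axioms) auto
    also have "\<dots> = dual_sum e xs x" by (simp add: dual_sum_def xs_def foldr_map comp_def)
    finally show ?thesis .
  qed
  moreover have "t \<otimes> t \<otimes> s \<in> S" using t s by (intro LR.S_mult')
  ultimately show ?thesis using S unfolding dual_ideal_def S_def by blast
qed

text \<open>Kunz: \<open>F\<^sup>e\<^sub>*R\<close> is projective.\<close>

theorem (in char_p_ring) exists_dual_basis:
  assumes reg: "regular_ring R" and W: "finite W" "W \<subseteq> carrier R" "frob_generates e W"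
  shows "\<exists>xs. dual_list e xs \<and> (\<forall>x\<in>carrier R. x = dual_sum e xs x)"
proof -
  have noeth: "noetherian_ring R" using reg by (simp add: regular_ring_def)
  have "dual_ideal e = carrier R"
  proof (rule ccontr)
    assume "dual_ideal e \<noteq> carrier R"
    then obtain P where P: "maximalideal P R" "dual_ideal e \<subseteq> P"
      using noetherian_ring.exists_maximal_ideal[OF noeth dual_ideal_ideal] by blast
    have pr: "primeideal P R" using maximalideal_prime[OF P(1)] .
    then have "regular_local_ring (localization R (carrier R - P) (self_module R))"
      using reg by (simp add: regular_ring_def)
    then show False using exists_dual_multiplier[OF pr _ noeth W] P(2) by blast
  qed
  then have "\<one> \<in> dual_ideal e" by simp
  then show ?thesis unfolding dual_ideal_def by auto
qed

section \<open>Finite generation of the Frobenius\<close>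

context char_p_ring begin

definition frob_span :: "nat \<Rightarrow> 'a set \<Rightarrow> 'a set" where
  "frob_span e W = frob_comb e W ` (W \<rightarrow> carrier R)"

lemma frob_generates_span: "frob_generates e W \<longleftrightarrow> carrier R \<subseteq> frob_span e W"
  by (auto simp: frob_generates_def frob_span_def)

context
  fixes W assumes W: "finite W" "W \<subseteq> carrier R"
begin

lemma frob_span_carrier: "frob_span e W \<subseteq> carrier R"
  unfolding frob_span_def using frob_comb_closed[OF W] by blast

lemma frob_span_zero: "\<zero> \<in> frob_span e W"
  unfolding frob_span_def using frob_comb_zero[OF W] by (intro image_eqI[of _ _ "\<lambda>_. \<zero>"]) auto

lemma frob_span_add:
  assumes "x \<in> frob_span e W" "y \<in> frob_span e W" shows "x \<oplus> y \<in> frob_span e W"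
proof -
  obtain a where a: "x = frob_comb e W a" "a \<in> W \<rightarrow> carrier R" using assms(1) unfolding frob_span_def by (rule imageE)
  obtain b where b: "y = frob_comb e W b" "b \<in> W \<rightarrow> carrier R" using assms(2) unfolding frob_span_def by (rule imageE)
  have "(\<lambda>u. a u \<oplus> b u) \<in> W \<rightarrow> carrier R" using a b by auto
  then show ?thesis unfolding a(1) b(1) frob_comb_add[OF W a(2) b(2), symmetric] frob_span_def by (rule imageI)
qed

lemma frob_span_smult:
  assumes "r \<in> carrier R" "x \<in> frob_span e W" shows "r [^] (p ^ e) \<otimes> x \<in> frob_span e W"
proof -
  obtain a where a: "x = frob_comb e W a" "a \<in> W \<rightarrow> carrier R" using assms(2) unfolding frob_span_def by (rule imageE)
  have "(\<lambda>u. r \<otimes> a u) \<in> W \<rightarrow> carrier R" using a assms by auto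
  then show ?thesis unfolding a(1) frob_comb_smult[OF W a(2) assms(1), symmetric] frob_span_def by (rule imageI)
qed

lemma frob_span_base:
  assumes "w \<in> W" shows "w \<in> frob_span e W"
proof -
  obtain a where a: "a \<in> W \<rightarrow> carrier R" "(\<Oplus>i\<in>{w}. \<one> [^] (p ^ e) \<otimes> i) = frob_comb e W a"
    using frob_span_closed[OF W, of "{w}" "\<lambda>_. \<one>" id] assms by auto
  have "w \<in> carrier R" using assms W by blast
  then have "(\<Oplus>i\<in>{w}. \<one> [^] (p ^ e) \<otimes> i) = w" by simp
  then show ?thesis using a unfolding frob_span_def by (metis imageI)
qed

lemma frob_span_minus:
  assumes "x \<in> frob_span e W" shows "\<ominus> x \<in> frob_span e W"
proof -
  have "x \<in> carrier R" using assms frob_span_carrier by blast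
  then have "\<ominus> x = (\<ominus> \<one>) [^] (p ^ e) \<otimes> x" by (simp add: frob_minus l_minus)
  then show ?thesis using frob_span_smult[OF _ assms, of "\<ominus> \<one>"] by simp
qed

lemma frob_span_induct [consumes 1, case_names zero add base]:
  assumes x: "x \<in> frob_span e W"
    and "P \<zero>" "\<And>x y. x \<in> carrier R \<Longrightarrow> y \<in> carrier R \<Longrightarrow> P x \<Longrightarrow> P y \<Longrightarrow> P (x \<oplus> y)"
    "\<And>a w. a \<in> carrier R \<Longrightarrow> w \<in> W \<Longrightarrow> P (a [^] (p ^ e) \<otimes> w)"
  shows "P x"
proof -
  obtain a where a: "x = frob_comb e W a" "a \<in> W \<rightarrow> carrier R" using x unfolding frob_span_def by (rule imageE)
  have "P (\<Oplus>w\<in>F. a w [^] (p ^ e) \<otimes> w)" if "finite F" "F \<subseteq> W" for F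
    using that
  proof (induction F rule: finite_induct)
    case (insert w F)
    then have w: "w \<in> W" "w \<in> carrier R" "a w \<in> carrier R" using W(2) a by auto
    have Fc: "(\<lambda>w. a w [^] (p ^ e) \<otimes> w) \<in> F \<rightarrow> carrier R" using insert W(2) a by (auto simp: Pi_iff subset_iff)
    have "(\<Oplus>w\<in>insert w F. a w [^] (p ^ e) \<otimes> w) = a w [^] (p ^ e) \<otimes> w \<oplus> (\<Oplus>w\<in>F. a w [^] (p ^ e) \<otimes> w)"
      using insert w Fc by (intro finsum_insert) auto
    then show ?case using insert w Fc assms(3,4) by (simp add: finsum_closed)
  qed (simp add: assms(2))
  then show ?thesis using a(1) W(1) unfolding frob_comb_def by blast
qed

text \<open>A span whose generators multiply into it is a subring. This is the property carried
  along while generators of the algebra are adjoined.\<close>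

lemma frob_span_mult:
  assumes base: "\<And>v w. v \<in> W \<Longrightarrow> w \<in> W \<Longrightarrow> v \<otimes> w \<in> frob_span e W"
    and x: "x \<in> frob_span e W" and y: "y \<in> frob_span e W"
  shows "x \<otimes> y \<in> frob_span e W"
proof -
  have 1: "x \<otimes> w \<in> frob_span e W" if w: "w \<in> W" for w
    using x
  proof (induction rule: frob_span_induct)
    case zero
    then show ?case using w W frob_span_zero by (auto simp: subset_iff)
  next
    case (add x y)
    then show ?case using w W frob_span_add by (auto simp: l_distr subset_iff)
  next
    case (base a v)
    then have "a [^] (p ^ e) \<otimes> v \<otimes> w = a [^] (p ^ e) \<otimes> (v \<otimes> w)" using w W by (simp add: m_assoc subset_iff)
    then show ?case using base w assms(1) frob_span_smult by simp
  qed
  have xc: "x \<in> carrier R" using x frob_span_carrier by blast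
  show ?thesis using y
  proof (induction rule: frob_span_induct)
    case zero
    then show ?case using xc frob_span_zero by simp
  next
    case (add y z)
    then show ?case using xc frob_span_add by (simp add: r_distr)
  next
    case (base a w)
    then have "x \<otimes> (a [^] (p ^ e) \<otimes> w) = a [^] (p ^ e) \<otimes> (x \<otimes> w)" using xc W by (simp add: m_lcomm subset_iff)
    then show ?case using base 1 frob_span_smult by simp
  qed
qed

end

lemma F_finite_frob_generates_1:
  assumes "F_finite R p" shows "\<exists>A. finite A \<and> A \<subseteq> carrier R \<and> frob_generates 1 A"
proof -
  define F where "F = frob_push R p 1 (self_module R)"
  have F: "carrier F = carrier R" "add F = add R" "ring.zero F = \<zero>" "\<And>r x. r \<odot>\<^bsub>F\<^esub> x = r [^] p \<otimes> x"
    by (simp_all add: F_def frob_push_def restrict_scalars_def)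
  obtain A where A: "finite A" "A \<subseteq> carrier R" "\<And>N. submodule N R F \<Longrightarrow> A \<subseteq> N \<Longrightarrow> N = carrier R"
    using assms unfolding F_finite_def fin_gen_module_def F_def[symmetric] F by blast
  have "submodule (frob_span 1 A) R F"
  proof (rule submodule.intro)
    have "m_inv (add_monoid F) x = \<ominus> x" for x by (simp add: m_inv_def a_inv_def F)
    then show "subgroup (frob_span 1 A) (add_monoid F)"
      using frob_span_carrier[OF A(1,2)] frob_span_zero[OF A(1,2)] frob_span_add[OF A(1,2)] frob_span_minus[OF A(1,2)]
      by (intro subgroup.intro) (simp_all add: F)
    show "submodule_axioms (frob_span 1 A) R F"
      using frob_span_smult[OF A(1,2), where e = 1] by unfold_locales (simp add: F)
  qed
  then have "frob_span 1 A = carrier R" using frob_span_base[OF A(1,2)] by (intro A(3)) auto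
  then show ?thesis using A unfolding frob_generates_span by blast
qed

lemma F_finite_frob_generates:
  assumes "F_finite R p" shows "\<exists>A. finite A \<and> A \<subseteq> carrier R \<and> frob_generates e A"
proof (induction e)
  case 0
  have "frob_generates 0 {\<one>}"
    unfolding frob_generates_def
  proof
    fix x assume "x \<in> carrier R"
    then show "\<exists>a\<in>{\<one>} \<rightarrow> carrier R. x = frob_comb 0 {\<one>} a"
      by (intro bexI[of _ "\<lambda>_. x"]) (auto simp: frob_comb_def)
  qed
  then show ?case by (intro exI[of _ "{\<one>}"]) auto
next
  case (Suc e)
  then obtain A where A: "finite A" "A \<subseteq> carrier R" "frob_generates e A" by blast
  obtain B where B: "finite B" "B \<subseteq> carrier R" "frob_generates 1 B" using F_finite_frob_generates_1[OF assms] by blast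
  \<comment> \<open>Expand x over B with coefficients c^p, then each c over A with coefficients
    a^(p^e). The products u^p b remain as generators, with scalars a^(p^(e+1)).\<close>
  define W where "W = (\<lambda>(u, b). u [^] p \<otimes> b) ` (A \<times> B)"
  have W: "finite W" "W \<subseteq> carrier R" using A B by (auto simp: W_def)
  have 1: "c [^] p \<otimes> b \<in> frob_span (Suc e) W" if b: "b \<in> B" and c: "c \<in> carrier R" for b c
    using A c
  proof (rule frob_generates_induct)
    have bc: "b \<in> carrier R" using b B by blast
    show "\<zero> [^] p \<otimes> b \<in> frob_span (Suc e) W" using frob_zero[of 1] bc frob_span_zero[OF W] by simp
    fix x y assume "x \<in> carrier R" "y \<in> carrier R" "x [^] p \<otimes> b \<in> frob_span (Suc e) W" "y [^] p \<otimes> b \<in> frob_span (Suc e) W"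
    then show "(x \<oplus> y) [^] p \<otimes> b \<in> frob_span (Suc e) W"
      using bc frob_span_add[OF W] by (simp add: frob1_add l_distr)
  next
    fix a u assume a: "a \<in> carrier R" "u \<in> A"
    then have c: "u \<in> carrier R" "b \<in> carrier R" using A B b by auto
    have "(a [^] (p ^ e) \<otimes> u) [^] p \<otimes> b = a [^] (p ^ Suc e) \<otimes> (u [^] p \<otimes> b)"
      using a(1) c by (simp add: nat_pow_distrib m_assoc nat_pow_pow mult.commute)
    moreover have "u [^] p \<otimes> b \<in> W" using a b by (auto simp: W_def)
    ultimately show "(a [^] (p ^ e) \<otimes> u) [^] p \<otimes> b \<in> frob_span (Suc e) W"
      using frob_span_smult[OF W a(1) frob_span_base[OF W], of "u [^] p \<otimes> b" "Suc e"] by simp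
  qed
  have "x \<in> frob_span (Suc e) W" if "x \<in> carrier R" for x
    using B that
  proof (rule frob_generates_induct)
    show "\<zero> \<in> frob_span (Suc e) W" by (rule frob_span_zero[OF W])
    fix x y assume "x \<in> frob_span (Suc e) W" "y \<in> frob_span (Suc e) W"
    then show "x \<oplus> y \<in> frob_span (Suc e) W" by (rule frob_span_add[OF W])
  next
    fix a w assume "a \<in> carrier R" "w \<in> B"
    then show "a [^] p ^ 1 \<otimes> w \<in> frob_span (Suc e) W" using 1 by simp
  qed
  then show ?case using W unfolding frob_generates_span by blast
qed

text \<open>Only the powers a^i with i < p^e have to be added to the generators, since a^(m p^e) is
  the p^e-th power of a^m and hence a scalar on F^e_* R.\<close>

lemma adjoin_frob_subring:
  assumes H: "finite H" "H \<subseteq> carrier R" and mult: "\<And>v w. v \<in> H \<Longrightarrow> w \<in> H \<Longrightarrow> v \<otimes> w \<in> frob_span e H"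
    and one: "\<one> \<in> frob_span e H" and a: "a \<in> carrier R"
  shows "\<exists>K. finite K \<and> K \<subseteq> carrier R \<and> (\<forall>v\<in>K. \<forall>w\<in>K. v \<otimes> w \<in> frob_span e K) \<and>
    frob_span e H \<subseteq> frob_span e K \<and> a \<in> frob_span e K"
proof -
  define K where "K = (\<lambda>(h, i). h \<otimes> a [^] i) ` (H \<times> {..<p ^ e})"
  have K: "finite K" "K \<subseteq> carrier R" using H a by (auto simp: K_def)
  have pow: "y \<otimes> a [^] (n::nat) \<in> frob_span e K" if y: "y \<in> frob_span e H" for y n
    using y
  proof (induction rule: frob_span_induct[OF H, consumes 1, case_names zero add base])
    case zero
    then show ?case using a frob_span_zero[OF K] by simp
  next
    case (add x y)
    then show ?case using a frob_span_add[OF K] by (simp add: l_distr)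
  next
    case (base r h)
    define m i where "m = n div p ^ e" and "i = n mod p ^ e"
    have n: "n = m * p ^ e + i" unfolding m_def i_def by (rule div_mult_mod_eq[symmetric])
    have hc: "h \<in> carrier R" using base H by blast
    have "r [^] (p ^ e) \<otimes> h \<otimes> a [^] n = (r \<otimes> a [^] m) [^] (p ^ e) \<otimes> (h \<otimes> a [^] i)"
      unfolding n using base(1) hc a by (simp add: nat_pow_distrib m_ac flip: nat_pow_mult nat_pow_pow)
    moreover have "h \<otimes> a [^] i \<in> K" using base(2) q_pos by (auto simp: K_def i_def)
    ultimately show ?case using frob_span_smult[OF K _ frob_span_base[OF K]] base(1) a by simp
  qed
  have "v \<otimes> w \<in> frob_span e K" if vK: "v \<in> K" and wK: "w \<in> K" for v w
  proof -
    obtain h i where h: "h \<in> H" "v = h \<otimes> a [^] (i::nat)" using vK by (auto simp: K_def)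
    obtain g j where g: "g \<in> H" "w = g \<otimes> a [^] (j::nat)" using wK by (auto simp: K_def)
    have "h \<in> carrier R" "g \<in> carrier R" using h g H by auto
    then have "v \<otimes> w = h \<otimes> g \<otimes> a [^] (i + j)" unfolding h(2) g(2) using a by (simp add: m_ac flip: nat_pow_mult)
    then show ?thesis using pow[OF mult[OF h(1) g(1)]] by simp
  qed
  moreover have "frob_span e H \<subseteq> frob_span e K"
  proof
    fix y assume y: "y \<in> frob_span e H"
    then have "y \<in> carrier R" using frob_span_carrier[OF H] by blast
    then show "y \<in> frob_span e K" using pow[OF y, of 0] by simp
  qed
  moreover have "a \<in> frob_span e K" using pow[OF one, of 1] a by simp
  ultimately show ?thesis using K by blast
qed

end

lemma (in cring) char_p_ring_hom:
  fixes k :: "('k, 'y) ring_scheme" (structure) and \<sigma> :: "'k \<Rightarrow> 'a"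
  assumes "cring k" "\<sigma> \<in> ring_hom k R" "[(p::nat)] \<cdot>\<^bsub>k\<^esub> \<one>\<^bsub>k\<^esub> = \<zero>\<^bsub>k\<^esub>" "Factorial_Ring.prime p"
  shows "char_p_ring R p"
proof -
  interpret k: cring k by fact
  interpret h: ring_hom_cring k R \<sigma>
    using assms by (intro ring_hom_cring.intro ring_hom_cring_axioms.intro cring_axioms)
  have "\<sigma> ([(n::nat)] \<cdot>\<^bsub>k\<^esub> x) = [n] \<cdot> \<sigma> x" if "x \<in> carrier k" for n x
    by (induction n) (use that in simp_all)
  then have "[p] \<cdot> \<one> = \<zero>" using assms(3) by (metis h.hom_one h.hom_zero k.one_closed)
  then show ?thesis using assms(4) by unfold_locales
qed

text \<open>The image of k is spanned by the image of finitely many generators of F^e_* k, and the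
  elements of A are adjoined one at a time. The final passage to fractions needs no further
  generators.\<close>

theorem (in char_p_ring) ess_finite_type_frob_generates:
  fixes k :: "('k, 'y) ring_scheme" (structure) and \<sigma> :: "'k \<Rightarrow> 'a"
  assumes k: "field k" "[p] \<cdot>\<^bsub>k\<^esub> \<one>\<^bsub>k\<^esub> = \<zero>\<^bsub>k\<^esub>" "F_finite k p" and R: "ess_finite_type k \<sigma> R"
  shows "\<exists>W. finite W \<and> W \<subseteq> carrier R \<and> frob_generates e W"
proof -
  interpret k: field k by fact
  interpret k: char_p_ring k p using k(2) prime_p by unfold_locales
  interpret h: ring_hom_cring k R \<sigma>
    using R unfolding ess_finite_type_def
    by (intro ring_hom_cring.intro ring_hom_cring_axioms.intro cring_axioms k.is_cring) blast
  obtain A W where A: "finite A" "A \<subseteq> carrier R" and W: "W \<subseteq> generate_ring R (\<sigma> ` carrier k \<union> A)" "W \<subseteq> Units R"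
    and frac: "\<forall>r\<in>carrier R. \<exists>b\<in>generate_ring R (\<sigma> ` carrier k \<union> A). \<exists>w\<in>W. r = b \<otimes> inv w"
    using R unfolding ess_finite_type_def Let_def by blast
  obtain C where C: "finite C" "C \<subseteq> carrier k" "k.frob_generates e C"
    using k.F_finite_frob_generates[OF k(3)] by blast
  define G where "G = \<sigma> ` C"
  have G: "finite G" "G \<subseteq> carrier R" using C by (auto simp: G_def)
  have kG: "\<sigma> x \<in> frob_span e G" if "x \<in> carrier k" for x
    using C that
  proof (rule k.frob_generates_induct)
    show "\<sigma> \<zero>\<^bsub>k\<^esub> \<in> frob_span e G" using frob_span_zero[OF G] by simp
    fix x y assume "x \<in> carrier k" "y \<in> carrier k" "\<sigma> x \<in> frob_span e G" "\<sigma> y \<in> frob_span e G"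
    then show "\<sigma> (x \<oplus>\<^bsub>k\<^esub> y) \<in> frob_span e G" using frob_span_add[OF G] by simp
  next
    fix a w assume a: "a \<in> carrier k" "w \<in> C"
    then have "\<sigma> (a [^]\<^bsub>k\<^esub> (p ^ e) \<otimes>\<^bsub>k\<^esub> w) = \<sigma> a [^] (p ^ e) \<otimes> \<sigma> w" using C(2) by (auto simp: subset_iff)
    moreover have "\<sigma> w \<in> G" using a by (simp add: G_def)
    ultimately show "\<sigma> (a [^]\<^bsub>k\<^esub> (p ^ e) \<otimes>\<^bsub>k\<^esub> w) \<in> frob_span e G"
      using frob_span_smult[OF G _ frob_span_base[OF G], of "\<sigma> a" "\<sigma> w"] a by simp
  qed
  have "\<exists>K. finite K \<and> K \<subseteq> carrier R \<and> (\<forall>v\<in>K. \<forall>w\<in>K. v \<otimes> w \<in> frob_span e K) \<and>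
    \<sigma> ` carrier k \<subseteq> frob_span e K \<and> A \<subseteq> frob_span e K"
    using A
  proof (induction A rule: finite_induct)
    case empty
    have "v \<otimes> w \<in> frob_span e G" if "v \<in> G" "w \<in> G" for v w
    proof -
      obtain x where x: "v = \<sigma> x" "x \<in> C" using \<open>v \<in> G\<close> unfolding G_def by (rule imageE)
      obtain y where y: "w = \<sigma> y" "y \<in> C" using \<open>w \<in> G\<close> unfolding G_def by (rule imageE)
      have "x \<in> carrier k" "y \<in> carrier k" using x y C by auto
      then show ?thesis using kG[of "x \<otimes>\<^bsub>k\<^esub> y"] x(1) y(1) by simp
    qed
    moreover have "\<sigma> ` carrier k \<subseteq> frob_span e G" using kG by (rule image_subsetI)
    ultimately show ?case using G by (intro exI[of _ G]) simp
  next
    case (insert a A)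
    then obtain H where H: "finite H" "H \<subseteq> carrier R" "\<And>v w. v \<in> H \<Longrightarrow> w \<in> H \<Longrightarrow> v \<otimes> w \<in> frob_span e H"
      "\<sigma> ` carrier k \<subseteq> frob_span e H" "A \<subseteq> frob_span e H" by (metis insert_subset)
    have "\<sigma> \<one>\<^bsub>k\<^esub> \<in> frob_span e H" using H(4) by blast
    then have "\<one> \<in> frob_span e H" by simp
    moreover have "a \<in> carrier R" using insert by blast
    ultimately obtain K where K: "finite K \<and> K \<subseteq> carrier R \<and> (\<forall>v\<in>K. \<forall>w\<in>K. v \<otimes> w \<in> frob_span e K) \<and>
        frob_span e H \<subseteq> frob_span e K \<and> a \<in> frob_span e K"
      using adjoin_frob_subring[OF H(1-3)] by metis
    then have "insert a A \<subseteq> frob_span e K" "\<sigma> ` carrier k \<subseteq> frob_span e K" using H(4,5) by auto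
    then show ?case using K by (intro exI[of _ K]) simp
  qed
  then obtain K where K: "finite K" "K \<subseteq> carrier R" "\<And>v w. v \<in> K \<Longrightarrow> w \<in> K \<Longrightarrow> v \<otimes> w \<in> frob_span e K"
      "\<sigma> ` carrier k \<subseteq> frob_span e K" "A \<subseteq> frob_span e K" by metis
  have B: "b \<in> frob_span e K" if "b \<in> generate_ring R (\<sigma> ` carrier k \<union> A)" for b
    using that
  proof (induction rule: generate_ring.induct)
    case one
    have "\<sigma> \<one>\<^bsub>k\<^esub> \<in> frob_span e K" using K(4) by blast
    then show ?case by simp
  next
    case (incl h)
    then show ?case using K(4,5) by blast
  qed (rule frob_span_minus[OF K(1,2)] frob_span_add[OF K(1,2)] frob_span_mult[OF K(1-3)]; assumption)+
  have Wp: "w [^] (n::nat) \<in> frob_span e K" if "w \<in> W" for w n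
  proof (rule B)
    show "w [^] n \<in> generate_ring R (\<sigma> ` carrier k \<union> A)"
    proof (induction n)
      case (Suc n)
      then show ?case using W(1) \<open>w \<in> W\<close> by (auto intro: generate_ring.eng_mult)
    qed (simp add: generate_ring.one)
  qed
  have "r \<in> frob_span e K" if r: "r \<in> carrier R" for r
  proof -
    obtain b w where bw: "b \<in> generate_ring R (\<sigma> ` carrier k \<union> A)" "w \<in> W" "r = b \<otimes> inv w" using frac r by blast
    have c: "b \<in> carrier R" "w \<in> carrier R" "inv w \<in> carrier R" "inv w \<otimes> w = \<one>"
      using B[OF bw(1)] frob_span_carrier[OF K(1,2)] bw(2) W(2) Units_closed Units_inv_closed Units_l_inv by auto
    obtain q where q: "p ^ e = Suc q" using q_pos[of e] by (cases "p ^ e") auto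
    \<comment> \<open>With q = p^e - 1 one has b/w = (1/w)^(p^e) (b w^q): the denominator becomes a
      scalar and the numerator stays in the subring.\<close>
    have "(inv w) [^] (p ^ e) \<otimes> (b \<otimes> w [^] q) = b \<otimes> (inv w \<otimes> w) [^] q \<otimes> inv w"
      unfolding q using c(1-3) by (simp add: nat_pow_distrib m_ac)
    also have "\<dots> = r" unfolding c(4) bw(3) using c by simp
    finally show ?thesis
      using frob_span_smult[OF K(1,2) c(3) frob_span_mult[OF K(1-3) B[OF bw(1)] Wp[OF bw(2)]], of q] by simp
  qed
  then show ?thesis using K(1,2) unfolding frob_generates_span by blast
qed

section \<open>Test modules\<close>

text \<open>Stated for abelian groups because it serves three quotients with different scalars: a
  localization modulo the image of a submodule, the span of the adjoint as a right module, and a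
  trace image modulo the next one.\<close>

locale quot_group = abelian_group M for M :: "('r, 'm) module" (structure) +
  fixes N assumes N_subgroup: "subgroup N (add_monoid M)"
begin

sublocale N: abelian_subgroup N M
  using N_subgroup abelian_group_axioms by (intro abelian_subgroupI3 additive_subgroupI)

abbreviation Q :: "('r, 'm set) module" where "Q \<equiv> quot_module M N"

lemma quot_carrier: "carrier Q = (\<lambda>x. N +> x) ` carrier M"
  by (auto simp: quot_module_def A_RCOSETS_def' a_r_coset_def')

lemma quot_zero: "\<zero>\<^bsub>Q\<^esub> = N"
  by (simp add: quot_module_def)

lemma quot_add: "x \<in> carrier M \<Longrightarrow> y \<in> carrier M \<Longrightarrow> (N +> x) \<oplus>\<^bsub>Q\<^esub> (N +> y) = N +> (x \<oplus> y)"
  by (simp add: quot_module_def N.a_rcos_sum)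

lemma coset_closed [simp]: "x \<in> carrier M \<Longrightarrow> N +> x \<in> carrier Q"
  by (auto simp: quot_carrier)

lemma mem_coset: "x \<in> carrier M \<Longrightarrow> y \<in> carrier M \<Longrightarrow> y \<in> N +> x \<longleftrightarrow> y \<oplus> \<ominus> x \<in> N"
  by (rule N.a_rcos_module)

lemma coset_eq_iff:
  assumes "x \<in> carrier M" "y \<in> carrier M"
  shows "N +> x = N +> y \<longleftrightarrow> y \<oplus> \<ominus> x \<in> N"
proof
  assume "N +> x = N +> y"
  then have "y \<in> N +> x" using N.a_rcos_self[OF assms(2)] by simp
  then show "y \<oplus> \<ominus> x \<in> N" using mem_coset assms by simp
next
  assume "y \<oplus> \<ominus> x \<in> N"
  then have "y \<in> N +> x" using mem_coset assms by simp
  then show "N +> x = N +> y" using assms(1) by (rule N.a_repr_independence')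
qed

lemma coset_zero: "N +> \<zero> = N"
  by (rule a_coset_add_zero) (rule N.a_subset)

lemma coset_eq_N_iff:
  assumes "x \<in> carrier M" shows "N +> x = N \<longleftrightarrow> x \<in> N"
proof -
  have "N = N +> x \<longleftrightarrow> x \<oplus> \<ominus> \<zero> \<in> N" using coset_eq_iff[OF zero_closed assms] by (simp only: coset_zero)
  moreover have "x \<oplus> \<ominus> \<zero> = x" using assms by simp
  ultimately show ?thesis by metis
qed

lemma quot_abelian_group: "abelian_group Q"
proof (rule abelian_groupI)
  fix U assume "U \<in> carrier Q"
  then obtain x where x: "x \<in> carrier M" "U = N +> x" by (auto simp: quot_carrier)
  have "(N +> \<ominus> x) \<oplus>\<^bsub>Q\<^esub> U = \<zero>\<^bsub>Q\<^esub>" using x by (simp add: quot_add l_neg quot_zero coset_zero)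
  moreover have "N +> \<ominus> x \<in> carrier Q" using x by simp
  ultimately show "\<exists>y\<in>carrier Q. y \<oplus>\<^bsub>Q\<^esub> U = \<zero>\<^bsub>Q\<^esub>" by blast
  have "(N +> \<zero>) \<oplus>\<^bsub>Q\<^esub> U = U" using x by (simp add: quot_add)
  then show "\<zero>\<^bsub>Q\<^esub> \<oplus>\<^bsub>Q\<^esub> U = U" by (simp add: quot_zero coset_zero)
next
  have "N +> \<zero> \<in> carrier Q" by (rule coset_closed) simp
  then show "\<zero>\<^bsub>Q\<^esub> \<in> carrier Q" by (simp add: quot_zero coset_zero)
qed (auto simp: quot_carrier quot_add a_ac)

text \<open>The union defining \<open>quot_map\<close> runs over all representatives of a coset;
  additivity of \<phi> and stability of N make its members coincide.\<close>

lemma quot_map_coset: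
  assumes "x \<in> carrier M" "\<phi> \<in> carrier M \<rightarrow> carrier M"
    "\<And>x y. x \<in> carrier M \<Longrightarrow> y \<in> carrier M \<Longrightarrow> \<phi> (x \<oplus> y) = \<phi> x \<oplus> \<phi> y"
    "\<And>x. x \<in> N \<Longrightarrow> \<phi> x \<in> N"
  shows "quot_map M N \<phi> (N +> x) = N +> \<phi> x"
proof -
  have "N +> \<phi> y = N +> \<phi> x" if y: "y \<in> N +> x" for y
  proof -
    obtain n where n: "n \<in> N" "y = n \<oplus> x" using y by (auto simp: a_r_coset_def')
    have c: "n \<in> carrier M" "\<phi> n \<in> carrier M" "\<phi> x \<in> carrier M" using n assms(1,2) N.a_subset by auto
    have "\<phi> y \<oplus> \<ominus> \<phi> x = \<phi> n" unfolding n(2) using assms(3)[OF c(1) assms(1)] c by (simp add: a_assoc r_neg)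
    then have "\<phi> y \<oplus> \<ominus> \<phi> x \<in> N" using assms(4)[OF n(1)] by simp
    then show ?thesis using coset_eq_iff[of "\<phi> x" "\<phi> y"] c assms(1,2) n(2) by auto
  qed
  then have "(\<Union>y\<in>N +> x. N +> \<phi> y) = (\<Union>y\<in>N +> x. N +> \<phi> x)" by (rule SUP_cong[OF refl])
  also have "\<dots> = N +> \<phi> x" using N.a_rcos_self[OF assms(1)] by blast
  finally show ?thesis by (simp add: quot_map_def)
qed

end

section \<open>Operators on a module and torsion at a prime\<close>

definition p_linear :: "('r, 'z) ring_scheme \<Rightarrow> nat \<Rightarrow> ('r, 'm, 'y) module_scheme \<Rightarrow> nat \<Rightarrow> ('m \<Rightarrow> 'm) \<Rightarrow> bool" where
  "p_linear R p M e \<phi> \<longleftrightarrow> \<phi> \<in> carrier M \<rightarrow> carrier M \<and>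
     (\<forall>x\<in>carrier M. \<forall>y\<in>carrier M. \<phi> (x \<oplus>\<^bsub>M\<^esub> y) = \<phi> x \<oplus>\<^bsub>M\<^esub> \<phi> y) \<and>
     (\<forall>r\<in>carrier R. \<forall>x\<in>carrier M. \<phi> (r [^]\<^bsub>R\<^esub> (p ^ e) \<odot>\<^bsub>M\<^esub> x) = r \<odot>\<^bsub>M\<^esub> \<phi> x)"

lemma p_linearD:
  assumes "p_linear R p M e \<phi>"
  shows "x \<in> carrier M \<Longrightarrow> \<phi> x \<in> carrier M"
    "x \<in> carrier M \<Longrightarrow> y \<in> carrier M \<Longrightarrow> \<phi> (x \<oplus>\<^bsub>M\<^esub> y) = \<phi> x \<oplus>\<^bsub>M\<^esub> \<phi> y"
    "r \<in> carrier R \<Longrightarrow> x \<in> carrier M \<Longrightarrow> \<phi> (r [^]\<^bsub>R\<^esub> (p ^ e) \<odot>\<^bsub>M\<^esub> x) = r \<odot>\<^bsub>M\<^esub> \<phi> x"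
  using assms by (auto simp: p_linear_def)

definition prime_torsion :: "('r, 'z) ring_scheme \<Rightarrow> 'r set \<Rightarrow> ('r, 'm, 'y) module_scheme \<Rightarrow> 'm set" where
  "prime_torsion R \<eta> M = {m \<in> carrier M. \<exists>n::nat. \<forall>r \<in> \<eta> [^]\<^bsub>ideals_set R\<^esub> n. r \<odot>\<^bsub>M\<^esub> m = \<zero>\<^bsub>M\<^esub>}"

lemma H0_submodule: "N \<subseteq> carrier M \<Longrightarrow> H0 R \<eta> (M\<lparr>carrier := N\<rparr>) = M\<lparr>carrier := N \<inter> prime_torsion R \<eta> M\<rparr>"
  and H0_eq: "H0 R \<eta> M = M\<lparr>carrier := prime_torsion R \<eta> M\<rparr>"
  by (auto simp: H0_def prime_torsion_def intro!: arg_cong[where f = "\<lambda>c. M\<lparr>carrier := c\<rparr>"])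

lemma (in cring) ideal_power_ideal:
  assumes "ideal \<eta> R" shows "ideal (\<eta> [^]\<^bsub>ideals_set R\<^esub> (n::nat)) R"
proof -
  interpret I: comm_monoid "ideals_set R" by (rule ideals_set_is_comm_monoid)
  have "\<eta> [^]\<^bsub>ideals_set R\<^esub> n \<in> carrier (ideals_set R)"
    using assms by (intro I.nat_pow_closed) (simp add: ideals_set_def)
  then show ?thesis by (simp add: ideals_set_def)
qed

lemma (in cring) ideal_power_antimono:
  assumes "ideal \<eta> R" shows "\<eta> [^]\<^bsub>ideals_set R\<^esub> (n + k::nat) \<subseteq> \<eta> [^]\<^bsub>ideals_set R\<^esub> n"
proof (induction k)
  case (Suc k)
  interpret I: comm_monoid "ideals_set R" by (rule ideals_set_is_comm_monoid)
  have "\<eta> [^]\<^bsub>ideals_set R\<^esub> (n + Suc k) = (\<eta> [^]\<^bsub>ideals_set R\<^esub> (n + k)) \<cdot> \<eta>"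
    by (simp add: ideals_set_def)
  also have "\<dots> \<subseteq> \<eta> [^]\<^bsub>ideals_set R\<^esub> (n + k)"
    using ideal_prod_inter[OF ideal_power_ideal[OF assms] assms] by blast
  finally show ?case using Suc by blast
qed simp

lemma (in module) prime_torsion_submodule:
  assumes "ideal \<eta> R" shows "submodule (prime_torsion R \<eta> M) R M"
proof (rule submoduleI)
  show "\<zero>\<^bsub>M\<^esub> \<in> prime_torsion R \<eta> M"
    using ideal.Icarr[OF R.ideal_power_ideal[OF assms]] by (auto simp: prime_torsion_def)
  fix a assume a: "a \<in> prime_torsion R \<eta> M"
  then obtain n where n: "a \<in> carrier M" "\<And>r. r \<in> \<eta> [^]\<^bsub>ideals_set R\<^esub> (n::nat) \<Longrightarrow> r \<odot>\<^bsub>M\<^esub> a = \<zero>\<^bsub>M\<^esub>"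
    by (auto simp: prime_torsion_def)
  interpret I: ideal "\<eta> [^]\<^bsub>ideals_set R\<^esub> n" R by (rule R.ideal_power_ideal[OF assms])
  have "r \<odot>\<^bsub>M\<^esub> (\<ominus>\<^bsub>M\<^esub> a) = \<zero>\<^bsub>M\<^esub>" if "r \<in> \<eta> [^]\<^bsub>ideals_set R\<^esub> n" for r
    using n(2)[OF that] n(1) I.Icarr[OF that] by (simp add: smult_r_minus)
  then show "\<ominus>\<^bsub>M\<^esub> a \<in> prime_torsion R \<eta> M" using n(1) by (auto simp: prime_torsion_def)
  fix x assume x: "x \<in> carrier R"
  have "r \<odot>\<^bsub>M\<^esub> (x \<odot>\<^bsub>M\<^esub> a) = \<zero>\<^bsub>M\<^esub>" if "r \<in> \<eta> [^]\<^bsub>ideals_set R\<^esub> n" for r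
    using n(2)[OF I.I_r_closed[OF that x]] n(1) I.Icarr[OF that] x by (simp add: smult_assoc1)
  then show "x \<odot>\<^bsub>M\<^esub> a \<in> prime_torsion R \<eta> M" using n(1) x by (auto simp: prime_torsion_def)
next
  fix a b assume a: "a \<in> prime_torsion R \<eta> M" and b: "b \<in> prime_torsion R \<eta> M"
  obtain n where n: "a \<in> carrier M" "\<And>r. r \<in> \<eta> [^]\<^bsub>ideals_set R\<^esub> (n::nat) \<Longrightarrow> r \<odot>\<^bsub>M\<^esub> a = \<zero>\<^bsub>M\<^esub>"
    using a by (auto simp: prime_torsion_def)
  obtain k where k: "b \<in> carrier M" "\<And>r. r \<in> \<eta> [^]\<^bsub>ideals_set R\<^esub> (k::nat) \<Longrightarrow> r \<odot>\<^bsub>M\<^esub> b = \<zero>\<^bsub>M\<^esub>"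
    using b by (auto simp: prime_torsion_def)
  have "r \<odot>\<^bsub>M\<^esub> (a \<oplus>\<^bsub>M\<^esub> b) = \<zero>\<^bsub>M\<^esub>" if r: "r \<in> \<eta> [^]\<^bsub>ideals_set R\<^esub> (n + k)" for r
  proof -
    have "r \<in> \<eta> [^]\<^bsub>ideals_set R\<^esub> n" using R.ideal_power_antimono[OF assms, of n k] r by blast
    moreover have "r \<in> \<eta> [^]\<^bsub>ideals_set R\<^esub> k" using R.ideal_power_antimono[OF assms, of k n] r by (auto simp: add.commute)
    moreover have "r \<in> carrier R" using ideal.Icarr[OF R.ideal_power_ideal[OF assms] r] .
    ultimately show ?thesis using n k by (simp add: smult_r_distr)
  qed
  then show "a \<oplus>\<^bsub>M\<^esub> b \<in> prime_torsion R \<eta> M" using n(1) k(1) by (auto simp: prime_torsion_def)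
qed (auto simp: prime_torsion_def)

text \<open>For r in the n-th power of \<eta>, also r^(p^e) lies in that power, so r \<phi>(x) =
  \<phi>(r^(p^e) x) = 0 with the same n.\<close>

lemma (in module) p_linear_prime_torsion:
  assumes "ideal \<eta> R" "p_linear R p M e \<phi>" "p > 0" "x \<in> prime_torsion R \<eta> M"
  shows "\<phi> x \<in> prime_torsion R \<eta> M"
proof -
  obtain n where n: "x \<in> carrier M" "\<And>r. r \<in> \<eta> [^]\<^bsub>ideals_set R\<^esub> (n::nat) \<Longrightarrow> r \<odot>\<^bsub>M\<^esub> x = \<zero>\<^bsub>M\<^esub>"
    using assms(4) by (auto simp: prime_torsion_def)
  interpret I: ideal "\<eta> [^]\<^bsub>ideals_set R\<^esub> n" R by (rule R.ideal_power_ideal[OF assms(1)])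
  have z: "\<phi> \<zero>\<^bsub>M\<^esub> = \<zero>\<^bsub>M\<^esub>"
    using p_linearD(2)[OF assms(2), of "\<zero>\<^bsub>M\<^esub>" "\<zero>\<^bsub>M\<^esub>"] p_linearD(1)[OF assms(2), of "\<zero>\<^bsub>M\<^esub>"]
    by (metis M.add.r_cancel_one' M.r_zero M.zero_closed)
  have "r \<odot>\<^bsub>M\<^esub> \<phi> x = \<zero>\<^bsub>M\<^esub>" if r: "r \<in> \<eta> [^]\<^bsub>ideals_set R\<^esub> n" for r
  proof -
    have rc: "r \<in> carrier R" using r by (rule I.Icarr)
    have "p ^ e > 0" using assms(3) by simp
    then obtain q where "p ^ e = Suc q" by (cases "p ^ e") auto
    then have "r [^]\<^bsub>R\<^esub> (p ^ e) \<in> \<eta> [^]\<^bsub>ideals_set R\<^esub> n" using I.I_l_closed[OF r, of "r [^]\<^bsub>R\<^esub> q"] rc by simp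
    then have "\<phi> (r [^]\<^bsub>R\<^esub> (p ^ e) \<odot>\<^bsub>M\<^esub> x) = \<zero>\<^bsub>M\<^esub>" using n(2) z by simp
    then show ?thesis using p_linearD(3)[OF assms(2) rc n(1)] by simp
  qed
  then show ?thesis using p_linearD(1)[OF assms(2) n(1)] by (auto simp: prime_torsion_def)
qed

text \<open>One prime at which the nil-isomorphism condition is examined. The aim is to translate
  nilpotence of the cokernel, a quotient of a localization of a torsion submodule, into statements
  about elements of M up to multipliers outside \<eta>: the criteria \<open>nilpotentI\<close> and
  \<open>nilpotentD\<close>.\<close>

locale generic_fibre = module R M for R :: "('a, 'z) ring_scheme" (structure) and M :: "('a, 'c) module" (structure) +
  fixes p :: nat and C :: "'c operators" and \<eta> N
  assumes p_pos: "p > 0" and eta: "primeideal \<eta> R" and N: "submodule N R M"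
    and C_linear: "\<And>e \<phi>. \<phi> \<in> C e \<Longrightarrow> p_linear R p M e \<phi>"
    and C_stable: "\<And>e \<phi> x. \<phi> \<in> C e \<Longrightarrow> x \<in> N \<Longrightarrow> \<phi> x \<in> N"
begin

abbreviation T where "T \<equiv> prime_torsion R \<eta> M"
abbreviation S where "S \<equiv> carrier R - \<eta>"

lemma eta_ideal: "ideal \<eta> R" using eta by (rule primeideal.axioms)

lemma T_submodule: "submodule T R M" by (rule prime_torsion_submodule[OF eta_ideal])
lemma NT_submodule: "submodule (N \<inter> T) R M"
proof (rule submoduleI)
  show "\<zero>\<^bsub>M\<^esub> \<in> N \<inter> T"
    using subgroup.one_closed[OF submodule.axioms(1)[OF N]] subgroup.one_closed[OF submodule.axioms(1)[OF T_submodule]] by simp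
qed (use submoduleE[OF N] submoduleE[OF T_submodule] in auto)

lemma T_closed: "x \<in> T \<Longrightarrow> x \<in> carrier M" by (simp add: prime_torsion_def)

lemma T_ops [simp]:
  "\<zero>\<^bsub>M\<^esub> \<in> T" "x \<in> T \<Longrightarrow> y \<in> T \<Longrightarrow> x \<oplus>\<^bsub>M\<^esub> y \<in> T" "r \<in> carrier R \<Longrightarrow> x \<in> T \<Longrightarrow> r \<odot>\<^bsub>M\<^esub> x \<in> T"
  using submoduleE[OF T_submodule] subgroup.one_closed[OF submodule.axioms(1)[OF T_submodule]] by auto

lemma N_ops:
  "\<zero>\<^bsub>M\<^esub> \<in> N" "x \<in> N \<Longrightarrow> y \<in> N \<Longrightarrow> x \<oplus>\<^bsub>M\<^esub> y \<in> N" "r \<in> carrier R \<Longrightarrow> x \<in> N \<Longrightarrow> r \<odot>\<^bsub>M\<^esub> x \<in> N"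
  using submoduleE[OF N] subgroup.one_closed[OF submodule.axioms(1)[OF N]] by auto

lemma S_mult_set: "S \<subseteq> carrier R" "\<one> \<in> S" "\<And>s t. s \<in> S \<Longrightarrow> t \<in> S \<Longrightarrow> s \<otimes> t \<in> S"
  using primeideal.one_notin[OF eta] primeideal.notin_mult[OF eta] by auto

sublocale HM: localized_module R "M\<lparr>carrier := T\<rparr>" S
  using submodule.submodule_is_module[OF T_submodule module_axioms] S_mult_set
  by (intro localized_module.intro localized_module_axioms.intro)

sublocale HN: localized_module R "M\<lparr>carrier := N \<inter> T\<rparr>" S
  using submodule.submodule_is_module[OF NT_submodule module_axioms] S_mult_set
  by (intro localized_module.intro localized_module_axioms.intro)

declare HM.S_closed [simp del] HN.S_closed [simp del]

abbreviation fr where "fr \<equiv> fraction R S (M\<lparr>carrier := T\<rparr>)"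
abbreviation L where "L \<equiv> localization R S (M\<lparr>carrier := T\<rparr>)"
abbreviation LN where "LN \<equiv> localization R S (M\<lparr>carrier := N \<inter> T\<rparr>)"

lemma fr_eq_iff: "x \<in> T \<Longrightarrow> s \<in> S \<Longrightarrow> y \<in> T \<Longrightarrow> t \<in> S \<Longrightarrow>
    fr x s = fr y t \<longleftrightarrow> (\<exists>u\<in>S. u \<odot>\<^bsub>M\<^esub> (t \<odot>\<^bsub>M\<^esub> x) = u \<odot>\<^bsub>M\<^esub> (s \<odot>\<^bsub>M\<^esub> y))"
  using HM.frac_eq_iff[of x s y t] by simp

lemma fr_cancel: "x \<in> T \<Longrightarrow> s \<in> S \<Longrightarrow> u \<in> S \<Longrightarrow> fr (u \<odot>\<^bsub>M\<^esub> x) (u \<otimes> s) = fr x s"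
  using HM.frac_cancel[of x s u] by simp

lemma fr_add: "x \<in> T \<Longrightarrow> s \<in> S \<Longrightarrow> y \<in> T \<Longrightarrow> fr x s \<oplus>\<^bsub>L\<^esub> fr y s = fr (x \<oplus>\<^bsub>M\<^esub> y) s"
  using HM.loc_add_same[of x s y] by simp

lemma fr_closed [simp]: "x \<in> T \<Longrightarrow> s \<in> S \<Longrightarrow> fr x s \<in> carrier L"
  using HM.frac_closed[of x s] by simp

lemma fr_zero: "s \<in> S \<Longrightarrow> fr \<zero>\<^bsub>M\<^esub> s = \<zero>\<^bsub>L\<^esub>"
  using HM.frac_zero[of s] HM.loc_zero by simp

lemma fr_eq_zero_iff: "x \<in> T \<Longrightarrow> s \<in> S \<Longrightarrow> fr x s = \<zero>\<^bsub>L\<^esub> \<longleftrightarrow> (\<exists>u\<in>S. u \<odot>\<^bsub>M\<^esub> x = \<zero>\<^bsub>M\<^esub>)"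
  using HM.frac_eq_zero_iff[of x s] HM.loc_zero by simp

lemma L_carrier: "carrier L = {fr x s | x s. x \<in> T \<and> s \<in> S}"
  using HM.loc_carrier by simp

lemma common_denominator:
  assumes x: "x \<in> T" "y \<in> T" and s: "s \<in> S" "t \<in> S"
  shows "fr x s = fr (t \<odot>\<^bsub>M\<^esub> x) (s \<otimes> t)" "fr y t = fr (s \<odot>\<^bsub>M\<^esub> y) (s \<otimes> t)"
  using fr_cancel[OF x(1) s(1,2)] fr_cancel[OF x(2) s(2,1)] R.m_comm[of s t] s by simp_all

lemma L_abelian_group: "abelian_group L" by (rule HM.loc_abelian_group)

definition I where "I = loc_inclusion R S (M\<lparr>carrier := T\<rparr>) ` carrier LN"

lemma loc_inclusion_frac:
  assumes x: "x \<in> N \<inter> T" and s: "s \<in> S"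
  shows "loc_inclusion R S (M\<lparr>carrier := T\<rparr>) (HN.frac x s) = fr x s"
  unfolding loc_inclusion_def
proof (rule HN.UN_frac)
  fix y t u
  assume h: "y \<in> carrier (M\<lparr>carrier := N \<inter> T\<rparr>)" "t \<in> S" "u \<in> S"
    "u \<odot>\<^bsub>M\<lparr>carrier := N \<inter> T\<rparr>\<^esub> (t \<odot>\<^bsub>M\<lparr>carrier := N \<inter> T\<rparr>\<^esub> x) = u \<odot>\<^bsub>M\<lparr>carrier := N \<inter> T\<rparr>\<^esub> (s \<odot>\<^bsub>M\<lparr>carrier := N \<inter> T\<rparr>\<^esub> y)"
  have "\<exists>u\<in>S. u \<odot>\<^bsub>M\<^esub> (s \<odot>\<^bsub>M\<^esub> y) = u \<odot>\<^bsub>M\<^esub> (t \<odot>\<^bsub>M\<^esub> x)" using h(3,4) by (intro bexI[of _ u]) simp_all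
  then show "fr y t = fr x s" using h(1,2) x s fr_eq_iff[of y t x s] by simp
qed (use x s in auto)

lemma LN_carrier: "carrier LN = {HN.frac x s | x s. x \<in> N \<inter> T \<and> s \<in> S}"
  using HN.loc_carrier by simp

lemma I_eq: "I = {fr x s | x s. x \<in> N \<inter> T \<and> s \<in> S}"
proof (intro Set.set_eqI iffI)
  fix U assume "U \<in> I"
  then obtain V where V: "U = loc_inclusion R S (M\<lparr>carrier := T\<rparr>) V" "V \<in> carrier LN" unfolding I_def by (rule imageE)
  then obtain x s where "x \<in> N \<inter> T" "s \<in> S" "V = HN.frac x s" unfolding LN_carrier by blast
  then show "U \<in> {fr x s | x s. x \<in> N \<inter> T \<and> s \<in> S}" using V(1) loc_inclusion_frac by blast
next
  fix U assume "U \<in> {fr x s | x s. x \<in> N \<inter> T \<and> s \<in> S}"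
  then obtain x s where x: "x \<in> N \<inter> T" "s \<in> S" "U = fr x s" by blast
  then have "HN.frac x s \<in> carrier LN" unfolding LN_carrier by blast
  then show "U \<in> I" unfolding I_def x(3) loc_inclusion_frac[OF x(1,2), symmetric] by (rule imageI)
qed

text \<open>The multiplier u is forced by clearing denominators: a fraction x/s can equal y/t with y
  in N although x itself is not in N.\<close>

lemma fr_mem_I: 
  assumes "x \<in> T" "s \<in> S" shows "fr x s \<in> I \<longleftrightarrow> (\<exists>u\<in>S. u \<odot>\<^bsub>M\<^esub> x \<in> N)"
proof
  assume "fr x s \<in> I"
  then obtain y t where y: "y \<in> N \<inter> T" "t \<in> S" "fr x s = fr y t" unfolding I_eq by blast
  then obtain u where u: "u \<in> S" "u \<odot>\<^bsub>M\<^esub> (t \<odot>\<^bsub>M\<^esub> x) = u \<odot>\<^bsub>M\<^esub> (s \<odot>\<^bsub>M\<^esub> y)"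
    using fr_eq_iff assms by auto
  have "(u \<otimes> t) \<odot>\<^bsub>M\<^esub> x = u \<odot>\<^bsub>M\<^esub> (t \<odot>\<^bsub>M\<^esub> x)" using u(1) y(2) assms T_closed by (simp add: smult_assoc1)
  also have "\<dots> \<in> N" unfolding u(2) using y(1) assms(2) u(1) by (intro N_ops) auto
  finally show "\<exists>u\<in>S. u \<odot>\<^bsub>M\<^esub> x \<in> N" using S_mult_set(3)[OF u(1) y(2)] by blast
next
  assume "\<exists>u\<in>S. u \<odot>\<^bsub>M\<^esub> x \<in> N"
  then obtain u where u: "u \<in> S" "u \<odot>\<^bsub>M\<^esub> x \<in> N" by blast
  have "u \<odot>\<^bsub>M\<^esub> x \<in> N \<inter> T" using u assms by simp
  moreover have "fr x s = fr (u \<odot>\<^bsub>M\<^esub> x) (u \<otimes> s)" using fr_cancel[OF assms u(1)] by simp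
  moreover have "u \<otimes> s \<in> S" using u assms S_mult_set(3) by simp
  ultimately show "fr x s \<in> I" unfolding I_eq by blast
qed

lemma subgroup_fractions:
  assumes V: "submodule V R M" "V \<subseteq> T"
  shows "subgroup {fr x s | x s. x \<in> V \<and> s \<in> S} (add_monoid L)"
proof -
  interpret L: abelian_group L by (rule L_abelian_group)
  have V': "\<And>x y. x \<in> V \<Longrightarrow> y \<in> V \<Longrightarrow> x \<oplus>\<^bsub>M\<^esub> y \<in> V" "\<And>r x. r \<in> carrier R \<Longrightarrow> x \<in> V \<Longrightarrow> r \<odot>\<^bsub>M\<^esub> x \<in> V"
    "\<And>x. x \<in> V \<Longrightarrow> \<ominus>\<^bsub>M\<^esub> x \<in> V" "\<zero>\<^bsub>M\<^esub> \<in> V"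
    using submoduleE[OF V(1)] subgroup.one_closed[OF submodule.axioms(1)[OF V(1)]] by auto
  show ?thesis
  proof (rule L.add.subgroupI)
    show "{fr x s | x s. x \<in> V \<and> s \<in> S} \<subseteq> carrier L" using V(2) fr_closed by auto
    show "{fr x s | x s. x \<in> V \<and> s \<in> S} \<noteq> {}" using V'(4) S_mult_set(2) by blast
    fix U assume "U \<in> {fr x s | x s. x \<in> V \<and> s \<in> S}"
    then obtain x s where x: "x \<in> V" "s \<in> S" "U = fr x s" by blast
    have xT: "x \<in> T" "\<ominus>\<^bsub>M\<^esub> x \<in> T" "x \<in> carrier M" using x V'(3) V(2) T_closed by auto
    have "fr (\<ominus>\<^bsub>M\<^esub> x) s \<oplus>\<^bsub>L\<^esub> U = \<zero>\<^bsub>L\<^esub>" using x xT by (simp add: fr_add M.l_neg fr_zero)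
    then have "\<ominus>\<^bsub>L\<^esub> U = fr (\<ominus>\<^bsub>M\<^esub> x) s" using x xT by (intro L.minus_equality) auto
    then show "\<ominus>\<^bsub>L\<^esub> U \<in> {fr x s | x s. x \<in> V \<and> s \<in> S}" using V'(3)[OF x(1)] x(2) by blast
  next
    fix U W assume U: "U \<in> {fr x s | x s. x \<in> V \<and> s \<in> S}" and W: "W \<in> {fr x s | x s. x \<in> V \<and> s \<in> S}"
    obtain x s where x: "x \<in> V" "s \<in> S" "U = fr x s" using U by blast
    obtain y t where y: "y \<in> V" "t \<in> S" "W = fr y t" using W by blast
    have xy: "x \<in> T" "y \<in> T" using x y V(2) by auto
    have "U \<oplus>\<^bsub>L\<^esub> W = fr (t \<odot>\<^bsub>M\<^esub> x \<oplus>\<^bsub>M\<^esub> s \<odot>\<^bsub>M\<^esub> y) (s \<otimes> t)"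
      unfolding x(3) y(3) common_denominator(1)[OF xy x(2) y(2)] common_denominator(2)[OF xy x(2) y(2)]
      using xy x(2) y(2) S_mult_set(3) by (intro fr_add) auto
    moreover have "t \<odot>\<^bsub>M\<^esub> x \<oplus>\<^bsub>M\<^esub> s \<odot>\<^bsub>M\<^esub> y \<in> V" using x y V'(1,2) by simp
    ultimately show "U \<oplus>\<^bsub>L\<^esub> W \<in> {fr x s | x s. x \<in> V \<and> s \<in> S}" using S_mult_set(3)[OF x(2) y(2)] by blast
  qed
qed

lemma I_subgroup: "subgroup I (add_monoid L)"
  unfolding I_eq by (rule subgroup_fractions[OF NT_submodule]) simp

sublocale Q: quot_group L I
  using L_abelian_group I_subgroup by (intro quot_group.intro quot_group_axioms.intro)

abbreviation cls where "cls x s \<equiv> I +>\<^bsub>L\<^esub> fr x s"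

lemma Q_carrier: "carrier Q.Q = {cls x s | x s. x \<in> T \<and> s \<in> S}"
  unfolding Q.quot_carrier L_carrier by blast

lemma cls_eq_zero: "x \<in> T \<Longrightarrow> s \<in> S \<Longrightarrow> cls x s = I \<longleftrightarrow> (\<exists>u\<in>S. u \<odot>\<^bsub>M\<^esub> x \<in> N)"
  by (simp add: Q.coset_eq_N_iff fr_mem_I)

definition loc_op where
  "loc_op e \<phi> U = (\<Union>(m, s)\<in>U. fr (\<phi> ((s [^] (p ^ e - 1)) \<odot>\<^bsub>M\<^esub> m)) s)"

lemma loc_op_fr:
  assumes \<phi>: "\<phi> \<in> C e" and x: "x \<in> T" "s \<in> S"
  shows "loc_op e \<phi> (fr x s) = fr (\<phi> ((s [^] (p ^ e - 1)) \<odot>\<^bsub>M\<^esub> x)) s"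
  unfolding loc_op_def
proof (rule HM.UN_frac)
  have pl: "p_linear R p M e \<phi>" using C_linear[OF \<phi>] .
  have phiT: "\<phi> z \<in> T" if "z \<in> T" for z using p_linear_prime_torsion[OF eta_ideal pl p_pos that] .
  obtain q where q: "p ^ e = Suc q" using p_pos by (cases "p ^ e") auto
  fix y t u
  assume h: "y \<in> carrier (M\<lparr>carrier := T\<rparr>)" "t \<in> S" "u \<in> S"
    "u \<odot>\<^bsub>M\<lparr>carrier := T\<rparr>\<^esub> (t \<odot>\<^bsub>M\<lparr>carrier := T\<rparr>\<^esub> x) = u \<odot>\<^bsub>M\<lparr>carrier := T\<rparr>\<^esub> (s \<odot>\<^bsub>M\<lparr>carrier := T\<rparr>\<^esub> y)"
  have yT: "y \<in> T" and eq: "u \<odot>\<^bsub>M\<^esub> (t \<odot>\<^bsub>M\<^esub> x) = u \<odot>\<^bsub>M\<^esub> (s \<odot>\<^bsub>M\<^esub> y)" using h by simp_all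
  have c: "x \<in> carrier M" "y \<in> carrier M" "s \<in> carrier R" "t \<in> carrier R" "u \<in> carrier R" "s [^] q \<in> carrier R" "t [^] q \<in> carrier R" "u [^] q \<in> carrier R"
    using x h(2,3) yT T_closed by auto
  \<comment> \<open>Here q = p^e - 1. Moving the scalars u and a inside \<phi> raises them to the
    power p^e; one factor of each forms the cross product u a z. What remains is symmetric in a and
    b, so equality of the cross products yields equality of the two images.\<close>
  have 1: "u \<odot>\<^bsub>M\<^esub> (a \<odot>\<^bsub>M\<^esub> \<phi> (b [^] q \<odot>\<^bsub>M\<^esub> z)) = \<phi> ((u [^] q \<otimes> a [^] q \<otimes> b [^] q) \<odot>\<^bsub>M\<^esub> (u \<odot>\<^bsub>M\<^esub> (a \<odot>\<^bsub>M\<^esub> z)))"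
    if "a \<in> carrier R" "b \<in> carrier R" "z \<in> carrier M" for a b z
  proof -
    have ab: "a [^] q \<in> carrier R" "b [^] q \<in> carrier R" using that by auto
    have "u \<odot>\<^bsub>M\<^esub> (a \<odot>\<^bsub>M\<^esub> \<phi> (b [^] q \<odot>\<^bsub>M\<^esub> z)) = (u \<otimes> a) \<odot>\<^bsub>M\<^esub> \<phi> (b [^] q \<odot>\<^bsub>M\<^esub> z)"
      using that c p_linearD(1)[OF pl] by (simp add: smult_assoc1)
    also have "\<dots> = \<phi> ((u \<otimes> a) [^] (p ^ e) \<odot>\<^bsub>M\<^esub> (b [^] q \<odot>\<^bsub>M\<^esub> z))"
      using that c by (intro p_linearD(3)[OF pl, symmetric]) auto
    also have "(u \<otimes> a) [^] (p ^ e) \<odot>\<^bsub>M\<^esub> (b [^] q \<odot>\<^bsub>M\<^esub> z) = (u [^] q \<otimes> a [^] q \<otimes> b [^] q) \<odot>\<^bsub>M\<^esub> (u \<odot>\<^bsub>M\<^esub> (a \<odot>\<^bsub>M\<^esub> z))"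
    proof -
      have "(u \<otimes> a) [^] (p ^ e) \<otimes> b [^] q = (u [^] q \<otimes> a [^] q \<otimes> b [^] q) \<otimes> (u \<otimes> a)"
        unfolding q using that(1) c(5,8) ab by (simp add: R.nat_pow_distrib R.m_ac)
      moreover have "(u \<otimes> a) [^] (p ^ e) \<in> carrier R" using that(1) c(5) by simp
      ultimately show ?thesis
        using that(1,3) c(5,8) ab by (simp flip: smult_assoc1)
    qed
    finally show ?thesis .
  qed
  have "u \<odot>\<^bsub>M\<^esub> (s \<odot>\<^bsub>M\<^esub> \<phi> (t [^] q \<odot>\<^bsub>M\<^esub> y)) = u \<odot>\<^bsub>M\<^esub> (t \<odot>\<^bsub>M\<^esub> \<phi> (s [^] q \<odot>\<^bsub>M\<^esub> x))"
    unfolding 1[OF c(3,4,2)] 1[OF c(4,3,1)] eq using c R.m_comm[of "s [^] q" "t [^] q"] by (simp add: R.m_assoc)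
  then have "\<exists>u\<in>S. u \<odot>\<^bsub>M\<^esub> (s \<odot>\<^bsub>M\<^esub> \<phi> (t [^] q \<odot>\<^bsub>M\<^esub> y)) = u \<odot>\<^bsub>M\<^esub> (t \<odot>\<^bsub>M\<^esub> \<phi> (s [^] q \<odot>\<^bsub>M\<^esub> x))" using h(3) by blast
  then show "fr (\<phi> (t [^] (p ^ e - 1) \<odot>\<^bsub>M\<^esub> y)) t = fr (\<phi> (s [^] (p ^ e - 1) \<odot>\<^bsub>M\<^esub> x)) s"
    unfolding q using fr_eq_iff[OF phiT h(2) phiT x(2)] yT x(1) c by simp
qed (use x in auto)

lemma phi_T: "\<phi> \<in> C e \<Longrightarrow> x \<in> T \<Longrightarrow> \<phi> x \<in> T"
  using p_linear_prime_torsion[OF eta_ideal C_linear p_pos] .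

lemma quot_op_cls:
  assumes \<phi>: "\<phi> \<in> C e" and x: "x \<in> T" "s \<in> S"
  shows "quot_map L I (loc_op e \<phi>) (cls x s) = cls (\<phi> ((s [^] (p ^ e - 1)) \<odot>\<^bsub>M\<^esub> x)) s"
proof -
  define n where "n = p ^ e - 1"
  have opc: "\<phi> (t [^] n \<odot>\<^bsub>M\<^esub> z) \<in> T" if "z \<in> T" "t \<in> S" for z t
    using that by (intro phi_T[OF \<phi>]) auto
  have op: "loc_op e \<phi> (fr z t) = fr (\<phi> (t [^] n \<odot>\<^bsub>M\<^esub> z)) t" if "z \<in> T" "t \<in> S" for z t
    using loc_op_fr[OF \<phi> that] by (simp add: n_def)
  have "quot_map L I (loc_op e \<phi>) (I +>\<^bsub>L\<^esub> fr x s) = I +>\<^bsub>L\<^esub> loc_op e \<phi> (fr x s)"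
  proof (rule Q.quot_map_coset)
    show "loc_op e \<phi> \<in> carrier L \<rightarrow> carrier L"
    proof
      fix U assume "U \<in> carrier L"
      then obtain z t where z: "z \<in> T" "t \<in> S" "U = fr z t" unfolding L_carrier by blast
      then show "loc_op e \<phi> U \<in> carrier L" using op opc by simp
    qed
    fix U W assume U: "U \<in> carrier L" and W: "W \<in> carrier L"
    obtain y t where y: "y \<in> T" "t \<in> S" "U = fr y t" using U unfolding L_carrier by blast
    obtain z r where z: "z \<in> T" "r \<in> S" "W = fr z r" using W unfolding L_carrier by blast
    define y' z' d where "y' = r \<odot>\<^bsub>M\<^esub> y" and "z' = t \<odot>\<^bsub>M\<^esub> z" and "d = t \<otimes> r"
    have y': "y' \<in> T" "z' \<in> T" "d \<in> S" "U = fr y' d" "W = fr z' d"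
      using common_denominator[OF y(1) z(1) y(2) z(2)] y z S_mult_set(3) by (auto simp: y'_def z'_def d_def)
    have c: "y' \<in> carrier M" "z' \<in> carrier M" "d [^] n \<in> carrier R" using y' T_closed by auto
    have "\<phi> (d [^] n \<odot>\<^bsub>M\<^esub> (y' \<oplus>\<^bsub>M\<^esub> z')) = \<phi> (d [^] n \<odot>\<^bsub>M\<^esub> y') \<oplus>\<^bsub>M\<^esub> \<phi> (d [^] n \<odot>\<^bsub>M\<^esub> z')"
      using c p_linearD(2)[OF C_linear[OF \<phi>]] by (simp add: smult_r_distr)
    then show "loc_op e \<phi> (U \<oplus>\<^bsub>L\<^esub> W) = loc_op e \<phi> U \<oplus>\<^bsub>L\<^esub> loc_op e \<phi> W"
      unfolding y'(4,5) using y'(1-3) opc by (simp add: fr_add op)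
  next
    fix U assume "U \<in> I"
    then obtain z t where z: "z \<in> N \<inter> T" "t \<in> S" "U = fr z t" unfolding I_eq by blast
    have "t [^] n \<odot>\<^bsub>M\<^esub> z \<in> N" using z by (intro N_ops) auto
    then have "\<phi> (t [^] n \<odot>\<^bsub>M\<^esub> z) \<in> N \<inter> T" using C_stable[OF \<phi>] opc z by simp
    then show "loc_op e \<phi> U \<in> I" unfolding z(3) using z op[of z t] unfolding I_eq by auto
  qed (use x in simp)
  then show ?thesis using op x by (simp add: n_def)
qed

abbreviation QC where "QC \<equiv> quot_operators L I (loc_operators R p S (M\<lparr>carrier := T\<rparr>) C)"

lemma QC_eq: "QC e = {quot_map L I (loc_op e \<phi>) | \<phi>. \<phi> \<in> C e}"
  unfolding quot_operators_def loc_operators_def loc_op_def[abs_def] by auto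

text \<open>The localized inclusion is injective, so its kernel is zero and nilpotent with exponent
  0. Only the cokernel carries a condition.\<close>

lemma nil_isomorphism_iff:
  "nil_isomorphism LN (loc_operators R p S (M\<lparr>carrier := N \<inter> T\<rparr>) C) L (loc_operators R p S (M\<lparr>carrier := T\<rparr>) C)
     (loc_inclusion R S (M\<lparr>carrier := T\<rparr>)) \<longleftrightarrow> nilpotent_module Q.Q QC"
proof -
  have "a_kernel LN L (loc_inclusion R S (M\<lparr>carrier := T\<rparr>)) = {\<zero>\<^bsub>LN\<^esub>}"
  proof (intro Set.set_eqI iffI)
    fix U assume "U \<in> a_kernel LN L (loc_inclusion R S (M\<lparr>carrier := T\<rparr>))"
    then have U: "U \<in> carrier LN" "loc_inclusion R S (M\<lparr>carrier := T\<rparr>) U = \<zero>\<^bsub>L\<^esub>"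
      unfolding a_kernel_def' by blast+
    then obtain x s where x: "x \<in> N \<inter> T" "s \<in> S" "U = HN.frac x s" unfolding LN_carrier by blast
    then have "fr x s = \<zero>\<^bsub>L\<^esub>" using U(2) loc_inclusion_frac by simp
    then have "\<exists>u\<in>S. u \<odot>\<^bsub>M\<^esub> x = \<zero>\<^bsub>M\<^esub>" using fr_eq_zero_iff[of x s] x by simp
    then show "U \<in> {\<zero>\<^bsub>LN\<^esub>}" using HN.frac_eq_zero_iff[of x s] HN.loc_zero x by simp
  next
    fix U assume "U \<in> {\<zero>\<^bsub>LN\<^esub>}"
    then have U: "U = HN.frac \<zero>\<^bsub>M\<^esub> \<one>" using HN.loc_zero by simp
    have z: "\<zero>\<^bsub>M\<^esub> \<in> N \<inter> T" using N_ops(1) by simp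
    then have "U \<in> carrier LN" unfolding U LN_carrier using S_mult_set(2) by blast
    moreover have "loc_inclusion R S (M\<lparr>carrier := T\<rparr>) U = \<zero>\<^bsub>L\<^esub>"
      unfolding U loc_inclusion_frac[OF z S_mult_set(2)] by (rule fr_zero[OF S_mult_set(2)])
    ultimately show "U \<in> a_kernel LN L (loc_inclusion R S (M\<lparr>carrier := T\<rparr>))" unfolding a_kernel_def' by blast
  qed
  then have "nilpotent_module (LN\<lparr>carrier := a_kernel LN L (loc_inclusion R S (M\<lparr>carrier := T\<rparr>))\<rparr>)
      (loc_operators R p S (M\<lparr>carrier := N \<inter> T\<rparr>) C)"
    unfolding nilpotent_module_def by (intro exI[of _ 0]) simp
  then show ?thesis unfolding nil_isomorphism_def I_def[symmetric] by simp
qed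

text \<open>A descending criterion: operators of positive degree push the submodules
  \<open>V k\<close> one place further, hence the k-th application of the positive part of the
  algebra lands in the classes of fractions with numerators in \<open>V k\<close>; at index a these
  classes vanish.\<close>

lemma nilpotentI:
  assumes V: "\<And>k. submodule (V k) R M" "\<And>k. V k \<subseteq> T" "V 0 = T"
    and step: "\<And>k e \<phi> x. 1 \<le> e \<Longrightarrow> \<phi> \<in> C e \<Longrightarrow> x \<in> V k \<Longrightarrow> \<phi> x \<in> V (Suc k)"
    and fin: "\<And>x. x \<in> V a \<Longrightarrow> \<exists>u\<in>S. u \<odot>\<^bsub>M\<^esub> x \<in> N"
  shows "nilpotent_module Q.Q QC"
proof -
  interpret QG: abelian_group Q.Q by (rule Q.quot_abelian_group)
  define D where "D k = {cls x s | x s. x \<in> V k \<and> s \<in> S}" for k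
  have Dsub: "subgroup (D k) (add_monoid Q.Q)" for k
  proof -
    have sg: "subgroup {fr x s | x s. x \<in> V k \<and> s \<in> S} (add_monoid L)" by (rule subgroup_fractions[OF V(1,2)])
    have Deq: "D k = (\<lambda>U. I +>\<^bsub>L\<^esub> U) ` {fr x s | x s. x \<in> V k \<and> s \<in> S}" unfolding D_def by blast
    have sc: "{fr x s | x s. x \<in> V k \<and> s \<in> S} \<subseteq> carrier L" using subgroup.subset[OF sg] by simp
    show ?thesis
    proof (rule QG.add.subgroupI)
      show "D k \<subseteq> carrier Q.Q" unfolding Deq using sc Q.coset_closed by blast
      show "D k \<noteq> {}" unfolding Deq using subgroup.one_closed[OF sg] by blast
      fix U assume "U \<in> D k"
      then obtain u where u: "U = I +>\<^bsub>L\<^esub> u" "u \<in> {fr x s | x s. x \<in> V k \<and> s \<in> S}" unfolding Deq by (rule imageE)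
      have uc: "u \<in> carrier L" using u sc by blast
      have "(I +>\<^bsub>L\<^esub> \<ominus>\<^bsub>L\<^esub> u) \<oplus>\<^bsub>Q.Q\<^esub> U = \<zero>\<^bsub>Q.Q\<^esub>" unfolding u(1)
        using uc by (simp add: Q.quot_add Q.l_neg Q.quot_zero Q.coset_zero)
      then have "\<ominus>\<^bsub>Q.Q\<^esub> U = I +>\<^bsub>L\<^esub> \<ominus>\<^bsub>L\<^esub> u" using uc u(1) by (intro QG.minus_equality) auto
      moreover have "\<ominus>\<^bsub>L\<^esub> u \<in> {fr x s | x s. x \<in> V k \<and> s \<in> S}"
        using subgroup.m_inv_closed[OF sg u(2)] by (simp add: a_inv_def)
      ultimately show "\<ominus>\<^bsub>Q.Q\<^esub> U \<in> D k" unfolding Deq by blast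
      fix W assume "W \<in> D k"
      then obtain w where w: "W = I +>\<^bsub>L\<^esub> w" "w \<in> {fr x s | x s. x \<in> V k \<and> s \<in> S}" unfolding Deq by (rule imageE)
      have wc: "w \<in> carrier L" using w sc by blast
      have "U \<oplus>\<^bsub>Q.Q\<^esub> W = I +>\<^bsub>L\<^esub> (u \<oplus>\<^bsub>L\<^esub> w)" unfolding u(1) w(1) by (rule Q.quot_add[OF uc wc])
      moreover have "u \<oplus>\<^bsub>L\<^esub> w \<in> {fr x s | x s. x \<in> V k \<and> s \<in> S}"
        using subgroup.m_closed[OF sg u(2) w(2)] by simp
      ultimately show "U \<oplus>\<^bsub>Q.Q\<^esub> W \<in> D k" unfolding Deq by blast
    qed
  qed
  define P where "P k = (positive_part_mult Q.Q QC ^^ k) (carrier Q.Q)" for k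
  have PD: "P k \<subseteq> D k" for k
  proof (induction k)
    case 0
    then show ?case unfolding P_def D_def V(3) Q_carrier by simp
  next
    case (Suc k)
    have "P (Suc k) = generate (add_monoid Q.Q) {\<phi> x | e \<phi> x. 1 \<le> e \<and> \<phi> \<in> QC e \<and> x \<in> P k}"
      unfolding P_def by (simp add: positive_part_mult_def)
    also have "\<dots> \<subseteq> D (Suc k)"
    proof (rule QG.add.generate_subgroup_incl[OF _ Dsub], rule subsetI)
      fix Y assume "Y \<in> {\<phi> x | e \<phi> x. 1 \<le> e \<and> \<phi> \<in> QC e \<and> x \<in> P k}"
      then obtain e \<psi> U where Y: "Y = \<psi> U" "1 \<le> e" "\<psi> \<in> QC e" "U \<in> P k" by blast
      obtain \<phi> where \<phi>: "\<psi> = quot_map L I (loc_op e \<phi>)" "\<phi> \<in> C e" using Y(3) unfolding QC_eq by blast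
      obtain x s where x: "x \<in> V k" "s \<in> S" "U = cls x s" using Y(4) Suc unfolding D_def by blast
      have xT: "x \<in> T" using x V(2) by blast
      have "Y = cls (\<phi> ((s [^] (p ^ e - 1)) \<odot>\<^bsub>M\<^esub> x)) s"
        unfolding Y(1) \<phi>(1) x(3) by (rule quot_op_cls[OF \<phi>(2) xT x(2)])
      moreover have "\<phi> ((s [^] (p ^ e - 1)) \<odot>\<^bsub>M\<^esub> x) \<in> V (Suc k)"
        using submoduleE(4)[OF V(1)] x by (intro step[OF Y(2) \<phi>(2)]) auto
      ultimately show "Y \<in> D (Suc k)" unfolding D_def using x(2) by blast
    qed
    finally show ?case .
  qed
  have "P a = {\<zero>\<^bsub>Q.Q\<^esub>}"
  proof
    show "P a \<subseteq> {\<zero>\<^bsub>Q.Q\<^esub>}"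
    proof
      fix U assume "U \<in> P a"
      then obtain x s where x: "x \<in> V a" "s \<in> S" "U = cls x s" using PD unfolding D_def by blast
      have "x \<in> T" using x V(2) by blast
      then show "U \<in> {\<zero>\<^bsub>Q.Q\<^esub>}" using cls_eq_zero[of x s] fin[OF x(1)] x by (simp add: Q.quot_zero)
    qed
    have "\<zero>\<^bsub>Q.Q\<^esub> \<in> P a"
    proof (cases a)
      case 0
      then show ?thesis using QG.zero_closed by (simp add: P_def)
    next
      case (Suc b)
      have "\<one>\<^bsub>add_monoid Q.Q\<^esub> \<in> P a" unfolding P_def Suc by (simp add: positive_part_mult_def generate.one del: monoid.simps)
      then show ?thesis by simp
    qed
    then show "{\<zero>\<^bsub>Q.Q\<^esub>} \<subseteq> P a" by simp
  qed
  then show ?thesis unfolding nilpotent_module_def P_def by blast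
qed

text \<open>Iterating one operator of positive degree a times is a special case of applying the
  positive part a times. The exponent a is uniform in x; the multiplier u depends on x.\<close>

lemma nilpotentD:
  assumes nil: "nilpotent_module Q.Q QC" and \<phi>: "\<phi> \<in> C e" "1 \<le> e"
  shows "\<exists>a. \<forall>x\<in>T. \<exists>u\<in>S. u \<odot>\<^bsub>M\<^esub> (\<phi> ^^ a) x \<in> N"
proof -
  define P where "P k = (positive_part_mult Q.Q QC ^^ k) (carrier Q.Q)" for k
  obtain a where a: "P a = {\<zero>\<^bsub>Q.Q\<^esub>}" using nil unfolding nilpotent_module_def P_def by blast
  have 1: "(\<phi> ^^ k) x \<in> T \<and> cls ((\<phi> ^^ k) x) \<one> \<in> P k" if x: "x \<in> T" for x k
  proof (induction k)
    case 0
    then show ?case using x S_mult_set(2) by (simp add: P_def)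
  next
    case (Suc k)
    define y where "y = (\<phi> ^^ k) x"
    have y: "y \<in> T" "cls y \<one> \<in> P k" using Suc by (auto simp: y_def)
    have "quot_map L I (loc_op e \<phi>) (cls y \<one>) = cls (\<phi> y) \<one>"
      using quot_op_cls[OF \<phi>(1) y(1) S_mult_set(2)] T_closed[OF y(1)] by simp
    moreover have "quot_map L I (loc_op e \<phi>) \<in> QC e" using \<phi>(1) unfolding QC_eq by blast
    ultimately have "cls (\<phi> y) \<one> \<in> {\<phi> x | e \<phi> x. 1 \<le> e \<and> \<phi> \<in> QC e \<and> x \<in> P k}"
      using y(2) \<phi>(2) by (metis (mono_tags, lifting) mem_Collect_eq)
    then have "cls (\<phi> y) \<one> \<in> P (Suc k)"
      unfolding P_def by (simp add: positive_part_mult_def generate.incl)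
    then show ?case using phi_T[OF \<phi>(1) y(1)] by (simp add: y_def)
  qed
  show ?thesis
  proof (intro exI ballI)
    fix x assume x: "x \<in> T"
    then have "(\<phi> ^^ a) x \<in> T" "cls ((\<phi> ^^ a) x) \<one> = I" using 1[OF x, of a] a by (auto simp: Q.quot_zero)
    then show "\<exists>u\<in>S. u \<odot>\<^bsub>M\<^esub> (\<phi> ^^ a) x \<in> N" using cls_eq_zero S_mult_set(2) by blast
  qed
qed

end

section \<open>Cartier modules and F-regularity\<close>

locale cartier = module R M for R :: "('a, 'z) ring_scheme" (structure) and M :: "('a, 'c) module" (structure) +
  fixes p :: nat and \<kappa> :: "'c \<Rightarrow> 'c"
  assumes p_prime: "Factorial_Ring.prime p" and \<kappa>: "p_linear R p M 1 \<kappa>"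
begin

lemma p_pos: "p > 0" using p_prime prime_gt_0_nat by blast

lemma \<kappa>_pow: "p_linear R p M e (\<kappa> ^^ e)"
proof (induction e)
  case 0
  show ?case by (auto simp: p_linear_def)
next
  case (Suc e)
  note IH = p_linearD[OF Suc] and k = p_linearD[OF \<kappa>]
  have "(\<kappa> ^^ Suc e) (r [^] (p ^ Suc e) \<odot>\<^bsub>M\<^esub> x) = r \<odot>\<^bsub>M\<^esub> (\<kappa> ^^ Suc e) x" if "r \<in> carrier R" "x \<in> carrier M" for r x
  proof -
    have "r [^] (p ^ Suc e) = (r [^] p) [^] (p ^ e)" using that(1) by (simp add: R.nat_pow_pow)
    then show ?thesis using IH(3)[of "r [^] p" x] IH(1)[of x] k(3)[of r "(\<kappa> ^^ e) x"] that by simp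
  qed
  then show ?case using IH(1,2) k(1,2) by (auto simp: p_linear_def)
qed

lemmas kp = p_linearD[OF \<kappa>_pow]

lemma p_linear_smult:
  assumes "c \<in> carrier R" shows "p_linear R p M e (\<lambda>m. (\<kappa> ^^ e) (c \<odot>\<^bsub>M\<^esub> m))"
proof -
  have "c \<odot>\<^bsub>M\<^esub> (r [^] (p ^ e) \<odot>\<^bsub>M\<^esub> x) = r [^] (p ^ e) \<odot>\<^bsub>M\<^esub> (c \<odot>\<^bsub>M\<^esub> x)"
    if "r \<in> carrier R" "x \<in> carrier M" for r x
    using that assms R.m_comm by (metis R.nat_pow_closed smult_assoc1)
  then show ?thesis using assms kp by (auto simp: p_linear_def smult_r_distr)
qed

lemma \<kappa>_pow_add: "(\<kappa> ^^ (a + b)) x = (\<kappa> ^^ a) ((\<kappa> ^^ b) x)"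
  by (simp add: funpow_add)

lemma \<kappa>_pow_smult: "r \<in> carrier R \<Longrightarrow> x \<in> carrier M \<Longrightarrow> r \<odot>\<^bsub>M\<^esub> (\<kappa> ^^ e) x = (\<kappa> ^^ e) (r [^] (p ^ e) \<odot>\<^bsub>M\<^esub> x)"
  using kp(3) by simp

lemma image_submodule:
  assumes V: "submodule V R M" and c: "c \<in> carrier R"
  shows "submodule ((\<lambda>m. (\<kappa> ^^ e) (c \<odot>\<^bsub>M\<^esub> m)) ` V) R M"
proof (rule submoduleI)
  note V' = submoduleE[OF V]
  note pl = p_linearD[OF p_linear_smult[OF c, of e]]
  have Vc: "x \<in> carrier M" if "x \<in> V" for x using that V'(1) by blast
  have V0: "\<zero>\<^bsub>M\<^esub> \<in> V" using subgroup.one_closed[OF submodule.axioms(1)[OF V]] by simp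
  have add: "(\<kappa> ^^ e) (c \<odot>\<^bsub>M\<^esub> x) \<oplus>\<^bsub>M\<^esub> (\<kappa> ^^ e) (c \<odot>\<^bsub>M\<^esub> y) \<in> (\<lambda>m. (\<kappa> ^^ e) (c \<odot>\<^bsub>M\<^esub> m)) ` V"
    if "x \<in> V" "y \<in> V" for x y
    using pl(2)[OF Vc[OF that(1)] Vc[OF that(2)], symmetric] V'(5)[OF that] by (rule image_eqI)
  have smult: "r \<odot>\<^bsub>M\<^esub> (\<kappa> ^^ e) (c \<odot>\<^bsub>M\<^esub> x) \<in> (\<lambda>m. (\<kappa> ^^ e) (c \<odot>\<^bsub>M\<^esub> m)) ` V"
    if "x \<in> V" "r \<in> carrier R" for x r
    using pl(3)[OF that(2) Vc[OF that(1)], symmetric] V'(4)[OF _ that(1)] that(2) by (intro image_eqI) auto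
  show "(\<lambda>m. (\<kappa> ^^ e) (c \<odot>\<^bsub>M\<^esub> m)) ` V \<subseteq> carrier M" using Vc pl(1) by blast
  have "\<zero>\<^bsub>M\<^esub> = \<zero> \<odot>\<^bsub>M\<^esub> (\<kappa> ^^ e) (c \<odot>\<^bsub>M\<^esub> \<zero>\<^bsub>M\<^esub>)" using pl(1)[of "\<zero>\<^bsub>M\<^esub>"] by simp
  then show "\<zero>\<^bsub>M\<^esub> \<in> (\<lambda>m. (\<kappa> ^^ e) (c \<odot>\<^bsub>M\<^esub> m)) ` V" using smult[OF V0, of \<zero>] by simp
  fix a assume "a \<in> (\<lambda>m. (\<kappa> ^^ e) (c \<odot>\<^bsub>M\<^esub> m)) ` V"
  then obtain x where x: "a = (\<kappa> ^^ e) (c \<odot>\<^bsub>M\<^esub> x)" "x \<in> V" by (rule imageE)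
  have "\<ominus>\<^bsub>M\<^esub> a = \<ominus> \<one> \<odot>\<^bsub>M\<^esub> a" unfolding x(1) using pl(1)[OF Vc[OF x(2)]] by (simp add: smult_l_minus)
  then show "\<ominus>\<^bsub>M\<^esub> a \<in> (\<lambda>m. (\<kappa> ^^ e) (c \<odot>\<^bsub>M\<^esub> m)) ` V" unfolding x(1) using smult[OF x(2), of "\<ominus> \<one>"] by simp
  show "r \<odot>\<^bsub>M\<^esub> a \<in> (\<lambda>m. (\<kappa> ^^ e) (c \<odot>\<^bsub>M\<^esub> m)) ` V" if "r \<in> carrier R" for r
    unfolding x(1) by (rule smult[OF x(2) that])
  fix b assume "b \<in> (\<lambda>m. (\<kappa> ^^ e) (c \<odot>\<^bsub>M\<^esub> m)) ` V"
  then obtain y where y: "b = (\<kappa> ^^ e) (c \<odot>\<^bsub>M\<^esub> y)" "y \<in> V" by (rule imageE)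
  show "a \<oplus>\<^bsub>M\<^esub> b \<in> (\<lambda>m. (\<kappa> ^^ e) (c \<odot>\<^bsub>M\<^esub> m)) ` V" unfolding x(1) y(1) by (rule add[OF x(2) y(2)])
qed

lemma algebra_p_linear:
  assumes f: "f \<in> carrier R" and \<phi>: "\<phi> \<in> cartier_algebra R p M \<kappa> f l e"
  shows "p_linear R p M e \<phi>"
proof (cases "e = 0")
  case True
  then obtain r where r: "r \<in> carrier R" "\<phi> = (\<lambda>m. r \<odot>\<^bsub>M\<^esub> m)" using \<phi> by (auto simp: cartier_algebra_def)
  show ?thesis using p_linear_smult[OF r(1), of 0] by (simp add: True r(2))
next
  case False
  then obtain r where r: "r \<in> carrier R" "\<phi> = (\<lambda>m. (\<kappa> ^^ e) ((f [^] nat \<lceil>l * of_nat (p ^ e)\<rceil> \<otimes> r) \<odot>\<^bsub>M\<^esub> m))"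
    using \<phi> by (auto simp: cartier_algebra_def)
  show ?thesis unfolding r(2) using f r(1) by (intro p_linear_smult) simp
qed

lemma generic_fibreI:
  assumes "f \<in> carrier R" "submodule N R M" "\<eta> \<in> assoc_primes R M"
    "\<forall>e. \<forall>\<phi>\<in>cartier_algebra R p M \<kappa> f l e. \<phi> ` N \<subseteq> N"
  shows "generic_fibre R M p (cartier_algebra R p M \<kappa> f l) \<eta> N"
proof (intro generic_fibre.intro generic_fibre_axioms.intro)
  show "primeideal \<eta> R" using assms(3) by (simp add: assoc_primes_def)
  fix e \<phi> x assume \<phi>: "\<phi> \<in> cartier_algebra R p M \<kappa> f l e"
  then show "p_linear R p M e \<phi>" by (rule algebra_p_linear[OF assms(1)])
  assume "x \<in> N"
  then show "\<phi> x \<in> N" using assms(4) \<phi> by blast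
qed (use assms(2) p_pos module_axioms in simp_all)

lemma generically_nil_isomorphic_iff:
  assumes f: "f \<in> carrier R" and N: "submodule N R M"
    and st: "\<forall>e. \<forall>\<phi>\<in>cartier_algebra R p M \<kappa> f l e. \<phi> ` N \<subseteq> N"
  shows "generically_nil_isomorphic R p M (cartier_algebra R p M \<kappa> f l) N \<longleftrightarrow>
    (\<forall>\<eta>\<in>assoc_primes R M. nilpotent_module
       (quot_module (localization R (carrier R - \<eta>) (M\<lparr>carrier := prime_torsion R \<eta> M\<rparr>)) (generic_fibre.I R M \<eta> N))
       (quot_operators (localization R (carrier R - \<eta>) (M\<lparr>carrier := prime_torsion R \<eta> M\<rparr>)) (generic_fibre.I R M \<eta> N)
         (loc_operators R p (carrier R - \<eta>) (M\<lparr>carrier := prime_torsion R \<eta> M\<rparr>) (cartier_algebra R p M \<kappa> f l))))"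
  unfolding generically_nil_isomorphic_def Let_def H0_submodule[OF submoduleE(1)[OF N]]
  unfolding H0_eq
  using generic_fibre.nil_isomorphism_iff[OF generic_fibreI[OF f N _ st]] by (intro ball_cong refl) simp

text \<open>If \<open>\<C>\<^sub>+M \<subseteq> N\<close> then the cokernels in question are annihilated by \<open>\<C>\<^sub>+\<close>.\<close>

lemma generically_nil_isomorphic_of_image:
  assumes f: "f \<in> carrier R" and N: "submodule N R M"
    and st: "\<forall>e. \<forall>\<phi>\<in>cartier_algebra R p M \<kappa> f l e. \<phi> ` N \<subseteq> N"
    and im: "\<forall>e\<ge>1. \<forall>\<phi>\<in>cartier_algebra R p M \<kappa> f l e. \<phi> ` carrier M \<subseteq> N"
  shows "generically_nil_isomorphic R p M (cartier_algebra R p M \<kappa> f l) N"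
  unfolding generically_nil_isomorphic_iff[OF f N st]
proof
  fix \<eta> assume \<eta>: "\<eta> \<in> assoc_primes R M"
  interpret G: generic_fibre R M p "cartier_algebra R p M \<kappa> f l" \<eta> N by (rule generic_fibreI[OF f N \<eta> st])
  show "nilpotent_module G.Q.Q G.QC"
  proof (rule G.nilpotentI[where V = "\<lambda>k. if k = (0::nat) then G.T else N \<inter> G.T" and a = 1])
    fix x assume "x \<in> (if (1::nat) = 0 then G.T else N \<inter> G.T)"
    then have "\<one> \<odot>\<^bsub>M\<^esub> x \<in> N" using G.T_closed by simp
    then show "\<exists>u\<in>G.S. u \<odot>\<^bsub>M\<^esub> x \<in> N" using G.S_mult_set(2) by blast
  next
    fix k :: nat and e \<phi> x assume h: "1 \<le> e" "\<phi> \<in> cartier_algebra R p M \<kappa> f l e" "x \<in> (if k = 0 then G.T else N \<inter> G.T)"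
    have "x \<in> G.T" using h(3) by (auto split: if_splits)
    then have "\<phi> x \<in> N \<inter> G.T" using im h(1,2) G.T_closed G.phi_T[OF h(2)] by blast
    then show "\<phi> x \<in> (if Suc k = 0 then G.T else N \<inter> G.T)" by simp
  qed (use G.T_submodule G.NT_submodule in auto)
qed

definition trace_image :: "'a \<Rightarrow> nat \<Rightarrow> nat \<Rightarrow> 'c set" where
  "trace_image f e n = (\<lambda>m. (\<kappa> ^^ e) (f [^] n \<odot>\<^bsub>M\<^esub> m)) ` carrier M"

lemma trace_image_submodule: "f \<in> carrier R \<Longrightarrow> submodule (trace_image f e n) R M"
  unfolding trace_image_def by (rule image_submodule[OF carrier_is_submodule]) simp

text \<open>For exponent 0 the Cartier algebra consists of the operators \<kappa>^e r and the
  scalars, so a submodule is stable under it as soon as it is stable under \<kappa>.\<close>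

lemma F_regular_minimal:
  assumes reg: "F_regular R p M \<kappa>" and N: "submodule N R M"
    and st: "\<kappa> ` N \<subseteq> N"
    and gen: "generically_nil_isomorphic R p M (cartier_algebra R p M \<kappa> \<one> 0) N"
  shows "N = carrier M"
proof -
  have stp: "(\<kappa> ^^ e) x \<in> N" if "x \<in> N" for e x using that st by (induction e) auto
  have "\<phi> ` N \<subseteq> N" if "\<phi> \<in> cartier_algebra R p M \<kappa> \<one> 0 e" for e \<phi>
    using that stp submoduleE(4)[OF N] by (auto simp: cartier_algebra_def split: if_splits)
  then have "carrier M \<subseteq> N" using reg N gen unfolding F_regular_def is_test_module_def Let_def by blast
  then show ?thesis using submoduleE(1)[OF N] by blast
qed

text \<open>The image of \<kappa> contains the images of all operators of positive degree, so its
  cokernel is annihilated by them. It thus competes with M for being the smallest test submodule,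
  and minimality makes it equal to M.\<close>

lemma F_regular_surj:
  assumes reg: "F_regular R p M \<kappa>"
  shows "(\<kappa> ^^ e) ` carrier M = carrier M"
proof -
  define N where "N = (\<lambda>m. (\<kappa> ^^ 1) (\<one> \<odot>\<^bsub>M\<^esub> m)) ` carrier M"
  have sub: "submodule N R M" unfolding N_def by (rule image_submodule[OF carrier_is_submodule]) simp
  have Neq: "N = \<kappa> ` carrier M" unfolding N_def by (rule image_cong) simp_all
  have Nc: "N \<subseteq> carrier M" using submoduleE(1)[OF sub] .
  have pos: "(\<kappa> ^^ e) x \<in> N" if "1 \<le> e" "x \<in> carrier M" for e x
  proof -
    obtain d where d: "e = Suc d" using \<open>1 \<le> e\<close> by (cases e) auto
    have "(\<kappa> ^^ e) x = \<kappa> ((\<kappa> ^^ d) x)" by (simp add: d)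
    then show ?thesis unfolding Neq using kp(1)[OF that(2), of d] by (rule image_eqI)
  qed
  have im: "\<phi> x \<in> N" if "1 \<le> e" "\<phi> \<in> cartier_algebra R p M \<kappa> \<one> 0 e" "x \<in> carrier M" for e \<phi> x
    using that pos[OF that(1)] by (auto simp: cartier_algebra_def)
  have st: "\<phi> x \<in> N" if "\<phi> \<in> cartier_algebra R p M \<kappa> \<one> 0 e" "x \<in> N" for e \<phi> x
  proof (cases "e = 0")
    case True
    then show ?thesis using that submoduleE(4)[OF sub] by (auto simp: cartier_algebra_def)
  next
    case False
    then show ?thesis using im[of e \<phi> x] that Nc by auto
  qed
  have "generically_nil_isomorphic R p M (cartier_algebra R p M \<kappa> \<one> 0) N"
    using st im by (intro generically_nil_isomorphic_of_image[OF R.one_closed sub]) blast+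
  moreover have "\<kappa> ` N \<subseteq> N"
  proof (rule image_subsetI)
    fix x assume "x \<in> N"
    then show "\<kappa> x \<in> N" using pos[of 1 x] Nc by auto
  qed
  ultimately have "N = carrier M" by (intro F_regular_minimal[OF reg sub])
  then have 1: "\<kappa> ` carrier M = carrier M" by (simp only: Neq)
  show ?thesis
  proof (induction e)
    case (Suc e)
    have "(\<kappa> ^^ Suc e) ` carrier M = \<kappa> ` ((\<kappa> ^^ e) ` carrier M)" by (simp add: image_comp comp_def)
    then show ?case using Suc 1 by simp
  qed simp
qed

lemma regular_power_notin_assoc:
  assumes "module_regular R M f" "\<eta> \<in> assoc_primes R M" shows "f [^] (n::nat) \<in> carrier R - \<eta>"
proof -
  have pr: "primeideal \<eta> R" using assms(2) by (simp add: assoc_primes_def)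
  obtain m where m: "m \<in> carrier M" "\<eta> = {r \<in> carrier R. r \<odot>\<^bsub>M\<^esub> m = \<zero>\<^bsub>M\<^esub>}" using assms(2) by (auto simp: assoc_primes_def)
  have fc: "f \<in> carrier R" using assms(1) by (simp add: module_regular_def)
  have "f \<notin> \<eta>"
  proof
    assume "f \<in> \<eta>"
    then have "m = \<zero>\<^bsub>M\<^esub>" using assms(1) m by (auto simp: module_regular_def)
    then have "\<one> \<in> \<eta>" using m by simp
    then show False using primeideal.one_notin[OF pr] by blast
  qed
  then show ?thesis
  proof (induction n)
    case 0
    show ?case using primeideal.one_notin[OF pr] by simp
  next
    case (Suc n)
    then show ?case using primeideal.notin_mult[OF pr, of "f [^] n" f] fc by simp
  qed
qed

section \<open>Test modules as trace images\<close>

definition exponent :: "nat \<Rightarrow> nat \<Rightarrow> nat \<Rightarrow> nat" where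
  "exponent n e b = nat \<lceil>(of_nat n / of_nat (p ^ e) * of_nat (p ^ b) :: rat)\<rceil>"

lemma exponent_add: "exponent n e (e + c) = n * p ^ c"
proof -
  have "(of_nat n / of_nat (p ^ e) * of_nat (p ^ (e + c)) :: rat) = of_nat (n * p ^ c)"
    using p_pos by (simp add: power_add)
  then show ?thesis unfolding exponent_def by (metis ceiling_of_nat nat_int)
qed

text \<open>In degrees b below e the ceiling is effective. After raising to the power p^(e-b), the
  rounded exponent is at least n, which is enough for containment; in degrees at least e there is no
  rounding.\<close>

lemma exponent_ge: "n \<le> exponent n (b + c) b * p ^ c"
proof -
  define x where "x = (of_nat n / of_nat (p ^ (b + c)) * of_nat (p ^ b) :: rat)"
  have x: "x * of_nat (p ^ c) = of_nat n" using p_pos by (simp add: x_def power_add)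
  have "x \<le> of_int \<lceil>x\<rceil>" by (rule le_of_int_ceiling)
  also have "\<dots> \<le> of_nat (nat \<lceil>x\<rceil>)" by (cases "0 \<le> \<lceil>x\<rceil>") simp_all
  finally have "x * of_nat (p ^ c) \<le> of_nat (nat \<lceil>x\<rceil>) * of_nat (p ^ c)" by (intro mult_right_mono) auto
  then have "(of_nat n :: rat) \<le> of_nat (nat \<lceil>x\<rceil> * p ^ c)" unfolding x by simp
  then show ?thesis unfolding exponent_def x_def[symmetric] by (simp only: of_nat_le_iff)
qed

lemma algebra_elem:
  "1 \<le> b \<Longrightarrow> \<phi> \<in> cartier_algebra R p M \<kappa> f (of_nat n / of_nat (p ^ e)) b \<longleftrightarrow>
    (\<exists>r\<in>carrier R. \<phi> = (\<lambda>m. (\<kappa> ^^ b) ((f [^] exponent n e b \<otimes> r) \<odot>\<^bsub>M\<^esub> m)))"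
  by (auto simp: cartier_algebra_def exponent_def)

theorem test_module_eq_trace_image:
  assumes reg: "F_regular R p M \<kappa>" and f: "module_regular R M f" and e: "1 \<le> e"
  shows "test_module R p M \<kappa> f (of_nat n / of_nat (p ^ e)) = trace_image f e n"
proof -
  have fc: "f \<in> carrier R" using f by (simp add: module_regular_def)
  define l :: rat where "l = of_nat n / of_nat (p ^ e)"
  define C where "C = cartier_algebra R p M \<kappa> f l"
  define N0 where "N0 = trace_image f e n"
  have N0: "submodule N0 R M" unfolding N0_def by (rule trace_image_submodule[OF fc])
  have C0: "\<phi> \<in> C 0 \<longleftrightarrow> (\<exists>r\<in>carrier R. \<phi> = (\<lambda>m. r \<odot>\<^bsub>M\<^esub> m))" for \<phi>
    by (auto simp: C_def cartier_algebra_def)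
  have im: "\<phi> x \<in> N0" if b: "1 \<le> b" and \<phi>: "\<phi> \<in> C b" and x: "x \<in> carrier M" for b \<phi> x
  proof -
    obtain r where r: "r \<in> carrier R" "\<phi> = (\<lambda>m. (\<kappa> ^^ b) ((f [^] exponent n e b \<otimes> r) \<odot>\<^bsub>M\<^esub> m))"
      using \<phi> algebra_elem[OF b] unfolding C_def l_def by blast
    show ?thesis
    \<comment> \<open>In degree b = e + c the operator factors as \<kappa>^e f^n \<kappa>^c r. In
      degree b < e, surjectivity writes x as \<kappa>^c y with c = e - b, and moving f^g r past
      \<kappa>^c raises it to the power p^c, which contains the factor f^n.\<close>
    proof (cases "e \<le> b")
      case True
      define c where "c = b - e"
      have bc: "b = e + c" using True by (simp add: c_def)
      have "\<phi> x = (\<kappa> ^^ e) ((\<kappa> ^^ c) ((f [^] n) [^] (p ^ c) \<odot>\<^bsub>M\<^esub> (r \<odot>\<^bsub>M\<^esub> x)))"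
        unfolding r(2) bc exponent_add \<kappa>_pow_add using fc r(1) x by (simp add: R.nat_pow_pow smult_assoc1)
      also have "\<dots> = (\<kappa> ^^ e) (f [^] n \<odot>\<^bsub>M\<^esub> (\<kappa> ^^ c) (r \<odot>\<^bsub>M\<^esub> x))" using fc r(1) x by (simp add: kp(3))
      also have "\<dots> \<in> N0" unfolding N0_def trace_image_def using r(1) x kp(1) by (intro imageI) simp
      finally show ?thesis .
    next
      case False
      define c where "c = e - b"
      have bc: "e = b + c" using False by (simp add: c_def)
      have "x \<in> (\<kappa> ^^ c) ` carrier M" using F_regular_surj[OF reg, of c] x by simp
      then obtain y where y: "x = (\<kappa> ^^ c) y" "y \<in> carrier M" by (rule imageE)
      define g where "g = exponent n e b"
      have "n \<le> g * p ^ c" using exponent_ge[of n b c] by (simp add: g_def bc)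
      then obtain d where d: "g * p ^ c = n + d" using le_Suc_ex by blast
      have "\<phi> x = (\<kappa> ^^ b) ((\<kappa> ^^ c) ((f [^] g \<otimes> r) [^] (p ^ c) \<odot>\<^bsub>M\<^esub> y))"
        unfolding r(2) y(1) g_def[symmetric] using fc r(1) y(2) by (simp add: kp(3))
      also have "\<dots> = (\<kappa> ^^ e) ((f [^] g \<otimes> r) [^] (p ^ c) \<odot>\<^bsub>M\<^esub> y)" unfolding bc by (rule \<kappa>_pow_add[symmetric])
      also have "(f [^] g \<otimes> r) [^] (p ^ c) = f [^] n \<otimes> (f [^] d \<otimes> r [^] (p ^ c))"
        using fc r(1) d by (simp add: R.nat_pow_distrib R.nat_pow_pow R.m_assoc flip: R.nat_pow_mult)
      also have "(f [^] n \<otimes> (f [^] d \<otimes> r [^] (p ^ c))) \<odot>\<^bsub>M\<^esub> y = f [^] n \<odot>\<^bsub>M\<^esub> ((f [^] d \<otimes> r [^] (p ^ c)) \<odot>\<^bsub>M\<^esub> y)"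
        using fc r(1) y(2) by (simp add: smult_assoc1)
      also have "(\<kappa> ^^ e) \<dots> \<in> N0" unfolding N0_def trace_image_def using fc r(1) y(2) by (intro imageI) simp
      finally show ?thesis .
    qed
  qed
  have N0c: "N0 \<subseteq> carrier M" using submoduleE(1)[OF N0] .
  have st: "\<phi> x \<in> N0" if "\<phi> \<in> C b" "x \<in> N0" for b \<phi> x
  proof (cases "b = 0")
    case True
    then show ?thesis using that C0 submoduleE(4)[OF N0] by auto
  next
    case False
    then show ?thesis using im[of b \<phi> x] that N0c by auto
  qed
  have gen0: "generically_nil_isomorphic R p M C N0"
    using st im unfolding C_def by (intro generically_nil_isomorphic_of_image[OF fc N0]) blast+
  have minimal: "N0 \<subseteq> N" if N: "submodule N R M" and stN: "\<forall>b. \<forall>\<phi>\<in>C b. \<phi> ` N \<subseteq> N"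
    and gen: "generically_nil_isomorphic R p M C N" for N
  proof -
    have stN': "\<phi> x \<in> N" if "\<phi> \<in> C b" "x \<in> N" for b \<phi> x using stN that by blast
    have Nc: "N \<subseteq> carrier M" using submoduleE(1)[OF N] .
    note N' = submoduleE[OF N]
    \<comment> \<open>The defining operators are those of degree e + a in the algebra, where the
      exponent of f is exactly n p^a. Hence N lies in \<open>K\<close>; the case a = 0, r = 1 will
      give the wanted inclusion once \<open>K\<close> is M.\<close>
    define K where "K = {m \<in> carrier M. \<forall>a. \<forall>r\<in>carrier R. (\<kappa> ^^ (e + a)) ((f [^] (n * p ^ a) \<otimes> r) \<odot>\<^bsub>M\<^esub> m) \<in> N}"
    have NK: "N \<subseteq> K"
    proof
      fix m assume m: "m \<in> N"
      have "(\<kappa> ^^ (e + a)) ((f [^] (n * p ^ a) \<otimes> r) \<odot>\<^bsub>M\<^esub> m) \<in> N" if "r \<in> carrier R" for a r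
      proof -
        have "(\<lambda>m. (\<kappa> ^^ (e + a)) ((f [^] (n * p ^ a) \<otimes> r) \<odot>\<^bsub>M\<^esub> m)) \<in> C (e + a)"
          unfolding C_def l_def using algebra_elem[of "e + a" _ f n e] e that exponent_add[of n e a] by auto
        then show ?thesis using stN' m by blast
      qed
      then show "m \<in> K" using m Nc by (auto simp: K_def)
    qed
    have K: "submodule K R M"
    proof (rule submoduleI)
      show "\<zero>\<^bsub>M\<^esub> \<in> K" using NK subgroup.one_closed[OF submodule.axioms(1)[OF N]] by auto
      fix x assume x: "x \<in> K"
      have smult: "r \<odot>\<^bsub>M\<^esub> x \<in> K" if r: "r \<in> carrier R" for r
      proof -
        have "(f [^] (n * p ^ a) \<otimes> s) \<odot>\<^bsub>M\<^esub> (r \<odot>\<^bsub>M\<^esub> x) = (f [^] (n * p ^ a) \<otimes> (s \<otimes> r)) \<odot>\<^bsub>M\<^esub> x" if "s \<in> carrier R" for a s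
          using that r fc x by (simp add: K_def smult_assoc1)
        then show ?thesis using x r by (simp add: K_def)
      qed
      then show "r \<odot>\<^bsub>M\<^esub> x \<in> K" if "r \<in> carrier R" for r using that .
      have "\<ominus>\<^bsub>M\<^esub> x = \<ominus> \<one> \<odot>\<^bsub>M\<^esub> x" using x by (simp add: K_def smult_l_minus)
      then show "\<ominus>\<^bsub>M\<^esub> x \<in> K" using smult[of "\<ominus> \<one>"] by simp
      fix y assume y: "y \<in> K"
      have "(\<kappa> ^^ (e + a)) ((f [^] (n * p ^ a) \<otimes> s) \<odot>\<^bsub>M\<^esub> (x \<oplus>\<^bsub>M\<^esub> y)) \<in> N" if s: "s \<in> carrier R" for a s
      proof -
        have "(\<kappa> ^^ (e + a)) ((f [^] (n * p ^ a) \<otimes> s) \<odot>\<^bsub>M\<^esub> (x \<oplus>\<^bsub>M\<^esub> y)) =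
          (\<kappa> ^^ (e + a)) ((f [^] (n * p ^ a) \<otimes> s) \<odot>\<^bsub>M\<^esub> x) \<oplus>\<^bsub>M\<^esub> (\<kappa> ^^ (e + a)) ((f [^] (n * p ^ a) \<otimes> s) \<odot>\<^bsub>M\<^esub> y)"
          using p_linearD(2)[OF p_linear_smult, of "f [^] (n * p ^ a) \<otimes> s" x y "e + a"] fc s x y by (simp add: K_def)
        then show ?thesis using N'(5) x y s by (simp add: K_def)
      qed
      then show "x \<oplus>\<^bsub>M\<^esub> y \<in> K" using x y by (simp add: K_def)
    qed (auto simp: K_def)
    \<comment> \<open>Precomposing with \<kappa> stays in the family: \<kappa>^(e+a) f^(n p^a) r
      \<kappa> = \<kappa>^(e+a+1) f^(n p^(a+1)) r^p.\<close>
    have Kst: "\<kappa> x \<in> K" if x: "x \<in> K" for x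
    proof -
      have xc: "x \<in> carrier M" using x by (simp add: K_def)
      have "(\<kappa> ^^ (e + a)) ((f [^] (n * p ^ a) \<otimes> r) \<odot>\<^bsub>M\<^esub> \<kappa> x) \<in> N" if r: "r \<in> carrier R" for a r
      proof -
        have "(f [^] (n * p ^ a) \<otimes> r) \<odot>\<^bsub>M\<^esub> \<kappa> x = \<kappa> ((f [^] (n * p ^ a) \<otimes> r) [^] p \<odot>\<^bsub>M\<^esub> x)"
          using p_linearD(3)[OF \<kappa>, of "f [^] (n * p ^ a) \<otimes> r" x] fc r xc by simp
        also have "(f [^] (n * p ^ a) \<otimes> r) [^] p = f [^] (n * p ^ Suc a) \<otimes> r [^] p"
          using fc r by (simp add: R.nat_pow_distrib R.nat_pow_pow mult.assoc mult.commute[of p])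
        finally have "(\<kappa> ^^ (e + a)) ((f [^] (n * p ^ a) \<otimes> r) \<odot>\<^bsub>M\<^esub> \<kappa> x) = (\<kappa> ^^ (e + Suc a)) ((f [^] (n * p ^ Suc a) \<otimes> r [^] p) \<odot>\<^bsub>M\<^esub> x)"
          by (simp add: funpow_swap1)
        moreover have "r [^] p \<in> carrier R" using r by simp
        then have "(\<kappa> ^^ (e + Suc a)) ((f [^] (n * p ^ Suc a) \<otimes> r [^] p) \<odot>\<^bsub>M\<^esub> x) \<in> N" using x unfolding K_def by blast
        ultimately show ?thesis by (simp only:)
      qed
      then show ?thesis using p_linearD(1)[OF \<kappa> xc] by (simp add: K_def)
    qed
    have Kstp: "(\<kappa> ^^ b) x \<in> K" if "x \<in> K" for b x using that by (induction b) (auto intro: Kst)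
    have KstC: "\<forall>b. \<forall>\<phi>\<in>cartier_algebra R p M \<kappa> \<one> 0 b. \<phi> ` K \<subseteq> K"
      using Kstp submoduleE(4)[OF K] by (auto simp: cartier_algebra_def)
    have "generically_nil_isomorphic R p M (cartier_algebra R p M \<kappa> \<one> 0) K"
      unfolding generically_nil_isomorphic_iff[OF R.one_closed K KstC]
    proof
      fix \<eta> assume \<eta>: "\<eta> \<in> assoc_primes R M"
      interpret G: generic_fibre R M p C \<eta> N unfolding C_def by (rule generic_fibreI[OF fc N \<eta> stN[unfolded C_def]])
      interpret H: generic_fibre R M p "cartier_algebra R p M \<kappa> \<one> 0" \<eta> K by (rule generic_fibreI[OF R.one_closed K \<eta> KstC])
      have nil: "nilpotent_module G.Q.Q G.QC"
        using gen \<eta> unfolding C_def generically_nil_isomorphic_iff[OF fc N stN[unfolded C_def]] by blast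
      define \<phi> where "\<phi> = (\<lambda>m. (\<kappa> ^^ e) ((f [^] n \<otimes> \<one>) \<odot>\<^bsub>M\<^esub> m))"
      have \<phi>: "\<phi> \<in> C e" unfolding C_def l_def \<phi>_def using algebra_elem[OF e, of _ f n e] exponent_add[of n e 0] by auto
      obtain a where a: "\<And>x. x \<in> G.T \<Longrightarrow> \<exists>u\<in>G.S. u \<odot>\<^bsub>M\<^esub> (\<phi> ^^ a) x \<in> N" using G.nilpotentD[OF nil \<phi> e] by blast
      \<comment> \<open>Moving all powers of f to the right turns an iterate of \<kappa>^e f^n into
        a power of \<kappa> after some f^B. The value of B may be arbitrary, since f^B lies outside
        every associated prime.\<close>
      have iter: "\<exists>B. \<forall>x\<in>carrier M. (\<phi> ^^ a) x = (\<kappa> ^^ (e * a)) (f [^] (B::nat) \<odot>\<^bsub>M\<^esub> x)" for a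
      proof (induction a)
        case 0
        show ?case by (rule exI[of _ 0]) simp
      next
        case (Suc a)
        then obtain B where B: "\<And>x. x \<in> carrier M \<Longrightarrow> (\<phi> ^^ a) x = (\<kappa> ^^ (e * a)) (f [^] (B::nat) \<odot>\<^bsub>M\<^esub> x)" by blast
        have "(\<phi> ^^ Suc a) x = (\<kappa> ^^ (e * Suc a)) (f [^] (n * p ^ (e * a) + B) \<odot>\<^bsub>M\<^esub> x)" if x: "x \<in> carrier M" for x
        proof -
          have "(\<phi> ^^ Suc a) x = (\<kappa> ^^ e) (f [^] n \<odot>\<^bsub>M\<^esub> (\<kappa> ^^ (e * a)) (f [^] B \<odot>\<^bsub>M\<^esub> x))"
            using B[OF x] fc by (simp add: \<phi>_def)
          also have "f [^] n \<odot>\<^bsub>M\<^esub> (\<kappa> ^^ (e * a)) (f [^] B \<odot>\<^bsub>M\<^esub> x) = (\<kappa> ^^ (e * a)) (f [^] (n * p ^ (e * a) + B) \<odot>\<^bsub>M\<^esub> x)"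
            using fc x by (simp add: \<kappa>_pow_smult R.nat_pow_pow smult_assoc1 flip: R.nat_pow_mult)
          finally show ?thesis by (simp add: funpow_add)
        qed
        then show ?case by blast
      qed
      obtain B where B: "\<And>x. x \<in> carrier M \<Longrightarrow> (\<phi> ^^ a) x = (\<kappa> ^^ (e * a)) (f [^] (B::nat) \<odot>\<^bsub>M\<^esub> x)" using iter by blast
      \<comment> \<open>For y = \<kappa>^(e a) x, the element f^B y equals \<phi>^a applied to f^(B
        d) x, with d = p^(e a) - 1, because B + B d = B p^(e a) comes out of \<kappa>^(e a) as f^B.
        So u f^B multiplies y into N, and M-regularity makes u f^B an admissible
        denominator.\<close>
      have fin: "\<exists>u\<in>G.S. u \<odot>\<^bsub>M\<^esub> y \<in> K" if y: "y \<in> (\<kappa> ^^ (e * a)) ` G.T" for y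
      proof -
        obtain x where x: "y = (\<kappa> ^^ (e * a)) x" "x \<in> G.T" using y by (rule imageE)
        have xc: "x \<in> carrier M" using G.T_closed x(2) .
        have "p ^ (e * a) > 0" using p_pos by simp
        then obtain d where d: "p ^ (e * a) = Suc d" by (cases "p ^ (e * a)") auto
        have "f [^] (B * d) \<odot>\<^bsub>M\<^esub> x \<in> G.T" using fc x(2) by simp
        then obtain u where u: "u \<in> G.S" "u \<odot>\<^bsub>M\<^esub> (\<phi> ^^ a) (f [^] (B * d) \<odot>\<^bsub>M\<^esub> x) \<in> N" using a by blast
        have "(\<phi> ^^ a) (f [^] (B * d) \<odot>\<^bsub>M\<^esub> x) = (\<kappa> ^^ (e * a)) ((f [^] B) [^] (p ^ (e * a)) \<odot>\<^bsub>M\<^esub> x)"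
          using B[of "f [^] (B * d) \<odot>\<^bsub>M\<^esub> x"] fc xc by (simp add: d R.nat_pow_mult R.nat_pow_pow add.commute flip: smult_assoc1)
        also have "\<dots> = f [^] B \<odot>\<^bsub>M\<^esub> y" unfolding x(1) using fc xc by (simp add: kp(3))
        finally have "u \<odot>\<^bsub>M\<^esub> (f [^] B \<odot>\<^bsub>M\<^esub> y) \<in> N" using u(2) by simp
        moreover have "y \<in> carrier M" unfolding x(1) using kp(1) xc by blast
        ultimately have "(u \<otimes> f [^] B) \<odot>\<^bsub>M\<^esub> y \<in> K" using NK u(1) fc by (auto simp: smult_assoc1)
        moreover have "u \<otimes> f [^] B \<in> G.S" using G.S_mult_set(3)[OF u(1) regular_power_notin_assoc[OF f \<eta>]] .
        ultimately show ?thesis by blast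
      qed
      show "nilpotent_module H.Q.Q H.QC"
      \<comment> \<open>Every operator of positive degree for exponent 0 carries \<kappa>^k T into
        \<kappa>^(k+1) T, so images under powers of \<kappa> form the required filtration;
        \<open>fin\<close> deals with its member of index e a.\<close>
      proof (rule H.nilpotentI[where V = "\<lambda>k. (\<kappa> ^^ k) ` H.T" and a = "e * a"])
        fix k
        have "(\<lambda>m. (\<kappa> ^^ k) (\<one> \<odot>\<^bsub>M\<^esub> m)) ` H.T = (\<kappa> ^^ k) ` H.T" using H.T_closed by (intro image_cong) simp_all
        then show "submodule ((\<kappa> ^^ k) ` H.T) R M" using image_submodule[OF H.T_submodule R.one_closed, of k] by simp
        show "(\<kappa> ^^ k) ` H.T \<subseteq> H.T" using p_linear_prime_torsion[OF H.eta_ideal \<kappa>_pow p_pos] by blast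
        fix b \<psi> x assume h: "1 \<le> b" "\<psi> \<in> cartier_algebra R p M \<kappa> \<one> 0 b" "x \<in> (\<kappa> ^^ k) ` H.T"
        obtain y where y: "x = (\<kappa> ^^ k) y" "y \<in> H.T" using h(3) by (rule imageE)
        have yc: "y \<in> carrier M" using H.T_closed y(2) .
        obtain r where r: "r \<in> carrier R" "\<psi> = (\<lambda>m. (\<kappa> ^^ b) (r \<odot>\<^bsub>M\<^esub> m))"
          using h(1,2) by (auto simp: cartier_algebra_def)
        obtain b' where b': "b = Suc b'" using h(1) by (cases b) auto
        have "\<psi> x = (\<kappa> ^^ (b + k)) (r [^] (p ^ k) \<odot>\<^bsub>M\<^esub> y)" unfolding r(2) y(1) using r(1) yc by (simp add: \<kappa>_pow_smult \<kappa>_pow_add)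
        also have "b + k = Suc k + b'" by (simp add: b')
        also have "(\<kappa> ^^ (Suc k + b')) (r [^] (p ^ k) \<odot>\<^bsub>M\<^esub> y) = (\<kappa> ^^ Suc k) ((\<kappa> ^^ b') (r [^] (p ^ k) \<odot>\<^bsub>M\<^esub> y))" by (rule \<kappa>_pow_add)
        also have "\<dots> \<in> (\<kappa> ^^ Suc k) ` H.T"
          using p_linear_prime_torsion[OF H.eta_ideal \<kappa>_pow p_pos] y(2) r(1) by (intro imageI) auto
        finally show "\<psi> x \<in> (\<kappa> ^^ Suc k) ` H.T" .
      qed (use fin in simp_all)
    qed
    moreover have "\<kappa> ` K \<subseteq> K" using Kst by (rule image_subsetI)
    ultimately have "K = carrier M" by (intro F_regular_minimal[OF reg K])
    then have "(\<kappa> ^^ (e + 0)) ((f [^] (n * p ^ 0) \<otimes> \<one>) \<odot>\<^bsub>M\<^esub> m) \<in> N" if "m \<in> carrier M" for m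
      using that unfolding K_def by blast
    then show ?thesis using fc by (auto simp: N0_def trace_image_def)
  qed
  have "is_test_module R p M C N0"
    unfolding is_test_module_def Let_def using N0 st gen0 minimal by blast
  then have "test_module R p M \<kappa> f l = N0"
    unfolding test_module_def C_def[symmetric]
    by (intro the_equality) (auto simp: is_test_module_def Let_def)
  then show ?thesis by (simp add: l_def N0_def)
qed

end

section \<open>Binomial coefficients modulo a prime\<close>

text \<open>From i C(p^j, i) = p^j C(p^j - 1, i - 1): if p did not divide the binomial coefficient,
  p^j would divide i.\<close>

lemma prime_dvd_choose_prime_power:
  fixes p :: nat
  assumes p: "Factorial_Ring.prime p" and i: "0 < i" "i < p ^ j"
  shows "p dvd (p ^ j choose i)"
proof (rule ccontr)
  assume "\<not> p dvd (p ^ j choose i)"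
  then have "coprime (p ^ j) (p ^ j choose i)" using p by (simp add: prime_imp_coprime)
  moreover have "i * (p ^ j choose i) = p ^ j * ((p ^ j - 1) choose (i - 1))"
    using i by (intro times_binomial_minus1_eq) simp
  then have "p ^ j dvd i * (p ^ j choose i)" by simp
  ultimately have "p ^ j dvd i" by (simp add: coprime_dvd_mult_left_iff)
  then show False using i by (simp add: dvd_imp_le leD)
qed

text \<open>The case of Lucas' theorem that is needed: C(n, p^j) reads off the j-th base-p digit of
  n. Vandermonde's identity for n = m + p^j has only its two extreme terms left modulo p, so both
  sides grow by 1 when p^j is added.\<close>

lemma choose_prime_power_mod:
  fixes p :: nat
  assumes p: "Factorial_Ring.prime p"
  shows "(n choose p ^ j) mod p = (n div p ^ j) mod p"
proof (induction n rule: less_induct)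
  case (less n)
  have pj: "p ^ j > 0" using p prime_gt_0_nat by simp
  show ?case
  proof (cases "n < p ^ j")
    case True
    then show ?thesis by (simp add: binomial_eq_0)
  next
    case False
    define m where "m = n - p ^ j"
    have n: "n = m + p ^ j" using False by (simp add: m_def)
    obtain r where r: "p ^ j = Suc r" using pj by (cases "p ^ j") auto
    define t where "t k = (m choose k) * (p ^ j choose (p ^ j - k))" for k
    have mid: "p dvd t k" if "k \<in> {1..r}" for k
      using that r prime_dvd_choose_prime_power[OF p, of "p ^ j - k" j] by (simp add: t_def)
    have "(n choose p ^ j) = (\<Sum>k\<le>p ^ j. t k)" unfolding n t_def by (rule vandermonde[symmetric])
    also have "{..p ^ j} = insert 0 (insert (p ^ j) {1..r})" unfolding r by auto
    also have "(\<Sum>k\<in>insert 0 (insert (p ^ j) {1..r}). t k) = t 0 + (t (p ^ j) + (\<Sum>k\<in>{1..r}. t k))"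
      using r by simp
    also have "t 0 = 1" by (simp add: t_def)
    also have "t (p ^ j) = (m choose p ^ j)" by (simp add: t_def)
    finally have eq: "(n choose p ^ j) = 1 + ((m choose p ^ j) + (\<Sum>k\<in>{1..r}. t k))" .
    have "p dvd (\<Sum>k\<in>{1..r}. t k)" using mid by (rule dvd_sum)
    then obtain s where "(\<Sum>k\<in>{1..r}. t k) = p * s" by (elim dvdE)
    then have "(n choose p ^ j) mod p = (1 + (m choose p ^ j)) mod p" unfolding eq by (simp flip: add.assoc)
    also have "\<dots> = (1 + m div p ^ j) mod p" using n pj by (intro mod_add_cong refl less) simp
    also have "1 + m div p ^ j = n div p ^ j" using n pj by simp
    finally show ?thesis .
  qed
qed

lemma mod_prime_power_eqI:
  fixes p :: nat
  shows "(\<And>j. j < e \<Longrightarrow> m div p ^ j mod p = n div p ^ j mod p) \<Longrightarrow> m mod p ^ e = n mod p ^ e"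
proof (induction e)
  case (Suc e)
  then have "m mod p ^ e = n mod p ^ e" "m div p ^ e mod p = n div p ^ e mod p" by auto
  then show ?case by (simp add: mod_mult2_eq mult.commute[of p])
qed simp

lemma div_mod_add_prime_power:
  fixes p :: nat
  assumes "p > 0" "j < e" shows "(m + b * p ^ e) div p ^ j mod p = m div p ^ j mod p"
proof -
  define c where "c = e - j - 1"
  have "p ^ e = p ^ j * (p * p ^ c)" using assms by (simp add: c_def flip: power_Suc power_add)
  then have eq: "m + b * p ^ e = m + p ^ j * (p * (b * p ^ c))" by (simp add: mult.left_commute)
  have "(m + p ^ j * (p * (b * p ^ c))) div p ^ j = p * (b * p ^ c) + m div p ^ j"
    using assms(1) by (intro div_mult_self2) simp
  then have "(m + b * p ^ e) div p ^ j = p * (b * p ^ c) + m div p ^ j" by (simp only: eq)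
  then show ?thesis by simp
qed

lemma digit_expansion:
  fixes p :: nat
  assumes "\<forall>j\<in>{1..e}. i j < p" "p > 0"
  shows "(\<Sum>j=1..e. i j * p ^ (j - 1)) < p ^ e \<and>
    (\<forall>j\<in>{1..e}. (\<Sum>j=1..e. i j * p ^ (j - 1)) div p ^ (j - 1) mod p = i j)"
  using assms(1)
proof (induction e)
  case (Suc e)
  define N where "N = (\<Sum>j=1..e. i j * p ^ (j - 1))"
  have IH: "N < p ^ e" "\<And>j. j \<in> {1..e} \<Longrightarrow> N div p ^ (j - 1) mod p = i j" using Suc unfolding N_def by auto
  have S: "(\<Sum>j=1..Suc e. i j * p ^ (j - 1)) = N + i (Suc e) * p ^ e" by (simp add: N_def)
  have lt: "i (Suc e) < p" using Suc.prems by simp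
  have "N + i (Suc e) * p ^ e < p ^ e + i (Suc e) * p ^ e" using IH(1) by simp
  also have "\<dots> = Suc (i (Suc e)) * p ^ e" by simp
  also have "\<dots> \<le> p * p ^ e" using lt by (intro mult_right_mono) auto
  finally have 1: "N + i (Suc e) * p ^ e < p ^ Suc e" by simp
  have "(N + i (Suc e) * p ^ e) div p ^ (j - 1) mod p = i j" if j: "j \<in> {1..Suc e}" for j
  proof (cases "j = Suc e")
    case True
    have "(N + i (Suc e) * p ^ e) div p ^ e = i (Suc e)" using IH(1) assms(2) by simp
    then show ?thesis using lt by (simp add: True)
  next
    case False
    then have "j - 1 < e" "j \<in> {1..e}" using j by auto
    then show ?thesis using div_mod_add_prime_power[OF assms(2), of "j - 1" e N "i (Suc e)"] IH(2) by simp
  qed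
  then show ?case unfolding S using 1 by blast
qed simp

text \<open>Fermat's theorem makes 1 - (a - m)^(p-1) the indicator of a = m modulo p. Writing p - 1
  for -1 and p - m for -m keeps the expression in the natural numbers, so that it can serve as a
  repeated sum of operators.\<close>

lemma indicator_mod:
  fixes p :: nat
  assumes p: "Factorial_Ring.prime p" and m: "m < p"
  shows "(1 + (p - 1) * (a + (p - m)) ^ (p - 1)) mod p = (if a mod p = m then 1 else 0)"
proof -
  have p1: "p > 1" using p prime_gt_1_nat by blast
  have amod: "p dvd a + (p - m) \<longleftrightarrow> a mod p = m"
  proof -
    have "p dvd a + (p - m) \<longleftrightarrow> p dvd a mod p + (p - m)" by (metis dvd_eq_mod_eq_0 mod_add_left_eq)
    also have "\<dots> \<longleftrightarrow> a mod p = m"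
    proof
      assume "p dvd a mod p + (p - m)"
      then obtain k where k: "a mod p + (p - m) = p * k" by (auto elim: dvdE)
      have "a mod p < p" using p1 by simp
      then have "p * k < p * 2" "0 < p * k" using k m by linarith+
      then have "k = 1" by simp
      then show "a mod p = m" using k m by simp
    next
      assume "a mod p = m"
      then show "p dvd a mod p + (p - m)" using m by simp
    qed
    finally show ?thesis .
  qed
  show ?thesis
  proof (cases "a mod p = m")
    case True
    then have "p dvd (a + (p - m)) ^ (p - 1)" using amod p1 by (intro dvd_power_le[of p _ 1, simplified]) auto
    then have "p dvd (p - 1) * (a + (p - m)) ^ (p - 1)" by simp
    then have "(1 + (p - 1) * (a + (p - m)) ^ (p - 1)) mod p = 1 mod p" by (metis add.right_neutral dvd_imp_mod_0 mod_add_right_eq)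
    then show ?thesis using True p1 by simp
  next
    case False
    then have "\<not> p dvd a + (p - m)" using amod by simp
    then have "[(a + (p - m)) ^ (p - 1) = 1] (mod p)" by (rule fermat_theorem[OF p])
    then have "(1 + (p - 1) * (a + (p - m)) ^ (p - 1)) mod p = (1 + (p - 1) * 1) mod p"
      unfolding cong_def by (metis mod_add_right_eq mod_mult_right_eq)
    also have "\<dots> = 0" using p1 by simp
    finally show ?thesis using False by simp
  qed
qed

text \<open>The inverse exists already in the prime field. The natural number d = a + (p - 1) b
  represents a - b modulo p, and d^(p-2) is its inverse by Fermat's theorem.\<close>

lemma (in char_p_ring) difference_unit:
  assumes "a mod p \<noteq> b mod p"
  shows "\<exists>\<beta>\<in>carrier R. \<beta> \<otimes> ([a] \<cdot> \<one> \<ominus> [b] \<cdot> \<one>) = \<one>"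
proof -
  define d where "d = a + (p - 1) * b"
  have p1: "p > 1" using prime_p prime_gt_1_nat by blast
  obtain r where r: "p = Suc r" using p1 by (cases p) auto
  have db: "d + b = a + p * b" by (simp add: d_def r)
  then have "[d] \<cdot> \<one> \<oplus> [b] \<cdot> \<one> = [a] \<cdot> \<one> \<oplus> [(p * b)] \<cdot> \<one>"
    by (simp add: add.nat_pow_mult)
  also have "[(p * b)] \<cdot> \<one> = \<zero>" by (intro char_p_dvd) auto
  finally have "[a] \<cdot> \<one> = [d] \<cdot> \<one> \<oplus> [b] \<cdot> \<one>" by simp
  then have dd: "[a] \<cdot> \<one> \<ominus> [b] \<cdot> \<one> = [d] \<cdot> \<one>" by (simp add: minus_eq a_assoc r_neg)
  have "\<not> p dvd d"
  proof
    assume "p dvd d"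
    then have "d mod p = 0" by simp
    have "(d + b) mod p = a mod p" unfolding db by simp
    then have "b mod p = a mod p" using \<open>p dvd d\<close> by (metis add.left_neutral mod_add_left_eq \<open>d mod p = 0\<close>)
    then show False using assms by simp
  qed
  then have "[d ^ (p - 1) = 1] (mod p)" by (rule fermat_theorem[OF prime_p])
  then have "d ^ (p - 1) mod p = 1" using p1 by (simp add: cong_def)
  then obtain k where k: "d ^ (p - 1) = 1 + p * k" by (metis add.commute mult_div_mod_eq)
  have "d ^ (p - 2) * d = d ^ (p - 1)" using p1 by (metis One_nat_def Suc_diff_Suc Suc_1 power_Suc2)
  then have "([(d ^ (p - 2))] \<cdot> \<one>) \<otimes> ([d] \<cdot> \<one>) = [(1 + p * k)] \<cdot> \<one>"
    using k by (simp add: add_pow_ldistr add.nat_pow_pow mult.commute)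
  also have "\<dots> = \<one> \<oplus> [(p * k)] \<cdot> \<one>" by (simp add: a_comm flip: add.nat_pow_mult)
  also have "[(p * k)] \<cdot> \<one> = \<zero>" by (intro char_p_dvd) auto
  finally show ?thesis unfolding dd by (intro bexI[of _ "[(d ^ (p - 2))] \<cdot> \<one>"]) auto
qed

section \<open>Differential operators and the graph embedding\<close>

text \<open>Additive groups of homomorphisms under pointwise addition; this covers both
  \<open>\<D>\<^sup>e\<^sub>A\<close> and \<open>F\<^sup>e\<^sup>!P\<close>.\<close>

lemma pointwise_group:
  fixes K :: "('m \<Rightarrow> 'n, 'f) ring_scheme" and P :: "('r, 'n) module" and M0 :: "('r, 'm) module"
  assumes carr: "carrier K = Hom_module A M0 P" and zero: "\<zero>\<^bsub>K\<^esub> = (\<lambda>x\<in>carrier M0. \<zero>\<^bsub>P\<^esub>)"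
    and add: "add K = (\<lambda>\<phi> \<psi>. \<lambda>x\<in>carrier M0. \<phi> x \<oplus>\<^bsub>P\<^esub> \<psi> x)"
    and P: "module A P" and M0: "module A M0"
  shows "abelian_group K" "\<phi> \<in> carrier K \<Longrightarrow> \<ominus>\<^bsub>K\<^esub> \<phi> = (\<lambda>x\<in>carrier M0. \<ominus>\<^bsub>P\<^esub> \<phi> x)"
proof -
  interpret P: module A P by (rule P)
  interpret M0: module A M0 by (rule M0)
  have mem: "\<phi> \<in> carrier K \<longleftrightarrow> \<phi> \<in> extensional (carrier M0) \<and> \<phi> \<in> carrier M0 \<rightarrow> carrier P \<and>
     (\<forall>x\<in>carrier M0. \<forall>y\<in>carrier M0. \<phi> (x \<oplus>\<^bsub>M0\<^esub> y) = \<phi> x \<oplus>\<^bsub>P\<^esub> \<phi> y) \<and>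
     (\<forall>r\<in>carrier A. \<forall>x\<in>carrier M0. \<phi> (r \<odot>\<^bsub>M0\<^esub> x) = r \<odot>\<^bsub>P\<^esub> \<phi> x)" for \<phi>
    by (simp add: carr Hom_module_def linear_map_def)
  have neg: "(\<lambda>x\<in>carrier M0. \<ominus>\<^bsub>P\<^esub> \<phi> x) \<in> carrier K" if "\<phi> \<in> carrier K" for \<phi>
    using that unfolding mem by (auto simp: P.M.minus_add P.smult_r_minus Pi_iff P.M.a_comm)
  have negl: "(\<lambda>x\<in>carrier M0. \<ominus>\<^bsub>P\<^esub> \<phi> x) \<oplus>\<^bsub>K\<^esub> \<phi> = \<zero>\<^bsub>K\<^esub>" if "\<phi> \<in> carrier K" for \<phi>
    using that unfolding mem add zero by (intro restrict_ext) (auto simp: P.M.l_neg Pi_iff)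
  show gr: "abelian_group K"
  proof (rule abelian_groupI)
    fix \<phi> \<psi> assume h: "\<phi> \<in> carrier K" "\<psi> \<in> carrier K"
    then show "\<phi> \<oplus>\<^bsub>K\<^esub> \<psi> \<in> carrier K"
      unfolding mem add by (auto simp: Pi_iff P.smult_r_distr P.M.a_ac)
    show "\<phi> \<oplus>\<^bsub>K\<^esub> \<psi> = \<psi> \<oplus>\<^bsub>K\<^esub> \<phi>"
      using h unfolding mem add by (intro restrict_ext) (auto simp: Pi_iff P.M.a_comm)
    fix \<chi> assume "\<chi> \<in> carrier K"
    then show "\<phi> \<oplus>\<^bsub>K\<^esub> \<psi> \<oplus>\<^bsub>K\<^esub> \<chi> = \<phi> \<oplus>\<^bsub>K\<^esub> (\<psi> \<oplus>\<^bsub>K\<^esub> \<chi>)"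
      using h unfolding mem add by (intro restrict_ext) (auto simp: Pi_iff P.M.a_assoc)
  next
    show "\<zero>\<^bsub>K\<^esub> \<in> carrier K" unfolding mem zero by auto
    fix \<phi> assume h: "\<phi> \<in> carrier K"
    show "\<zero>\<^bsub>K\<^esub> \<oplus>\<^bsub>K\<^esub> \<phi> = \<phi>"
    proof (rule extensionalityI)
      show "\<phi> \<in> extensional (carrier M0)" using h unfolding mem by blast
      show "\<zero>\<^bsub>K\<^esub> \<oplus>\<^bsub>K\<^esub> \<phi> \<in> extensional (carrier M0)" unfolding add by simp
    qed (use h in \<open>auto simp: mem add zero Pi_iff\<close>)
    show "\<exists>y\<in>carrier K. y \<oplus>\<^bsub>K\<^esub> \<phi> = \<zero>\<^bsub>K\<^esub>" using neg[OF h] negl[OF h] by blast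
  qed
  show "\<ominus>\<^bsub>K\<^esub> \<phi> = (\<lambda>x\<in>carrier M0. \<ominus>\<^bsub>P\<^esub> \<phi> x)" if "\<phi> \<in> carrier K"
    using abelian_group.minus_equality[OF gr negl[OF that] that neg[OF that]] .
qed

context char_p_ring begin

lemma frob_push_simps [simp]:
  "carrier (frob_push R p e (self_module R)) = carrier R" "add (frob_push R p e (self_module R)) = add R"
  "\<zero>\<^bsub>frob_push R p e (self_module R)\<^esub> = \<zero>"
  "r \<odot>\<^bsub>frob_push R p e (self_module R)\<^esub> x = r [^] (p ^ e) \<otimes> x"
  by (simp_all add: frob_push_def restrict_scalars_def)

lemma frob_push_module: "module R (frob_push R p e (self_module R))"
proof (rule moduleI)
  show "abelian_group (frob_push R p e (self_module R))"
    by (rule abelian_groupI) (auto simp: a_ac intro: l_neg)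
qed (auto simp: is_cring frob_add l_distr r_distr nat_pow_distrib m_assoc)

lemma mem_diff_ops:
  "d \<in> carrier (diff_ops R p e) \<longleftrightarrow> d \<in> extensional (carrier R) \<and> d \<in> carrier R \<rightarrow> carrier R \<and>
    (\<forall>x\<in>carrier R. \<forall>y\<in>carrier R. d (x \<oplus> y) = d x \<oplus> d y) \<and>
    (\<forall>r\<in>carrier R. \<forall>x\<in>carrier R. d (r [^] (p ^ e) \<otimes> x) = r [^] (p ^ e) \<otimes> d x)"
  by (simp add: diff_ops_def Let_def Hom_module_def linear_map_def)

lemma diff_ops_simps:
  "monoid.mult (diff_ops R p e) = compose (carrier R)" "one (diff_ops R p e) = (\<lambda>x\<in>carrier R. x)"
  "\<zero>\<^bsub>diff_ops R p e\<^esub> = (\<lambda>x\<in>carrier R. \<zero>)" "add (diff_ops R p e) = (\<lambda>\<phi> \<psi>. \<lambda>x\<in>carrier R. \<phi> x \<oplus> \<psi> x)"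
  by (simp_all add: diff_ops_def Let_def)

lemma diff_ops_group: "abelian_group (diff_ops R p e)"
  and diff_ops_minus: "d \<in> carrier (diff_ops R p e) \<Longrightarrow> \<ominus>\<^bsub>diff_ops R p e\<^esub> d = (\<lambda>x\<in>carrier R. \<ominus> d x)"
proof -
  let ?F = "frob_push R p e (self_module R)"
  have K: "carrier (diff_ops R p e) = Hom_module R ?F ?F" "\<zero>\<^bsub>diff_ops R p e\<^esub> = (\<lambda>x\<in>carrier ?F. \<zero>\<^bsub>?F\<^esub>)"
    "add (diff_ops R p e) = (\<lambda>\<phi> \<psi>. \<lambda>x\<in>carrier ?F. \<phi> x \<oplus>\<^bsub>?F\<^esub> \<psi> x)"
    by (simp_all add: diff_ops_def Let_def)
  show "abelian_group (diff_ops R p e)" by (rule pointwise_group(1)[OF K frob_push_module frob_push_module])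
  show "\<ominus>\<^bsub>diff_ops R p e\<^esub> d = (\<lambda>x\<in>carrier R. \<ominus> d x)" if "d \<in> carrier (diff_ops R p e)"
    using pointwise_group(2)[OF K frob_push_module frob_push_module that] by (simp add: a_inv_def m_inv_def)
qed

lemma diff_ops_compose:
  "d \<in> carrier (diff_ops R p e) \<Longrightarrow> d' \<in> carrier (diff_ops R p e) \<Longrightarrow> compose (carrier R) d d' \<in> carrier (diff_ops R p e)"
  unfolding mem_diff_ops by (auto simp: compose_def Pi_iff)

lemma diff_ops_one: "(\<lambda>x\<in>carrier R. x) \<in> carrier (diff_ops R p e)"
  unfolding mem_diff_ops by auto

lemma generate_ring_diff_ops:
  assumes "H \<subseteq> carrier (diff_ops R p e)" shows "generate_ring (diff_ops R p e) H \<subseteq> carrier (diff_ops R p e)"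
proof
  interpret D: abelian_group "diff_ops R p e" by (rule diff_ops_group)
  fix d assume "d \<in> generate_ring (diff_ops R p e) H"
  then show "d \<in> carrier (diff_ops R p e)"
  proof (induction rule: generate_ring.induct)
    case one
    show ?case unfolding diff_ops_simps by (rule diff_ops_one)
  next
    case (eng_mult h1 h2)
    then show ?case using diff_ops_compose by (simp add: diff_ops_simps)
  qed (use assms in auto)
qed

lemma frob_shriek_simps:
  "\<zero>\<^bsub>frob_shriek R p e P\<^esub> = (\<lambda>x\<in>carrier R. \<zero>\<^bsub>P\<^esub>)"
  "add (frob_shriek R p e P) = (\<lambda>\<phi> \<psi>. \<lambda>x\<in>carrier R. \<phi> x \<oplus>\<^bsub>P\<^esub> \<psi> x)"
  "smult (frob_shriek R p e P) = (\<lambda>d \<phi>. compose (carrier R) \<phi> d)"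
  by (simp_all add: frob_shriek_def)

lemma mem_frob_shriek:
  "\<phi> \<in> carrier (frob_shriek R p e P) \<longleftrightarrow> \<phi> \<in> extensional (carrier R) \<and> \<phi> \<in> carrier R \<rightarrow> carrier P \<and>
    (\<forall>x\<in>carrier R. \<forall>y\<in>carrier R. \<phi> (x \<oplus> y) = \<phi> x \<oplus>\<^bsub>P\<^esub> \<phi> y) \<and>
    (\<forall>r\<in>carrier R. \<forall>x\<in>carrier R. \<phi> (r [^] (p ^ e) \<otimes> x) = r \<odot>\<^bsub>P\<^esub> \<phi> x)"
  by (simp add: frob_shriek_def Hom_module_def linear_map_def)

lemma frob_shriek_group:
  assumes "module R P"
  shows "abelian_group (frob_shriek R p e P)"
    "\<phi> \<in> carrier (frob_shriek R p e P) \<Longrightarrow> \<ominus>\<^bsub>frob_shriek R p e P\<^esub> \<phi> = (\<lambda>x\<in>carrier R. \<ominus>\<^bsub>P\<^esub> \<phi> x)"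
proof -
  let ?F = "frob_push R p e (self_module R)"
  have K: "carrier (frob_shriek R p e P) = Hom_module R ?F P" "\<zero>\<^bsub>frob_shriek R p e P\<^esub> = (\<lambda>x\<in>carrier ?F. \<zero>\<^bsub>P\<^esub>)"
    "add (frob_shriek R p e P) = (\<lambda>\<phi> \<psi>. \<lambda>x\<in>carrier ?F. \<phi> x \<oplus>\<^bsub>P\<^esub> \<psi> x)"
    by (simp_all add: frob_shriek_def)
  show "abelian_group (frob_shriek R p e P)" by (rule pointwise_group(1)[OF K assms frob_push_module])
  show "\<ominus>\<^bsub>frob_shriek R p e P\<^esub> \<phi> = (\<lambda>x\<in>carrier R. \<ominus>\<^bsub>P\<^esub> \<phi> x)" if "\<phi> \<in> carrier (frob_shriek R p e P)"
    using pointwise_group(2)[OF K assms frob_push_module that] by simp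
qed

lemma frob_shriek_compose:
  "\<phi> \<in> carrier (frob_shriek R p e P) \<Longrightarrow> d \<in> carrier (diff_ops R p e) \<Longrightarrow>
    compose (carrier R) \<phi> d \<in> carrier (frob_shriek R p e P)"
  unfolding mem_diff_ops mem_frob_shriek by (auto simp: compose_def Pi_iff)

end

section \<open>The graph embedding and operators on polynomials\<close>

locale graph_setup = cartier R M p \<kappa> + char_p_ring R p
  for R :: "'a ring" (structure) and M :: "('a, 'c) module" (structure) and p \<kappa> +
  fixes f :: 'a and e :: nat
  assumes f: "f \<in> carrier R"
begin

abbreviation A where "A \<equiv> UP R"
abbreviation q where "q \<equiv> p ^ e"
abbreviation \<gamma> where "\<gamma> \<equiv> graph_hom R f"
abbreviation mon where "mon \<equiv> up_ring.monom (UP R)"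
abbreviation cf where "cf \<equiv> up_ring.coeff (UP R)"

sublocale U: UP_cring R "UP R"
  by (intro UP_cring.intro cring_axioms) simp

sublocale UE: UP_pre_univ_prop R R id "UP R"
  by (intro UP_pre_univ_propI is_cring id_ring_hom) 

lemma \<gamma>_hom: "\<gamma> \<in> ring_hom A R"
  unfolding graph_hom_def using f by (rule UE.eval_ring_hom)

lemma \<gamma>_closed [simp]: "s \<in> carrier A \<Longrightarrow> \<gamma> s \<in> carrier R"
  by (rule ring_hom_closed[OF \<gamma>_hom])

lemma \<gamma>_mult: "s \<in> carrier A \<Longrightarrow> t \<in> carrier A \<Longrightarrow> \<gamma> (s \<otimes>\<^bsub>A\<^esub> t) = \<gamma> s \<otimes> \<gamma> t"
  by (rule ring_hom_mult[OF \<gamma>_hom])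

lemma \<gamma>_add: "s \<in> carrier A \<Longrightarrow> t \<in> carrier A \<Longrightarrow> \<gamma> (s \<oplus>\<^bsub>A\<^esub> t) = \<gamma> s \<oplus> \<gamma> t"
  by (rule ring_hom_add[OF \<gamma>_hom])

lemma \<gamma>_pow: "s \<in> carrier A \<Longrightarrow> \<gamma> (s [^]\<^bsub>A\<^esub> (n::nat)) = \<gamma> s [^] n"
  by (induction n) (simp_all add: \<gamma>_mult ring_hom_one[OF \<gamma>_hom])

lemma \<gamma>_mon: "r \<in> carrier R \<Longrightarrow> \<gamma> (mon r n) = r \<otimes> f [^] n"
  unfolding graph_hom_def using UE.eval_monom[of r f n] f by simp

lemma char_p_A: "char_p_ring A p"
proof -
  have c: "cf ([(n::nat)] \<cdot>\<^bsub>A\<^esub> s) k = [n] \<cdot> cf s k" if "s \<in> carrier A" for n s k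
    by (induction n) (use that in simp_all)
  have "[p] \<cdot>\<^bsub>A\<^esub> \<one>\<^bsub>A\<^esub> = \<zero>\<^bsub>A\<^esub>"
  proof (rule U.up_eqI)
    show "cf ([p] \<cdot>\<^bsub>A\<^esub> \<one>\<^bsub>A\<^esub>) n = cf \<zero>\<^bsub>A\<^esub> n" for n by (simp add: c char_p)
  qed auto
  then show ?thesis using prime_p by unfold_locales
qed

sublocale CA: char_p_ring A p by (rule char_p_A)

lemma poly_induct [consumes 1, case_names mon add]:
  assumes s: "s \<in> carrier A" and base: "\<And>r n. r \<in> carrier R \<Longrightarrow> P (mon r n)"
    and add: "\<And>s t. s \<in> carrier A \<Longrightarrow> t \<in> carrier A \<Longrightarrow> P s \<Longrightarrow> P t \<Longrightarrow> P (s \<oplus>\<^bsub>A\<^esub> t)"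
  shows "P s"
proof -
  have "P (\<Oplus>\<^bsub>A\<^esub>i\<in>{..n}. mon (cf s i) i)" for n :: nat
  proof (induction n)
    case 0
    then show ?case using base s by simp
  next
    case (Suc n)
    then show ?case using base s add by simp
  qed
  then show ?thesis using U.up_repr[OF s] by metis
qed

lemma additive_ext:
  assumes "\<And>s t. s \<in> carrier A \<Longrightarrow> t \<in> carrier A \<Longrightarrow> \<phi> (s \<oplus>\<^bsub>A\<^esub> t) = pl (\<phi> s) (\<phi> t)"
    "\<And>s t. s \<in> carrier A \<Longrightarrow> t \<in> carrier A \<Longrightarrow> \<psi> (s \<oplus>\<^bsub>A\<^esub> t) = pl (\<psi> s) (\<psi> t)"
    "\<And>r n. r \<in> carrier R \<Longrightarrow> \<phi> (mon r n) = \<psi> (mon r n)" "s \<in> carrier A"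
  shows "\<phi> s = \<psi> s"
  using assms(4) by (induction rule: poly_induct) (simp_all add: assms)

lemma mon_pow_q: "r \<in> carrier R \<Longrightarrow> mon r b [^]\<^bsub>A\<^esub> (q::nat) = mon (r [^] q) (b * q)"
  by (rule U.monom_pow)

text \<open>Both s and x enter additively, in s because the Frobenius is additive, so the identity
  may be tested on monomials. It is used for operators on R[t] and for maps into M through
  \<gamma>.\<close>

lemma frob_linear_ext:
  assumes V: "module A V" and cl: "\<phi> \<in> carrier A \<rightarrow> carrier V"
    and add: "\<And>s t. s \<in> carrier A \<Longrightarrow> t \<in> carrier A \<Longrightarrow> \<phi> (s \<oplus>\<^bsub>A\<^esub> t) = \<phi> s \<oplus>\<^bsub>V\<^esub> \<phi> t"
    and mon: "\<And>r b c n. r \<in> carrier R \<Longrightarrow> c \<in> carrier R \<Longrightarrow> \<phi> (mon (r [^] q \<otimes> c) (b * q + n)) = mon r b \<odot>\<^bsub>V\<^esub> \<phi> (mon c n)"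
    and s: "s \<in> carrier A" and x: "x \<in> carrier A"
  shows "\<phi> (s [^]\<^bsub>A\<^esub> q \<otimes>\<^bsub>A\<^esub> x) = s \<odot>\<^bsub>V\<^esub> \<phi> x"
proof -
  interpret V: module A V by (rule V)
  have cl': "\<phi> y \<in> carrier V" if "y \<in> carrier A" for y using cl that by blast
  have monr: "\<phi> (mon r b [^]\<^bsub>A\<^esub> q \<otimes>\<^bsub>A\<^esub> x) = mon r b \<odot>\<^bsub>V\<^esub> \<phi> x" if r: "r \<in> carrier R" for r b
    using x
  proof (induction rule: poly_induct)
    case (mon c n)
    then show ?case using assms(4)[OF r mon, of b n] r by (simp add: mon_pow_q)
  next
    case (add s t)
    then show ?case using r cl' by (simp add: U.P.r_distr assms(3) V.smult_r_distr)
  qed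
  show ?thesis using s
  proof (induction rule: poly_induct)
    case (mon r n)
    then show ?case by (rule monr)
  next
    case (add s t)
    then show ?case using x cl' by (simp add: CA.frob_add U.P.l_distr assms(3) V.smult_l_distr)
  qed
qed

text \<open>Operators that act on each coefficient in a way depending on its exponent. This common
  form covers operators of R acting on coefficients, Euler operators and projections onto sets of
  exponents.\<close>

definition cop :: "(nat \<Rightarrow> 'a \<Rightarrow> 'a) \<Rightarrow> (nat \<Rightarrow> 'a) \<Rightarrow> (nat \<Rightarrow> 'a)" where
  "cop h = (\<lambda>s\<in>carrier A. \<lambda>n. h n (cf s n))"

definition adm :: "(nat \<Rightarrow> 'a \<Rightarrow> 'a) \<Rightarrow> bool" where
  "adm h \<longleftrightarrow> (\<forall>n. h n \<in> carrier R \<rightarrow> carrier R \<and> (\<forall>x\<in>carrier R. \<forall>y\<in>carrier R. h n (x \<oplus> y) = h n x \<oplus> h n y))"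

lemma adm_zero:
  assumes "adm h" shows "h n \<zero> = \<zero>"
proof -
  have h: "h n \<zero> \<in> carrier R" "h n (\<zero> \<oplus> \<zero>) = h n \<zero> \<oplus> h n \<zero>"
    using assms R.zero_closed unfolding adm_def by blast+
  then show ?thesis using R.add.r_cancel_one'[OF h(1) h(1)] by simp
qed

lemma cop_closed: 
  assumes "adm h" "s \<in> carrier A" shows "cop h s \<in> carrier A" "cf (cop h s) n = h n (cf s n)"
proof -
  have cA: "carrier A = up R" by (simp add: UP_def)
  have cf: "cf t n = t n" if t: "t \<in> up R" for t n
    unfolding UP_def up_ring.simps restrict_apply using t by (simp only: if_True)
  have s: "s \<in> up R" using assms(2) cA by simp
  obtain N where N: "bound \<zero> N s" using s by (auto simp: up_def)
  have up: "(\<lambda>n. h n (s n)) \<in> up R"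
  proof (rule mem_upI)
    fix n
    have "s n \<in> carrier R" using s by (rule mem_upD)
    then show "h n (s n) \<in> carrier R" using assms(1) unfolding adm_def by blast
  next
    have "bound \<zero> N (\<lambda>n. h n (s n))" using N adm_zero[OF assms(1)] by (auto simp: bound_def)
    then show "\<exists>n. bound \<zero> n (\<lambda>n. h n (s n))" by blast
  qed
  have eq: "cop h s = (\<lambda>n. h n (s n))" using assms(2) cf[OF s] by (simp add: cop_def)
  show "cop h s \<in> carrier A" unfolding eq cA by (rule up)
  show "cf (cop h s) n = h n (cf s n)" unfolding eq cf[OF up] cf[OF s] ..
qed

lemma cop_mon: "adm h \<Longrightarrow> r \<in> carrier R \<Longrightarrow> cop h (mon r n) = mon (h n r) n"
proof (rule U.up_eqI)
  assume h: "adm h" and r: "r \<in> carrier R"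
  have hr: "h n r \<in> carrier R" using h r unfolding adm_def by blast
  show "cf (cop h (mon r n)) k = cf (mon (h n r) n) k" for k
    using r hr adm_zero[OF h] by (simp add: cop_closed[OF h])
  show "cop h (mon r n) \<in> carrier A" using cop_closed[OF h] r by simp
  show "mon (h n r) n \<in> carrier A" using hr by simp
qed

lemma cop_add: "adm h \<Longrightarrow> s \<in> carrier A \<Longrightarrow> t \<in> carrier A \<Longrightarrow> cop h (s \<oplus>\<^bsub>A\<^esub> t) = cop h s \<oplus>\<^bsub>A\<^esub> cop h t"
  by (rule U.up_eqI) (auto simp: cop_closed adm_def)

text \<open>Multiplication by the p^e-th power of r t^b shifts exponents by b p^e, which is why
  periodicity in the exponent is required besides linearity on coefficients.\<close>

lemma cop_diff_ops:
  assumes h: "adm h" and per: "\<And>n b x. x \<in> carrier R \<Longrightarrow> h (b * q + n) x = h n x"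
    and lin: "\<And>n r x. r \<in> carrier R \<Longrightarrow> x \<in> carrier R \<Longrightarrow> h n (r [^] q \<otimes> x) = r [^] q \<otimes> h n x"
  shows "cop h \<in> carrier (diff_ops A p e)"
  unfolding CA.mem_diff_ops
proof (intro conjI ballI)
  show "cop h \<in> extensional (carrier A)" by (simp add: cop_def)
  show "cop h \<in> carrier A \<rightarrow> carrier A" using cop_closed[OF h] by blast
  show "cop h (x \<oplus>\<^bsub>A\<^esub> y) = cop h x \<oplus>\<^bsub>A\<^esub> cop h y" if "x \<in> carrier A" "y \<in> carrier A" for x y by (rule cop_add[OF h that])
  fix s x assume s: "s \<in> carrier A" and x: "x \<in> carrier A"
  have "cop h (s [^]\<^bsub>A\<^esub> q \<otimes>\<^bsub>A\<^esub> x) = s \<odot>\<^bsub>frob_push A p e (self_module A)\<^esub> cop h x"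
  proof (rule frob_linear_ext[OF CA.frob_push_module _ _ _ s x])
    show "cop h \<in> carrier A \<rightarrow> carrier (frob_push A p e (self_module A))" using cop_closed[OF h] by simp
    show "cop h (s \<oplus>\<^bsub>A\<^esub> t) = cop h s \<oplus>\<^bsub>frob_push A p e (self_module A)\<^esub> cop h t" if "s \<in> carrier A" "t \<in> carrier A" for s t
      using cop_add[OF h that] by simp
    fix r c b n assume r: "r \<in> carrier R" and c: "c \<in> carrier R"
    have hc: "h n c \<in> carrier R" using h c unfolding adm_def by blast
    show "cop h (mon (r [^] q \<otimes> c) (b * q + n)) = mon r b \<odot>\<^bsub>frob_push A p e (self_module A)\<^esub> cop h (mon c n)"
      using r c hc by (simp add: cop_mon[OF h] per lin mon_pow_q flip: U.monom_mult)
  qed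
  then show "cop h (s [^]\<^bsub>A\<^esub> q \<otimes>\<^bsub>A\<^esub> x) = s [^]\<^bsub>A\<^esub> q \<otimes>\<^bsub>A\<^esub> cop h x" by simp
qed

text \<open>The diagonal operator multiplying t^n by g n. Only g modulo p matters, sums of weights
  give sums of operators and products of weights give composites, so membership in the Euler algebra
  becomes arithmetic of functions on exponents.\<close>

definition dg :: "(nat \<Rightarrow> nat) \<Rightarrow> (nat \<Rightarrow> 'a) \<Rightarrow> (nat \<Rightarrow> 'a)" where
  "dg g = cop (\<lambda>n x. [(g n)] \<cdot> x)"

lemma adm_dg: "adm (\<lambda>n x. [(g n :: nat)] \<cdot> x)"
  unfolding adm_def
proof (intro allI conjI ballI)
  fix n x y assume h: "x \<in> carrier R" "y \<in> carrier R"
  then show "[g n] \<cdot> (x \<oplus> y) = [g n] \<cdot> x \<oplus> [g n] \<cdot> y"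
    unfolding add_pow_eq_mult_one[OF h(1)] add_pow_eq_mult_one[OF h(2)] add_pow_eq_mult_one[OF R.a_closed[OF h]]
    by (simp add: r_distr)
qed auto

lemma add_pow_mod: "x \<in> carrier R \<Longrightarrow> [(a mod p)] \<cdot> x = [(a::nat)] \<cdot> x"
proof -
  assume x: "x \<in> carrier R"
  have "[a] \<cdot> x = [(p * (a div p) + a mod p)] \<cdot> x" by simp
  also have "\<dots> = [(p * (a div p))] \<cdot> x \<oplus> [(a mod p)] \<cdot> x" using x by (rule R.add.nat_pow_mult[symmetric])
  also have "[(p * (a div p))] \<cdot> x = \<zero>" using x by (intro char_p_dvd) auto
  finally show ?thesis using x by simp
qed

lemma add_pow_cong: "x \<in> carrier R \<Longrightarrow> a mod p = b mod p \<Longrightarrow> [(a::nat)] \<cdot> x = [(b::nat)] \<cdot> x"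
  by (metis add_pow_mod)

lemma dg_cong: "(\<And>n. g n mod p = g' n mod p) \<Longrightarrow> dg g = dg g'"
  unfolding dg_def cop_def by (intro restrict_ext ext add_pow_cong U.coeff_closed)

lemma dg_mon: "r \<in> carrier R \<Longrightarrow> dg g (mon r n) = mon ([(g n)] \<cdot> r) n"
  unfolding dg_def by (rule cop_mon[OF adm_dg])

lemma dg_closed: "s \<in> carrier A \<Longrightarrow> dg g s \<in> carrier A"
  unfolding dg_def by (rule cop_closed(1)[OF adm_dg])

lemma euler_dg: "euler_op R a = dg (\<lambda>n. n choose a)"
  by (simp add: euler_op_def dg_def cop_def)

lemma dg_diff_ops:
  assumes "\<And>n b. g (b * q + n) mod p = g n mod p" shows "dg g \<in> carrier (diff_ops A p e)"
  unfolding dg_def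
proof (rule cop_diff_ops[OF adm_dg])
  show "[(g (b * q + n))] \<cdot> x = [(g n)] \<cdot> x" if "x \<in> carrier R" for n b x
    using add_pow_cong[OF that assms] .
qed (simp add: add_pow_rdistr)

text \<open>By Lucas the weight is the digit with index j of the exponent. For j < e it is
  unaffected by multiples of p^e, which puts the Euler operator at level e.\<close>

lemma choose_periodic: "j < e \<Longrightarrow> (b * q + n choose p ^ j) mod p = (n choose p ^ j) mod p"
  using div_mod_add_prime_power[OF p_pos, of j e n b] by (simp add: choose_prime_power_mod[OF p_prime] add.commute)

lemma on_coeffs_cop: "on_coeffs R d = cop (\<lambda>_. d)"
  by (simp add: on_coeffs_def cop_def)

lemma adm_diff_op: "d \<in> carrier (diff_ops R p e) \<Longrightarrow> adm (\<lambda>_. d)"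
  by (simp add: adm_def mem_diff_ops)

lemma on_coeffs_mon: "d \<in> carrier (diff_ops R p e) \<Longrightarrow> r \<in> carrier R \<Longrightarrow> on_coeffs R d (mon r n) = mon (d r) n"
  unfolding on_coeffs_cop by (rule cop_mon[OF adm_diff_op])

section \<open>The Euler algebra and its residue projections\<close>

abbreviation D where "D \<equiv> euler_algebra R p e"

lemma D_gens: "on_coeffs R ` carrier (diff_ops R p e) \<union> {euler_op R (p ^ j) | j. j < e} \<subseteq> carrier (diff_ops A p e)"
proof -
  have "on_coeffs R d \<in> carrier (diff_ops A p e)" if d: "d \<in> carrier (diff_ops R p e)" for d
    unfolding on_coeffs_cop using d by (intro cop_diff_ops adm_diff_op[OF d]) (simp_all add: mem_diff_ops)
  moreover have "euler_op R (p ^ j) \<in> carrier (diff_ops A p e)" if "j < e" for j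
    unfolding euler_dg using choose_periodic[OF that] by (rule dg_diff_ops)
  ultimately show ?thesis by blast
qed

lemma D_carrier: "D \<subseteq> carrier (diff_ops A p e)"
  unfolding euler_algebra_def by (rule CA.generate_ring_diff_ops[OF D_gens])

lemma D_on_coeffs: "d \<in> carrier (diff_ops R p e) \<Longrightarrow> on_coeffs R d \<in> D"
  unfolding euler_algebra_def by (rule generate_ring.incl) blast

lemma D_euler: "j < e \<Longrightarrow> euler_op R (p ^ j) \<in> D"
  unfolding euler_algebra_def by (rule generate_ring.incl) blast

lemma D_compose: "d \<in> D \<Longrightarrow> d' \<in> D \<Longrightarrow> compose (carrier A) d d' \<in> D"
  unfolding euler_algebra_def using generate_ring.eng_mult[of d "diff_ops A p e" _ d'] by (simp add: CA.diff_ops_simps)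

lemma cf_dg: "s \<in> carrier A \<Longrightarrow> cf (dg g s) n = [(g n)] \<cdot> cf s n"
  unfolding dg_def by (rule cop_closed(2)[OF adm_dg])

lemma dg_extensional: "dg g \<in> extensional (carrier A)"
  by (simp add: dg_def cop_def)

lemma D_dg_one: "dg (\<lambda>_. Suc 0) \<in> D"
proof -
  have "dg (\<lambda>_. Suc 0) s = s" if s: "s \<in> carrier A" for s
    by (rule U.up_eqI) (use s in \<open>simp_all add: dg_closed cf_dg\<close>)
  then have "dg (\<lambda>_. Suc 0) = (\<lambda>s\<in>carrier A. s)"
    by (intro extensionalityI[OF dg_extensional restrict_extensional]) simp
  then show ?thesis unfolding euler_algebra_def using generate_ring.one[of "diff_ops A p e"] by (simp add: CA.diff_ops_simps)
qed

lemma D_dg_add: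
  assumes "dg g \<in> D" "dg g' \<in> D" shows "dg (\<lambda>n. g n + g' n) \<in> D"
proof -
  have "dg (\<lambda>n. g n + g' n) s = dg g s \<oplus>\<^bsub>A\<^esub> dg g' s" if s: "s \<in> carrier A" for s
    by (rule U.up_eqI) (use s in \<open>simp_all add: dg_closed cf_dg R.add.nat_pow_mult\<close>)
  then have "dg (\<lambda>n. g n + g' n) = (\<lambda>s\<in>carrier A. dg g s \<oplus>\<^bsub>A\<^esub> dg g' s)"
    by (intro extensionalityI[OF dg_extensional restrict_extensional]) simp
  also have "\<dots> = dg g \<oplus>\<^bsub>diff_ops A p e\<^esub> dg g'" by (simp add: CA.diff_ops_simps)
  finally show ?thesis using assms unfolding euler_algebra_def by (simp add: generate_ring.eng_add)
qed

lemma D_dg_mult: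
  assumes "dg g \<in> D" "dg g' \<in> D" shows "dg (\<lambda>n. g n * g' n) \<in> D"
proof -
  have "dg (\<lambda>n. g n * g' n) s = dg g (dg g' s)" if s: "s \<in> carrier A" for s
    by (rule U.up_eqI) (use s in \<open>simp_all add: dg_closed cf_dg R.add.nat_pow_pow mult.commute\<close>)
  then have "dg (\<lambda>n. g n * g' n) = compose (carrier A) (dg g) (dg g')"
    by (intro extensionalityI[OF dg_extensional compose_extensional]) (simp add: compose_eq)
  then show ?thesis using D_compose[OF assms] by simp
qed

lemma D_dg_const: "dg (\<lambda>_. Suc c) \<in> D"
  by (induction c) (use D_dg_one D_dg_add[OF D_dg_one] in auto)

lemma D_dg_power: "dg g \<in> D \<Longrightarrow> dg (\<lambda>n. g n ^ k) \<in> D"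
  by (induction k) (simp_all add: D_dg_one D_dg_mult)

text \<open>The projection onto the exponents congruent to m modulo p^e is the product over j < e of
  the indicators that the j-th digit agrees with that of m. Each factor is a polynomial with natural
  coefficients in one Euler operator.\<close>

lemma D_dg_indicator:
  assumes "m < q" shows "dg (\<lambda>n. if n mod q = m then 1 else 0) \<in> D"
proof -
  define ind where "ind j n = (1 + (p - 1) * ((n choose p ^ j) + (p - m div p ^ j mod p)) ^ (p - 1))" for j n
  have p1: "p > 1" using p_prime prime_gt_1_nat by blast
  have pd: "\<exists>c. p - m div p ^ j mod p = Suc c" for j
    using p1 by (metis Suc_diff_Suc mod_less_divisor less_trans zero_less_one)
  have ind: "dg (ind j) \<in> D" if j: "j < e" for j
  proof -
    obtain c where c: "p - m div p ^ j mod p = Suc c" using pd by blast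
    obtain c' where c': "p - 1 = Suc c'" using p1 by (metis Suc_diff_Suc One_nat_def)
    have "dg (\<lambda>n. (n choose p ^ j) + Suc c) \<in> D"
      using D_dg_add[OF D_euler[OF j, unfolded euler_dg] D_dg_const] .
    then have "dg (\<lambda>n. ((n choose p ^ j) + Suc c) ^ Suc c') \<in> D" by (rule D_dg_power)
    then have "dg (\<lambda>n. Suc c' * ((n choose p ^ j) + Suc c) ^ Suc c') \<in> D" by (rule D_dg_mult[OF D_dg_const])
    then have "dg (\<lambda>n. Suc 0 + Suc c' * ((n choose p ^ j) + Suc c) ^ Suc c') \<in> D" by (rule D_dg_add[OF D_dg_one])
    moreover have "ind j = (\<lambda>n. Suc 0 + Suc c' * ((n choose p ^ j) + Suc c) ^ Suc c')"
      unfolding ind_def c One_nat_def c'[unfolded One_nat_def] ..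
    ultimately show ?thesis by simp
  qed
  have ind_mod: "ind j n mod p = (if n div p ^ j mod p = m div p ^ j mod p then 1 else 0)" for j n
    unfolding ind_def using indicator_mod[OF p_prime, of "m div p ^ j mod p" "n choose p ^ j"] p1
    by (simp add: choose_prime_power_mod[OF p_prime])
  have "k \<le> e \<Longrightarrow> dg (\<lambda>n. \<Prod>j<k. ind j n) \<in> D" for k
  proof (induction k)
    case (Suc k)
    then show ?case using D_dg_mult[OF Suc.IH ind[of k]] by simp
  qed (simp add: D_dg_one)
  then have "dg (\<lambda>n. \<Prod>j<e. ind j n) \<in> D" by simp
  also have "dg (\<lambda>n. \<Prod>j<e. ind j n) = dg (\<lambda>n. if n mod q = m then 1 else 0)"
  proof (rule dg_cong)
    fix n
    have "(\<Prod>j<e. ind j n) mod p = (\<Prod>j<e. ind j n mod p) mod p" by (simp add: mod_prod_eq)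
    also have "(\<Prod>j<e. ind j n mod p) = (if n mod q = m then 1 else 0)"
    proof (cases "n mod q = m")
      case True
      have "n div p ^ j mod p = m div p ^ j mod p" if "j < e" for j
        using div_mod_add_prime_power[OF p_pos that, of m "n div q"] True by (metis add.commute div_mult_mod_eq)
      then show ?thesis using True by (simp add: ind_mod)
    next
      case False
      then have "n mod q \<noteq> m mod q" using assms by simp
      then obtain j where j: "j < e" "n div p ^ j mod p \<noteq> m div p ^ j mod p" using mod_prime_power_eqI by blast
      then have "(\<Prod>j<e. ind j n mod p) = 0" by (intro prod_zero) (auto simp: ind_mod)
      then show ?thesis using False by simp
    qed
    finally show "(\<Prod>j<e. ind j n) mod p = (if n mod q = m then 1 else 0) mod p" .
  qed
  finally show ?thesis .
qed

end

section \<open>The span of the adjoint\<close>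

context graph_setup begin

abbreviation gM where "gM \<equiv> restrict_scalars \<gamma> M"
abbreviation Pm where "Pm \<equiv> frob_shriek A p e gM"

lemma gM_simps [simp]: "carrier gM = carrier M" "add gM = add M" "\<zero>\<^bsub>gM\<^esub> = \<zero>\<^bsub>M\<^esub>" "s \<odot>\<^bsub>gM\<^esub> x = \<gamma> s \<odot>\<^bsub>M\<^esub> x"
  by (simp_all add: restrict_scalars_def)

lemma gM_minus: "\<ominus>\<^bsub>gM\<^esub> x = \<ominus>\<^bsub>M\<^esub> x"
  by (simp add: a_inv_def m_inv_def)

lemma gM_module: "module A gM"
proof (rule moduleI)
  show "abelian_group gM"
    by (rule abelian_groupI) (auto simp: M.a_ac intro: M.l_neg)
qed (auto simp: U.P.is_cring \<gamma>_add \<gamma>_mult smult_l_distr smult_r_distr smult_assoc1 ring_hom_one[OF \<gamma>_hom])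

lemma P_group: "abelian_group Pm"
  by (rule CA.frob_shriek_group(1)[OF gM_module])

lemma P_minus: "\<phi> \<in> carrier Pm \<Longrightarrow> s \<in> carrier A \<Longrightarrow> (\<ominus>\<^bsub>Pm\<^esub> \<phi>) s = \<ominus>\<^bsub>M\<^esub> \<phi> s"
  by (simp add: CA.frob_shriek_group(2)[OF gM_module] gM_minus)

lemma P_add: "s \<in> carrier A \<Longrightarrow> (\<phi> \<oplus>\<^bsub>Pm\<^esub> \<psi>) s = \<phi> s \<oplus>\<^bsub>M\<^esub> \<psi> s"
  by (simp add: CA.frob_shriek_simps)

lemma P_zero: "s \<in> carrier A \<Longrightarrow> \<zero>\<^bsub>Pm\<^esub> s = \<zero>\<^bsub>M\<^esub>"
  by (simp add: CA.frob_shriek_simps)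

lemma P_smult: "d \<odot>\<^bsub>Pm\<^esub> \<phi> = compose (carrier A) \<phi> d"
  by (simp add: CA.frob_shriek_simps)

lemma mem_P:
  "\<phi> \<in> carrier Pm \<longleftrightarrow> \<phi> \<in> extensional (carrier A) \<and> \<phi> \<in> carrier A \<rightarrow> carrier M \<and>
    (\<forall>x\<in>carrier A. \<forall>y\<in>carrier A. \<phi> (x \<oplus>\<^bsub>A\<^esub> y) = \<phi> x \<oplus>\<^bsub>M\<^esub> \<phi> y) \<and>
    (\<forall>s\<in>carrier A. \<forall>x\<in>carrier A. \<phi> (s [^]\<^bsub>A\<^esub> q \<otimes>\<^bsub>A\<^esub> x) = \<gamma> s \<odot>\<^bsub>M\<^esub> \<phi> x)"
  unfolding CA.mem_frob_shriek by simp

lemma PD: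
  assumes "\<phi> \<in> carrier Pm"
  shows "\<phi> \<in> extensional (carrier A)" "s \<in> carrier A \<Longrightarrow> \<phi> s \<in> carrier M"
    "s \<in> carrier A \<Longrightarrow> t \<in> carrier A \<Longrightarrow> \<phi> (s \<oplus>\<^bsub>A\<^esub> t) = \<phi> s \<oplus>\<^bsub>M\<^esub> \<phi> t"
    "s \<in> carrier A \<Longrightarrow> t \<in> carrier A \<Longrightarrow> \<phi> (s [^]\<^bsub>A\<^esub> q \<otimes>\<^bsub>A\<^esub> t) = \<gamma> s \<odot>\<^bsub>M\<^esub> \<phi> t"
  using assms unfolding mem_P by blast+

lemma P_mon_add: "\<phi> \<in> carrier Pm \<Longrightarrow> r \<in> carrier R \<Longrightarrow> r' \<in> carrier R \<Longrightarrow> \<phi> (mon (r \<oplus> r') n) = \<phi> (mon r n) \<oplus>\<^bsub>M\<^esub> \<phi> (mon r' n)"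
  using PD(3)[of \<phi> "mon r n" "mon r' n"] by simp

lemma P_mon:
  assumes "\<phi> \<in> carrier Pm" "r \<in> carrier R" "c \<in> carrier R"
  shows "\<phi> (mon (r [^] q \<otimes> c) (b * q + n)) = (r \<otimes> f [^] b) \<odot>\<^bsub>M\<^esub> \<phi> (mon c n)"
proof -
  have "mon (r [^] q \<otimes> c) (b * q + n) = mon r b [^]\<^bsub>A\<^esub> q \<otimes>\<^bsub>A\<^esub> mon c n"
    using assms by (simp add: mon_pow_q)
  then show ?thesis using PD(4)[OF assms(1), of "mon r b" "mon c n"] assms by (simp add: \<gamma>_mon)
qed

text \<open>The p^e-th power of t acts on these maps through \<gamma>(t) = f. Values at large
  exponents are therefore powers of f times values at the residue, and exponents below p^e determine
  the map.\<close>

lemma P_mon_div: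
  assumes "\<phi> \<in> carrier Pm" "c \<in> carrier R"
  shows "\<phi> (mon c n) = f [^] (n div q) \<odot>\<^bsub>M\<^esub> \<phi> (mon c (n mod q))"
proof -
  have "n div q * q + n mod q = n" by (rule div_mult_mod_eq)
  then show ?thesis using P_mon[OF assms(1) R.one_closed assms(2), of "n div q" "n mod q"] assms(2) f by simp
qed

lemma P_mon_smult:
  assumes "\<phi> \<in> carrier Pm" "r \<in> carrier R" "c \<in> carrier R"
  shows "\<phi> (mon (r [^] q \<otimes> c) n) = r \<odot>\<^bsub>M\<^esub> \<phi> (mon c n)"
  using P_mon[OF assms, of 0 n] assms(2) by simp

lemma P_ext:
  assumes "\<phi> \<in> carrier Pm" "\<psi> \<in> carrier Pm" "\<And>r n. r \<in> carrier R \<Longrightarrow> \<phi> (mon r n) = \<psi> (mon r n)"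
  shows "\<phi> = \<psi>"
proof (rule extensionalityI[OF PD(1)[OF assms(1)] PD(1)[OF assms(2)]])
  fix s assume "s \<in> carrier A"
  then show "\<phi> s = \<psi> s"
    by (rule additive_ext[where pl = "add M", rotated 3]) (simp_all add: PD(3)[OF assms(1)] PD(3)[OF assms(2)] assms(3))
qed

lemma P_zero_arg: "\<phi> \<in> carrier Pm \<Longrightarrow> \<phi> \<zero>\<^bsub>A\<^esub> = \<zero>\<^bsub>M\<^esub>"
proof -
  assume \<phi>: "\<phi> \<in> carrier Pm"
  have "\<phi> \<zero>\<^bsub>A\<^esub> \<in> carrier M" "\<phi> (\<zero>\<^bsub>A\<^esub> \<oplus>\<^bsub>A\<^esub> \<zero>\<^bsub>A\<^esub>) = \<phi> \<zero>\<^bsub>A\<^esub> \<oplus>\<^bsub>M\<^esub> \<phi> \<zero>\<^bsub>A\<^esub>" using PD[OF \<phi>] by blast+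
  then show ?thesis using M.add.r_cancel_one'[of "\<phi> \<zero>\<^bsub>A\<^esub>" "\<phi> \<zero>\<^bsub>A\<^esub>"] by simp
qed

lemma M_add_pow: "x \<in> carrier M \<Longrightarrow> ([(Suc k)] \<cdot> \<one>) \<odot>\<^bsub>M\<^esub> x = ([k] \<cdot> \<one>) \<odot>\<^bsub>M\<^esub> x \<oplus>\<^bsub>M\<^esub> x"
  by (simp add: smult_l_distr)

lemma P_mon_add_pow:
  assumes \<phi>: "\<phi> \<in> carrier Pm" and r: "r \<in> carrier R"
  shows "\<phi> (mon ([(k::nat)] \<cdot> r) n) = ([k] \<cdot> \<one>) \<odot>\<^bsub>M\<^esub> \<phi> (mon r n)"
proof (induction k)
  case 0
  then show ?case using r PD(2)[OF \<phi>] P_zero_arg[OF \<phi>] by simp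
next
  case (Suc k)
  have "[(Suc k)] \<cdot> r = [k] \<cdot> r \<oplus> r" by simp
  then show ?case using Suc r P_mon_add[OF \<phi>, of "[k] \<cdot> r" r n] PD(2)[OF \<phi>, of "mon r n"] M_add_pow[of "\<phi> (mon r n)" k] by simp
qed

lemma P_compose: "\<phi> \<in> carrier Pm \<Longrightarrow> d \<in> D \<Longrightarrow> compose (carrier A) \<phi> d \<in> carrier Pm"
  using CA.frob_shriek_compose D_carrier by blast

lemma D_closed: "d \<in> D \<Longrightarrow> s \<in> carrier A \<Longrightarrow> d s \<in> carrier A"
  using D_carrier CA.mem_diff_ops by blast

text \<open>The description of the span of \<open>\<gamma>\<^sub>*C\<^sup>e(f\<^sup>kM)\<close> by its values at the monomials \<open>r t\<^sup>m\<close>,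
  which decouples the exponents \<open>m\<close>.\<close>

definition Bt :: "nat \<Rightarrow> ((nat \<Rightarrow> 'a) \<Rightarrow> 'c) set" where
  "Bt k = {\<phi> \<in> carrier Pm. \<forall>m<q. \<forall>r\<in>carrier R. \<phi> (mon r m) \<in> trace_image f e (m + k)}"

lemma trace_image_ops:
  "x \<in> trace_image f e n \<Longrightarrow> x \<in> carrier M" "\<zero>\<^bsub>M\<^esub> \<in> trace_image f e n"
  "x \<in> trace_image f e n \<Longrightarrow> y \<in> trace_image f e n \<Longrightarrow> x \<oplus>\<^bsub>M\<^esub> y \<in> trace_image f e n"
  "x \<in> trace_image f e n \<Longrightarrow> \<ominus>\<^bsub>M\<^esub> x \<in> trace_image f e n"
  "r \<in> carrier R \<Longrightarrow> x \<in> trace_image f e n \<Longrightarrow> r \<odot>\<^bsub>M\<^esub> x \<in> trace_image f e n"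
  using submoduleE[OF trace_image_submodule[OF f, of e n]] subgroup.one_closed[OF submodule.axioms(1)[OF trace_image_submodule[OF f, of e n]]]
  by auto

lemma Bt_subgroup: "subgroup (Bt k) (add_monoid Pm)"
proof -
  interpret P: abelian_group Pm by (rule P_group)
  show ?thesis
  proof (rule P.add.subgroupI)
    have "\<zero>\<^bsub>Pm\<^esub> \<in> Bt k" using P.zero_closed by (simp add: Bt_def P_zero trace_image_ops)
    then show "Bt k \<noteq> {}" by blast
  qed (auto simp: Bt_def P_add P_minus trace_image_ops)
qed

text \<open>The generators of the algebra send r t^m to some r' t^m with the same exponent, so
  conditions imposed exponent by exponent survive. Differences and sums of operators are handled by
  the subgroup property, products by acting twice.\<close>

lemma Bt_generated:
  "d \<in> generate_ring (diff_ops A p e) (on_coeffs R ` carrier (diff_ops R p e) \<union> {euler_op R (p ^ j) | j. j < e}) \<Longrightarrow>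
    \<forall>\<phi>\<in>Bt k. compose (carrier A) \<phi> d \<in> Bt k"
proof (induction rule: generate_ring.induct)
  case one
  have "compose (carrier A) \<phi> (\<lambda>x\<in>carrier A. x) = \<phi>" if "\<phi> \<in> Bt k" for \<phi>
    using that PD(1)[of \<phi>] by (intro extensionalityI[OF compose_extensional]) (auto simp: Bt_def compose_eq)
  then show ?case unfolding CA.diff_ops_simps by (intro ballI) (simp only:)
next
  case (incl d)
  have dD: "d \<in> D" unfolding euler_algebra_def using incl by (rule generate_ring.incl)
  show ?case
  proof
    fix \<phi> assume \<phi>: "\<phi> \<in> Bt k"
    then have \<phi>P: "\<phi> \<in> carrier Pm" by (simp add: Bt_def)
    have ex: "\<exists>r'\<in>carrier R. d (mon r m) = mon r' m" if r: "r \<in> carrier R" for r m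
    proof (cases "d \<in> on_coeffs R ` carrier (diff_ops R p e)")
      case True
      then obtain d' where d': "d = on_coeffs R d'" "d' \<in> carrier (diff_ops R p e)" by (rule imageE)
      have "d' r \<in> carrier R" using d'(2) r by (auto simp: mem_diff_ops)
      then show ?thesis using on_coeffs_mon[OF d'(2) r] d'(1) by blast
    next
      case False
      then obtain j where "d = euler_op R (p ^ j)" using incl by blast
      then show ?thesis using dg_mon[OF r] r by (auto simp: euler_dg)
    qed
    have "compose (carrier A) \<phi> d (mon r m) \<in> trace_image f e (m + k)" if m: "m < q" and r: "r \<in> carrier R" for m r
    proof -
      obtain r' where r': "r' \<in> carrier R" "d (mon r m) = mon r' m" using ex[OF r] by blast
      have "\<phi> (mon r' m) \<in> trace_image f e (m + k)" using \<phi> m r'(1) by (simp add: Bt_def)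
      then show ?thesis using r'(2) r by (simp add: compose_eq)
    qed
    then show "compose (carrier A) \<phi> d \<in> Bt k" using P_compose[OF \<phi>P dD] by (simp add: Bt_def)
  qed
next
  case (a_inv d)
  then have d: "d \<in> carrier (diff_ops A p e)" using D_carrier unfolding euler_algebra_def by blast
  show ?case
  proof
    fix \<phi> assume \<phi>: "\<phi> \<in> Bt k"
    then have \<phi>P: "\<phi> \<in> carrier Pm" by (simp add: Bt_def)
    have c: "compose (carrier A) \<phi> d \<in> Bt k" using a_inv \<phi> by blast
    then have cP: "compose (carrier A) \<phi> d \<in> carrier Pm" by (simp add: Bt_def)
    have "compose (carrier A) \<phi> (\<ominus>\<^bsub>diff_ops A p e\<^esub> d) = \<ominus>\<^bsub>Pm\<^esub> (compose (carrier A) \<phi> d)"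
    proof (rule extensionalityI[OF compose_extensional])
      show "\<ominus>\<^bsub>Pm\<^esub> (compose (carrier A) \<phi> d) \<in> extensional (carrier A)"
        using PD(1)[OF abelian_group.a_inv_closed[OF P_group cP]] .
      fix s assume s: "s \<in> carrier A"
      have ds: "d s \<in> carrier A" using d s CA.mem_diff_ops by blast
      have "\<phi> (\<ominus>\<^bsub>A\<^esub> d s) \<oplus>\<^bsub>M\<^esub> \<phi> (d s) = \<phi> (\<ominus>\<^bsub>A\<^esub> d s \<oplus>\<^bsub>A\<^esub> d s)" using PD(3)[OF \<phi>P] ds by simp
      also have "\<dots> = \<zero>\<^bsub>M\<^esub>" using ds P_zero_arg[OF \<phi>P] by (simp add: U.P.l_neg)
      finally have "\<ominus>\<^bsub>M\<^esub> \<phi> (d s) = \<phi> (\<ominus>\<^bsub>A\<^esub> d s)" using PD(2)[OF \<phi>P] ds by (intro M.minus_equality) auto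
      then show "compose (carrier A) \<phi> (\<ominus>\<^bsub>diff_ops A p e\<^esub> d) s = (\<ominus>\<^bsub>Pm\<^esub> (compose (carrier A) \<phi> d)) s"
        using s P_minus[OF cP s] by (simp add: compose_eq CA.diff_ops_minus[OF d])
    qed
    then show "compose (carrier A) \<phi> (\<ominus>\<^bsub>diff_ops A p e\<^esub> d) \<in> Bt k"
      using subgroup.m_inv_closed[OF Bt_subgroup c] by (simp add: a_inv_def)
  qed
next
  case (eng_add d d')
  then have d: "d \<in> carrier (diff_ops A p e)" "d' \<in> carrier (diff_ops A p e)" using D_carrier unfolding euler_algebra_def by blast+
  show ?case
  proof
    fix \<phi> assume \<phi>: "\<phi> \<in> Bt k"
    then have \<phi>P: "\<phi> \<in> carrier Pm" by (simp add: Bt_def)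
    have "d s \<in> carrier A \<and> d' s \<in> carrier A" if "s \<in> carrier A" for s using d that CA.mem_diff_ops by blast
    then have "compose (carrier A) \<phi> (d \<oplus>\<^bsub>diff_ops A p e\<^esub> d') = compose (carrier A) \<phi> d \<oplus>\<^bsub>Pm\<^esub> compose (carrier A) \<phi> d'"
      by (intro extensionalityI[OF compose_extensional])
        (simp_all add: CA.frob_shriek_simps CA.diff_ops_simps compose_eq PD(3)[OF \<phi>P])
    then show "compose (carrier A) \<phi> (d \<oplus>\<^bsub>diff_ops A p e\<^esub> d') \<in> Bt k"
      using subgroup.m_closed[OF Bt_subgroup, of "compose (carrier A) \<phi> d" k "compose (carrier A) \<phi> d'"] eng_add \<phi> by simp
  qed
next
  case (eng_mult d d')
  then have d: "d \<in> carrier (diff_ops A p e)" "d' \<in> carrier (diff_ops A p e)" using D_carrier unfolding euler_algebra_def by blast+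
  show ?case
  proof
    fix \<phi> assume \<phi>: "\<phi> \<in> Bt k"
    have "d' s \<in> carrier A" if "s \<in> carrier A" for s using d that CA.mem_diff_ops by blast
    then have "compose (carrier A) \<phi> (d \<otimes>\<^bsub>diff_ops A p e\<^esub> d') = compose (carrier A) (compose (carrier A) \<phi> d) d'"
      unfolding CA.diff_ops_simps
      by (intro extensionalityI[OF compose_extensional compose_extensional]) (simp add: compose_eq)
    then show "compose (carrier A) \<phi> (d \<otimes>\<^bsub>diff_ops A p e\<^esub> d') \<in> Bt k" using eng_mult \<phi> by simp
  qed
qed

lemma Bt_D: "\<phi> \<in> Bt k \<Longrightarrow> d \<in> D \<Longrightarrow> compose (carrier A) \<phi> d \<in> Bt k"
  using Bt_generated[of d k] unfolding euler_algebra_def by blast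

definition G :: "'c \<Rightarrow> (nat \<Rightarrow> 'a) \<Rightarrow> 'c" where
  "G m = compose (carrier A) (cartier_adjoint R M \<kappa> e m) \<gamma>"

lemma graph_push_adjoint_eq: "graph_push_adjoint R M \<kappa> f e Y = G ` Y"
  unfolding graph_push_adjoint_def image_image G_def ..

lemma G_apply: "s \<in> carrier A \<Longrightarrow> G m s = (\<kappa> ^^ e) (\<gamma> s \<odot>\<^bsub>M\<^esub> m)"
  by (simp add: G_def compose_eq cartier_adjoint_def)

lemma G_P: "m \<in> carrier M \<Longrightarrow> G m \<in> carrier Pm"
  unfolding mem_P
  by (auto simp: G_apply kp \<gamma>_add \<gamma>_mult \<gamma>_pow smult_l_distr smult_assoc1) (simp add: G_def)

lemma G_mon: "r \<in> carrier R \<Longrightarrow> G m (mon r n) = (\<kappa> ^^ e) ((r \<otimes> f [^] n) \<odot>\<^bsub>M\<^esub> m)"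
  by (simp add: G_apply \<gamma>_mon)

lemma trace_imageI: "y \<in> carrier M \<Longrightarrow> (\<kappa> ^^ e) (f [^] n \<odot>\<^bsub>M\<^esub> y) \<in> trace_image f e n"
  by (auto simp: trace_image_def)

lemma G_Bt:
  assumes "m \<in> carrier M" shows "G (f [^] k \<odot>\<^bsub>M\<^esub> m) \<in> Bt k"
proof -
  have "(r \<otimes> f [^] n) \<odot>\<^bsub>M\<^esub> (f [^] k \<odot>\<^bsub>M\<^esub> m) = f [^] (n + k) \<odot>\<^bsub>M\<^esub> (r \<odot>\<^bsub>M\<^esub> m)" if "r \<in> carrier R" for r n
    using assms that f by (simp add: R.m_ac flip: smult_assoc1 R.nat_pow_mult)
  then show ?thesis using assms f by (auto simp: Bt_def G_P G_mon intro!: trace_imageI)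
qed

definition span :: "nat \<Rightarrow> ((nat \<Rightarrow> 'a) \<Rightarrow> 'c) set" where
  "span k = right_span Pm (G ` (\<lambda>m. f [^] k \<odot>\<^bsub>M\<^esub> m) ` carrier M) D"

abbreviation gens where
  "gens k \<equiv> {d \<odot>\<^bsub>Pm\<^esub> x | d x. d \<in> D \<and> x \<in> G ` (\<lambda>m. f [^] k \<odot>\<^bsub>M\<^esub> m) ` carrier M}"

lemma gens_Bt: "gens k \<subseteq> Bt k"
proof
  fix u assume "u \<in> gens k"
  then obtain d m where "d \<in> D" "m \<in> carrier M" "u = compose (carrier A) (G (f [^] k \<odot>\<^bsub>M\<^esub> m)) d"
    unfolding P_smult by blast
  then show "u \<in> Bt k" using Bt_D[OF G_Bt] by simp
qed

lemma span_subset: "span k \<subseteq> Bt k"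
proof -
  interpret P: abelian_group Pm by (rule P_group)
  show ?thesis unfolding span_def right_span_def by (rule P.add.generate_subgroup_incl[OF gens_Bt Bt_subgroup])
qed

lemma span_subgroup: "subgroup (span k) (add_monoid Pm)"
proof -
  interpret P: abelian_group Pm by (rule P_group)
  have "Bt k \<subseteq> carrier Pm" by (auto simp: Bt_def)
  with gens_Bt have "gens k \<subseteq> carrier Pm" by (rule subset_trans)
  then show ?thesis unfolding span_def right_span_def using P.add.generate_is_subgroup by simp
qed

lemma span_gen: "d \<in> D \<Longrightarrow> m \<in> carrier M \<Longrightarrow> compose (carrier A) (G (f [^] k \<odot>\<^bsub>M\<^esub> m)) d \<in> span k"
  unfolding span_def right_span_def P_smult by (rule generate.incl) blast

text \<open>Composing a functional F^e_* R -> R with the embedding r -> r^(p^e) . 1 into F^e_* R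
  gives an endomorphism. In this form the functionals of the dual basis act as differential
  operators.\<close>

lemma frob_linear_diff_op:
  assumes "frob_linear e l" shows "(\<lambda>x\<in>carrier R. l x [^] q) \<in> carrier (diff_ops R p e)"
  using assms unfolding frob_linear_def mem_diff_ops by (auto simp: frob_add nat_pow_distrib Pi_iff)

lemma frob_linear_zero: "frob_linear e l \<Longrightarrow> l \<zero> = \<zero>"
proof -
  assume l: "frob_linear e l"
  have "l (\<zero> [^] q \<otimes> \<zero>) = \<zero> \<otimes> l \<zero>" using l R.zero_closed unfolding frob_linear_def by blast
  moreover have "l \<zero> \<in> carrier R" using frob_linear_closed[OF l] by simp
  ultimately show ?thesis by simp
qed

lemma dg_ind_D: "m < q \<Longrightarrow> dg (\<lambda>n. if n mod q = m then 1 else 0) \<in> D"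
  by (rule D_dg_indicator)

text \<open>The heart of the span computation. At the exponent m choose, for every w, an element
  \<open>y w\<close> that produces the value of \<phi> at w t^m. Each dual pair (l, w) then yields
  an element of the span with value l(c) \<phi>(w t^m) at c t^m and zero at other residues; summed
  over the dual basis these values give \<phi>(c t^m).\<close>

lemma component_in_span:
  assumes xs: "dual_list e xs" "\<And>x. x \<in> carrier R \<Longrightarrow> x = dual_sum e xs x"
    and \<phi>: "\<phi> \<in> Bt k" and m: "m < q"
  shows "compose (carrier A) \<phi> (dg (\<lambda>n. if n mod q = m then 1 else 0)) \<in> span k"
proof -
  interpret P: abelian_group Pm by (rule P_group)
  define \<pi> where "\<pi> = dg (\<lambda>n. if n mod q = m then 1 else 0)"
  have \<pi>D: "\<pi> \<in> D" unfolding \<pi>_def by (rule dg_ind_D[OF m])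
  have \<pi>_mon: "\<pi> (mon c n) = (if n mod q = m then mon c n else \<zero>\<^bsub>A\<^esub>)" if "c \<in> carrier R" for c n
    unfolding \<pi>_def using that by (simp add: dg_mon)
  have \<phi>P: "\<phi> \<in> carrier Pm" using \<phi> by (simp add: Bt_def)
  have "\<forall>w\<in>carrier R. \<exists>y. y \<in> carrier M \<and> \<phi> (mon w m) = (\<kappa> ^^ e) (f [^] (m + k) \<odot>\<^bsub>M\<^esub> y)"
    using \<phi> m unfolding Bt_def trace_image_def by blast
  then obtain y where y: "\<And>w. w \<in> carrier R \<Longrightarrow> y w \<in> carrier M"
    "\<And>w. w \<in> carrier R \<Longrightarrow> \<phi> (mon w m) = (\<kappa> ^^ e) (f [^] (m + k) \<odot>\<^bsub>M\<^esub> y w)" by metis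
  \<comment> \<open>Read from the inside: project onto the residue m, replace the coefficient c by
    l(c)^(p^e), then apply the adjoint of f^k \<open>y w\<close>. The power l(c)^(p^e) leaves
    \<kappa>^e as the scalar l(c).\<close>
  define t where "t l w = compose (carrier A) (G (f [^] k \<odot>\<^bsub>M\<^esub> y w)) (compose (carrier A) (on_coeffs R (\<lambda>x\<in>carrier R. l x [^] q)) \<pi>)" for l w
  have t_span: "t l w \<in> span k" if "frob_linear e l" "w \<in> carrier R" for l w
    unfolding t_def using that y(1) by (intro span_gen D_compose D_on_coeffs frob_linear_diff_op \<pi>D)
  have span_P: "u \<in> carrier Pm" if "u \<in> span k" for u using that span_subset by (auto simp: Bt_def)
  have t_mon: "t l w (mon c n) = (if n mod q = m then f [^] (n div q) \<odot>\<^bsub>M\<^esub> (l c \<odot>\<^bsub>M\<^esub> \<phi> (mon w m)) else \<zero>\<^bsub>M\<^esub>)"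
    if l: "frob_linear e l" and w: "w \<in> carrier R" and c: "c \<in> carrier R" for l w c n
  proof -
    have lc: "l c \<in> carrier R" using frob_linear_closed[OF l c] .
    define d where "d = on_coeffs R (\<lambda>x\<in>carrier R. l x [^] q)"
    have dD: "d \<in> carrier (diff_ops A p e)" unfolding d_def using D_on_coeffs[OF frob_linear_diff_op[OF l]] D_carrier by blast
    have t1: "t l w (mon c n) = G (f [^] k \<odot>\<^bsub>M\<^esub> y w) (d (\<pi> (mon c n)))" using c by (simp add: t_def compose_eq d_def)
    show ?thesis
    proof (cases "n mod q = m")
      case True
      have n: "n = n div q * q + m" using True by (metis div_mult_mod_eq)
      have "d (mon c n) = mon (l c [^] q) n" unfolding d_def using on_coeffs_mon[OF frob_linear_diff_op[OF l] c] c by simp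
      then have "t l w (mon c n) = (\<kappa> ^^ e) ((l c [^] q \<otimes> f [^] n) \<odot>\<^bsub>M\<^esub> (f [^] k \<odot>\<^bsub>M\<^esub> y w))"
        unfolding t1 \<pi>_mon[OF c] using True lc by (simp add: G_mon)
      also have "(l c [^] q \<otimes> f [^] n) \<odot>\<^bsub>M\<^esub> (f [^] k \<odot>\<^bsub>M\<^esub> y w) = (f [^] (n div q) \<otimes> l c) [^] q \<odot>\<^bsub>M\<^esub> (f [^] (m + k) \<odot>\<^bsub>M\<^esub> y w)"
      proof -
        have "f [^] n = (f [^] (n div q)) [^] q \<otimes> f [^] m" using f by (subst n) (simp add: R.nat_pow_pow flip: R.nat_pow_mult)
        then show ?thesis using lc f y(1)[OF w] by (simp add: R.nat_pow_distrib R.m_ac flip: smult_assoc1 R.nat_pow_mult)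
      qed
      also have "(\<kappa> ^^ e) \<dots> = (f [^] (n div q) \<otimes> l c) \<odot>\<^bsub>M\<^esub> \<phi> (mon w m)"
        using lc f y(1)[OF w] by (simp add: kp(3) y(2)[OF w])
      finally show ?thesis using True lc f PD(2)[OF \<phi>P] w by (simp add: smult_assoc1)
    next
      case False
      have "d \<zero>\<^bsub>A\<^esub> = \<zero>\<^bsub>A\<^esub>"
      proof -
        have "d (mon \<zero> 0) = mon (l \<zero> [^] q) 0" unfolding d_def using on_coeffs_mon[OF frob_linear_diff_op[OF l], of \<zero> 0] by simp
        then show ?thesis by (simp add: frob_linear_zero[OF l] frob_zero)
      qed
      then show ?thesis unfolding t1 \<pi>_mon[OF c] using False P_zero_arg[OF G_P] y(1)[OF w] f by simp
    qed
  qed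
  define S where "S ys = foldr (\<lambda>(l, w) acc. t l w \<oplus>\<^bsub>Pm\<^esub> acc) ys \<zero>\<^bsub>Pm\<^esub>" for ys
  have S: "S ys \<in> span k \<and> (\<forall>c\<in>carrier R. \<forall>n. S ys (mon c n) =
      (if n mod q = m then f [^] (n div q) \<odot>\<^bsub>M\<^esub> \<phi> (mon (dual_sum e ys c) m) else \<zero>\<^bsub>M\<^esub>))"
    if "dual_list e ys" for ys
    using that
  proof (induction ys)
    case Nil
    have "\<zero>\<^bsub>Pm\<^esub> \<in> span k" using subgroup.one_closed[OF span_subgroup] by simp
    then show ?case using P_zero_arg[OF \<phi>P] f by (simp add: S_def P_zero)
  next
    case (Cons a ys)
    obtain l w where a: "a = (l, w)" by (cases a)
    have lw: "frob_linear e l" "w \<in> carrier R" "dual_list e ys" using Cons.prems a by auto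
    note IH = Cons.IH[OF lw(3)]
    have Sa: "S (a # ys) = t l w \<oplus>\<^bsub>Pm\<^esub> S ys" by (simp add: S_def a)
    have mem: "S (a # ys) \<in> span k"
      unfolding Sa using subgroup.m_closed[OF span_subgroup t_span[OF lw(1,2)] conjunct1[OF IH]] by simp
    have "S (a # ys) (mon c n) = (if n mod q = m then f [^] (n div q) \<odot>\<^bsub>M\<^esub> \<phi> (mon (dual_sum e (a # ys) c) m) else \<zero>\<^bsub>M\<^esub>)"
      if c: "c \<in> carrier R" for c n
    proof -
      have lc: "l c \<in> carrier R" "dual_sum e ys c \<in> carrier R" using frob_linear_closed[OF lw(1) c] dual_sum_closed[OF lw(3) c] .
      have "\<phi> (mon (dual_sum e (a # ys) c) m) = \<phi> (mon (l c [^] q \<otimes> w) m) \<oplus>\<^bsub>M\<^esub> \<phi> (mon (dual_sum e ys c) m)"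
        using P_mon_add[OF \<phi>P, of "l c [^] q \<otimes> w" "dual_sum e ys c" m] lc lw(2) by (simp add: a)
      also have "\<phi> (mon (l c [^] q \<otimes> w) m) = l c \<odot>\<^bsub>M\<^esub> \<phi> (mon w m)" by (rule P_mon_smult[OF \<phi>P lc(1) lw(2)])
      finally show ?thesis
        unfolding Sa using c IH t_mon[OF lw(1,2) c, of n] PD(2)[OF \<phi>P] lc lw(2) f by (simp add: P_add smult_r_distr)
    qed
    then show ?case using mem by blast
  qed
  have "compose (carrier A) \<phi> \<pi> = S xs"
  proof (rule P_ext[OF P_compose[OF \<phi>P \<pi>D] span_P])
    show "S xs \<in> span k" using S[OF xs(1)] by blast
    fix c n assume c: "c \<in> carrier R"
    have "compose (carrier A) \<phi> \<pi> (mon c n) = (if n mod q = m then f [^] (n div q) \<odot>\<^bsub>M\<^esub> \<phi> (mon c m) else \<zero>\<^bsub>M\<^esub>)"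
      using c \<pi>_mon[OF c] P_mon_div[OF \<phi>P c, of n] P_zero_arg[OF \<phi>P] by (simp add: compose_eq)
    then show "compose (carrier A) \<phi> \<pi> (mon c n) = S xs (mon c n)"
      using S[OF xs(1)] c xs(2)[OF c] by simp
  qed
  then show ?thesis using S[OF xs(1)] unfolding \<pi>_def by simp
qed

text \<open>Every map is the sum of its p^e components at the residues, and each component is in the
  span by the preceding lemma.\<close>

lemma span_eq:
  assumes xs: "dual_list e xs" "\<And>x. x \<in> carrier R \<Longrightarrow> x = dual_sum e xs x"
  shows "span k = Bt k"
proof
  show "Bt k \<subseteq> span k"
  proof
    fix \<phi> assume \<phi>: "\<phi> \<in> Bt k"
    then have \<phi>P: "\<phi> \<in> carrier Pm" by (simp add: Bt_def)
    \<comment> \<open>The sum of the first j residue projections: the composite with \<phi> grows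
      from 0 at j = 0 to \<phi> at j = p^e, by one component per step.\<close>
    define \<sigma> where "\<sigma> j = dg (\<lambda>n. if n mod q < j then 1 else 0)" for j
    have \<sigma>_ops: "\<sigma> j \<in> carrier (diff_ops A p e)" for j unfolding \<sigma>_def by (rule dg_diff_ops) simp
    have \<sigma>P: "compose (carrier A) \<phi> (\<sigma> j) \<in> carrier Pm" for j using CA.frob_shriek_compose[OF \<phi>P \<sigma>_ops] .
    have \<sigma>_mon: "compose (carrier A) \<phi> (\<sigma> j) (mon c n) = (if n mod q < j then \<phi> (mon c n) else \<zero>\<^bsub>M\<^esub>)" if "c \<in> carrier R" for c n j
      unfolding \<sigma>_def using that P_zero_arg[OF \<phi>P] by (simp add: compose_eq dg_mon)
    have "j \<le> q \<Longrightarrow> compose (carrier A) \<phi> (\<sigma> j) \<in> span k" for j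
    proof (induction j)
      case 0
      have "compose (carrier A) \<phi> (\<sigma> 0) = \<zero>\<^bsub>Pm\<^esub>"
        using \<sigma>_mon by (intro P_ext[OF \<sigma>P]) (simp_all add: P_zero abelian_group.axioms(1)[OF P_group] abelian_monoid.zero_closed)
      then show ?case using subgroup.one_closed[OF span_subgroup] by simp
    next
      case (Suc j)
      define \<pi> where "\<pi> = dg (\<lambda>n. if n mod q = j then 1 else 0)"
      have c: "compose (carrier A) \<phi> \<pi> \<in> span k" unfolding \<pi>_def using component_in_span[OF xs \<phi>] Suc.prems by simp
      have \<pi>_mon: "compose (carrier A) \<phi> \<pi> (mon c n) = (if n mod q = j then \<phi> (mon c n) else \<zero>\<^bsub>M\<^esub>)" if "c \<in> carrier R" for c n
        unfolding \<pi>_def using that P_zero_arg[OF \<phi>P] by (simp add: compose_eq dg_mon)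
      have sum: "compose (carrier A) \<phi> (\<sigma> j) \<oplus>\<^bsub>Pm\<^esub> compose (carrier A) \<phi> \<pi> \<in> span k"
        using subgroup.m_closed[OF span_subgroup, of "compose (carrier A) \<phi> (\<sigma> j)" k "compose (carrier A) \<phi> \<pi>"] c Suc by simp
      have "compose (carrier A) \<phi> (\<sigma> (Suc j)) = compose (carrier A) \<phi> (\<sigma> j) \<oplus>\<^bsub>Pm\<^esub> compose (carrier A) \<phi> \<pi>"
      proof (rule P_ext[OF \<sigma>P])
        show "compose (carrier A) \<phi> (\<sigma> j) \<oplus>\<^bsub>Pm\<^esub> compose (carrier A) \<phi> \<pi> \<in> carrier Pm" using sum span_subset by (auto simp: Bt_def)
        fix c n assume c: "c \<in> carrier R"
        then show "compose (carrier A) \<phi> (\<sigma> (Suc j)) (mon c n) = (compose (carrier A) \<phi> (\<sigma> j) \<oplus>\<^bsub>Pm\<^esub> compose (carrier A) \<phi> \<pi>) (mon c n)"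
          using PD(2)[OF \<phi>P] by (simp add: P_add \<sigma>_mon \<pi>_mon less_Suc_eq)
      qed
      then show ?case using sum by simp
    qed
    then have "compose (carrier A) \<phi> (\<sigma> q) \<in> span k" by simp
    moreover have "compose (carrier A) \<phi> (\<sigma> q) = \<phi>"
      using \<sigma>_mon p_pos by (intro P_ext[OF \<sigma>P \<phi>P]) simp
    ultimately show "\<phi> \<in> span k" by simp
  qed
qed (rule span_subset)

end

section \<open>Eigenspaces\<close>

lemma abelian_group_restrict:
  fixes G :: "('a, 'c) module"
  assumes "abelian_group G" "subgroup H (add_monoid G)"
  shows "abelian_group (G\<lparr>carrier := H\<rparr>)"
    "x \<in> H \<Longrightarrow> \<ominus>\<^bsub>G\<lparr>carrier := H\<rparr>\<^esub> x = \<ominus>\<^bsub>G\<^esub> x"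
    "subgroup K (add_monoid G) \<Longrightarrow> K \<subseteq> H \<Longrightarrow> subgroup K (add_monoid (G\<lparr>carrier := H\<rparr>))"
proof -
  interpret G: abelian_group G by fact
  have sub: "H \<subseteq> carrier G" using subgroup.subset[OF assms(2)] by simp
  have m: "\<And>x y. x \<in> H \<Longrightarrow> y \<in> H \<Longrightarrow> x \<oplus>\<^bsub>G\<^esub> y \<in> H" "\<zero>\<^bsub>G\<^esub> \<in> H" "\<And>x. x \<in> H \<Longrightarrow> \<ominus>\<^bsub>G\<^esub> x \<in> H"
    using subgroup.m_closed[OF assms(2)] subgroup.one_closed[OF assms(2)] subgroup.m_inv_closed[OF assms(2)]
    by (simp_all add: a_inv_def)
  show gr: "abelian_group (G\<lparr>carrier := H\<rparr>)"
  proof (rule abelian_groupI)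
    fix x assume "x \<in> carrier (G\<lparr>carrier := H\<rparr>)"
    then have "\<ominus>\<^bsub>G\<^esub> x \<in> H" "\<ominus>\<^bsub>G\<^esub> x \<oplus>\<^bsub>G\<^esub> x = \<zero>\<^bsub>G\<^esub>" using m(3) sub by (auto intro: G.l_neg)
    then show "\<exists>y\<in>carrier (G\<lparr>carrier := H\<rparr>). y \<oplus>\<^bsub>G\<lparr>carrier := H\<rparr>\<^esub> x = \<zero>\<^bsub>G\<lparr>carrier := H\<rparr>\<^esub>" by auto
  qed (use m sub in \<open>auto intro: G.a_assoc G.a_comm\<close>)
  interpret GH: abelian_group "G\<lparr>carrier := H\<rparr>" by (rule gr)
  show inv: "\<ominus>\<^bsub>G\<lparr>carrier := H\<rparr>\<^esub> x = \<ominus>\<^bsub>G\<^esub> x" if "x \<in> H" for x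
    using that m(3) sub by (intro GH.minus_equality) (auto intro: G.l_neg)
  assume K: "subgroup K (add_monoid G)" "K \<subseteq> H"
  have k: "\<And>x y. x \<in> K \<Longrightarrow> y \<in> K \<Longrightarrow> x \<oplus>\<^bsub>G\<^esub> y \<in> K" "\<zero>\<^bsub>G\<^esub> \<in> K" "\<And>x. x \<in> K \<Longrightarrow> \<ominus>\<^bsub>G\<^esub> x \<in> K"
    using subgroup.m_closed[OF K(1)] subgroup.one_closed[OF K(1)] subgroup.m_inv_closed[OF K(1)]
    by (simp_all add: a_inv_def)
  show "subgroup K (add_monoid (G\<lparr>carrier := H\<rparr>))"
  proof (rule GH.add.subgroupI)
    show "K \<noteq> {}" using k(2) by blast
    show "\<ominus>\<^bsub>G\<lparr>carrier := H\<rparr>\<^esub> x \<in> K" if "x \<in> K" for x using inv[of x] k(3)[OF that] that K(2) by auto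
  qed (use k K(2) in auto)
qed

context graph_setup begin

lemma trace_image_antimono: "trace_image f e (Suc n) \<subseteq> trace_image f e n"
proof
  fix x assume "x \<in> trace_image f e (Suc n)"
  then obtain m where m: "m \<in> carrier M" "x = (\<kappa> ^^ e) (f [^] Suc n \<odot>\<^bsub>M\<^esub> m)" by (auto simp: trace_image_def)
  then have "x = (\<kappa> ^^ e) (f [^] n \<odot>\<^bsub>M\<^esub> (f \<odot>\<^bsub>M\<^esub> m))" using f by (simp add: smult_assoc1)
  then show "x \<in> trace_image f e n" using m(1) f by (simp add: trace_imageI)
qed

lemma Bt_antimono: "Bt 1 \<subseteq> Bt 0"
  using trace_image_antimono by (auto simp: Bt_def)

abbreviation PA where "PA \<equiv> Pm\<lparr>carrier := Bt 0\<rparr>"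

sublocale PQ: quot_group PA "Bt 1"
  using abelian_group_restrict(1)[OF P_group Bt_subgroup[of 0]]
    abelian_group_restrict(3)[OF P_group Bt_subgroup[of 0] Bt_subgroup[of 1] Bt_antimono]
  by (intro quot_group.intro quot_group_axioms.intro)

abbreviation tM where "tM n \<equiv> M\<lparr>carrier := trace_image f e n\<rparr>"

lemma tM_quot: "quot_group (tM n) (trace_image f e (Suc n))"
  using abelian_group_restrict(1)[OF M.abelian_group_axioms submodule.axioms(1)[OF trace_image_submodule[OF f, of e n]]]
    abelian_group_restrict(3)[OF M.abelian_group_axioms submodule.axioms(1)[OF trace_image_submodule[OF f, of e n]]
      submodule.axioms(1)[OF trace_image_submodule[OF f, of e "Suc n"]] trace_image_antimono]
  by (intro quot_group.intro quot_group_axioms.intro)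

lemma Bt_P: "\<phi> \<in> Bt k \<Longrightarrow> \<phi> \<in> carrier Pm"
  by (simp add: Bt_def)

abbreviation cosP where "cosP \<phi> \<equiv> Bt 1 +>\<^bsub>PA\<^esub> \<phi>"
abbreviation QN where "QN \<equiv> quot_module PA (Bt 1)"

lemma QN_smult:
  assumes "d \<in> D" "\<phi> \<in> Bt 0" shows "d \<odot>\<^bsub>QN\<^esub> cosP \<phi> = cosP (compose (carrier A) \<phi> d)"
proof -
  have "quot_map PA (Bt 1) (\<lambda>\<phi>. compose (carrier A) \<phi> d) (cosP \<phi>) = cosP (compose (carrier A) \<phi> d)"
  proof (rule PQ.quot_map_coset)
    show "(\<lambda>\<phi>. compose (carrier A) \<phi> d) \<in> carrier PA \<rightarrow> carrier PA" using Bt_D[OF _ assms(1)] by auto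
    fix x y assume "x \<in> carrier PA" "y \<in> carrier PA"
    then show "compose (carrier A) (x \<oplus>\<^bsub>PA\<^esub> y) d = compose (carrier A) x d \<oplus>\<^bsub>PA\<^esub> compose (carrier A) y d"
      using D_closed[OF assms(1)]
      by (intro extensionalityI[OF compose_extensional]) (simp_all add: CA.frob_shriek_simps compose_eq)
  qed (use assms Bt_D[OF _ assms(1)] in auto)
  then show ?thesis by (simp add: quot_module_def P_smult)
qed

lemma cosP_eq_iff:
  assumes "\<phi> \<in> Bt 0" "\<psi> \<in> Bt 0"
  shows "cosP \<phi> = cosP \<psi> \<longleftrightarrow> (\<forall>m<q. \<forall>r\<in>carrier R. \<psi> (mon r m) \<oplus>\<^bsub>M\<^esub> \<ominus>\<^bsub>M\<^esub> \<phi> (mon r m) \<in> trace_image f e (Suc m))"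
proof -
  interpret P: abelian_group Pm by (rule P_group)
  have c: "\<psi> \<oplus>\<^bsub>Pm\<^esub> \<ominus>\<^bsub>Pm\<^esub> \<phi> \<in> carrier Pm" using assms Bt_P by simp
  have "cosP \<phi> = cosP \<psi> \<longleftrightarrow> \<psi> \<oplus>\<^bsub>Pm\<^esub> \<ominus>\<^bsub>Pm\<^esub> \<phi> \<in> Bt 1"
    using PQ.coset_eq_iff[of \<phi> \<psi>] assms abelian_group_restrict(2)[OF P_group Bt_subgroup[of 0] assms(1)] by simp
  then show ?thesis using c Bt_P[OF assms(1)] by (simp add: Bt_def P_add P_minus)
qed

text \<open>Integer multiples taken on values. It provides a representative for the k-fold sum of a
  coset, so that the eigenvalue equation can be compared value by value.\<close>

definition sc :: "nat \<Rightarrow> ((nat \<Rightarrow> 'a) \<Rightarrow> 'c) \<Rightarrow> (nat \<Rightarrow> 'a) \<Rightarrow> 'c" where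
  "sc k \<phi> = (\<lambda>s\<in>carrier A. ([k] \<cdot> \<one>) \<odot>\<^bsub>M\<^esub> \<phi> s)"

lemma sc_Bt:
  assumes "\<phi> \<in> Bt l" shows "sc k \<phi> \<in> Bt l"
proof -
  note P = PD[OF Bt_P[OF assms]]
  have c: "[k] \<cdot> \<one> \<in> carrier R" by simp
  have "([k] \<cdot> \<one>) \<odot>\<^bsub>M\<^esub> (r \<odot>\<^bsub>M\<^esub> x) = r \<odot>\<^bsub>M\<^esub> (([k] \<cdot> \<one>) \<odot>\<^bsub>M\<^esub> x)" if "r \<in> carrier R" "x \<in> carrier M" for r x
    using that c R.m_comm[OF c that(1)] by (metis smult_assoc1)
  then have "sc k \<phi> \<in> carrier Pm" unfolding mem_P sc_def using P c by (auto simp: smult_r_distr)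
  then show ?thesis using assms c by (auto simp: Bt_def sc_def trace_image_ops)
qed

lemma add_pow_cosP:
  assumes "\<phi> \<in> Bt 0" shows "add_pow QN (k::nat) (cosP \<phi>) = cosP (sc k \<phi>)"
proof (induction k)
  case 0
  have "sc 0 \<phi> = \<zero>\<^bsub>PA\<^esub>"
    using PD(2)[OF Bt_P[OF assms]] by (auto simp: sc_def CA.frob_shriek_simps intro!: restrict_ext)
  then show ?case using PQ.coset_zero by (simp add: add_pow_def PQ.quot_zero del: One_nat_def)
next
  case (Suc k)
  have "sc (Suc k) \<phi> = sc k \<phi> \<oplus>\<^bsub>PA\<^esub> \<phi>"
    using PD(2)[OF Bt_P[OF assms]] by (auto simp: sc_def CA.frob_shriek_simps smult_l_distr intro!: restrict_ext)
  moreover have "add_pow QN (Suc k) (cosP \<phi>) = add_pow QN k (cosP \<phi>) \<oplus>\<^bsub>QN\<^esub> cosP \<phi>"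
    by (simp add: add_pow_def)
  ultimately show ?case using Suc sc_Bt[OF assms] assms by (simp add: PQ.quot_add del: One_nat_def)
qed

end

section \<open>The eigenspace attached to the base-p digits of n\<close>

locale eigen_setup = graph_setup R M p \<kappa> f e
  for R :: "'a ring" (structure) and M :: "('a, 'c) module" (structure) and p \<kappa> f e +
  fixes i :: "nat \<Rightarrow> nat" and n :: nat and xs
  assumes n_lt: "n < p ^ e" and digits: "\<And>j. j \<in> {1..e} \<Longrightarrow> n div p ^ (j - 1) mod p = i j" and i_lt: "\<And>j. j \<in> {1..e} \<Longrightarrow> i j < p"
    and xs: "dual_list e xs" "\<And>x. x \<in> carrier R \<Longrightarrow> x = dual_sum e xs x"
begin

abbreviation MT where "MT \<equiv> M\<lparr>carrier := trace_image f e n\<rparr>"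
abbreviation T' where "T' \<equiv> trace_image f e (Suc n)"
abbreviation QT where "QT \<equiv> quot_module MT T'"
abbreviation H where "H \<equiv> frob_shriek R p e QT"

sublocale TQ: quot_group MT T' by (rule tM_quot)

abbreviation cosT where "cosT x \<equiv> T' +>\<^bsub>MT\<^esub> x"

lemma QT_smult:
  assumes "r \<in> carrier R" "x \<in> trace_image f e n" shows "r \<odot>\<^bsub>QT\<^esub> cosT x = cosT (r \<odot>\<^bsub>M\<^esub> x)"
proof -
  have "quot_map MT T' (\<lambda>x. r \<odot>\<^bsub>M\<^esub> x) (cosT x) = cosT (r \<odot>\<^bsub>M\<^esub> x)"
    by (rule TQ.quot_map_coset) (use assms trace_image_ops in \<open>auto simp: smult_r_distr\<close>)
  then show ?thesis by (simp add: quot_module_def)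
qed

lemma QT_add: "x \<in> trace_image f e n \<Longrightarrow> y \<in> trace_image f e n \<Longrightarrow> cosT x \<oplus>\<^bsub>QT\<^esub> cosT y = cosT (x \<oplus>\<^bsub>M\<^esub> y)"
  using TQ.quot_add[of x y] by simp

lemma cosT_eq_iff: "x \<in> trace_image f e n \<Longrightarrow> y \<in> trace_image f e n \<Longrightarrow> cosT x = cosT y \<longleftrightarrow> y \<oplus>\<^bsub>M\<^esub> \<ominus>\<^bsub>M\<^esub> x \<in> T'"
  using TQ.coset_eq_iff[of x y] abelian_group_restrict(2)[OF M.abelian_group_axioms submodule.axioms(1)[OF trace_image_submodule[OF f, of e n]], of x]
  by simp

lemma QT_carrier: "U \<in> carrier QT \<longleftrightarrow> (\<exists>x\<in>trace_image f e n. U = cosT x)"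
  using TQ.quot_carrier by auto

definition ev :: "((nat \<Rightarrow> 'a) \<Rightarrow> 'c) \<Rightarrow> 'a \<Rightarrow> 'c set" where
  "ev \<phi> = (\<lambda>r\<in>carrier R. cosT (\<phi> (mon r n)))"

text \<open>Evaluation at r t^n on cosets, as a union over representatives so that none has to be
  chosen; on the coset of \<phi> it agrees with \<open>ev \<phi>\<close>.\<close>

definition eigen_map :: "((nat \<Rightarrow> 'a) \<Rightarrow> 'c) set \<Rightarrow> 'a \<Rightarrow> 'c set" where
  "eigen_map U = (\<lambda>r\<in>carrier R. \<Union>\<phi>\<in>U. cosT (\<phi> (mon r n)))"

lemma Bt_value: "\<phi> \<in> Bt 0 \<Longrightarrow> r \<in> carrier R \<Longrightarrow> \<phi> (mon r n) \<in> trace_image f e n"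
  using n_lt by (auto simp: Bt_def)

lemma eigen_map_cosP:
  assumes "\<phi> \<in> Bt 0" shows "eigen_map (cosP \<phi>) = ev \<phi>"
  unfolding eigen_map_def ev_def
proof (rule restrict_ext)
  fix r assume r: "r \<in> carrier R"
  have "cosT (\<psi> (mon r n)) = cosT (\<phi> (mon r n))" if \<psi>: "\<psi> \<in> cosP \<phi>" for \<psi>
  proof -
    obtain b where b: "b \<in> Bt 1" "\<psi> = b \<oplus>\<^bsub>Pm\<^esub> \<phi>" using \<psi> by (auto simp: a_r_coset_def')
    have b0: "b \<in> Bt 0" using b(1) Bt_antimono by blast
    have bv: "b (mon r n) \<in> T'" using b(1) n_lt r by (auto simp: Bt_def)
    have c: "b (mon r n) \<in> trace_image f e n" "\<phi> (mon r n) \<in> trace_image f e n" using Bt_value b0 assms r by auto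
    have v: "\<psi> (mon r n) = b (mon r n) \<oplus>\<^bsub>M\<^esub> \<phi> (mon r n)" unfolding b(2) using r by (simp add: P_add)
    have "\<psi> (mon r n) \<oplus>\<^bsub>M\<^esub> \<ominus>\<^bsub>M\<^esub> \<phi> (mon r n) = b (mon r n)"
      unfolding v using trace_image_ops(1) c by (simp add: M.a_assoc M.r_neg)
    then show ?thesis using cosT_eq_iff[of "\<phi> (mon r n)" "\<psi> (mon r n)"] c v bv trace_image_ops(3) by simp
  qed
  then have "(\<Union>\<psi>\<in>cosP \<phi>. cosT (\<psi> (mon r n))) = (\<Union>\<psi>\<in>cosP \<phi>. cosT (\<phi> (mon r n)))" by (rule SUP_cong[OF refl])
  also have "\<dots> = cosT (\<phi> (mon r n))"
  proof -
    have "\<phi> \<in> cosP \<phi>" using PQ.N.a_rcos_self[of \<phi>] assms by simp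
    then show ?thesis by blast
  qed
  finally show "(\<Union>\<psi>\<in>cosP \<phi>. cosT (\<psi> (mon r n))) = cosT (\<phi> (mon r n))" .
qed

lemma ev_H:
  assumes "\<phi> \<in> Bt 0" shows "ev \<phi> \<in> carrier H"
  unfolding mem_frob_shriek ev_def
  using Bt_value[OF assms] Bt_P[OF assms]
  by (auto simp: QT_carrier QT_add QT_smult P_mon_smult PD(3)[OF Bt_P[OF assms]] Pi_iff)

abbreviation EV where "EV \<equiv> {U \<in> carrier QN. \<forall>j\<in>{1..e}. euler_op R (p ^ (j - 1)) \<odot>\<^bsub>QN\<^esub> U = add_pow QN (i j) U}"

lemma QN_carrier: "U \<in> carrier QN \<longleftrightarrow> (\<exists>\<phi>\<in>Bt 0. U = cosP \<phi>)"
  using PQ.quot_carrier by auto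

text \<open>An Euler operator multiplies the value at r t^m by C(m, p^(j-1)). The eigenvalue
  equation in the quotient therefore splits into one condition per exponent m, each modulo the trace
  image for m + 1.\<close>

lemma euler_cosP:
  assumes \<phi>: "\<phi> \<in> Bt 0" and j: "j \<in> {1..e}"
  shows "euler_op R (p ^ (j - 1)) \<odot>\<^bsub>QN\<^esub> cosP \<phi> = add_pow QN (i j) (cosP \<phi>) \<longleftrightarrow>
    (\<forall>m<q. \<forall>r\<in>carrier R. ([i j] \<cdot> \<one> \<ominus> [(m choose p ^ (j - 1))] \<cdot> \<one>) \<odot>\<^bsub>M\<^esub> \<phi> (mon r m) \<in> trace_image f e (Suc m))"
proof -
  define \<theta> where "\<theta> = euler_op R (p ^ (j - 1))"
  have \<theta>: "\<theta> \<in> D" unfolding \<theta>_def using j by (intro D_euler) auto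
  have "\<theta> \<odot>\<^bsub>QN\<^esub> cosP \<phi> = add_pow QN (i j) (cosP \<phi>) \<longleftrightarrow> cosP (compose (carrier A) \<phi> \<theta>) = cosP (sc (i j) \<phi>)"
    by (simp only: QN_smult[OF \<theta> \<phi>] add_pow_cosP[OF \<phi>])
  also have "\<dots> \<longleftrightarrow> (\<forall>m<q. \<forall>r\<in>carrier R. sc (i j) \<phi> (mon r m) \<oplus>\<^bsub>M\<^esub> \<ominus>\<^bsub>M\<^esub> compose (carrier A) \<phi> \<theta> (mon r m) \<in> trace_image f e (Suc m))"
    by (rule cosP_eq_iff[OF Bt_D[OF \<phi> \<theta>] sc_Bt[OF \<phi>]])
  also have "\<dots> \<longleftrightarrow> (\<forall>m<q. \<forall>r\<in>carrier R. ([i j] \<cdot> \<one> \<ominus> [(m choose p ^ (j - 1))] \<cdot> \<one>) \<odot>\<^bsub>M\<^esub> \<phi> (mon r m) \<in> trace_image f e (Suc m))"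
  proof -
    have "sc (i j) \<phi> (mon r m) \<oplus>\<^bsub>M\<^esub> \<ominus>\<^bsub>M\<^esub> compose (carrier A) \<phi> \<theta> (mon r m) = ([i j] \<cdot> \<one> \<ominus> [(m choose p ^ (j - 1))] \<cdot> \<one>) \<odot>\<^bsub>M\<^esub> \<phi> (mon r m)"
      if r: "r \<in> carrier R" for r m
    proof -
      have "compose (carrier A) \<phi> \<theta> (mon r m) = ([(m choose p ^ (j - 1))] \<cdot> \<one>) \<odot>\<^bsub>M\<^esub> \<phi> (mon r m)"
        unfolding \<theta>_def euler_dg using r P_mon_add_pow[OF Bt_P[OF \<phi>] r] by (simp add: compose_eq dg_mon)
      then show ?thesis using r PD(2)[OF Bt_P[OF \<phi>]] by (simp add: sc_def R.minus_eq smult_l_distr smult_l_minus)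
    qed
    then show ?thesis by simp
  qed
  finally show ?thesis unfolding \<theta>_def .
qed

text \<open>If m and n are distinct below p^e, some digit differs. The corresponding scalar in the
  eigenvalue condition is then a unit, and the value at m already vanishes in the quotient.\<close>

lemma EV_off_diagonal:
  assumes \<phi>: "\<phi> \<in> Bt 0" "cosP \<phi> \<in> EV" and m: "m < q" "m \<noteq> n" and r: "r \<in> carrier R"
  shows "\<phi> (mon r m) \<in> trace_image f e (Suc m)"
proof -
  have "m mod q \<noteq> n mod q" using m n_lt by simp
  then obtain k where k: "k < e" "m div p ^ k mod p \<noteq> n div p ^ k mod p" using mod_prime_power_eqI by blast
  define j where "j = Suc k"
  have j: "j \<in> {1..e}" "j - 1 = k" using k by (auto simp: j_def)
  have "i j mod p \<noteq> (m choose p ^ (j - 1)) mod p"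
    using k digits[OF j(1)] i_lt[OF j(1)] j(2) by (simp add: choose_prime_power_mod[OF p_prime])
  then obtain \<beta> where \<beta>: "\<beta> \<in> carrier R" "\<beta> \<otimes> ([i j] \<cdot> \<one> \<ominus> [(m choose p ^ (j - 1))] \<cdot> \<one>) = \<one>"
    using difference_unit by blast
  have v: "\<phi> (mon r m) \<in> carrier M" using PD(2)[OF Bt_P[OF \<phi>(1)]] r by simp
  have "([i j] \<cdot> \<one> \<ominus> [(m choose p ^ (j - 1))] \<cdot> \<one>) \<odot>\<^bsub>M\<^esub> \<phi> (mon r m) \<in> trace_image f e (Suc m)"
    using \<phi>(2) euler_cosP[OF \<phi>(1) j(1)] j(1) m(1) r by blast
  then have "\<beta> \<odot>\<^bsub>M\<^esub> (([i j] \<cdot> \<one> \<ominus> [(m choose p ^ (j - 1))] \<cdot> \<one>) \<odot>\<^bsub>M\<^esub> \<phi> (mon r m)) \<in> trace_image f e (Suc m)"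
    by (rule trace_image_ops(5)[OF \<beta>(1)])
  then show ?thesis using \<beta> v by (simp flip: smult_assoc1)
qed

lemma EV_E: "U \<in> EV \<Longrightarrow> (\<And>\<phi>. \<phi> \<in> Bt 0 \<Longrightarrow> U = cosP \<phi> \<Longrightarrow> P) \<Longrightarrow> P"
  unfolding mem_Collect_eq QN_carrier by (elim conjE bexE)

text \<open>At the exponent n equality of the images is the required congruence; at every other
  exponent both values lie in the smaller trace image, by the preceding lemma.\<close>

lemma eigen_map_inj: "inj_on eigen_map EV"
proof (rule inj_onI)
  fix U V assume U: "U \<in> EV" and V: "V \<in> EV" and eq: "eigen_map U = eigen_map V"
  obtain \<phi> where \<phi>: "\<phi> \<in> Bt 0" "U = cosP \<phi>" using U by (rule EV_E)
  obtain \<psi> where \<psi>: "\<psi> \<in> Bt 0" "V = cosP \<psi>" using V by (rule EV_E)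
  have ev: "ev \<phi> = ev \<psi>" using eq eigen_map_cosP[OF \<phi>(1)] eigen_map_cosP[OF \<psi>(1)] \<phi>(2) \<psi>(2) by simp
  show "U = V" unfolding \<phi>(2) \<psi>(2) cosP_eq_iff[OF \<phi>(1) \<psi>(1)]
  proof (intro allI impI ballI)
    fix m r assume m: "m < q" and r: "r \<in> carrier R"
    show "\<psi> (mon r m) \<oplus>\<^bsub>M\<^esub> \<ominus>\<^bsub>M\<^esub> \<phi> (mon r m) \<in> trace_image f e (Suc m)"
    proof (cases "m = n")
      case True
      have "cosT (\<phi> (mon r n)) = cosT (\<psi> (mon r n))" using fun_cong[OF ev, of r] r by (simp add: ev_def)
      then show ?thesis using cosT_eq_iff[OF Bt_value[OF \<phi>(1) r] Bt_value[OF \<psi>(1) r]] True by simp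
    next
      case False
      show ?thesis
        using trace_image_ops(3)[OF EV_off_diagonal[OF \<psi>(1) V[unfolded \<psi>(2)] m False r]
          trace_image_ops(4)[OF EV_off_diagonal[OF \<phi>(1) U[unfolded \<phi>(2)] m False r]]] .
    qed
  qed
qed

text \<open>Lifting along \<open>T \<rightarrow> T / T'\<close> by means of the dual basis.\<close>

lemma frob_shriek_lift:
  assumes g: "g \<in> carrier H"
  shows "\<exists>\<psi>. \<psi> \<in> carrier R \<rightarrow> trace_image f e n \<and>
    (\<forall>x\<in>carrier R. \<forall>y\<in>carrier R. \<psi> (x \<oplus> y) = \<psi> x \<oplus>\<^bsub>M\<^esub> \<psi> y) \<and>
    (\<forall>r\<in>carrier R. \<forall>x\<in>carrier R. \<psi> (r [^] q \<otimes> x) = r \<odot>\<^bsub>M\<^esub> \<psi> x) \<and>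
    (\<forall>x\<in>carrier R. cosT (\<psi> x) = g x)"
proof -
  have g': "\<And>x. x \<in> carrier R \<Longrightarrow> g x \<in> carrier QT" "\<And>x y. x \<in> carrier R \<Longrightarrow> y \<in> carrier R \<Longrightarrow> g (x \<oplus> y) = g x \<oplus>\<^bsub>QT\<^esub> g y"
    "\<And>r x. r \<in> carrier R \<Longrightarrow> x \<in> carrier R \<Longrightarrow> g (r [^] q \<otimes> x) = r \<odot>\<^bsub>QT\<^esub> g x"
    using g unfolding mem_frob_shriek by auto
  have "\<forall>w\<in>carrier R. \<exists>y. y \<in> trace_image f e n \<and> g w = cosT y" using g'(1) QT_carrier by blast
  then obtain y where y: "\<And>w. w \<in> carrier R \<Longrightarrow> y w \<in> trace_image f e n" "\<And>w. w \<in> carrier R \<Longrightarrow> g w = cosT (y w)" by metis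
  define S where "S ys x = foldr (\<lambda>(l, w) acc. l x \<odot>\<^bsub>M\<^esub> y w \<oplus>\<^bsub>M\<^esub> acc) ys \<zero>\<^bsub>M\<^esub>" for ys :: "(('a \<Rightarrow> 'a) \<times> 'a) list" and x
  have S_Cons: "S ((l, w) # ys) x = l x \<odot>\<^bsub>M\<^esub> y w \<oplus>\<^bsub>M\<^esub> S ys x" for l w ys x by (simp add: S_def)
  have S_Nil: "S [] x = \<zero>\<^bsub>M\<^esub>" for x by (simp add: S_def)
  have g0: "g \<zero> = cosT \<zero>\<^bsub>M\<^esub>"
    using g'(3)[of \<zero> \<zero>] y(1)[of \<zero>] y(2)[of \<zero>] trace_image_ops(1) by (simp add: QT_smult)
  have S: "(\<forall>x\<in>carrier R. S ys x \<in> trace_image f e n \<and> cosT (S ys x) = g (dual_sum e ys x)) \<and>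
      (\<forall>x\<in>carrier R. \<forall>x'\<in>carrier R. S ys (x \<oplus> x') = S ys x \<oplus>\<^bsub>M\<^esub> S ys x') \<and>
      (\<forall>r\<in>carrier R. \<forall>x\<in>carrier R. S ys (r [^] q \<otimes> x) = r \<odot>\<^bsub>M\<^esub> S ys x)" if "dual_list e ys" for ys
    using that
  proof (induction ys)
    case Nil
    then show ?case by (simp add: S_Nil trace_image_ops g0)
  next
    case (Cons a ys)
    obtain l w where a: "a = (l, w)" by (cases a)
    have lw: "frob_linear e l" "w \<in> carrier R" "dual_list e ys" using Cons.prems a by auto
    note IH = Cons.IH[OF lw(3)]
    have l: "l x \<in> carrier R" if "x \<in> carrier R" for x using frob_linear_closed[OF lw(1) that] .
    have l2: "l (x \<oplus> x') = l x \<oplus> l x'" "l (r [^] q \<otimes> x) = r \<otimes> l x" if "x \<in> carrier R" "x' \<in> carrier R" "r \<in> carrier R" for x x' r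
      using lw(1) that unfolding frob_linear_def by blast+
    have yc: "y w \<in> trace_image f e n" "y w \<in> carrier M" using y(1)[OF lw(2)] trace_image_ops(1) by auto
    have Sc: "S ys x \<in> trace_image f e n" "S ys x \<in> carrier M" if "x \<in> carrier R" for x using IH that trace_image_ops(1) by auto
    show ?case unfolding a
    proof (intro conjI ballI)
      fix x assume x: "x \<in> carrier R"
      have t: "l x \<odot>\<^bsub>M\<^esub> y w \<in> trace_image f e n" using l[OF x] yc trace_image_ops(5) by blast
      show "S ((l, w) # ys) x \<in> trace_image f e n" unfolding S_Cons using t Sc[OF x] trace_image_ops(3) by blast
      have "cosT (S ((l, w) # ys) x) = cosT (l x \<odot>\<^bsub>M\<^esub> y w) \<oplus>\<^bsub>QT\<^esub> cosT (S ys x)"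
        unfolding S_Cons using t Sc[OF x] by (simp add: QT_add)
      also have "cosT (l x \<odot>\<^bsub>M\<^esub> y w) = g (l x [^] q \<otimes> w)"
        using g'(3)[OF l[OF x] lw(2)] y(2)[OF lw(2)] QT_smult[OF l[OF x] yc(1)] by simp
      also have "cosT (S ys x) = g (dual_sum e ys x)" using IH x by blast
      also have "g (l x [^] q \<otimes> w) \<oplus>\<^bsub>QT\<^esub> g (dual_sum e ys x) = g (dual_sum e ((l, w) # ys) x)"
        using g'(2)[of "l x [^] q \<otimes> w" "dual_sum e ys x"] l[OF x] lw(2) dual_sum_closed[OF lw(3) x] by simp
      finally show "cosT (S ((l, w) # ys) x) = g (dual_sum e ((l, w) # ys) x)" .
      fix x' assume x': "x' \<in> carrier R"
      have "S ys (x \<oplus> x') = S ys x \<oplus>\<^bsub>M\<^esub> S ys x'" using IH x x' by blast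
      then show "S ((l, w) # ys) (x \<oplus> x') = S ((l, w) # ys) x \<oplus>\<^bsub>M\<^esub> S ((l, w) # ys) x'"
        unfolding S_Cons using l2(1)[OF x x' x] l[OF x] l[OF x'] yc(2) Sc(2)[OF x] Sc(2)[OF x'] by (simp add: smult_l_distr M.a_ac)
    next
      fix r x assume r: "r \<in> carrier R" and x: "x \<in> carrier R"
      have "S ys (r [^] q \<otimes> x) = r \<odot>\<^bsub>M\<^esub> S ys x" using IH r x by blast
      then show "S ((l, w) # ys) (r [^] q \<otimes> x) = r \<odot>\<^bsub>M\<^esub> S ((l, w) # ys) x"
        unfolding S_Cons using l2(2)[OF x x r] l[OF x] yc(2) Sc(2)[OF x] r by (simp add: smult_r_distr smult_assoc1)
    qed
  qed
  show ?thesis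
    using S[OF xs(1)] xs(2) by (intro exI[of _ "S xs"]) auto
qed

text \<open>The element of \<open>F\<^sup>e\<^sup>!\<gamma>\<^sub>*M\<close> concentrated in the exponents congruent to \<open>n\<close> that extends \<open>\<psi>\<close>.\<close>

definition ext_map :: "('a \<Rightarrow> 'c) \<Rightarrow> (nat \<Rightarrow> 'a) \<Rightarrow> 'c" where
  "ext_map \<psi> = (\<lambda>s\<in>carrier A. \<Oplus>\<^bsub>M\<^esub>b\<in>{..deg R s}. f [^] b \<odot>\<^bsub>M\<^esub> \<psi> (cf s (b * q + n)))"

lemma ext_map_P:
  assumes \<psi>: "\<And>x. x \<in> carrier R \<Longrightarrow> \<psi> x \<in> carrier M" "\<And>x y. x \<in> carrier R \<Longrightarrow> y \<in> carrier R \<Longrightarrow> \<psi> (x \<oplus> y) = \<psi> x \<oplus>\<^bsub>M\<^esub> \<psi> y"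
    "\<And>r x. r \<in> carrier R \<Longrightarrow> x \<in> carrier R \<Longrightarrow> \<psi> (r [^] q \<otimes> x) = r \<odot>\<^bsub>M\<^esub> \<psi> x"
  shows "ext_map \<psi> \<in> carrier Pm"
    "c \<in> carrier R \<Longrightarrow> ext_map \<psi> (mon c k) = (if k mod q = n then f [^] (k div q) \<odot>\<^bsub>M\<^esub> \<psi> c else \<zero>\<^bsub>M\<^esub>)"
proof -
  have \<psi>0: "\<psi> \<zero> = \<zero>\<^bsub>M\<^esub>" using \<psi>(3)[of \<zero> \<zero>] \<psi>(1)[of \<zero>] by simp
  define t where "t s b = f [^] b \<odot>\<^bsub>M\<^esub> \<psi> (cf s (b * q + n))" for s b
  have t: "t s b \<in> carrier M" if "s \<in> carrier A" for s b using that \<psi>(1) f by (simp add: t_def)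
  have qp: "q \<ge> 1" using q_pos[of e] by linarith
  \<comment> \<open>The upper summation limit may be raised beyond the degree: for b > deg s the
    exponent b p^e + n also exceeds the degree, because p^e is at least 1. This allows s, s' and
    their sum to be treated over one range.\<close>
  have bound: "ext_map \<psi> s = (\<Oplus>\<^bsub>M\<^esub>b\<in>{..N}. t s b)" if s: "s \<in> carrier A" and N: "deg R s \<le> N" for s N
  proof -
    have "t s b = \<zero>\<^bsub>M\<^esub>" if "b \<in> {..N} - {..deg R s}" for b
    proof -
      have "deg R s < b" using that by auto
      also have "b \<le> b * q + n" using qp by (simp add: trans_le_add1)
      finally have "cf s (b * q + n) = \<zero>" using U.deg_aboveD s by blast
      then show ?thesis using \<psi>0 f by (simp add: t_def)
    qed
    then have "(\<Oplus>\<^bsub>M\<^esub>b\<in>{..deg R s}. t s b) = (\<Oplus>\<^bsub>M\<^esub>b\<in>{..N}. t s b)"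
      using N t[OF s] by (intro M.add.finprod_mono_neutral_cong_left) auto
    then show ?thesis using s by (simp add: ext_map_def t_def)
  qed
  have cl: "ext_map \<psi> s \<in> carrier M" if s: "s \<in> carrier A" for s
    using bound[OF s order_refl] t[OF s] by (simp add: M.finsum_closed)
  have add: "ext_map \<psi> (s \<oplus>\<^bsub>A\<^esub> s') = ext_map \<psi> s \<oplus>\<^bsub>M\<^esub> ext_map \<psi> s'" if s: "s \<in> carrier A" "s' \<in> carrier A" for s s'
  proof -
    define N where "N = max (deg R s) (max (deg R s') (deg R (s \<oplus>\<^bsub>A\<^esub> s')))"
    have "ext_map \<psi> (s \<oplus>\<^bsub>A\<^esub> s') = (\<Oplus>\<^bsub>M\<^esub>b\<in>{..N}. t (s \<oplus>\<^bsub>A\<^esub> s') b)" using s by (intro bound) (auto simp: N_def)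
    also have "\<dots> = (\<Oplus>\<^bsub>M\<^esub>b\<in>{..N}. t s b \<oplus>\<^bsub>M\<^esub> t s' b)"
      using s t f \<psi>(1) by (intro M.finsum_cong') (auto simp: t_def \<psi>(2) smult_r_distr)
    also have "\<dots> = (\<Oplus>\<^bsub>M\<^esub>b\<in>{..N}. t s b) \<oplus>\<^bsub>M\<^esub> (\<Oplus>\<^bsub>M\<^esub>b\<in>{..N}. t s' b)"
      using s t by (intro M.finsum_addf) auto
    also have "\<dots> = ext_map \<psi> s \<oplus>\<^bsub>M\<^esub> ext_map \<psi> s'" using s by (simp add: bound[of s N] bound[of s' N] N_def)
    finally show ?thesis .
  qed
  have mono: "ext_map \<psi> (mon c k) = (if k mod q = n then f [^] (k div q) \<odot>\<^bsub>M\<^esub> \<psi> c else \<zero>\<^bsub>M\<^esub>)" if c: "c \<in> carrier R" for c k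
  proof -
    have kd: "k = b * q + n \<longleftrightarrow> k mod q = n \<and> b = k div q" for b using n_lt p_prime by (auto simp: div_mult_mod_eq)
    have tk: "t (mon c k) b = (if b = k div q then (if k mod q = n then f [^] (k div q) \<odot>\<^bsub>M\<^esub> \<psi> c else \<zero>\<^bsub>M\<^esub>) else \<zero>\<^bsub>M\<^esub>)" for b
      using c \<psi>0 f kd[of b] by (auto simp: t_def)
    have "deg R (mon c k) \<le> k" using U.deg_monom_le c by blast
    then have "ext_map \<psi> (mon c k) = (\<Oplus>\<^bsub>M\<^esub>b\<in>{..k}. t (mon c k) b)" using c by (intro bound) auto
    also have "\<dots> = (\<Oplus>\<^bsub>M\<^esub>b\<in>{..k}. if k div q = b then (if k mod q = n then f [^] (k div q) \<odot>\<^bsub>M\<^esub> \<psi> c else \<zero>\<^bsub>M\<^esub>) else \<zero>\<^bsub>M\<^esub>)"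
      unfolding tk by (rule M.finsum_cong') (use c \<psi>(1) f in auto)
    also have "\<dots> = (if k mod q = n then f [^] (k div q) \<odot>\<^bsub>M\<^esub> \<psi> c else \<zero>\<^bsub>M\<^esub>)"
      by (rule M.finsum_singleton) (use c \<psi>(1) f in \<open>auto\<close>)
    finally show ?thesis .
  qed
  show "ext_map \<psi> (mon c k) = (if k mod q = n then f [^] (k div q) \<odot>\<^bsub>M\<^esub> \<psi> c else \<zero>\<^bsub>M\<^esub>)" if "c \<in> carrier R"
    by (rule mono[OF that])
  show "ext_map \<psi> \<in> carrier Pm" unfolding mem_P
  proof (intro conjI ballI)
    show "ext_map \<psi> \<in> extensional (carrier A)" by (simp add: ext_map_def)
    show "ext_map \<psi> \<in> carrier A \<rightarrow> carrier M" using cl by blast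
    show "ext_map \<psi> (s \<oplus>\<^bsub>A\<^esub> s') = ext_map \<psi> s \<oplus>\<^bsub>M\<^esub> ext_map \<psi> s'" if "s \<in> carrier A" "s' \<in> carrier A" for s s' by (rule add[OF that])
    fix s x assume s: "s \<in> carrier A" and x: "x \<in> carrier A"
    have "ext_map \<psi> (s [^]\<^bsub>A\<^esub> q \<otimes>\<^bsub>A\<^esub> x) = s \<odot>\<^bsub>gM\<^esub> ext_map \<psi> x"
    proof (rule frob_linear_ext[OF gM_module _ _ _ s x])
      show "ext_map \<psi> \<in> carrier A \<rightarrow> carrier gM" using cl by simp
      show "ext_map \<psi> (s \<oplus>\<^bsub>A\<^esub> s') = ext_map \<psi> s \<oplus>\<^bsub>gM\<^esub> ext_map \<psi> s'" if "s \<in> carrier A" "s' \<in> carrier A" for s s'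
        using add[OF that] by simp
      fix r c b k assume r: "r \<in> carrier R" and c: "c \<in> carrier R"
      have k: "(b * q + k) mod q = k mod q" "(b * q + k) div q = b + k div q" using p_prime by auto
      have eq: "f [^] (b + k div q) \<odot>\<^bsub>M\<^esub> (r \<odot>\<^bsub>M\<^esub> \<psi> c) = (r \<otimes> f [^] b) \<odot>\<^bsub>M\<^esub> (f [^] (k div q) \<odot>\<^bsub>M\<^esub> \<psi> c)"
        using r c \<psi>(1) f by (simp add: R.m_ac flip: smult_assoc1 R.nat_pow_mult)
      have "ext_map \<psi> (mon (r [^] q \<otimes> c) (b * q + k)) = (if k mod q = n then f [^] (b + k div q) \<odot>\<^bsub>M\<^esub> (r \<odot>\<^bsub>M\<^esub> \<psi> c) else \<zero>\<^bsub>M\<^esub>)"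
        using mono[of "r [^] q \<otimes> c" "b * q + k"] r c unfolding k \<psi>(3)[OF r c] by blast
      also have "\<dots> = mon r b \<odot>\<^bsub>gM\<^esub> (if k mod q = n then f [^] (k div q) \<odot>\<^bsub>M\<^esub> \<psi> c else \<zero>\<^bsub>M\<^esub>)"
        using eq r f by (cases "k mod q = n") (simp_all add: \<gamma>_mon)
      finally show "ext_map \<psi> (mon (r [^] q \<otimes> c) (b * q + k)) = mon r b \<odot>\<^bsub>gM\<^esub> ext_map \<psi> (mon c k)"
        unfolding mono[OF c] .
    qed
    then show "ext_map \<psi> (s [^]\<^bsub>A\<^esub> q \<otimes>\<^bsub>A\<^esub> x) = \<gamma> s \<odot>\<^bsub>M\<^esub> ext_map \<psi> x" by simp
  qed
qed

text \<open>A map g is lifted to one with values in the trace image and extended by zero to the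
  other residues. The result is an eigenvector: at m = n the scalar in the eigenvalue condition is
  zero, and at m \<noteq> n the value is zero.\<close>

lemma eigen_map_surj: "eigen_map ` EV = carrier H"
proof
  show "eigen_map ` EV \<subseteq> carrier H"
  proof (rule image_subsetI)
    fix U assume "U \<in> EV"
    then obtain \<phi> where "\<phi> \<in> Bt 0" "U = cosP \<phi>" by (rule EV_E)
    then show "eigen_map U \<in> carrier H" using eigen_map_cosP ev_H by simp
  qed
  show "carrier H \<subseteq> eigen_map ` EV"
  proof
    fix g assume g: "g \<in> carrier H"
    obtain \<psi> where \<psi>: "\<psi> \<in> carrier R \<rightarrow> trace_image f e n" "\<forall>x\<in>carrier R. \<forall>y\<in>carrier R. \<psi> (x \<oplus> y) = \<psi> x \<oplus>\<^bsub>M\<^esub> \<psi> y"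
      "\<forall>r\<in>carrier R. \<forall>x\<in>carrier R. \<psi> (r [^] q \<otimes> x) = r \<odot>\<^bsub>M\<^esub> \<psi> x" "\<forall>x\<in>carrier R. cosT (\<psi> x) = g x"
      using frob_shriek_lift[OF g] by blast
    have \<psi>c: "\<psi> x \<in> trace_image f e n" "\<psi> x \<in> carrier M" if "x \<in> carrier R" for x using \<psi>(1) that trace_image_ops(1) by blast+
    define \<phi> where "\<phi> = ext_map \<psi>"
    have \<phi>P: "\<phi> \<in> carrier Pm" unfolding \<phi>_def by (rule ext_map_P(1)) (use \<psi> \<psi>c in auto)
    have \<phi>_mon: "\<phi> (mon c k) = (if k mod q = n then f [^] (k div q) \<odot>\<^bsub>M\<^esub> \<psi> c else \<zero>\<^bsub>M\<^esub>)" if "c \<in> carrier R" for c k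
      unfolding \<phi>_def by (rule ext_map_P(2)) (use \<psi> \<psi>c that in auto)
    have \<phi>B: "\<phi> \<in> Bt 0"
      using \<phi>P \<psi>c by (auto simp: Bt_def \<phi>_mon trace_image_ops(2))
    have "cosP \<phi> \<in> EV"
    proof -
      have "euler_op R (p ^ (j - 1)) \<odot>\<^bsub>QN\<^esub> cosP \<phi> = add_pow QN (i j) (cosP \<phi>)" if j: "j \<in> {1..e}" for j
        unfolding euler_cosP[OF \<phi>B j]
      proof (intro allI impI ballI)
        fix m r assume m: "m < q" and r: "r \<in> carrier R"
        show "([i j] \<cdot> \<one> \<ominus> [(m choose p ^ (j - 1))] \<cdot> \<one>) \<odot>\<^bsub>M\<^esub> \<phi> (mon r m) \<in> trace_image f e (Suc m)"
        proof (cases "m = n")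
          case True
          have "i j mod p = (m choose p ^ (j - 1)) mod p"
            using digits[OF j] i_lt[OF j] True by (simp add: choose_prime_power_mod[OF p_prime])
          then have "[i j] \<cdot> \<one> = [(m choose p ^ (j - 1))] \<cdot> \<one>" by (rule add_pow_cong[OF R.one_closed])
          then have z: "[i j] \<cdot> \<one> \<ominus> [(m choose p ^ (j - 1))] \<cdot> \<one> = \<zero>" by (simp add: R.minus_eq R.r_neg)
          show ?thesis unfolding z using PD(2)[OF \<phi>P] r trace_image_ops(2) by simp
        next
          case False
          then have "\<phi> (mon r m) = \<zero>\<^bsub>M\<^esub>" using \<phi>_mon[OF r] m by simp
          then show ?thesis using trace_image_ops(2) by (simp add: R.minus_closed)
        qed
      qed
      moreover have "cosP \<phi> \<in> carrier QN" unfolding QN_carrier using refl \<phi>B by (rule bexI)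
      ultimately show ?thesis unfolding mem_Collect_eq by (intro conjI ballI)
    qed
    moreover have "eigen_map (cosP \<phi>) = g"
      unfolding eigen_map_cosP[OF \<phi>B]
    proof (rule extensionalityI[of _ "carrier R"])
      show "ev \<phi> \<in> extensional (carrier R)" by (simp add: ev_def)
      show "g \<in> extensional (carrier R)" using g unfolding mem_frob_shriek by blast
      fix x assume x: "x \<in> carrier R"
      then have "\<phi> (mon x n) = \<psi> x" using \<phi>_mon[OF x, of n] n_lt \<psi>c(2)[OF x] by simp
      then show "ev \<phi> x = g x" using x \<psi>(4) by (simp add: ev_def)
    qed
    ultimately show "g \<in> eigen_map ` EV" by (intro image_eqI[OF sym])
  qed
qed

lemma eigen_map_linear:
  "linear_map (diff_ops R p e) (restrict_scalars (on_coeffs R) (QN\<lparr>carrier := EV\<rparr>)) H eigen_map"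
  unfolding linear_map_def
proof (intro conjI ballI)
  have simps: "carrier (restrict_scalars (on_coeffs R) (QN\<lparr>carrier := EV\<rparr>)) = EV"
    "add (restrict_scalars (on_coeffs R) (QN\<lparr>carrier := EV\<rparr>)) = add QN"
    "smult (restrict_scalars (on_coeffs R) (QN\<lparr>carrier := EV\<rparr>)) = (\<lambda>d U. on_coeffs R d \<odot>\<^bsub>QN\<^esub> U)"
    by (simp_all add: restrict_scalars_def)
  show "eigen_map \<in> carrier (restrict_scalars (on_coeffs R) (QN\<lparr>carrier := EV\<rparr>)) \<rightarrow> carrier H"
    unfolding simps Pi_iff using eigen_map_surj by (intro ballI) (simp only: flip: eigen_map_surj, rule imageI)
  fix U assume "U \<in> carrier (restrict_scalars (on_coeffs R) (QN\<lparr>carrier := EV\<rparr>))"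
  then have "U \<in> carrier QN" unfolding simps by blast
  then obtain \<phi> where \<phi>: "\<phi> \<in> Bt 0" "U = cosP \<phi>" using QN_carrier by blast
  {
    fix V assume "V \<in> carrier (restrict_scalars (on_coeffs R) (QN\<lparr>carrier := EV\<rparr>))"
    then have "V \<in> carrier QN" unfolding simps by blast
    then obtain \<psi> where \<psi>: "\<psi> \<in> Bt 0" "V = cosP \<psi>" using QN_carrier by blast
    have sum: "\<phi> \<oplus>\<^bsub>Pm\<^esub> \<psi> \<in> Bt 0" using subgroup.m_closed[OF Bt_subgroup \<phi>(1) \<psi>(1)] by simp
    have "U \<oplus>\<^bsub>QN\<^esub> V = cosP (\<phi> \<oplus>\<^bsub>Pm\<^esub> \<psi>)" unfolding \<phi>(2) \<psi>(2) using PQ.quot_add[of \<phi> \<psi>] \<phi>(1) \<psi>(1) by simp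
    then have "eigen_map (U \<oplus>\<^bsub>QN\<^esub> V) = ev (\<phi> \<oplus>\<^bsub>Pm\<^esub> \<psi>)" using eigen_map_cosP[OF sum] by simp
    also have "\<dots> = ev \<phi> \<oplus>\<^bsub>H\<^esub> ev \<psi>"
      unfolding frob_shriek_simps ev_def
      by (rule restrict_ext) (use Bt_value[OF \<phi>(1)] Bt_value[OF \<psi>(1)] in \<open>simp add: P_add QT_add\<close>)
    finally show "eigen_map (U \<oplus>\<^bsub>restrict_scalars (on_coeffs R) (QN\<lparr>carrier := EV\<rparr>)\<^esub> V) = eigen_map U \<oplus>\<^bsub>H\<^esub> eigen_map V"
      unfolding simps using eigen_map_cosP \<phi> \<psi> by simp
  }
  fix d assume d: "d \<in> carrier (diff_ops R p e)"
  have dc: "d r \<in> carrier R" if "r \<in> carrier R" for r using d that unfolding mem_diff_ops by blast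
  have "eigen_map (on_coeffs R d \<odot>\<^bsub>QN\<^esub> U) = ev (compose (carrier A) \<phi> (on_coeffs R d))"
    unfolding \<phi>(2) QN_smult[OF D_on_coeffs[OF d] \<phi>(1)] by (rule eigen_map_cosP[OF Bt_D[OF \<phi>(1) D_on_coeffs[OF d]]])
  also have "\<dots> = d \<odot>\<^bsub>H\<^esub> ev \<phi>"
    unfolding frob_shriek_simps
  proof (rule extensionalityI[OF _ compose_extensional])
    show "ev (compose (carrier A) \<phi> (on_coeffs R d)) \<in> extensional (carrier R)" by (simp add: ev_def)
    fix r assume r: "r \<in> carrier R"
    then show "ev (compose (carrier A) \<phi> (on_coeffs R d)) r = compose (carrier R) (ev \<phi>) d r"
      using dc[OF r] by (simp add: ev_def compose_eq on_coeffs_mon[OF d r])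
  qed
  finally show "eigen_map (d \<odot>\<^bsub>restrict_scalars (on_coeffs R) (QN\<lparr>carrier := EV\<rparr>)\<^esub> U) = d \<odot>\<^bsub>H\<^esub> eigen_map U"
    unfolding simps using eigen_map_cosP \<phi> by simp
qed

text \<open>The two spans in the definition are those of f^k M for k = 0 and k = 1, so this module
  is the quotient of \<open>Bt 0\<close> by \<open>Bt 1\<close>.\<close>

lemma N_module_eq: "N_module R p M \<kappa> f e = QN"
proof -
  have 0: "right_span Pm (graph_push_adjoint R M \<kappa> f e (carrier M)) D = Bt 0"
  proof -
    have "(\<lambda>m. f [^] (0::nat) \<odot>\<^bsub>M\<^esub> m) ` carrier M = carrier M" by simp
    then show ?thesis using span_eq[OF xs, of 0] unfolding span_def graph_push_adjoint_eq by (simp only:)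
  qed
  have 1: "right_span Pm (graph_push_adjoint R M \<kappa> f e ((\<lambda>m. f \<odot>\<^bsub>M\<^esub> m) ` carrier M)) D = Bt 1"
  proof -
    have "(\<lambda>m. f [^] (1::nat) \<odot>\<^bsub>M\<^esub> m) ` carrier M = (\<lambda>m. f \<odot>\<^bsub>M\<^esub> m) ` carrier M" using f by simp
    then show ?thesis using span_eq[OF xs, of 1] unfolding span_def graph_push_adjoint_eq by (simp only:)
  qed
  show ?thesis unfolding N_module_def Let_def 0 1 ..
qed

theorem eigenspace_isomorphic:
  "module_isomorphic (diff_ops R p e) (eigenspace R p e i (N_module R p M \<kappa> f e)) H"
proof -
  have "carrier (restrict_scalars (on_coeffs R) (QN\<lparr>carrier := EV\<rparr>)) = EV" by (simp add: restrict_scalars_def)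
  then show ?thesis
    unfolding N_module_eq eigenspace_def module_isomorphic_def
    using eigen_map_linear eigen_map_inj eigen_map_surj by (intro exI[of _ eigen_map]) (simp add: bij_betw_def)
qed

end

theorem theorem3p7:
  fixes p :: nat and k :: "'k ring" and \<sigma> :: "'k \<Rightarrow> 'r" and R :: "'r ring"
    and M :: "('r, 'm) module" and \<kappa> :: "'m \<Rightarrow> 'm" and f :: 'r
    and e :: nat and i :: "nat \<Rightarrow> nat"
  assumes p: "Factorial_Ring.prime p"
    and k: "field k" "add_pow k p \<one>\<^bsub>k\<^esub> = \<zero>\<^bsub>k\<^esub>" "F_finite k p"
    and R: "regular_ring R" "ess_finite_type k \<sigma> R"
    and M: "cartier_module R p M \<kappa>" "F_regular R p M \<kappa>"
    and f: "module_regular R M f"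
    and e: "1 \<le> e"
    and i: "\<forall>j\<in>{1..e}. i j < p"
  shows "let n = (\<Sum>j=1..e. i j * p ^ (j - 1));
             T = test_module R p M \<kappa> f (of_nat n / of_nat (p ^ e));
             T' = test_module R p M \<kappa> f (of_nat (1 + n) / of_nat (p ^ e))
         in module_isomorphic (diff_ops R p e)
              (eigenspace R p e i (N_module R p M \<kappa> f e))
              (frob_shriek R p e (quot_module (M\<lparr>carrier := T\<rparr>) T'))"
proof -
  interpret R: cring R using R(1) by (simp add: regular_ring_def)
  interpret k: field k by (rule k)
  have \<sigma>: "\<sigma> \<in> ring_hom k R" using R(2) by (simp add: ess_finite_type_def)
  \<comment> \<open>The characteristic of R is inherited from k along the structure map.\<close>
  interpret C: char_p_ring R p by (rule R.char_p_ring_hom[OF k.is_cring \<sigma> k(2) p])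
  obtain W where W: "finite W" "W \<subseteq> carrier R" "C.frob_generates e W"
    using C.ess_finite_type_frob_generates[OF k R(2)] by blast
  obtain xs where xs: "C.dual_list e xs" "\<And>x. x \<in> carrier R \<Longrightarrow> x = C.dual_sum e xs x"
    using C.exists_dual_basis[OF R(1) W] by blast
  have mod: "module R M" and lin: "linear_map R (frob_push R p 1 M) M \<kappa>" using M(1) by (auto simp: cartier_module_def)
  have "p_linear R p M 1 \<kappa>"
    using lin unfolding linear_map_def p_linear_def by (simp add: frob_push_def restrict_scalars_def)
  then interpret K: cartier R M p \<kappa>
    using mod p by (intro cartier.intro cartier_axioms.intro)
  have fc: "f \<in> carrier R" using f by (simp add: module_regular_def)
  define n where "n = (\<Sum>j=1..e. i j * p ^ (j - 1))"
  have p0: "p > 0" using p prime_gt_0_nat by blast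
  \<comment> \<open>The number n with base-p digits i lies below p^e and returns these digits, which
    ties the eigenvalues to the exponent n of t.\<close>
  interpret E: eigen_setup R M p \<kappa> f e i n xs
    using digit_expansion[OF i p0] i fc xs unfolding n_def[symmetric]
    by unfold_locales auto
  have tm: "test_module R p M \<kappa> f (of_nat m / of_nat (p ^ e)) = K.trace_image f e m" for m
    by (rule K.test_module_eq_trace_image[OF M(2) f e])
  have "test_module R p M \<kappa> f (of_nat (1 + n) / of_nat (p ^ e)) = K.trace_image f e (Suc n)"
    using tm[of "Suc n"] by (simp only: plus_1_eq_Suc)
  note tm = tm[of n] this
  show ?thesis
    unfolding Let_def n_def[symmetric] tm using E.eigenspace_isomorphic by (simp only:)
qed

end
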